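(* Let $n\ge2$. Then, as sets of products in the group $(1+\mathfrak p_n)^*=\mathrm{GL}_\infty(\mathbb S_{n-1})$, $$\mathrm{GL}_\infty(\mathbb S_{n-1})=(1+\mathfrak p_n)^*=\widetilde{\mathcal E}_{n,1}\widetilde\Theta_{n,2}\widetilde{\mathcal E}_{n,2}\cdots\widetilde\Theta_{n,n-1}\widetilde{\mathcal E}_{n,n-1}.$$ Moreover, for $2\le s\le n-1$, $(1+\mathfrak p_n)^*_s=\widetilde\Theta_{n,s}\widetilde{\mathcal E}_{n,s}\cdots\widetilde\Theta_{n,n-1}\widetilde{\mathcal E}_{n,n-1}$, and $(1+\mathfrak p_n)^*_n=(1+F_n)^*$.
   Context: $K$ is a field, $\mathbb N=\{0,1,\dots\}$. $\mathbb S_n$ is the $K$-algebra generated by $x_1,\dots,x_n,y_1,\dots,y_n$ with relations $y_ix_i=1$ and $[x_i,y_j]=[x_i,x_j]=[y_i,y_j]=0$ ($i\ne j$). $E_{st}(i):=x_i^sy_i^t-x_i^{s+1}y_i^{t+1}$, $e_i:=E_{00}(i)$, $e_I:=\prod_{i\in I}e_i$; for $\alpha,\beta\in\mathbb N^I$, $E_{\alpha\beta}(I):=\prod_{i\in I}E_{\alpha_i\beta_i}(i)$. $\theta_{ij}(J):=(1+(y_i-1)e_{J\setminus\{i\}})(1+(x_j-1)e_{J\setminus\{j\}})$ for $|J|\ge2$, $i\ne j\in J$. $\mathfrak p_i$ is the ideal of $\mathbb S_n$ generated by $e_i$, $\mathfrak p_I:=\prod_{i\in I}\mathfrak p_i$,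 $\mathfrak a_{n,s}:=\sum_{|I|=s}\mathfrak p_I$, $F_n:=\mathfrak p_{\{1,\dots,n\}}$; $(1+\mathfrak b)^*$ is the group of units of $\mathbb S_n$ in $1+\mathfrak b$; $(1+\mathfrak p_n)^*_s:=(1+\mathfrak p_n)^*\cap(1+\mathfrak a_{n,s})^*$. $\mathrm{GL}_\infty(\mathbb S_{n-1})$ ($\mathbb S_{n-1}$ = subalgebra generated by $x_k,y_k$, $k<n$) is identified with $(1+\mathfrak p_n)^*$ via $(a_{kl})\mapsto 1+\sum(a_{kl}-\delta_{kl})E_{kl}(n)$. For $I\subseteq\{1,\dots,n\}$: $\mu_I(\lambda):=\lambda e_I+1-e_I$, $U_I(K):=\{\mu_I(\lambda):\lambda\in K^*\}$; $CI$ is the complement of $I$, $\mathbb S_{CI}$ the subalgebra generated by $x_k,y_k$, $k\in CI$; $E_\infty(\mathbb S_{CI})$ the subgroup of $\mathbb S_n^*$ generated by $1+aE_{\alpha\beta}(I)$, $a\in\mathbb S_{CI}$, $\alpha\ne\beta\in\mathbb N^I$. For $1\le s\le n-1$, $\widetilde{\mathcal E}_{n,s}$ is the set of products $g_1\cdots g_r$ where $I_1,\dots,I_r$ are all subsets with $|I|=s$ and $n\in I$, listed in a fixed order, and $g_k\in U_{I_k}(K)E_\infty(\mathbb S_{CI_k})$. For $2\le s\le n-1$, $\widetilde\Theta_{n,s}$ is the set of products, in a fixed order, $\prod_J\prod_{j}\theta_{m(J),j}(J)^{n(j,J)}$ with $n(j,J)\in\mathbb Z$, where $J$ ranges over subsets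 with $|J|=s+1$, $n\in J$, $m(J):=\max(J\setminus\{n\})$, and $j\in J\setminus\{n,m(J)\}$. A product $A_1A_2\cdots A_r$ of subsets denotes $\{a_1\cdots a_r: a_k\in A_k\}$. *)

theory Defs
  imports Main
begin

text \<open>Concrete faithful model of the Jacobson algebra S_n over a field 'k:
  S_n is realised as the algebra of K-linear operators on the space of all functions
  (nat => nat) => 'k generated by the operators x_i, y_i (i in {1..n}), where
  (x_i f)(a) = f(a - eps_i) if a_i > 0 (else 0) and (y_i f)(a) = f(a + eps_i).
  These satisfy y_i x_i = 1 and the commutation relations, and the representation is
  faithful, so the generated algebra is isomorphic to S_n.  Multiplication is composition.\<close>

type_synonym 'k vec = "(nat \<Rightarrow> nat) \<Rightarrow> 'k"
type_synonym 'k kop = "'k vec \<Rightarrow> 'k vec"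

definition Xop :: "nat \<Rightarrow> 'k::field kop" where
  "Xop i f = (\<lambda>a. if 0 < a i then f (a(i := a i - 1)) else 0)"

definition Yop :: "nat \<Rightarrow> 'k::field kop" where
  "Yop i f = (\<lambda>a. f (a(i := Suc (a i))))"

definition opadd :: "'k::field kop \<Rightarrow> 'k kop \<Rightarrow> 'k kop" where
  "opadd A B = (\<lambda>f a. A f a + B f a)"

definition opsub :: "'k::field kop \<Rightarrow> 'k kop \<Rightarrow> 'k kop" where
  "opsub A B = (\<lambda>f a. A f a - B f a)"

definition opsmul :: "'k::field \<Rightarrow> 'k kop \<Rightarrow> 'k kop" where
  "opsmul c A = (\<lambda>f a. c * A f a)"

definition opzero :: "'k::field kop" where
  "opzero = (\<lambda>f a. 0)"

inductive_set Salg :: "nat set \<Rightarrow> 'k::field kop set" for J :: "nat set" where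
  scal: "opsmul c id \<in> Salg J"
| genX: "k \<in> J \<Longrightarrow> Xop k \<in> Salg J"
| genY: "k \<in> J \<Longrightarrow> Yop k \<in> Salg J"
| add: "A \<in> Salg J \<Longrightarrow> B \<in> Salg J \<Longrightarrow> opadd A B \<in> Salg J"
| mult: "A \<in> Salg J \<Longrightarrow> B \<in> Salg J \<Longrightarrow> A \<circ> B \<in> Salg J"

abbreviation Sn :: "nat \<Rightarrow> 'k::field kop set" where
  "Sn n \<equiv> Salg {1..n}"

definition listprod :: "'k kop list \<Rightarrow> 'k kop" where
  "listprod xs = foldr (\<circ>) xs id"

definition Est :: "nat \<Rightarrow> nat \<Rightarrow> nat \<Rightarrow> 'k::field kop" where
  "Est i s t = opsub ((Xop i ^^ s) \<circ> (Yop i ^^ t)) ((Xop i ^^ Suc s) \<circ> (Yop i ^^ Suc t))"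

definition ee :: "nat \<Rightarrow> 'k::field kop" where
  "ee i = Est i 0 0"

definition eI :: "nat set \<Rightarrow> 'k::field kop" where
  "eI I = listprod (map ee (sorted_list_of_set I))"

definition EI :: "(nat \<Rightarrow> nat) \<Rightarrow> (nat \<Rightarrow> nat) \<Rightarrow> nat set \<Rightarrow> 'k::field kop" where
  "EI al be I = listprod (map (\<lambda>i. Est i (al i) (be i)) (sorted_list_of_set I))"

definition theta :: "nat \<Rightarrow> nat \<Rightarrow> nat set \<Rightarrow> 'k::field kop" where
  "theta i j J = opadd id (opsub (Yop i) id \<circ> eI (J - {i})) \<circ> opadd id (opsub (Xop j) id \<circ> eI (J - {j}))"

inductive_set ideal_gen :: "nat \<Rightarrow> 'k::field kop set \<Rightarrow> 'k kop set" for n G where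
  zero: "opzero \<in> ideal_gen n G"
| gen: "a \<in> Sn n \<Longrightarrow> g \<in> G \<Longrightarrow> b \<in> Sn n \<Longrightarrow> a \<circ> g \<circ> b \<in> ideal_gen n G"
| add: "a \<in> ideal_gen n G \<Longrightarrow> b \<in> ideal_gen n G \<Longrightarrow> opadd a b \<in> ideal_gen n G"

inductive_set idprod :: "'k::field kop set \<Rightarrow> 'k kop set \<Rightarrow> 'k kop set" for A B where
  zero: "opzero \<in> idprod A B"
| prod: "a \<in> A \<Longrightarrow> b \<in> B \<Longrightarrow> a \<circ> b \<in> idprod A B"
| add: "a \<in> idprod A B \<Longrightarrow> b \<in> idprod A B \<Longrightarrow> opadd a b \<in> idprod A B"

inductive_set addclo :: "'k::field kop set \<Rightarrow> 'k kop set" for S where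
  zero: "opzero \<in> addclo S"
| base: "a \<in> S \<Longrightarrow> a \<in> addclo S"
| add: "a \<in> addclo S \<Longrightarrow> b \<in> addclo S \<Longrightarrow> opadd a b \<in> addclo S"

definition pp :: "nat \<Rightarrow> nat \<Rightarrow> 'k::field kop set" where
  "pp n i = ideal_gen n {ee i}"

definition pI :: "nat \<Rightarrow> nat set \<Rightarrow> 'k::field kop set" where
  "pI n I = foldr idprod (map (pp n) (sorted_list_of_set I)) (Sn n)"

definition aa :: "nat \<Rightarrow> nat \<Rightarrow> 'k::field kop set" where
  "aa n s = addclo (\<Union>{pI n I | I. I \<subseteq> {1..n} \<and> card I = s})"

definition Fn :: "nat \<Rightarrow> 'k::field kop set" where
  "Fn n = pI n {1..n}"

definition units_in :: "nat \<Rightarrow> 'k::field kop set \<Rightarrow> 'k kop set" where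
  "units_in n b = {u \<in> Sn n. opsub u id \<in> b \<and> (\<exists>v \<in> Sn n. u \<circ> v = id \<and> v \<circ> u = id)}"

definition units_pn_s :: "nat \<Rightarrow> nat \<Rightarrow> 'k::field kop set" where
  "units_pn_s n s = units_in n (pp n n) \<inter> units_in n (aa n s)"

definition mu :: "nat set \<Rightarrow> 'k::field \<Rightarrow> 'k kop" where
  "mu I c = opadd (opsmul c (eI I)) (opsub id (eI I))"

definition UI :: "nat set \<Rightarrow> 'k::field kop set" where
  "UI I = {mu I c | c. c \<noteq> 0}"

inductive_set grp_gen :: "'k kop set \<Rightarrow> 'k kop set" for G where
  one: "id \<in> grp_gen G"
| mul: "g \<in> G \<Longrightarrow> h \<in> grp_gen G \<Longrightarrow> g \<circ> h \<in> grp_gen G"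
| mulinv: "g \<in> G \<Longrightarrow> h \<in> grp_gen G \<Longrightarrow> inv g \<circ> h \<in> grp_gen G"

definition Einf :: "nat \<Rightarrow> nat set \<Rightarrow> 'k::field kop set" where
  "Einf n I = grp_gen {opadd id (a \<circ> EI al be I) | a al be.
       a \<in> Salg ({1..n} - I) \<and> (\<exists>i \<in> I. al i \<noteq> be i)}"

definition UE :: "nat \<Rightarrow> nat set \<Rightarrow> 'k::field kop set" where
  "UE n I = {u \<circ> g | u g. u \<in> UI I \<and> g \<in> Einf n I}"

fun set_prods :: "'k kop set list \<Rightarrow> 'k kop set" where
  "set_prods [] = {id}"
| "set_prods (A # As) = {a \<circ> b | a b. a \<in> A \<and> b \<in> set_prods As}"

definition zpow :: "'k kop \<Rightarrow> int \<Rightarrow> 'k kop" where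
  "zpow a k = (if 0 \<le> k then a ^^ nat k else inv a ^^ nat (- k))"

text \<open>tilde E_{n,s} for a given ordering of the subsets I.\<close>
definition Etil :: "nat \<Rightarrow> nat set list \<Rightarrow> 'k::field kop set" where
  "Etil n Is = set_prods (map (UE n) Is)"

text \<open>tilde Theta_{n,s} for a given ordering of the J's and, inside each J, of the j's.\<close>
definition Thtil :: "nat \<Rightarrow> nat set list \<Rightarrow> (nat set \<Rightarrow> nat list) \<Rightarrow> 'k::field kop set" where
  "Thtil n Js jord = set_prods (concat (map (\<lambda>J. map (\<lambda>j.
       {zpow (theta (Max (J - {n})) j J) k | k. True}) (jord J)) Js))"

end

theory Submission
  imports Defs "Jordan_Normal_Form.Determinant" "HOL-Library.Countable_Set" "HOL-Library.Poly_Mapping"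
    "HOL-Computational_Algebra.Polynomial" "HOL-Computational_Algebra.Polynomial_Factorial"
begin

text \<open>For \<open>|I| = s\<close>, letting the generators \<open>x\<^sub>k, y\<^sub>k\<close> with \<open>k \<notin> I\<close> act as mutually inverse variables
  \<open>X\<^sub>k\<close> attaches to a unit of \<open>1 + a\<^sub>s\<close> an invertible matrix over the Laurent polynomial ring in these
  variables, its symbol at \<open>I\<close>; the units all of whose symbols are trivial are those of \<open>1 + a\<^sub>s\<^sub>+\<^sub>1\<close>.
  An invertible matrix over a Laurent polynomial ring over a field is elementary up to a unit
  \<open>\<lambda> X\<^sup>d\<close>. The elementary part and \<open>\<lambda>\<close> lift to \<open>U\<^sub>I(K) E\<^sub>\<infinity>(S\<^sub>C\<^sub>I)\<close>. The exponents \<open>d\<close> satisfy one linear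
  relation for each \<open>J\<close> with \<open>|J| = s + 1\<close>, expressing that the Fredholm index of an invertible operator
  vanishes, and products of the \<open>\<theta>\<^sub>i\<^sub>j(J)\<close> realise every family of exponents satisfying these
  relations. The units of \<open>1 + F\<^sub>n\<close> left over at the end are finite matrices over \<open>K\<close>, which become
  elementary over the Jacobson algebra in one variable.\<close>

subsection \<open>Elementary operations over a subring of a field\<close>

text \<open>All rings are subsets of one field and all matrices are operators on functions over an
  infinite index type. Localisations are then literal sets of fractions, groups over different rings
  can be intersected, and a fresh index is always at hand, which makes the elementary group normal
  without any condition on the size. A fixed order of factors costs nothing, because a unit in
  \<open>1 + p_I\<close> has trivial symbol at every other set of the size of \<open>I\<close>: the
  factors of one level are chosen independently. Lying in \<open>1 + p_n\<close> makes the symbols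
  at sets without \<open>n\<close> trivial. Hence the index relation of \<open>J\<close> has one
  term for each \<open>k\<close> in \<open>J - {n}\<close>. It leaves all these exponents but one
  free, so the \<open>theta\<close> may share one index \<open>m(J)\<close>. For
  \<open>J = {k, n}\<close> it kills the only exponent, so level 1 has no Theta factor. The relation
  is a dimension count: far from the origin the operator shifts axis \<open>k\<close> of N^J by its
  exponent, and an injective map cannot send a large box into a smaller set; the inverse gives the
  opposite inequality. What is left at level \<open>n\<close> is absorbed by the last factor, whose
  set is \<open>{1..n}\<close> minus one point.\<close>

definition is_subring :: "'a::field set \<Rightarrow> bool" where
  "is_subring R \<longleftrightarrow> 0 \<in> R \<and> 1 \<in> R \<and> (\<forall>a\<in>R. \<forall>b\<in>R. a + b \<in> R \<and> a * b \<in> R) \<and> (\<forall>a\<in>R. - a \<in> R)"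

lemma subring_0: "is_subring R \<Longrightarrow> 0 \<in> R"
  and subring_1: "is_subring R \<Longrightarrow> 1 \<in> R"
  and subring_add: "is_subring R \<Longrightarrow> a \<in> R \<Longrightarrow> b \<in> R \<Longrightarrow> a + b \<in> R"
  and subring_mult: "is_subring R \<Longrightarrow> a \<in> R \<Longrightarrow> b \<in> R \<Longrightarrow> a * b \<in> R"
  and subring_uminus: "is_subring R \<Longrightarrow> a \<in> R \<Longrightarrow> - a \<in> R"
  unfolding is_subring_def by blast+

lemma subring_diff: "is_subring R \<Longrightarrow> a \<in> R \<Longrightarrow> b \<in> R \<Longrightarrow> a - b \<in> R"
  using subring_add[of R a "- b"] subring_uminus[of R b] by simp

lemma subring_power: "is_subring R \<Longrightarrow> a \<in> R \<Longrightarrow> a ^ k \<in> R"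
  by (induction k) (auto intro: subring_1 subring_mult)

lemma subring_sum: "is_subring R \<Longrightarrow> (\<And>x. x \<in> A \<Longrightarrow> f x \<in> R) \<Longrightarrow> sum f A \<in> R"
  by (induction A rule: infinite_finite_induct) (auto intro: subring_0 subring_add)

lemma subring_prod: "is_subring R \<Longrightarrow> (\<And>x. x \<in> A \<Longrightarrow> f x \<in> R) \<Longrightarrow> prod f A \<in> R"
  by (induction A rule: infinite_finite_induct) (auto intro: subring_1 subring_mult)

lemmas subring_intros = subring_0 subring_1 subring_add subring_mult subring_uminus subring_diff
  subring_power subring_sum subring_prod

definition transv :: "'i \<Rightarrow> 'i \<Rightarrow> 'a::field \<Rightarrow> ('i \<Rightarrow> 'a) \<Rightarrow> 'i \<Rightarrow> 'a" where
  "transv i j a f = f(i := f i + a * f j)"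

text \<open>The elementary group, generated as a monoid. Inverses need no rule of their own, because
  \<open>transv i j (- a)\<close> inverts \<open>transv i j a\<close>.\<close>

inductive_set elem_ops :: "'a::field set \<Rightarrow> (('i \<Rightarrow> 'a) \<Rightarrow> 'i \<Rightarrow> 'a) set" for R where
  elem_id: "id \<in> elem_ops R"
| elem_step: "i \<noteq> j \<Longrightarrow> a \<in> R \<Longrightarrow> g \<in> elem_ops R \<Longrightarrow> transv i j a \<circ> g \<in> elem_ops R"

lemma elem_comp: "g \<in> elem_ops R \<Longrightarrow> h \<in> elem_ops R \<Longrightarrow> g \<circ> h \<in> elem_ops R"
  by (induction g rule: elem_ops.induct) (auto simp: comp_assoc intro: elem_step)

lemma elem_transv: "i \<noteq> j \<Longrightarrow> a \<in> R \<Longrightarrow> transv i j a \<in> elem_ops R"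
  using elem_step[OF _ _ elem_id, of i j a R] by simp

lemma transv_add: "i \<noteq> j \<Longrightarrow> transv i j a \<circ> transv i j b = transv i j (a + b)"
  by (auto simp: transv_def fun_eq_iff algebra_simps)

lemma transv_0: "transv i j 0 = id"
  by (auto simp: transv_def fun_eq_iff)

lemma elem_inverse:
  assumes "is_subring R" "g \<in> elem_ops R"
  shows "\<exists>h\<in>elem_ops R. g \<circ> h = id \<and> h \<circ> g = id"
  using assms(2)
proof induction
  case elem_id
  show ?case by (rule bexI[of _ id]) (simp_all add: elem_ops.elem_id)
next
  case (elem_step i j a g)
  then obtain h where h: "h \<in> elem_ops R" "g \<circ> h = id" "h \<circ> g = id" by blast
  have "(transv i j a \<circ> g) \<circ> (h \<circ> transv i j (- a)) = transv i j a \<circ> (g \<circ> h) \<circ> transv i j (- a)"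
    by (simp add: comp_assoc)
  also have "\<dots> = id" using h elem_step by (simp add: transv_add transv_0)
  finally have 1: "(transv i j a \<circ> g) \<circ> (h \<circ> transv i j (- a)) = id" .
  have "(h \<circ> transv i j (- a)) \<circ> (transv i j a \<circ> g) = h \<circ> (transv i j (- a) \<circ> transv i j a) \<circ> g"
    by (simp add: comp_assoc)
  also have "\<dots> = id" using h elem_step by (simp add: transv_add transv_0)
  finally have 2: "(h \<circ> transv i j (- a)) \<circ> (transv i j a \<circ> g) = id" .
  have "h \<circ> transv i j (- a) \<in> elem_ops R"
    using elem_step h assms(1) by (intro elem_comp elem_transv subring_uminus)
  with 1 2 show ?case by blast
qed

lemma elem_mono: "g \<in> elem_ops R \<Longrightarrow> R \<subseteq> R' \<Longrightarrow> g \<in> elem_ops R'"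
  by (induction rule: elem_ops.induct) (auto intro: elem_ops.intros)

lemma elem_left_cancel:
  assumes "is_subring R" "g \<in> elem_ops R" "g \<circ> h \<in> elem_ops R"
  shows "h \<in> elem_ops R"
proof -
  obtain g' where "g' \<in> elem_ops R" "g' \<circ> g = id" using elem_inverse[OF assms(1,2)] by blast
  then have "g' \<circ> (g \<circ> h) \<in> elem_ops R" using assms(3) elem_comp by blast
  then show ?thesis using \<open>g' \<circ> g = id\<close> by (simp add: comp_assoc[symmetric])
qed

lemma elem_col_op:
  assumes "finite S" "p \<notin> S" "\<And>i. i \<in> S \<Longrightarrow> v i \<in> R"
  shows "(\<lambda>f i. if i \<in> S then f i + v i * f p else f i) \<in> elem_ops R"
  using assms
proof (induction S rule: finite_induct)
  case empty
  then show ?case using elem_id by (simp add: id_def)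
next
  case (insert x S)
  have "(\<lambda>f i. if i \<in> insert x S then f i + v i * f p else f i)
      = transv x p (v x) \<circ> (\<lambda>f i. if i \<in> S then f i + v i * f p else f i)"
    using insert by (auto simp: transv_def fun_eq_iff)
  moreover have "\<dots> \<in> elem_ops R" using insert by (intro elem_comp elem_transv) auto
  ultimately show ?case by simp
qed

lemma elem_row_op:
  assumes "finite S" "p \<notin> S" "\<And>i. i \<in> S \<Longrightarrow> w i \<in> R"
  shows "(\<lambda>f. f(p := f p + (\<Sum>j\<in>S. w j * f j))) \<in> elem_ops R"
  using assms
proof (induction S rule: finite_induct)
  case empty
  then show ?case using elem_id by (simp add: id_def)
next
  case (insert x S)
  have "(\<lambda>f. f(p := f p + (\<Sum>j\<in>insert x S. w j * f j)))
      = transv p x (w x) \<circ> (\<lambda>f. f(p := f p + (\<Sum>j\<in>S. w j * f j)))"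
    using insert by (auto simp: transv_def fun_eq_iff)
  moreover have "(\<lambda>f. f(p := f p + (\<Sum>j\<in>S. w j * f j))) \<in> elem_ops R"
    using insert by blast
  then have "transv p x (w x) \<circ> (\<lambda>f. f(p := f p + (\<Sum>j\<in>S. w j * f j))) \<in> elem_ops R"
    using insert by (intro elem_comp elem_transv) auto
  ultimately show ?case by metis
qed

text \<open>A rank one perturbation \<open>1 + v w\<close> with \<open>w v = 0\<close> is the commutator of
  \<open>1 + v e\<^sub>p\<^sup>T\<close> and \<open>1 + e\<^sub>p w\<close> for any index \<open>p\<close> off the support.\<close>
lemma elem_rank_one:
  fixes v w :: "'i \<Rightarrow> 'a::field"
  assumes inf: "infinite (UNIV :: 'i set)" and R: "is_subring R" and S: "finite S"
    and v: "\<And>i. i \<in> S \<Longrightarrow> v i \<in> R" "\<And>i. i \<notin> S \<Longrightarrow> v i = 0"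
    and w: "\<And>i. i \<in> S \<Longrightarrow> w i \<in> R" and wv: "(\<Sum>j\<in>S. w j * v j) = 0"
  shows "(\<lambda>f i. f i + v i * (\<Sum>j\<in>S. w j * f j)) \<in> elem_ops R"
proof -
  obtain p where p: "p \<notin> S" using ex_new_if_finite[OF inf S] ..
  let ?A = "\<lambda>v f i. if i \<in> S then f i + v i * f p else f i"
  let ?B = "\<lambda>w f. f(p := f p + (\<Sum>j\<in>S. w j * f j))"
  have "?A v \<circ> (?B w \<circ> (?A (\<lambda>i. - v i) \<circ> ?B (\<lambda>i. - w i))) \<in> elem_ops R"
    using p S v w R by (intro elem_comp elem_col_op elem_row_op) (auto intro: subring_uminus)
  moreover have "?A v \<circ> (?B w \<circ> (?A (\<lambda>i. - v i) \<circ> ?B (\<lambda>i. - w i)))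
     = (\<lambda>f i. f i + v i * (\<Sum>j\<in>S. w j * f j))"
  proof (intro ext)
    fix f :: "'i \<Rightarrow> 'a" and i
    define s where "s = (\<Sum>j\<in>S. w j * f j)"
    have B': "?B (\<lambda>i. - w i) f = f(p := f p - s)" by (simp add: s_def sum_negf)
    define g where "g = ?A (\<lambda>i. - v i) (f(p := f p - s))"
    have g: "g j = (if j \<in> S then f j - v j * (f p - s) else if j = p then f p - s else f j)" for j
      using p by (auto simp: g_def)
    \<comment> \<open>Subtracting a multiple of \<open>v\<close> does not change the pairing with
      \<open>w\<close>, because \<open>w v = 0\<close>. So the second row operation adds back
      exactly the \<open>s\<close> that the first one removed, and coordinate \<open>p\<close> is
      restored.\<close>
    have "(\<Sum>j\<in>S. w j * g j) = (\<Sum>j\<in>S. w j * f j - (w j * v j) * (f p - s))"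
      by (intro sum.cong) (auto simp: g algebra_simps)
    also have "\<dots> = s" by (simp add: sum_subtractf wv flip: sum_distrib_right s_def)
    finally have Bg: "?B w g = g(p := f p)" using g p by simp
    have gi: "g i + v i * f p = f i + v i * s" if "i \<in> S" using that by (simp add: g algebra_simps)
    have "(?A v \<circ> (?B w \<circ> (?A (\<lambda>i. - v i) \<circ> ?B (\<lambda>i. - w i)))) f = ?A v (?B w g)"
      by (simp only: comp_apply B' g_def)
    also have "\<dots> = ?A v (g(p := f p))" by (simp only: Bg)
    finally have "(?A v \<circ> (?B w \<circ> (?A (\<lambda>i. - v i) \<circ> ?B (\<lambda>i. - w i)))) f i = ?A v (g(p := f p)) i"
      by (rule fun_cong)
    also have "\<dots> = f i + v i * s" using gi v(2)[of i] p by (auto simp: g)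
    finally show "(?A v \<circ> (?B w \<circ> (?A (\<lambda>i. - v i) \<circ> ?B (\<lambda>i. - w i)))) f i = f i + v i * (\<Sum>j\<in>S. w j * f j)"
      by (simp only: s_def)
  qed
  ultimately show ?thesis by metis
qed

section \<open>Infinite matrices as operators\<close>

definition uvec :: "'i \<Rightarrow> 'i \<Rightarrow> 'a::field" where
  "uvec i = (\<lambda>k. if k = i then 1 else 0)"

definition linear_op :: "(('i \<Rightarrow> 'a::field) \<Rightarrow> 'j \<Rightarrow> 'a) \<Rightarrow> bool" where
  "linear_op M \<longleftrightarrow> (\<forall>f g. M (\<lambda>i. f i + g i) = (\<lambda>i. M f i + M g i)) \<and>
     (\<forall>c f. M (\<lambda>i. c * f i) = (\<lambda>i. c * M f i))"

lemma linear_opD: "linear_op M \<Longrightarrow> M (\<lambda>i. f i + g i) j = M f j + M g j"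
  "linear_op M \<Longrightarrow> M (\<lambda>i. c * f i) j = c * M f j"
  by (simp_all add: linear_op_def)

lemma linear_op_0: "linear_op M \<Longrightarrow> M (\<lambda>i. 0) j = 0"
  using linear_opD(2)[of M 0 "\<lambda>i. 0" j] by simp

lemma linear_op_sum: "linear_op M \<Longrightarrow> M (\<lambda>i. \<Sum>s\<in>S. c s * F s i) j = (\<Sum>s\<in>S. c s * M (F s) j)"
  
proof (induction S rule: infinite_finite_induct)
  case (insert x S)
  then show ?case
    using linear_opD(1)[of M "\<lambda>i. c x * F x i" "\<lambda>i. \<Sum>s\<in>S. c s * F s i" j]
    by (simp add: linear_opD(2))
qed (simp_all add: linear_op_0)

lemma linear_op_comp: "linear_op M \<Longrightarrow> linear_op M' \<Longrightarrow> linear_op (M \<circ> M')"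
  by (simp add: linear_op_def)

text \<open>Operators act on all functions, not only on finitely supported ones, because
  \<open>asy\<close> tests them on geometric progressions. Finite dependence of each output
  coordinate is what makes such an operator a matrix; \<open>fin_op\<close> adds finite columns,
  which conjugation of transvections requires.\<close>

definition row_op :: "'a::field set \<Rightarrow> (('i \<Rightarrow> 'a) \<Rightarrow> 'i \<Rightarrow> 'a) \<Rightarrow> bool" where
  "row_op R M \<longleftrightarrow> linear_op M \<and> (\<forall>i k. M (uvec i) k \<in> R) \<and>
     (\<forall>j. \<exists>S. finite S \<and> (\<forall>f g. (\<forall>s\<in>S. f s = g s) \<longrightarrow> M f j = M g j))"

definition fin_op :: "'a::field set \<Rightarrow> (('i \<Rightarrow> 'a) \<Rightarrow> 'i \<Rightarrow> 'a) \<Rightarrow> bool" where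
  "fin_op R M \<longleftrightarrow> row_op R M \<and> (\<forall>i. finite {k. M (uvec i) k \<noteq> 0})"

lemma row_expand:
  assumes "linear_op M" "finite S" "\<And>f g. (\<And>s. s \<in> S \<Longrightarrow> f s = g s) \<Longrightarrow> M f j = M g j"
  shows "M f j = (\<Sum>s\<in>S. M (uvec s) j * f s)"
proof -
  have "M f j = M (\<lambda>i. \<Sum>s\<in>S. f s * uvec s i) j"
    using assms(2) by (intro assms(3)) (simp add: uvec_def if_distrib cong: if_cong)
  then show ?thesis by (simp add: linear_op_sum[OF assms(1)] mult.commute)
qed

lemma row_opE:
  assumes "row_op R M"
  shows "\<exists>S. finite S \<and> (\<forall>f. M f j = (\<Sum>s\<in>S. M (uvec s) j * f s))"
proof -
  from assms obtain S where S: "finite S" "\<forall>f g. (\<forall>s\<in>S. f s = g s) \<longrightarrow> M f j = M g j"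
    unfolding row_op_def by blast
  from assms have "linear_op M" by (simp add: row_op_def)
  then have "M f j = (\<Sum>s\<in>S. M (uvec s) j * f s)" for f
    by (rule row_expand) (use S in auto)
  with S(1) show ?thesis by blast
qed

lemma row_op_comp:
  assumes R: "is_subring R" and "row_op R M" "row_op R M'"
  shows "row_op R (M \<circ> M')"
  unfolding row_op_def
proof (intro conjI allI)
  show "linear_op (M \<circ> M')" using assms by (simp add: row_op_def linear_op_comp)
next
  fix i k
  obtain S where S: "\<And>f. M f k = (\<Sum>s\<in>S. M (uvec s) k * f s)" using row_opE[OF assms(2), of k] by blast
  have "(\<Sum>s\<in>S. M (uvec s) k * M' (uvec i) s) \<in> R"
    using assms by (auto simp: row_op_def intro!: subring_intros)
  then show "(M \<circ> M') (uvec i) k \<in> R" unfolding comp_apply by (subst S)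
next
  fix j
  from assms obtain S where S: "finite S" "\<And>f g. (\<forall>s\<in>S. f s = g s) \<Longrightarrow> M f j = M g j"
    unfolding row_op_def by blast
  from assms have "\<forall>s. \<exists>S. finite S \<and> (\<forall>f g. (\<forall>s\<in>S. f s = g s) \<longrightarrow> M' f s = M' g s)"
    unfolding row_op_def by blast
  then obtain T where T: "\<And>s. finite (T s)" "\<And>s f g. (\<forall>s\<in>T s. f s = g s) \<Longrightarrow> M' f s = M' g s"
    by metis
  show "\<exists>S. finite S \<and> (\<forall>f g. (\<forall>s\<in>S. f s = g s) \<longrightarrow> (M \<circ> M') f j = (M \<circ> M') g j)"
  proof (intro exI[of _ "\<Union>s\<in>S. T s"] conjI allI impI)
    show "finite (\<Union>s\<in>S. T s)" using S(1) T(1) by blast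
    fix f g :: "'b \<Rightarrow> 'a"
    assume fg: "\<forall>s\<in>\<Union>s\<in>S. T s. f s = g s"
    have "\<forall>s\<in>S. M' f s = M' g s" using fg by (auto intro!: T(2))
    then show "(M \<circ> M') f j = (M \<circ> M') g j" using S(2) by auto
  qed
qed

lemma fin_op_comp:
  assumes R: "is_subring R" and "fin_op R M" "fin_op R M'"
  shows "fin_op R (M \<circ> M')"
  unfolding fin_op_def
proof (intro conjI allI)
  show "row_op R (M \<circ> M')" using assms row_op_comp by (auto simp: fin_op_def)
  fix i
  let ?g = "M' (uvec i)" and ?S = "{k. M' (uvec i) k \<noteq> 0}"
  have fS: "finite ?S" using assms by (simp add: fin_op_def)
  have lin: "linear_op M" using assms by (simp add: fin_op_def row_op_def)
  have "?g = (\<lambda>k. \<Sum>s\<in>?S. ?g s * uvec s k)"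
    using fS by (auto simp: uvec_def fun_eq_iff if_distrib cong: if_cong)
  then have "M ?g k = (\<Sum>s\<in>?S. ?g s * M (uvec s) k)" for k
    using linear_op_sum[OF lin, of ?g uvec ?S k] by simp
  then have "{k. (M \<circ> M') (uvec i) k \<noteq> 0} \<subseteq> (\<Union>s\<in>?S. {k. M (uvec s) k \<noteq> 0})"
    by (auto elim!: sum.not_neutral_contains_not_neutral)
  moreover have "finite (\<Union>s\<in>?S. {k. M (uvec s) k \<noteq> 0})"
    using fS assms by (auto simp: fin_op_def)
  ultimately show "finite {k. (M \<circ> M') (uvec i) k \<noteq> 0}" by (rule finite_subset)
qed

lemma fin_op_id: "is_subring R \<Longrightarrow> fin_op R id"
  by (auto simp: fin_op_def row_op_def linear_op_def uvec_def subring_0 subring_1)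

lemma linear_transv: "linear_op (transv i j a)"
  by (auto simp: linear_op_def transv_def fun_eq_iff algebra_simps)

lemma fin_op_transv:
  assumes "is_subring R" "a \<in> R"
  shows "fin_op R (transv i j a)"
proof -
  have "\<forall>s\<in>{k, j}. f s = g s \<Longrightarrow> transv i j a f k = transv i j a g k" for f g k
    by (auto simp: transv_def)
  moreover have "finite {k. transv i j a (uvec l) k \<noteq> 0}" for l
    by (rule finite_subset[of _ "{i, l}"]) (auto simp: transv_def uvec_def)
  ultimately show ?thesis
    using assms unfolding fin_op_def row_op_def
    apply (intro conjI allI linear_transv)
    subgoal for l k by (auto simp: transv_def uvec_def intro!: subring_intros)
    subgoal for k by (rule exI[of _ "{k, j}"]) blast
    by blast
qed

lemma fin_op_elem:
  assumes "is_subring R" "g \<in> elem_ops R"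
  shows "fin_op R g"
  using assms(2,1) by induction (simp_all add: fin_op_id fin_op_comp fin_op_transv)

text \<open>The conjugate of \<open>transv i j a\<close> is \<open>1 + v w\<close>, where
  \<open>v\<close> is \<open>a\<close> times column \<open>i\<close> of \<open>M\<close> and
  \<open>w\<close> is row \<open>j\<close> of \<open>M'\<close>. The product \<open>w v\<close> is
  \<open>a\<close> times the entry \<open>(j, i)\<close> of \<open>M' M = id\<close>, hence 0, and
  \<open>elem_rank_one\<close> applies. So the elementary group is normalised by all invertible
  operators with finite rows and columns.\<close>

lemma elem_conj:
  fixes M M' :: "('i \<Rightarrow> 'a::field) \<Rightarrow> 'i \<Rightarrow> 'a"
  assumes inf: "infinite (UNIV :: 'i set)" and R: "is_subring R"
    and M: "fin_op R M" "fin_op R M'" "M \<circ> M' = id" "M' \<circ> M = id" and g: "g \<in> elem_ops R"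
  shows "M \<circ> g \<circ> M' \<in> elem_ops R"
  using g
proof induction
  case elem_id
  show ?case using M(3) elem_ops.elem_id[of R] by (metis comp_id)
next
  case (elem_step i j a g)
  have lin: "linear_op M" using M by (simp add: fin_op_def row_op_def)
  have "row_op R M'" using M by (simp add: fin_op_def)
  then obtain S where S: "finite S" "\<And>f. M' f j = (\<Sum>s\<in>S. M' (uvec s) j * f s)"
    using row_opE[of R M' j] by blast
  define T where "T = S \<union> {k. M (uvec i) k \<noteq> 0}"
  define w where "w = (\<lambda>s. if s \<in> S then M' (uvec s) j else 0)"
  define v where "v = (\<lambda>k. a * M (uvec i) k)"
  have T: "finite T" using S M by (auto simp: T_def fin_op_def)
  have M'j: "M' f j = (\<Sum>s\<in>T. w s * f s)" for f
    using T by (intro trans[OF S(2)] sum.mono_neutral_cong_left) (auto simp: T_def w_def)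
  have wv: "(\<Sum>s\<in>T. w s * v s) = 0"
  proof -
    have "(\<Sum>s\<in>T. w s * v s) = a * M' (M (uvec i)) j"
      unfolding M'j by (simp add: v_def sum_distrib_left algebra_simps)
    also have "M' (M (uvec i)) = uvec i" using M(4) by (metis comp_apply id_apply)
    finally show ?thesis using elem_step by (simp add: uvec_def)
  qed
  have "M \<circ> transv i j a \<circ> M' = (\<lambda>f k. f k + v k * (\<Sum>s\<in>T. w s * f s))"
  proof (intro ext)
    fix f k
    have "transv i j a (M' f) = (\<lambda>l. M' f l + (a * M' f j) * uvec i l)"
      by (auto simp: transv_def uvec_def)
    then have "M (transv i j a (M' f)) k = M (M' f) k + a * M' f j * M (uvec i) k"
      by (simp add: linear_opD[OF lin])
    moreover have "M (M' f) = f" using M(3) by (metis comp_apply id_apply)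
    ultimately show "(M \<circ> transv i j a \<circ> M') f k = f k + v k * (\<Sum>s\<in>T. w s * f s)"
      unfolding M'j[symmetric] v_def by simp
  qed
  also have "\<dots> \<in> elem_ops R"
    using M R elem_step T wv
    by (intro elem_rank_one[OF inf R T])
       (auto simp: v_def w_def T_def fin_op_def row_op_def intro!: subring_intros)
  finally have "M \<circ> transv i j a \<circ> M' \<in> elem_ops R" .
  then have "(M \<circ> transv i j a \<circ> M') \<circ> (M \<circ> g \<circ> M') \<in> elem_ops R"
    using elem_step by (rule_tac elem_comp)
  moreover have "(M \<circ> transv i j a \<circ> M') \<circ> (M \<circ> g \<circ> M') = M \<circ> transv i j a \<circ> (M' \<circ> M) \<circ> g \<circ> M'"
    by (simp only: comp_assoc)
  moreover have "M \<circ> transv i j a \<circ> (M' \<circ> M) \<circ> g \<circ> M' = M \<circ> (transv i j a \<circ> g) \<circ> M'"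
    by (simp only: M(4) comp_id comp_assoc)
  ultimately show ?case by (simp only:)
qed

section \<open>Localisation, and words with comaximal denominators\<close>

definition loc :: "'a::field set \<Rightarrow> 'a \<Rightarrow> 'a set" where
  "loc R h = {r / h ^ k | r k. r \<in> R}"

lemma locI: "r \<in> R \<Longrightarrow> r / h ^ k \<in> loc R h"
  unfolding loc_def by blast

lemma loc_subring:
  assumes "is_subring R" "h \<in> R" "h \<noteq> 0"
  shows "is_subring (loc R h)"
  unfolding is_subring_def
proof (intro conjI ballI)
  show "0 \<in> loc R h" "1 \<in> loc R h"
    using assms unfolding loc_def by (force intro: subring_intros exI[of _ "0::nat"])+
next
  fix a b assume "a \<in> loc R h" "b \<in> loc R h"
  then obtain r k r' k' where ab: "a = r / h ^ k" "b = r' / h ^ k'" "r \<in> R" "r' \<in> R"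
    by (auto simp: loc_def)
  have "a + b = (r * h ^ k' + r' * h ^ k) / h ^ (k + k')" "a * b = (r * r') / h ^ (k + k')"
    using assms by (auto simp: ab power_add field_simps)
  moreover have "(r * h ^ k' + r' * h ^ k) / h ^ (k + k') \<in> loc R h" "(r * r') / h ^ (k + k') \<in> loc R h"
    using ab(3,4) assms(1,2) by (auto intro!: locI subring_add subring_mult subring_power)
  ultimately show "a + b \<in> loc R h" "a * b \<in> loc R h" by (metis, metis)
next
  fix a assume "a \<in> loc R h"
  then obtain r k where "a = r / h ^ k" "r \<in> R" by (auto simp: loc_def)
  then have "- a = (- r) / h ^ k" "- r \<in> R" using assms by (auto intro: subring_intros)
  then show "- a \<in> loc R h" unfolding loc_def by blast
qed

lemma loc_incl: "R \<subseteq> loc R h"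
  unfolding loc_def by (force intro: exI[of _ "0::nat"])

lemma loc_finite_denominator:
  assumes "is_subring R" "h \<in> R" "h \<noteq> 0" "finite S" "\<And>s. s \<in> S \<Longrightarrow> v s \<in> loc R h"
  shows "\<exists>k. \<forall>s\<in>S. h ^ k * v s \<in> R"
  using assms(4,5)
proof (induction S rule: finite_induct)
  case (insert x S)
  then obtain k where k: "\<forall>s\<in>S. h ^ k * v s \<in> R" by auto
  have "v x \<in> loc R h" using insert by blast
  then obtain r l where r: "v x = r / h ^ l" "r \<in> R" unfolding loc_def by blast
  have "h ^ (k + l) * v s \<in> R" if "s \<in> insert x S" for s
  proof (cases "s = x")
    case True
    then have "h ^ (k + l) * v s = h ^ k * r" using r assms by (simp add: power_add)
    then show ?thesis using r assms by (auto intro: subring_intros)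
  next
    case False
    have "h ^ (k + l) * v s = h ^ l * (h ^ k * v s)" by (simp add: power_add)
    then show ?thesis using False that k assms(1,2) by (metis insertE subring_mult subring_power)
  qed
  then show ?case by blast
qed auto

text \<open>Splitting a coefficient as \<open>a = b + c\<close> with \<open>b\<close> having no denominator \<open>q\<close> and \<open>c\<close> divisible by
  a high power of \<open>p\<close>, the transvection at \<open>c\<close> may be moved past a word with denominators \<open>p\<close>.\<close>
lemma elem_loc_factor:
  fixes g :: "('i \<Rightarrow> 'a::field) \<Rightarrow> 'i \<Rightarrow> 'a"
  assumes inf: "infinite (UNIV :: 'i set)" and R: "is_subring R"
    and pq: "p \<in> R" "q \<in> R" "p \<noteq> 0" "q \<noteq> 0"
    and comax: "\<And>N. \<exists>a\<in>R. \<exists>b\<in>R. a * p ^ N + b * q ^ N = 1"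
    and g: "g \<in> elem_ops (loc R (p * q))"
  shows "\<exists>g1\<in>elem_ops (loc R p). \<exists>g2\<in>elem_ops (loc R q). g = g1 \<circ> g2"
  using g
proof induction
  case elem_id
  then show ?case by (metis comp_id elem_ops.elem_id)
next
  case (elem_step i j a g)
  note Rp = loc_subring[OF R pq(1) pq(3)] and Rq = loc_subring[OF R pq(2) pq(4)]
  from elem_step obtain g1 g2 where g12: "g1 \<in> elem_ops (loc R p)" "g2 \<in> elem_ops (loc R q)" "g = g1 \<circ> g2"
    by blast
  obtain h where h: "h \<in> elem_ops (loc R p)" "g1 \<circ> h = id" "h \<circ> g1 = id"
    using elem_inverse[OF Rp g12(1)] by blast
  have fin: "fin_op (loc R p) g1" "fin_op (loc R p) h" using fin_op_elem[OF Rp] g12 h by auto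
  have lin: "linear_op h" using fin by (simp add: fin_op_def row_op_def)
  have "row_op (loc R p) g1" using fin by (simp add: fin_op_def)
  then obtain S where S: "finite S" "\<And>f. g1 f j = (\<Sum>s\<in>S. g1 (uvec s) j * f s)"
    using row_opE[of "loc R p" g1 j] by blast
  define T where "T = S \<union> {k. h (uvec i) k \<noteq> 0}"
  define w where "w = (\<lambda>s. if s \<in> S then g1 (uvec s) j else 0)"
  define v where "v = h (uvec i)"
  have T: "finite T" using S fin by (auto simp: T_def fin_op_def)
  have g1j: "g1 f j = (\<Sum>s\<in>T. w s * f s)" for f
    using T by (intro trans[OF S(2)] sum.mono_neutral_cong_left) (auto simp: T_def w_def)
  have wv: "(\<Sum>s\<in>T. w s * v s) = 0"
  proof -
    have "(\<Sum>s\<in>T. w s * v s) = g1 (h (uvec i)) j" unfolding g1j by (simp add: v_def)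
    also have "g1 (h (uvec i)) = uvec i" using h by (metis comp_apply id_apply)
    finally show ?thesis using elem_step by (simp add: uvec_def)
  qed
  have "\<exists>k. \<forall>s\<in>T. p ^ k * w s \<in> R"
    using fin by (intro loc_finite_denominator[OF R pq(1,3) T])
      (auto simp: w_def fin_op_def row_op_def subring_0[OF Rp])
  moreover have "\<exists>k. \<forall>s\<in>T. p ^ k * v s \<in> R"
    using fin by (intro loc_finite_denominator[OF R pq(1,3) T])
      (auto simp: v_def fin_op_def row_op_def)
  ultimately obtain k1 k2 where k: "\<forall>s\<in>T. p ^ k1 * w s \<in> R" "\<forall>s\<in>T. p ^ k2 * v s \<in> R" by blast
  from elem_step obtain r l where a: "a = r / (p * q) ^ l" "r \<in> R" by (auto simp: loc_def)
  \<comment> \<open>In the exponent, \<open>l\<close> cancels the denominator of \<open>a\<close>,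
    while \<open>k1\<close> and \<open>k2\<close> clear the denominators of the row \<open>w\<close>
    and of the column \<open>v\<close>, the two vectors that describe the conjugate of a
    transvection by \<open>g1\<close>.\<close>
  obtain x y where xy: "x \<in> R" "y \<in> R" "x * p ^ (k1 + k2 + l) + y * q ^ (k1 + k2 + l) = 1"
    using comax by blast
  define c' where "c' = r * x / q ^ l"
  define c where "c = p ^ (k1 + k2) * c'"
  define b where "b = r * y * q ^ (k1 + k2) / p ^ l"
  have abc: "a = b + c"
  proof -
    have "a = a * (x * p ^ (k1 + k2 + l) + y * q ^ (k1 + k2 + l))" using xy by simp
    also have "\<dots> = b + c"
      using pq by (simp add: a b_def c_def c'_def power_mult_distrib power_add field_simps)
    finally show ?thesis .
  qed
  have b: "b \<in> loc R p" unfolding b_def using xy a pq R by (intro locI subring_mult subring_power)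
  have c': "c' \<in> loc R q" unfolding c'_def using xy a pq R by (intro locI subring_mult subring_power)
  have "h \<circ> transv i j c \<circ> g1 = (\<lambda>f k. f k + (c' * (p ^ k2 * v k)) * (\<Sum>s\<in>T. (p ^ k1 * w s) * f s))"
  proof (intro ext)
    fix f k
    have "transv i j c (g1 f) = (\<lambda>l. g1 f l + (c * g1 f j) * uvec i l)"
      by (auto simp: transv_def uvec_def)
    then have "h (transv i j c (g1 f)) k = h (g1 f) k + c * g1 f j * h (uvec i) k"
      by (simp add: linear_opD[OF lin])
    moreover have "h (g1 f) = f" using h(3) by (metis comp_apply id_apply)
    moreover have "(\<Sum>s\<in>T. (p ^ k1 * w s) * f s) = p ^ k1 * g1 f j"
      unfolding g1j by (simp add: sum_distrib_left mult.assoc)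
    ultimately show "(h \<circ> transv i j c \<circ> g1) f k = f k + (c' * (p ^ k2 * v k)) * (\<Sum>s\<in>T. (p ^ k1 * w s) * f s)"
      by (simp add: v_def c_def power_add algebra_simps)
  qed
  also have "\<dots> \<in> elem_ops (loc R q)"
  proof (rule elem_rank_one[OF inf Rq T])
    have "(\<Sum>j\<in>T. p ^ k1 * w j * (c' * (p ^ k2 * v j))) = c' * p ^ k1 * p ^ k2 * (\<Sum>j\<in>T. w j * v j)"
      by (simp add: sum_distrib_left algebra_simps)
    then show "(\<Sum>j\<in>T. p ^ k1 * w j * (c' * (p ^ k2 * v j))) = 0" using wv by simp
    show "c' * (p ^ k2 * v s) \<in> loc R q" if "s \<in> T" for s
      using k that loc_incl[of R q] by (intro subring_mult[OF Rq c']) auto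
    show "p ^ k1 * w s \<in> loc R q" if "s \<in> T" for s
      using k that loc_incl[of R q] by auto
  qed (auto simp: T_def v_def)
  finally have *: "h \<circ> transv i j c \<circ> g1 \<in> elem_ops (loc R q)" .
  have "transv i j a \<circ> g = transv i j b \<circ> transv i j c \<circ> (g1 \<circ> g2)"
    using elem_step by (simp add: g12 abc transv_add)
  also have "\<dots> = transv i j b \<circ> (g1 \<circ> h) \<circ> transv i j c \<circ> (g1 \<circ> g2)" using h by simp
  also have "\<dots> = (transv i j b \<circ> g1) \<circ> ((h \<circ> transv i j c \<circ> g1) \<circ> g2)" by (simp only: comp_assoc)
  finally have "transv i j a \<circ> g = (transv i j b \<circ> g1) \<circ> ((h \<circ> transv i j c \<circ> g1) \<circ> g2)" .
  moreover have "transv i j b \<circ> g1 \<in> elem_ops (loc R p)" using elem_step(1) b g12(1) by (intro elem_comp elem_transv)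
  moreover have "(h \<circ> transv i j c \<circ> g1) \<circ> g2 \<in> elem_ops (loc R q)" using * g12(2) by (rule elem_comp)
  ultimately show ?case by (intro bexI)
qed

lemma comaximal_power:
  fixes p q :: "'a::field"
  assumes R: "is_subring R" and pq: "p \<in> R" "q \<in> R" and ab: "\<exists>a\<in>R. \<exists>b\<in>R. a * p + b * q = 1"
  shows "\<exists>a\<in>R. \<exists>b\<in>R. a * p ^ N + b * q ^ N = 1"
proof -
  have mult: "\<exists>a\<in>R. \<exists>b\<in>R. a * (x * y) + b * z = 1"
    if "\<exists>a\<in>R. \<exists>b\<in>R. a * x + b * z = 1" "\<exists>a\<in>R. \<exists>b\<in>R. a * y + b * z = 1" "x \<in> R" "y \<in> R" "z \<in> R" for x y z
  proof -
    from that obtain a b c d where h: "a \<in> R" "b \<in> R" "c \<in> R" "d \<in> R" "a * x + b * z = 1" "c * y + d * z = 1"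
      by blast
    have "(a * c) * (x * y) + (a * x * d + b * (c * y) + b * z * d) * z = (a * x + b * z) * (c * y + d * z)"
      by (simp add: algebra_simps)
    also have "\<dots> = 1" using h by simp
    finally have "(a * c) * (x * y) + (a * x * d + b * (c * y) + b * z * d) * z = 1" .
    moreover have "a * c \<in> R" "a * x * d + b * (c * y) + b * z * d \<in> R"
      using h(1-4) that(3-5) R by (auto intro!: subring_intros)
    ultimately show ?thesis by blast
  qed
  have 1: "\<exists>a\<in>R. \<exists>b\<in>R. a * p ^ N + b * q = 1" for N
  proof (induction N)
    case 0
    then show ?case using R by (intro bexI[of _ 1] bexI[of _ 0]) (auto intro: subring_intros)
  next
    case (Suc N)
    show ?case using mult[OF ab Suc] pq R by (auto intro: subring_intros)
  qed
  have swap: "\<exists>a\<in>R. \<exists>b\<in>R. a * y + b * x = 1" if "\<exists>a\<in>R. \<exists>b\<in>R. a * x + b * y = 1" for x y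
    using that by (metis add.commute)
  have "\<exists>a\<in>R. \<exists>b\<in>R. a * q ^ M + b * p ^ N = 1" for M
  proof (induction M)
    case 0
    then show ?case using R by (intro bexI[of _ 1] bexI[of _ 0]) (auto intro: subring_intros)
  next
    case (Suc M)
    show ?case using mult[OF swap[OF 1] Suc] pq R by (auto intro: subring_intros)
  qed
  from swap[OF this[of N]] show ?thesis .
qed

text \<open>Multiplying the partition of unity \<open>x p^N + y q^N = 1\<close> by \<open>r\<close>
  lets each summand absorb one of the two denominators.\<close>

lemma loc_inter:
  assumes R: "is_subring R" and pq: "p \<noteq> 0" "q \<noteq> 0"
    and comax: "\<And>N. \<exists>a\<in>R. \<exists>b\<in>R. a * p ^ N + b * q ^ N = 1"
    and pqR: "p \<in> R" "q \<in> R"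
    and r: "r \<in> loc R p" "r \<in> loc R q"
  shows "r \<in> R"
proof -
  from r obtain a k b l where ab: "r = a / p ^ k" "r = b / q ^ l" "a \<in> R" "b \<in> R" unfolding loc_def by blast
  obtain x y where xy: "x \<in> R" "y \<in> R" "x * p ^ (k + l) + y * q ^ (k + l) = 1" using comax by blast
  have "r * p ^ k = a" "r * q ^ l = b" using ab pq by (auto simp: field_simps)
  then have "x * p ^ l * a + y * q ^ k * b = r * (x * p ^ (k + l) + y * q ^ (k + l))"
    by (auto simp add: power_add algebra_simps)
  then have "r = x * p ^ l * a + y * q ^ k * b" using xy(3) by simp
  moreover have "x * p ^ l * a + y * q ^ k * b \<in> R"
    using xy ab(3,4) pqR R by (intro subring_add subring_mult subring_power)
  ultimately show ?thesis by simp
qed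

subsection \<open>Invertible block operators\<close>

text \<open>GL_N inside the stable group: an \<open>N\<close> by \<open>N\<close> block, continued
  by the identity. A block and its enlargement are the same operator, so stabilisation is merely
  \<open>isblk_mono\<close>.\<close>

definition isblk :: "nat \<Rightarrow> 'a::field set \<Rightarrow> ((nat \<Rightarrow> 'a) \<Rightarrow> nat \<Rightarrow> 'a) \<Rightarrow> bool" where
  "isblk N R g \<longleftrightarrow> linear_op g \<and> (\<forall>f i. N \<le> i \<longrightarrow> g f i = f i) \<and>
     (\<forall>f h i. (\<forall>j<N. f j = h j) \<longrightarrow> i < N \<longrightarrow> g f i = g h i) \<and>
     (\<forall>i<N. \<forall>j<N. g (uvec j) i \<in> R)"

lemma isblk_outside: "isblk N R g \<Longrightarrow> N \<le> i \<Longrightarrow> g f i = f i"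
  by (simp add: isblk_def)

lemma isblk_local: "isblk N R g \<Longrightarrow> (\<And>j. j < N \<Longrightarrow> f j = h j) \<Longrightarrow> i < N \<Longrightarrow> g f i = g h i"
  by (simp add: isblk_def)

lemma isblk_linear: "isblk N R g \<Longrightarrow> linear_op g"
  by (simp add: isblk_def)

lemma isblk_expand:
  assumes "isblk N R g" "i < N"
  shows "g f i = (\<Sum>j<N. g (uvec j) i * f j)"
proof (rule row_expand[OF isblk_linear[OF assms(1)] finite_lessThan])
  fix f h :: "nat \<Rightarrow> 'a" assume "\<And>s. s \<in> {..<N} \<Longrightarrow> f s = h s"
  then show "g f i = g h i" by (intro isblk_local[OF assms(1) _ assms(2)]) simp
qed

lemma isblk_far_column:
  assumes "isblk N R g" "N \<le> j" "i < N"
  shows "g (uvec j) i = 0"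
proof -
  have "g (uvec j) i = g (\<lambda>_. 0) i"
    by (rule isblk_local[OF assms(1) _ assms(3)]) (use assms in \<open>auto simp: uvec_def\<close>)
  then show ?thesis using linear_op_0[OF isblk_linear[OF assms(1)]] by simp
qed

lemma isblk_entry:
  assumes "is_subring R" "isblk N R g"
  shows "g (uvec j) i \<in> R"
proof (cases "i < N")
  case True
  then show ?thesis
    using assms isblk_far_column[OF assms(2), of j i] subring_0[OF assms(1)]
    by (cases "j < N") (auto simp: isblk_def)
next
  case False
  then have "g (uvec j) i = uvec j i" using assms by (simp add: isblk_def)
  then show ?thesis using subring_0[OF assms(1)] subring_1[OF assms(1)] by (simp add: uvec_def)
qed

lemma isblk_mono:
  assumes "is_subring R" "isblk N R g" "N \<le> N'"
  shows "isblk N' R g"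
  unfolding isblk_def
proof (intro conjI allI impI)
  show "linear_op g" using assms by (simp add: isblk_def)
next
  fix f h :: "nat \<Rightarrow> 'a" and i assume "\<forall>j<N'. f j = h j" "i < N'"
  then show "g f i = g h i"
    using assms isblk_local[OF assms(2), of f h i] isblk_outside[OF assms(2), of i] by (cases "i < N") auto
qed (use assms isblk_entry[OF assms(1,2)] isblk_outside[OF assms(2)] in auto)

lemma isblk_subset: "isblk N R g \<Longrightarrow> R \<subseteq> R' \<Longrightarrow> isblk N R' g"
  unfolding isblk_def by blast

lemma isblk_Int: "isblk N R g \<Longrightarrow> isblk N R' g \<Longrightarrow> isblk N (R \<inter> R') g"
  by (simp add: isblk_def)

lemma isblk_id: "is_subring R \<Longrightarrow> isblk N R id"
  by (auto simp: isblk_def linear_op_def uvec_def subring_0 subring_1)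

lemma isblk_comp:
  assumes R: "is_subring R" and g: "isblk N R g" and h: "isblk N R h"
  shows "isblk N R (g \<circ> h)"
  unfolding isblk_def
proof (intro conjI allI impI)
  show "linear_op (g \<circ> h)" using g h by (simp add: isblk_def linear_op_comp)
next
  fix f f' :: "nat \<Rightarrow> 'a" and i assume "\<forall>j<N. f j = f' j" "i < N"
  then have "h f j = h f' j" if "j < N" for j using isblk_local[OF h, of f f' j] that by auto
  then show "(g \<circ> h) f i = (g \<circ> h) f' i" using isblk_local[OF g, of "h f" "h f'" i] \<open>i < N\<close> by auto
next
  fix i j assume "i < N" "j < N"
  have "(g \<circ> h) (uvec j) i = (\<Sum>l<N. g (uvec l) i * h (uvec j) l)"
    using isblk_expand[OF g \<open>i < N\<close>, of "h (uvec j)"] by simp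
  also have "\<dots> \<in> R" using isblk_entry[OF R g] isblk_entry[OF R h] R by (intro subring_sum subring_mult)
  finally show "(g \<circ> h) (uvec j) i \<in> R" .
qed (use isblk_outside[OF g] isblk_outside[OF h] in auto)

lemma isblk_transv:
  assumes R: "is_subring R" and "a \<in> R" "i < N" "j < N"
  shows "isblk N R (transv i j a)"
  using assms linear_transv[of i j a]
  by (auto simp: isblk_def transv_def uvec_def intro!: subring_intros)

lemma isblk_elem:
  assumes R: "is_subring R" and "g \<in> elem_ops R"
  shows "\<exists>N. isblk N R g"
  using assms(2)
proof induction
  case elem_id
  then show ?case using isblk_id[OF R] by blast
next
  case (elem_step i j a g)
  then obtain N where N: "isblk N R g" by blast
  let ?N = "max N (Suc (max i j))"
  have "isblk ?N R (transv i j a)" using elem_step R by (intro isblk_transv) auto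
  moreover have "isblk ?N R g" using isblk_mono[OF R N] by simp
  ultimately show ?case using isblk_comp[OF R] by blast
qed

lemma fin_op_isblk:
  assumes R: "is_subring R" and g: "isblk N R g"
  shows "fin_op R g"
  unfolding fin_op_def row_op_def
proof (intro conjI allI)
  show "linear_op g" using g by (simp add: isblk_def)
  show "g (uvec i) k \<in> R" for i k by (rule isblk_entry[OF R g])
  show "\<exists>S. finite S \<and> (\<forall>f h. (\<forall>s\<in>S. f s = h s) \<longrightarrow> g f j = g h j)" for j
  proof (intro exI[of _ "insert j {..<N}"] conjI allI impI)
    fix f h :: "nat \<Rightarrow> 'a" assume "\<forall>s\<in>insert j {..<N}. f s = h s"
    then show "g f j = g h j"
      using isblk_local[OF g, of f h j] isblk_outside[OF g, of j] by (cases "j < N") auto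
  qed simp
  show "finite {k. g (uvec i) k \<noteq> 0}" for i
    by (rule finite_subset[of _ "insert i {..<N}"])
      (use isblk_outside[OF g, of _ "uvec i"] in \<open>auto simp: uvec_def simp flip: not_le\<close>)
qed

text \<open>\<open>g\<close> fixes every vector vanishing below \<open>N\<close>, hence so does
  \<open>h\<close>; applied to the difference of two vectors that agree below \<open>N\<close>, this
  makes \<open>h\<close> local to the same block. Inverses of words and of symbols come with a size
  \<open>M\<close> of their own, which is brought back to \<open>N\<close> here.\<close>

lemma isblk_inverse:
  assumes R: "is_subring R" and g: "isblk N R g" and h: "isblk M R h" and gh: "g \<circ> h = id" "h \<circ> g = id"
  shows "isblk N R h"
  unfolding isblk_def
proof (intro conjI allI impI)
  show lin: "linear_op h" using h by (simp add: isblk_def)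
  show "h f i = f i" if "N \<le> i" for f i
    using isblk_outside[OF g that, of "h f"] gh(1) by (metis comp_apply id_apply)
  fix f f' :: "nat \<Rightarrow> 'a" and i assume *: "\<forall>j<N. f j = f' j" "i < N"
  define d where "d = (\<lambda>i. f i + (- 1) * f' i)"
  have d: "d j = 0" if "j < N" for j using * that by (simp add: d_def)
  have "g d = d"
  proof
    fix j show "g d j = d j"
      using isblk_local[OF g, of d "\<lambda>_. 0" j] linear_op_0[OF isblk_linear[OF g]] isblk_outside[OF g, of j d] d
      by (cases "j < N") auto
  qed
  then have "h d i = 0" using gh(2) d \<open>i < N\<close> by (metis comp_apply id_apply)
  then show "h f i = h f' i" unfolding d_def by (simp only: linear_opD[OF lin]) simp
qed (rule isblk_entry[OF R h])

definition GLop :: "'a::field set \<Rightarrow> ((nat \<Rightarrow> 'a) \<Rightarrow> nat \<Rightarrow> 'a) set" where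
  "GLop R = {g. \<exists>N h. isblk N R g \<and> isblk N R h \<and> g \<circ> h = id \<and> h \<circ> g = id}"

lemma GLop_subset: "g \<in> GLop R \<Longrightarrow> R \<subseteq> R' \<Longrightarrow> g \<in> GLop R'"
  unfolding GLop_def using isblk_subset by blast

lemma GLop_comp:
  assumes R: "is_subring R" and "g \<in> GLop R" "h \<in> GLop R"
  shows "g \<circ> h \<in> GLop R"
proof -
  obtain N g' where g: "isblk N R g" "isblk N R g'" "g \<circ> g' = id" "g' \<circ> g = id"
    using assms by (auto simp: GLop_def)
  obtain M h' where h: "isblk M R h" "isblk M R h'" "h \<circ> h' = id" "h' \<circ> h = id"
    using assms by (auto simp: GLop_def)
  let ?N = "max M N"
  have "isblk ?N R (g \<circ> h)" "isblk ?N R (h' \<circ> g')"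
    using g h isblk_mono[OF R, of _ _ ?N] by (auto intro!: isblk_comp[OF R])
  moreover have "(g \<circ> h) \<circ> (h' \<circ> g') = g \<circ> (h \<circ> h') \<circ> g'" "(h' \<circ> g') \<circ> (g \<circ> h) = h' \<circ> (g' \<circ> g) \<circ> h"
    by (simp_all only: comp_assoc)
  ultimately show ?thesis unfolding GLop_def using g h by auto
qed

lemma GLop_elem:
  assumes R: "is_subring R" and g: "g \<in> elem_ops R"
  shows "g \<in> GLop R"
proof -
  obtain h where h: "h \<in> elem_ops R" "g \<circ> h = id" "h \<circ> g = id" using elem_inverse[OF R g] by blast
  obtain N M where "isblk N R g" "isblk M R h" using isblk_elem[OF R] g h by blast
  then have "isblk (max N M) R g" "isblk (max N M) R h" using isblk_mono[OF R] by (meson max.cobounded1 max.cobounded2)+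
  with h show ?thesis unfolding GLop_def by blast
qed

text \<open>Inverses of operators are unique, so the inverse over \<open>R\<close> and the inverse
  over \<open>R'\<close> coincide and have entries in both rings.\<close>

lemma GLop_Int:
  assumes R: "is_subring R" "is_subring R'" and g: "g \<in> GLop R" "g \<in> GLop R'"
  shows "g \<in> GLop (R \<inter> R')"
proof -
  obtain N h where h: "isblk N R g" "isblk N R h" "g \<circ> h = id" "h \<circ> g = id"
    using g by (auto simp: GLop_def)
  obtain M h' where h': "isblk M R' g" "isblk M R' h'" "g \<circ> h' = id" "h' \<circ> g = id"
    using g by (auto simp: GLop_def)
  have "h' = (h \<circ> g) \<circ> h'" using h by simp
  also have "\<dots> = h \<circ> (g \<circ> h')" by (simp only: comp_assoc)
  finally have "h' = h" using h' by simp
  let ?N = "max N M"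
  have "isblk ?N R g" "isblk ?N R h" "isblk ?N R' g" "isblk ?N R' h"
    using h h' \<open>h' = h\<close> isblk_mono[OF R(1), of _ _ ?N] isblk_mono[OF R(2), of _ _ ?N] by auto
  then have "isblk ?N (R \<inter> R') g" "isblk ?N (R \<inter> R') h" by (simp_all add: isblk_Int)
  then show ?thesis using h unfolding GLop_def by blast
qed

lemma infinite_nat: "infinite (UNIV :: nat set)"
  by simp

lemma GLop_conj:
  assumes R: "is_subring R" and g: "g \<in> GLop R" "h \<in> GLop R" "g \<circ> h = id" "h \<circ> g = id" and e: "e \<in> elem_ops R"
  shows "g \<circ> e \<circ> h \<in> elem_ops R"
proof -
  have "fin_op R g" "fin_op R h" using g(1,2) fin_op_isblk[OF R] by (auto simp: GLop_def)
  then show ?thesis using g e by (intro elem_conj[OF infinite_nat R])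
qed

section \<open>Elimination over a field, and determinants\<close>

definition dg :: "'a::field \<Rightarrow> (nat \<Rightarrow> 'a) \<Rightarrow> nat \<Rightarrow> 'a" where
  "dg u f = f(0 := u * f 0)"

lemma dg_mult: "dg u \<circ> dg v = dg (u * v)"
  by (auto simp: dg_def fun_eq_iff)

lemma dg_1: "dg 1 = id"
  by (auto simp: dg_def fun_eq_iff)

lemma isblk_dg: "is_subring R \<Longrightarrow> u \<in> R \<Longrightarrow> 0 < N \<Longrightarrow> isblk N R (dg u)"
  by (auto simp: isblk_def dg_def linear_op_def uvec_def fun_eq_iff algebra_simps intro!: subring_intros)

lemma GLop_dg:
  assumes "is_subring R" "u \<in> R" "v \<in> R" "u * v = 1"
  shows "dg u \<in> GLop R"
proof -
  have "dg u \<circ> dg v = id" "dg v \<circ> dg u = id" using assms by (simp_all add: dg_mult dg_1 mult.commute)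
  moreover have "isblk 1 R (dg u)" "isblk 1 R (dg v)" using isblk_dg[OF assms(1)] assms by auto
  ultimately show ?thesis unfolding GLop_def by blast
qed

definition is_subfield :: "'a::field set \<Rightarrow> bool" where
  "is_subfield F \<longleftrightarrow> is_subring F \<and> (\<forall>a\<in>F. inverse a \<in> F)"

lemma subfield_divide: "is_subfield F \<Longrightarrow> a \<in> F \<Longrightarrow> b \<in> F \<Longrightarrow> a / b \<in> F"
  unfolding is_subfield_def divide_inverse by (blast intro: subring_mult)

text \<open>Gaussian elimination. Left multiplication turns column \<open>N\<close> into a unit
  vector, right multiplication then clears row \<open>N\<close>, and a block of size
  \<open>N\<close> remains for the induction. Transvections cannot change the determinant, which
  survives as \<open>c\<close>.\<close>

lemma GL_field_aux:
  assumes F: "is_subfield F"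
  shows "isblk N F g \<Longrightarrow> isblk N F g' \<Longrightarrow> g \<circ> g' = id \<Longrightarrow> g' \<circ> g = id \<Longrightarrow>
    \<exists>e\<in>elem_ops F. \<exists>c\<in>F. c \<noteq> 0 \<and> g = e \<circ> dg c"
proof (induction N arbitrary: g g')
  case 0
  have "g = id" using isblk_outside[OF 0(1)] by (auto simp: fun_eq_iff)
  then show ?case using F elem_id by (intro bexI[of _ id] bexI[of _ 1]) (auto simp: dg_1 is_subfield_def subring_1)
next
  case (Suc N)
  have R: "is_subring F" using F by (simp add: is_subfield_def)
  show ?case
  proof (cases "N = 0")
    case True
    define c where "c = g (uvec 0) 0"
    have gdg: "g = dg c"
    proof (intro ext)
      fix f i show "g f i = dg c f i"
        using isblk_expand[OF Suc(2), of 0 f] isblk_outside[OF Suc(2), of i f] True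
        by (cases "i = 0") (auto simp: c_def dg_def)
    qed
    have "c \<noteq> 0"
    proof
      assume "c = 0"
      then have "g (uvec 0) = (\<lambda>i. 0)" unfolding gdg by (auto simp: dg_def uvec_def)
      then have "g' (g (uvec 0)) 0 = 0" using linear_op_0[OF isblk_linear[OF Suc(3)]] by simp
      moreover have "g' (g (uvec 0)) = uvec 0" using Suc(5) by (metis comp_apply id_apply)
      ultimately show False by (simp add: uvec_def)
    qed
    moreover have "c \<in> F" using isblk_entry[OF R Suc(2)] by (simp add: c_def)
    ultimately show ?thesis using gdg elem_id by (intro bexI[of _ id] bexI[of _ c]) auto
  next
    case False
    define v where "v = g (uvec N)"
    have vF: "v i \<in> F" for i using isblk_entry[OF R Suc(2)] by (simp add: v_def)
    have vout: "v i = 0" if "i > N" for i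
      using isblk_outside[OF Suc(2), of i "uvec N"] that by (auto simp: v_def uvec_def)
    have vne: "\<exists>i\<le>N. v i \<noteq> 0"
    proof (rule ccontr)
      assume "\<not> (\<exists>i\<le>N. v i \<noteq> 0)"
      then have "v = (\<lambda>i. 0)" using vout by (metis not_le)
      then have "g' v N = 0" using linear_op_0[OF isblk_linear[OF Suc(3)]] by simp
      moreover have "g' v = uvec N" unfolding v_def using Suc(5) by (metis comp_apply id_apply)
      ultimately show False by (simp add: uvec_def)
    qed
    \<comment> \<open>Entry \<open>N\<close> is to become 1 by adding a multiple of some nonzero
      entry above it. If the column is supported at \<open>N\<close> alone, its entry is first
      copied to position 0, which differs from \<open>N\<close> in this case.\<close>
    obtain e1 where e1: "e1 \<in> elem_ops F" "\<exists>i<N. e1 v i \<noteq> 0" "\<And>i. e1 v i \<in> F" "\<And>i. i > N \<Longrightarrow> e1 v i = 0"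
        "isblk (Suc N) F e1"
    proof (cases "\<exists>i<N. v i \<noteq> 0")
      case True
      then show ?thesis using that[of id] vF vout elem_id isblk_id[OF R] by auto
    next
      case v0: False
      then have "v N \<noteq> 0" using vne by (metis le_neq_implies_less)
      have t: "transv 0 N 1 v k = (if k = 0 then v N else v k)" for k
        using v0 False by (auto simp: transv_def)
      show ?thesis
      proof (rule that)
        show "transv 0 N 1 \<in> elem_ops F" using False by (intro elem_transv subring_1[OF R]) simp
        show "\<exists>i<N. transv 0 N 1 v i \<noteq> 0" using t \<open>v N \<noteq> 0\<close> False by (intro exI[of _ 0]) simp
        show "isblk (Suc N) F (transv 0 N 1)" by (intro isblk_transv[OF R] subring_1[OF R]) auto
      qed (use t vF vout in auto)
    qed
    then obtain i where i: "i < N" "e1 v i \<noteq> 0" by blast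
    define e2 where "e2 = transv N i ((1 - e1 v N) / e1 v i)"
    have e2: "e2 \<in> elem_ops F" unfolding e2_def
      using i e1 F R by (intro elem_transv subfield_divide subring_intros) auto
    define u where "u = e2 (e1 v)"
    have uN: "u N = 1" using i by (simp add: u_def e2_def transv_def)
    have ui: "u k \<in> F" "k > N \<Longrightarrow> u k = 0" for k
      using e1 i F R by (auto simp: u_def e2_def transv_def intro!: subring_intros subfield_divide)
    define e3 where "e3 = (\<lambda>f k. if k \<in> {..<N} then f k + (- u k) * f N else (f k :: 'a))"
    have e3: "e3 \<in> elem_ops F" unfolding e3_def
      using ui R by (intro elem_col_op) (auto intro: subring_intros)
    have e3u: "e3 u = uvec N" using ui uN by (auto simp: e3_def uvec_def fun_eq_iff)
    define e where "e = e3 \<circ> (e2 \<circ> e1)"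
    have e: "e \<in> elem_ops F" unfolding e_def using e1(1) e2 e3 by (intro elem_comp)
    have ev: "e v = uvec N" using e3u by (simp add: e_def u_def)
    obtain e' where e': "e' \<in> elem_ops F" "e \<circ> e' = id" "e' \<circ> e = id" using elem_inverse[OF R e] by blast
    have "isblk (Suc N) F e2" unfolding e2_def
      using i e1 F R by (intro isblk_transv subfield_divide subring_intros) auto
    moreover have "isblk (Suc N) F e3" unfolding isblk_def
      using ui R by (auto simp: e3_def linear_op_def fun_eq_iff algebra_simps uvec_def intro!: subring_intros)
    ultimately have be: "isblk (Suc N) F e" unfolding e_def using e1(5) by (intro isblk_comp[OF R])
    obtain M where "isblk M F e'" using isblk_elem[OF R e'(1)] by blast
    from isblk_inverse[OF R be this e'(2,3)] have be': "isblk (Suc N) F e'" .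
    define h where "h = e \<circ> g"
    have bh: "isblk (Suc N) F h" unfolding h_def by (rule isblk_comp[OF R be Suc(2)])
    have bh': "isblk (Suc N) F (g' \<circ> e')" by (rule isblk_comp[OF R Suc(3) be'])
    have "h \<circ> (g' \<circ> e') = e \<circ> (g \<circ> g') \<circ> e'" "(g' \<circ> e') \<circ> h = g' \<circ> (e' \<circ> e) \<circ> g"
      by (simp_all only: h_def comp_assoc)
    then have hh': "h \<circ> (g' \<circ> e') = id" "(g' \<circ> e') \<circ> h = id"
      by (simp_all only: Suc(4,5) e' comp_id)
    have hN: "h (uvec N) = uvec N" using ev by (simp add: h_def v_def)
    define w where "w = (\<lambda>j. h (uvec j) N)"
    have wF: "w j \<in> F" for j unfolding w_def by (rule isblk_entry[OF R bh])
    define r where "r = (\<lambda>f :: nat \<Rightarrow> 'a. f(N := f N + (\<Sum>j\<in>{..<N}. (- w j) * f j)))"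
    define r' where "r' = (\<lambda>f :: nat \<Rightarrow> 'a. f(N := f N + (\<Sum>j\<in>{..<N}. w j * f j)))"
    have r: "r \<in> elem_ops F" unfolding r_def using wF R by (intro elem_row_op) (auto intro: subring_intros)
    have r': "r' \<in> elem_ops F" unfolding r'_def using wF R by (intro elem_row_op) auto
    have br: "isblk (Suc N) F r" "isblk (Suc N) F r'" unfolding isblk_def r_def r'_def
      using wF R by (auto simp: linear_op_def fun_eq_iff algebra_simps uvec_def sum.distrib sum_distrib_left
         sum_negf sum_subtractf intro!: subring_intros)
    have rr': "r \<circ> r' = id" "r' \<circ> r = id"
      by (auto simp: r_def r'_def fun_eq_iff sum_negf)
    define k where "k = h \<circ> r"
    have bk: "isblk (Suc N) F k" unfolding k_def by (rule isblk_comp[OF R bh br(1)])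
    have bk': "isblk (Suc N) F (r' \<circ> (g' \<circ> e'))" by (rule isblk_comp[OF R br(2) bh'])
    have "k \<circ> (r' \<circ> (g' \<circ> e')) = h \<circ> (r \<circ> r') \<circ> (g' \<circ> e')"
      "(r' \<circ> (g' \<circ> e')) \<circ> k = r' \<circ> ((g' \<circ> e') \<circ> h) \<circ> r"
      by (simp_all only: k_def comp_assoc)
    then have kk': "k \<circ> (r' \<circ> (g' \<circ> e')) = id" "(r' \<circ> (g' \<circ> e')) \<circ> k = id"
      by (simp_all only: rr' hh' comp_id)
    have "r (uvec N) = uvec N" by (auto simp: r_def uvec_def fun_eq_iff)
    then have kN: "k (uvec N) = uvec N" using hN by (simp add: k_def)
    have kfN: "k f N = f N" for f
    proof -
      have "k f N = (\<Sum>j<Suc N. h (uvec j) N * r f j)"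
        using isblk_expand[OF bh, of N "r f"] by (simp add: k_def)
      also have "\<dots> = (\<Sum>j<N. w j * f j) + (f N + (\<Sum>j<N. - w j * f j))"
        using hN by (simp add: w_def r_def uvec_def)
      finally show ?thesis by (simp add: sum_negf)
    qed
    have "isblk N F k" unfolding isblk_def
    proof (intro conjI allI impI)
      show "linear_op k" using bk by (simp add: isblk_def)
      show "k f i = f i" if "N \<le> i" for f i
        using kfN isblk_outside[OF bk, of i f] that by (cases "i = N") auto
      fix f f' :: "nat \<Rightarrow> 'a" and i assume *: "\<forall>j<N. f j = f' j" "i < N"
      show "k f i = k f' i"
        using isblk_expand[OF bk, of i f] isblk_expand[OF bk, of i f'] * kN by (simp add: uvec_def)
    qed (rule isblk_entry[OF R bk])
    from Suc.IH[OF this isblk_inverse[OF R this bk' kk'] kk'] obtain e4 c where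
      e4: "e4 \<in> elem_ops F" "c \<in> F" "c \<noteq> 0" "k = e4 \<circ> dg c" by blast
    have c: "inverse c \<in> F" "c * inverse c = 1" "inverse c * c = 1" using F e4 by (auto simp: is_subfield_def)
    have dgc: "dg c \<in> GLop F" "dg (inverse c) \<in> GLop F" using GLop_dg[OF R] e4 c by blast+
    have dd: "dg c \<circ> dg (inverse c) = id" "dg (inverse c) \<circ> dg c = id" using c by (simp_all add: dg_mult dg_1)
    \<comment> \<open>As \<open>g = e' k r'\<close> and \<open>k = e4 dg c\<close>, the row
      operation \<open>r'\<close> stands to the right of \<open>dg c\<close>; conjugation moves it
      to the left.\<close>
    have e5: "dg c \<circ> r' \<circ> dg (inverse c) \<in> elem_ops F" by (rule GLop_conj[OF R dgc dd r'])
    have "e' \<circ> (e4 \<circ> (dg c \<circ> r' \<circ> dg (inverse c))) \<circ> dg c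
       = e' \<circ> (e4 \<circ> dg c) \<circ> r' \<circ> (dg (inverse c) \<circ> dg c)" by (simp only: comp_assoc)
    also have "\<dots> = e' \<circ> (e \<circ> g \<circ> r) \<circ> r'" using dd e4(4) by (simp add: k_def h_def)
    also have "\<dots> = (e' \<circ> e) \<circ> g \<circ> (r \<circ> r')" by (simp only: comp_assoc)
    also have "\<dots> = g" using e' rr' by simp
    finally have "g = e' \<circ> (e4 \<circ> (dg c \<circ> r' \<circ> dg (inverse c))) \<circ> dg c" by simp
    moreover have "e' \<circ> (e4 \<circ> (dg c \<circ> r' \<circ> dg (inverse c))) \<in> elem_ops F"
      using e'(1) e4(1) e5 by (meson elem_comp)
    ultimately show ?thesis using e4(2,3) by blast
  qed
qed

lemma GL_field:
  assumes "is_subfield F" "g \<in> GLop F"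
  shows "\<exists>e\<in>elem_ops F. \<exists>c\<in>F. c \<noteq> 0 \<and> g = e \<circ> dg c"
  using assms GL_field_aux unfolding GLop_def by blast

definition op_det :: "nat \<Rightarrow> ((nat \<Rightarrow> 'a::field) \<Rightarrow> nat \<Rightarrow> 'a) \<Rightarrow> 'a" where
  "op_det N g = det (mat N N (\<lambda>(i, j). g (uvec j) i))"

lemma op_det_comp:
  assumes g: "isblk N R g" and h: "isblk N R h"
  shows "op_det N (g \<circ> h) = op_det N g * op_det N h"
proof -
  have "mat N N (\<lambda>(i, j). (g \<circ> h) (uvec j) i) = mat N N (\<lambda>(i, j). g (uvec j) i) * mat N N (\<lambda>(i, j). h (uvec j) i)"
  proof (rule eq_matI)
    fix i j assume "i < dim_row (mat N N (\<lambda>(i, j). g (uvec j) i) * mat N N (\<lambda>(i, j). h (uvec j) i))"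
      "j < dim_col (mat N N (\<lambda>(i, j). g (uvec j) i) * mat N N (\<lambda>(i, j). h (uvec j) i))"
    then have ij: "i < N" "j < N" by auto
    show "mat N N (\<lambda>(i, j). (g \<circ> h) (uvec j) i) $$ (i, j)
       = (mat N N (\<lambda>(i, j). g (uvec j) i) * mat N N (\<lambda>(i, j). h (uvec j) i)) $$ (i, j)"
      using ij isblk_expand[OF g ij(1), of "h (uvec j)"]
      by (simp add: scalar_prod_def atLeast0LessThan)
  qed auto
  then show ?thesis unfolding op_det_def by (simp add: det_mult[of _ N])
qed

lemma op_det_id: "op_det N (id :: (nat \<Rightarrow> 'a::field) \<Rightarrow> nat \<Rightarrow> 'a) = 1"
proof -
  have "mat N N (\<lambda>(i, j). id (uvec j) i) = (1\<^sub>m N :: 'a mat)" by (rule eq_matI) (auto simp: uvec_def)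
  then have "det (mat N N (\<lambda>(i, j). id (uvec j) i)) = det (1\<^sub>m N :: 'a mat)" by (rule arg_cong)
  then show ?thesis unfolding op_det_def by simp
qed

lemma op_det_transv:
  assumes "i \<noteq> j" "i < N" "j < N"
  shows "op_det N (transv i j a) = 1"
proof -
  have "mat N N (\<lambda>(k, l). transv i j a (uvec l) k) = addrow_mat N a i j"
    using assms by (intro eq_matI) (auto simp: transv_def uvec_def)
  then show ?thesis using assms by (simp add: op_det_def det_addrow_mat)
qed

lemma op_det_dg: "0 < N \<Longrightarrow> op_det N (dg u) = u"
proof -
  assume "0 < N"
  moreover have "mat N N (\<lambda>(k, l). dg u (uvec l) k) = multrow_mat N 0 u"
    by (intro eq_matI) (auto simp: dg_def uvec_def)
  ultimately show ?thesis by (simp add: op_det_def det_multrow_mat)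
qed

lemma op_det_mem:
  assumes R: "is_subring R" and g: "isblk N R g"
  shows "op_det N g \<in> R"
proof -
  have "signof p \<in> R" for p using R by (auto simp: sign_def intro: subring_intros)
  moreover have "mat N N (\<lambda>(i, j). g (uvec j) i) $$ (i, p i) \<in> R" if "p permutes {0..<N}" "i \<in> {0..<N}" for p i
    using that permutes_in_image[OF that(1), of i] isblk_entry[OF R g] by simp
  ultimately show ?thesis unfolding op_det_def
    by (subst det_def'[of _ N]) (auto intro!: subring_sum[OF R] subring_mult[OF R] subring_prod[OF R])
qed

text \<open>Only for large \<open>N\<close>: a transvection that reaches beyond the corner of size
  \<open>N\<close> would be cut by \<open>op_det N\<close>.\<close>

lemma op_det_elem:
  assumes R: "is_subring R" and "g \<in> elem_ops R"
  shows "\<exists>N0. \<forall>N\<ge>N0. op_det N g = 1"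
  using assms(2)
proof induction
  case elem_id
  then show ?case using op_det_id by blast
next
  case (elem_step i j a g)
  then obtain N0 where N0: "\<And>N. N \<ge> N0 \<Longrightarrow> op_det N g = 1" by blast
  obtain M where M: "isblk M R g" using isblk_elem[OF R elem_step(3)] by blast
  have "op_det N (transv i j a \<circ> g) = 1" if "N \<ge> Suc (max (max i j) (max M N0))" for N
  proof -
    have "isblk N R (transv i j a)" "isblk N R g"
      using that elem_step R isblk_mono[OF R M, of N] by (auto intro: isblk_transv)
    from op_det_comp[OF this] show ?thesis using N0[of N] that elem_step by (simp add: op_det_transv)
  qed
  then show ?case by blast
qed

text \<open>The factor \<open>u\<close> is the determinant of \<open>g\<close>, since elementary
  operators have determinant 1 over any ring. So \<open>u\<close> and its inverse are determinants
  of matrices over \<open>R\<close>, although \<open>e\<close> is elementary only over the larger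
  ring.\<close>

lemma GL_det_unit:
  assumes R: "is_subring R" and R': "is_subring R'" and RR': "R \<subseteq> R'"
    and g: "g \<in> GLop R" and eq: "g = e \<circ> dg u" "e \<in> elem_ops R'" "u \<in> R'" "u \<noteq> 0"
  shows "u \<in> R" "inverse u \<in> R"
proof -
  obtain N h where h: "isblk N R g" "isblk N R h" "g \<circ> h = id" "h \<circ> g = id"
    using g by (auto simp: GLop_def)
  obtain N0 where N0: "\<And>N. N \<ge> N0 \<Longrightarrow> op_det N e = 1" using op_det_elem[OF R' eq(2)] by blast
  obtain N1 where N1: "isblk N1 R' e" using isblk_elem[OF R' eq(2)] by blast
  define M where "M = Suc (max N (max N0 N1))"
  have M: "isblk M R g" "isblk M R h" "isblk M R' e" "isblk M R' (dg u)"
    using isblk_mono[OF R h(1), of M] isblk_mono[OF R h(2), of M] isblk_mono[OF R' N1, of M] isblk_dg[OF R' eq(3), of M]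
    by (auto simp: M_def)
  have "op_det M g = u" using op_det_comp[OF M(3,4)] N0[of M] eq(1) by (simp add: M_def op_det_dg)
  then show "u \<in> R" using op_det_mem[OF R M(1)] by simp
  have "op_det M g * op_det M h = 1" using op_det_comp[OF M(1,2)] h(3) by (simp add: op_det_id)
  then have "op_det M h = inverse u" using \<open>op_det M g = u\<close> by (metis inverse_unique)
  then show "inverse u \<in> R" using op_det_mem[OF R M(2)] by simp
qed

subsection \<open>Toeplitz operators and the patching argument\<close>

lemma row_op_entry: "row_op R M \<Longrightarrow> M (uvec i) k \<in> R"
  unfolding row_op_def by blast

section \<open>Polynomials over a subring and their values at a transcendental element\<close>

definition pol :: "'a::field set \<Rightarrow> 'a poly \<Rightarrow> bool" where
  "pol B p \<longleftrightarrow> (\<forall>i. coeff p i \<in> B)"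

lemma pol_0: "is_subring B \<Longrightarrow> pol B 0"
  and pol_add: "is_subring B \<Longrightarrow> pol B p \<Longrightarrow> pol B q \<Longrightarrow> pol B (p + q)"
  and pol_diff: "is_subring B \<Longrightarrow> pol B p \<Longrightarrow> pol B q \<Longrightarrow> pol B (p - q)"
  and pol_uminus: "is_subring B \<Longrightarrow> pol B p \<Longrightarrow> pol B (- p)"
  and pol_mult: "is_subring B \<Longrightarrow> pol B p \<Longrightarrow> pol B q \<Longrightarrow> pol B (p * q)"
  by (auto simp: pol_def coeff_mult intro!: subring_intros)

lemma pol_monom: "is_subring B \<Longrightarrow> c \<in> B \<Longrightarrow> pol B (monom c n)"
  by (auto simp: pol_def coeff_monom subring_0)

lemma pol_1: "is_subring B \<Longrightarrow> pol B 1"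
  using pol_monom[of B 1 0] subring_1[of B] by (simp add: monom_eq_1)

lemma pol_sum: "is_subring B \<Longrightarrow> (\<And>x. x \<in> A \<Longrightarrow> pol B (f x)) \<Longrightarrow> pol B (sum f A)"
  by (induction A rule: infinite_finite_induct) (auto intro: pol_0 pol_add)

lemma pol_pCons: "pol B (pCons c p) \<longleftrightarrow> c \<in> B \<and> pol B p"
proof
  assume h: "pol B (pCons c p)"
  have "coeff p i \<in> B" for i using h[unfolded pol_def, rule_format, of "Suc i"] by simp
  moreover have "c \<in> B" using h[unfolded pol_def, rule_format, of 0] by simp
  ultimately show "c \<in> B \<and> pol B p" by (simp add: pol_def)
qed (auto simp: pol_def coeff_pCons split: nat.split)

definition transc :: "'a::field set \<Rightarrow> 'a \<Rightarrow> bool" where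
  "transc B t \<longleftrightarrow> (\<forall>p. pol B p \<longrightarrow> poly p t = 0 \<longrightarrow> p = 0)"

lemma transc_eq:
  assumes "is_subring B" "transc B t" "pol B p" "pol B q" "poly p t = poly q t"
  shows "p = q"
proof -
  have "poly (p - q) t = 0" "pol B (p - q)" using assms by (auto intro: pol_diff)
  then have "p - q = 0" using assms(2) by (auto simp: transc_def)
  then show ?thesis by simp
qed

lemma transc_nz:
  assumes "is_subring B" "transc B t"
  shows "t \<noteq> 0"
proof
  assume "t = 0"
  then have "poly [:0, 1:] t = 0" by simp
  moreover have "pol B [:0, 1:]" using assms by (auto simp: pol_pCons subring_0 subring_1 pol_0)
  ultimately show False using assms(2) by (fastforce simp: transc_def)
qed

lemma pol_reflect: "is_subring B \<Longrightarrow> pol B p \<Longrightarrow> pol B (reflect_poly p)"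
  by (auto simp: pol_def coeff_reflect_poly subring_0)

text \<open>A relation satisfied by \<open>1 / t\<close> becomes one satisfied by \<open>t\<close>
  when its coefficients are reversed.\<close>

lemma transc_inverse:
  assumes B: "is_subring B" and t: "transc B t"
  shows "transc B (1 / t)"
  unfolding transc_def
proof (intro allI impI)
  fix p assume p: "pol B p" "poly p (1 / t) = 0"
  have t0: "t \<noteq> 0" by (rule transc_nz[OF B t])
  have "poly (reflect_poly p) t = t ^ degree p * poly p (inverse t)"
    using t0 by (rule poly_reflect_poly_nz)
  also have "\<dots> = 0" using p(2) by (simp add: inverse_eq_divide)
  finally have "reflect_poly p = 0" using t pol_reflect[OF B p(1)] by (auto simp: transc_def)
  then show "p = 0" by simp
qed

definition adj :: "'a::field set \<Rightarrow> 'a \<Rightarrow> 'a set" where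
  "adj B t = {poly p t | p. pol B p}"

lemma adjI: "pol B p \<Longrightarrow> poly p t \<in> adj B t"
  by (auto simp: adj_def)

lemma adj_subring:
  assumes B: "is_subring B"
  shows "is_subring (adj B t)"
  unfolding is_subring_def
proof (intro conjI ballI)
  show "0 \<in> adj B t" "1 \<in> adj B t"
    using adjI[OF pol_0[OF B], of t] adjI[OF pol_1[OF B], of t] by simp_all
next
  fix a b assume "a \<in> adj B t" "b \<in> adj B t"
  then obtain p q where "a = poly p t" "b = poly q t" "pol B p" "pol B q" by (auto simp: adj_def)
  then show "a + b \<in> adj B t" "a * b \<in> adj B t"
    using adjI[OF pol_add[OF B, of p q], of t] adjI[OF pol_mult[OF B, of p q], of t] by simp_all
next
  fix a assume "a \<in> adj B t"
  then obtain p where "a = poly p t" "pol B p" by (auto simp: adj_def)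
  then show "- a \<in> adj B t" using adjI[OF pol_uminus[OF B, of p], of t] by simp
qed

lemma adj_incl: "is_subring B \<Longrightarrow> B \<subseteq> adj B t"
proof
  fix b assume "is_subring B" "b \<in> B"
  then show "b \<in> adj B t" using adjI[of B "[:b:]" t] by (simp add: pol_pCons pol_0)
qed

lemma adj_gen: "is_subring B \<Longrightarrow> t \<in> adj B t"
  using adjI[of B "[:0, 1:]" t] by (simp add: pol_pCons pol_0 subring_0 subring_1)

lemma adj_least:
  assumes R: "is_subring R" and "B \<subseteq> R" "t \<in> R"
  shows "adj B t \<subseteq> R"
proof -
  have "poly p t \<in> R" if "pol B p" for p
    using that assms by (auto simp: poly_altdef pol_def intro!: subring_intros)
  then show ?thesis by (auto simp: adj_def)
qed

section \<open>Block Toeplitz operators and their symbols\<close>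

definition papp :: "((nat \<Rightarrow> 'a::field) \<Rightarrow> nat \<Rightarrow> 'a) \<Rightarrow> 'a poly \<Rightarrow> (nat \<Rightarrow> 'a) \<Rightarrow> nat \<Rightarrow> 'a" where
  "papp Z p h a = (\<Sum>d\<le>degree p. coeff p d * (Z ^^ d) h a)"

lemma papp_ext: "degree p \<le> n \<Longrightarrow> papp Z p h a = (\<Sum>d\<le>n. coeff p d * (Z ^^ d) h a)"
  unfolding papp_def by (rule sum.mono_neutral_left) (auto simp: coeff_eq_0)

lemma papp_pCons: "papp Z (pCons c p) h a = c * h a + papp Z p (Z h) a"
proof -
  have "papp Z (pCons c p) h a = (\<Sum>d\<le>Suc (degree p). coeff (pCons c p) d * (Z ^^ d) h a)"
    by (rule papp_ext) (rule degree_pCons_le)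
  also have "\<dots> = c * h a + (\<Sum>d\<le>degree p. coeff p d * (Z ^^ Suc d) h a)"
    by (subst sum.atMost_Suc_shift) simp
  also have "(\<Sum>d\<le>degree p. coeff p d * (Z ^^ Suc d) h a) = papp Z p (Z h) a"
    unfolding papp_def by (simp add: funpow_swap1)
  finally show ?thesis .
qed

lemma papp_0: "papp Z 0 h a = 0"
  by (simp add: papp_def)

lemma papp_1: "papp Z 1 h a = h a"
  by (simp add: papp_def)

lemma papp_add: "papp Z (p + q) h a = papp Z p h a + papp Z q h a"
proof -
  let ?n = "max (degree p) (degree q)"
  have "papp Z (p + q) h a = (\<Sum>d\<le>?n. coeff (p + q) d * (Z ^^ d) h a)"
    by (rule papp_ext) (rule degree_add_le_max)
  then show ?thesis
    by (simp add: papp_ext[of p ?n] papp_ext[of q ?n] sum.distrib algebra_simps)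
qed

lemma papp_smult: "papp Z (Polynomial.smult c p) h a = c * papp Z p h a"
  by (subst papp_ext[of _ "degree p"]) (auto simp: papp_def sum_distrib_left mult.assoc degree_smult_le)

lemma papp_sum: "papp Z (\<Sum>x\<in>A. p x) h a = (\<Sum>x\<in>A. papp Z (p x) h a)"
  by (induction A rule: infinite_finite_induct) (auto simp: papp_0 papp_add)

lemma linear_funpow:
  fixes Z :: "('i \<Rightarrow> 'a::field) \<Rightarrow> 'i \<Rightarrow> 'a"
  shows "linear_op Z \<Longrightarrow> linear_op (Z ^^ d)"
  by (induction d) (simp_all add: linear_op_comp, simp add: linear_op_def)

lemma linear_papp:
  assumes "linear_op Z"
  shows "linear_op (papp Z p)"
  using linear_opD[OF linear_funpow[OF assms]]
  by (auto simp: linear_op_def papp_def fun_eq_iff sum.distrib sum_distrib_left algebra_simps)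

lemma papp_comm:
  assumes "linear_op Z"
  shows "papp Z p (Z h) a = Z (papp Z p h) a"
proof -
  have "papp Z p h = (\<lambda>a. \<Sum>d\<le>degree p. coeff p d * (Z ^^ d) h a)" by (auto simp: papp_def)
  then have "Z (papp Z p h) a = (\<Sum>d\<le>degree p. coeff p d * Z ((Z ^^ d) h) a)"
    by (simp add: linear_op_sum[OF assms])
  then show ?thesis by (simp add: papp_def funpow_swap1)
qed

lemma papp_mult:
  assumes "linear_op Z"
  shows "papp Z (p * q) h a = papp Z p (papp Z q h) a"
proof (induction p arbitrary: h)
  case 0
  then show ?case by (simp add: papp_0)
next
  case (pCons c p)
  have "papp Z (pCons c p * q) h a = c * papp Z q h a + papp Z (p * q) (Z h) a"
    by (simp add: papp_add papp_smult papp_pCons)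
  also have "papp Z (p * q) (Z h) a = papp Z p (Z (papp Z q h)) a"
    using pCons papp_comm[OF assms, of q h] by (simp add: fun_eq_iff[symmetric])
  finally show ?case by (simp add: papp_pCons)
qed

definition pblk :: "nat \<Rightarrow> (nat \<Rightarrow> nat \<Rightarrow> 'a::field poly) \<Rightarrow> 'a \<Rightarrow> (nat \<Rightarrow> 'a) \<Rightarrow> nat \<Rightarrow> 'a" where
  "pblk N P t f i = (if i < N then \<Sum>j<N. poly (P i j) t * f j else f i)"

text \<open>The block Toeplitz operator of \<open>P\<close>: the index \<open>(i, a)\<close> is
  matrix row \<open>i\<close> at position \<open>a\<close>, and the variable is replaced by the
  shift \<open>Z\<close>. It lifts the matrix \<open>P(t)\<close> if \<open>Z = Ysh\<close> and
  \<open>P(1 / t)\<close> if \<open>Z = Xsh\<close>.\<close>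

definition matop :: "((nat \<Rightarrow> 'a::field) \<Rightarrow> nat \<Rightarrow> 'a) \<Rightarrow> nat \<Rightarrow> (nat \<Rightarrow> nat \<Rightarrow> 'a poly) \<Rightarrow>
    (nat \<times> nat \<Rightarrow> 'a) \<Rightarrow> nat \<times> nat \<Rightarrow> 'a" where
  "matop Z N P f = (\<lambda>(i, a). if i < N then \<Sum>j<N. papp Z (P i j) (\<lambda>b. f (j, b)) a else f (i, a))"

lemma pblk_entry: "i < N \<Longrightarrow> j < N \<Longrightarrow> pblk N P t (uvec j) i = poly (P i j) t"
  by (simp add: pblk_def uvec_def if_distrib cong: if_cong)

text \<open>Transcendence of \<open>t\<close> turns an identity of values into an identity of
  polynomials, and this can be evaluated at a shift operator: it is the hypothesis of
  \<open>matop_inverse\<close>.\<close>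

lemma pblk_inverse_poly:
  assumes B: "is_subring B" "transc B t" and P: "\<And>i j. pol B (P i j)" "\<And>i j. pol B (Q i j)"
    and PQ: "pblk N P t \<circ> pblk N Q t = id" and ij: "i < N" "j < N"
  shows "(\<Sum>k<N. P i k * Q k j) = (if i = j then 1 else 0)"
proof (rule transc_eq[OF B])
  show "pol B (\<Sum>k<N. P i k * Q k j)" using P B by (intro pol_sum pol_mult)
  show "pol B (if i = j then 1 else 0)" using B by (simp add: pol_0 pol_1)
  have "pblk N P t (pblk N Q t (uvec j)) i = uvec j i" using PQ by (metis comp_apply id_apply)
  then have "(\<Sum>k<N. poly (P i k) t * pblk N Q t (uvec j) k) = uvec j i"
    using ij by (simp add: pblk_def[of N P])
  then show "poly (\<Sum>k<N. P i k * Q k j) t = poly (if i = j then 1 else 0) t"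
    using ij by (simp add: poly_sum pblk_entry) (simp add: uvec_def)
qed

lemma matop_inverse:
  assumes Z: "linear_op Z" and PQ: "\<And>i j. i < N \<Longrightarrow> j < N \<Longrightarrow> (\<Sum>k<N. P i k * Q k j) = (if i = j then 1 else 0)"
  shows "matop Z N P \<circ> matop Z N Q = id"
proof (intro ext)
  fix f :: "nat \<times> nat \<Rightarrow> 'a" and ia :: "nat \<times> nat"
  obtain i a where ia: "ia = (i, a)" by fastforce
  show "(matop Z N P \<circ> matop Z N Q) f ia = id f ia"
  proof (cases "i < N")
    case True
    have "papp Z (P i k) (\<lambda>b. matop Z N Q f (k, b)) a = (\<Sum>j<N. papp Z (P i k * Q k j) (\<lambda>b. f (j, b)) a)"
      if "k < N" for k
    proof -
      have "(\<lambda>b. matop Z N Q f (k, b)) = (\<lambda>b. \<Sum>j<N. 1 * papp Z (Q k j) (\<lambda>b. f (j, b)) b)"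
        using that by (simp add: matop_def)
      then have "papp Z (P i k) (\<lambda>b. matop Z N Q f (k, b)) a
          = (\<Sum>j<N. 1 * papp Z (P i k) (papp Z (Q k j) (\<lambda>b. f (j, b))) a)"
        by (simp only: linear_op_sum[OF linear_papp[OF Z]])
      then show ?thesis by (simp add: papp_mult[OF Z])
    qed
    then have "matop Z N P (matop Z N Q f) (i, a) = (\<Sum>k<N. \<Sum>j<N. papp Z (P i k * Q k j) (\<lambda>b. f (j, b)) a)"
      using True by (simp add: matop_def[of Z N P])
    also have "\<dots> = (\<Sum>j<N. \<Sum>k<N. papp Z (P i k * Q k j) (\<lambda>b. f (j, b)) a)" by (rule sum.swap)
    also have "\<dots> = (\<Sum>j<N. if i = j then f (j, a) else 0)"
      using True by (intro sum.cong) (auto simp: PQ papp_1 papp_0 simp flip: papp_sum)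
    also have "\<dots> = f (i, a)" using True by simp
    finally show ?thesis by (simp add: ia)
  qed (simp add: ia matop_def)
qed

definition Ysh :: "(nat \<Rightarrow> 'a::field) \<Rightarrow> nat \<Rightarrow> 'a" where "Ysh h a = h (Suc a)"

definition Xsh :: "(nat \<Rightarrow> 'a::field) \<Rightarrow> nat \<Rightarrow> 'a" where "Xsh h a = (if a = 0 then 0 else h (a - 1))"

lemma linear_Ysh: "linear_op Ysh" and linear_Xsh: "linear_op Xsh"
  by (auto simp: linear_op_def Ysh_def Xsh_def fun_eq_iff)

lemma Ysh_pow: "(Ysh ^^ d) h a = h (a + d)"
  by (induction d arbitrary: a) (auto simp: Ysh_def)

lemma Xsh_pow: "(Xsh ^^ d) h a = (if d \<le> a then h (a - d) else 0)"
  by (induction d arbitrary: a) (auto simp: Xsh_def)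

lemma papp_Ysh: "papp Ysh p h a = (\<Sum>d\<le>degree p. coeff p d * h (a + d))"
  by (simp add: papp_def Ysh_pow)

lemma papp_Xsh: "papp Xsh p h a = (\<Sum>d\<le>degree p. coeff p d * (if d \<le> a then h (a - d) else 0))"
  by (simp add: papp_def Xsh_pow)

text \<open>\<open>m\<close> is the symbol of \<open>M\<close>. A geometric progression
  \<open>t ^ b\<close> is an eigenvector of \<open>Ysh\<close> for \<open>t\<close> and, away from
  position 0, one of \<open>Xsh\<close> for \<open>1 / t\<close>; hence rows beyond \<open>r\<close>
  act on plane waves through a matrix. Row \<open>a\<close> may look only at positions from
  \<open>a - r\<close> on: far rows then never see the boundary, which makes symbols multiplicative
  (\<open>asy_comp\<close>).\<close>

definition asy :: "'a::field set \<Rightarrow> 'a \<Rightarrow> ((nat \<times> nat \<Rightarrow> 'a) \<Rightarrow> nat \<times> nat \<Rightarrow> 'a) \<Rightarrow>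
    ((nat \<Rightarrow> 'a) \<Rightarrow> nat \<Rightarrow> 'a) \<Rightarrow> bool" where
  "asy B t M m \<longleftrightarrow> row_op B M \<and>
    (\<exists>N. \<forall>f i a. N \<le> i \<longrightarrow> M f (i, a) = f (i, a)) \<and>
    (\<exists>r. (\<forall>f g i a. (\<forall>j b. a \<le> b + r \<longrightarrow> f (j, b) = g (j, b)) \<longrightarrow> M f (i, a) = M g (i, a)) \<and>
      (\<forall>\<phi> i a. r \<le> a \<longrightarrow> M (\<lambda>(j, b). \<phi> j * t ^ b) (i, a) = m \<phi> i * t ^ a))"

lemma asyI:
  assumes "row_op B M" "\<And>f i a. N \<le> i \<Longrightarrow> M f (i, a) = f (i, a)"
    "\<And>f g i a. (\<And>j b. a \<le> b + r \<Longrightarrow> f (j, b) = g (j, b)) \<Longrightarrow> M f (i, a) = M g (i, a)"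
    "\<And>\<phi> i a. r \<le> a \<Longrightarrow> M (\<lambda>(j, b). \<phi> j * t ^ b) (i, a) = m \<phi> i * t ^ a"
  shows "asy B t M m"
  unfolding asy_def
proof (intro conjI)
  show "\<exists>N. \<forall>f i a. N \<le> i \<longrightarrow> M f (i, a) = f (i, a)" using assms(2) by blast
  show "\<exists>r. (\<forall>f g i a. (\<forall>j b. a \<le> b + r \<longrightarrow> f (j, b) = g (j, b)) \<longrightarrow> M f (i, a) = M g (i, a)) \<and>
      (\<forall>\<phi> i a. r \<le> a \<longrightarrow> M (\<lambda>(j, b). \<phi> j * t ^ b) (i, a) = m \<phi> i * t ^ a)"
  proof (intro exI[of _ r] conjI allI impI)
    fix f g :: "nat \<times> nat \<Rightarrow> 'a" and i a assume "\<forall>j b. a \<le> b + r \<longrightarrow> f (j, b) = g (j, b)"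
    then show "M f (i, a) = M g (i, a)" by (intro assms(3)) auto
  qed (rule assms(4))
qed (rule assms(1))

lemma asy_comp:
  assumes B: "is_subring B" and M: "asy B t M m" and M': "asy B t M' m'"
  shows "asy B t (M \<circ> M') (m \<circ> m')"
proof -
  obtain N where N: "\<forall>f i a. N \<le> i \<longrightarrow> M f (i, a) = f (i, a)" using M by (auto simp: asy_def)
  obtain N' where N': "\<forall>f i a. N' \<le> i \<longrightarrow> M' f (i, a) = f (i, a)" using M' by (auto simp: asy_def)
  obtain r where r: "\<forall>f g i a. (\<forall>j b. a \<le> b + r \<longrightarrow> f (j, b) = g (j, b)) \<longrightarrow> M f (i, a) = M g (i, a)"
    "\<forall>\<phi> i a. r \<le> a \<longrightarrow> M (\<lambda>(j, b). \<phi> j * t ^ b) (i, a) = m \<phi> i * t ^ a"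
    using M by (auto simp: asy_def)
  obtain r' where r': "\<forall>f g i a. (\<forall>j b. a \<le> b + r' \<longrightarrow> f (j, b) = g (j, b)) \<longrightarrow> M' f (i, a) = M' g (i, a)"
    "\<forall>\<phi> i a. r' \<le> a \<longrightarrow> M' (\<lambda>(j, b). \<phi> j * t ^ b) (i, a) = m' \<phi> i * t ^ a"
    using M' by (auto simp: asy_def)
  show ?thesis
  proof (rule asyI[where N = "max N N'" and r = "r + r'"])
    show "row_op B (M \<circ> M')" using M M' row_op_comp[OF B] by (auto simp: asy_def)
    show "(M \<circ> M') f (i, a) = f (i, a)" if "max N N' \<le> i" for f i a using that N N' by simp
    show "(M \<circ> M') f (i, a) = (M \<circ> M') g (i, a)"
      if fg: "\<And>j b. a \<le> b + (r + r') \<Longrightarrow> f (j, b) = g (j, b)" for f g i a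
    proof -
      have "M' f (j, b) = M' g (j, b)" if "a \<le> b + r" for j b
        by (rule r'(1)[rule_format]) (use that fg in auto)
      then show ?thesis using r(1)[rule_format, of a "M' f" "M' g" i] by simp
    qed
    show "(M \<circ> M') (\<lambda>(j, b). \<phi> j * t ^ b) (i, a) = (m \<circ> m') \<phi> i * t ^ a" if "r + r' \<le> a" for \<phi> i a
    proof -
      have "M (M' (\<lambda>(j, b). \<phi> j * t ^ b)) (i, a) = M (\<lambda>(j, b). m' \<phi> j * t ^ b) (i, a)"
        by (rule r(1)[rule_format]) (use that r'(2) in auto)
      also have "\<dots> = m (m' \<phi>) i * t ^ a" using r(2) that by simp
      finally show ?thesis by simp
    qed
  qed
qed

text \<open>Plane waves \<open>\<phi> \<otimes> t\<^sup>b\<close> detect the far rows of an operator with entries in \<open>B\<close>,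
  because \<open>t\<close> is transcendental over \<open>B\<close>.\<close>
lemma asy_id_far:
  assumes B: "is_subring B" "transc B t" and G: "asy B t G id"
  shows "\<exists>r. \<forall>f i a. r \<le> a \<longrightarrow> G f (i, a) = f (i, a)"
proof -
  obtain r where r: "\<forall>\<phi> i a. r \<le> a \<longrightarrow> G (\<lambda>(j, b). \<phi> j * t ^ b) (i, a) = id \<phi> i * t ^ a"
    using G by (auto simp: asy_def)
  have row: "row_op B G" using G by (simp add: asy_def)
  have "G f (i, a) = f (i, a)" if "r \<le> a" for f i a
  proof -
    obtain S where S: "finite S" "\<And>f. G f (i, a) = (\<Sum>s\<in>S. G (uvec s) (i, a) * f s)"
      using row_opE[OF row, of "(i, a)"] by blast
    define \<kappa> where "\<kappa> = (\<lambda>s. G (uvec s) (i, a))"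
    have \<kappa>S: "\<kappa> s = 0" if "s \<notin> S" for s
    proof -
      have "\<kappa> s = (\<Sum>u\<in>S. G (uvec u) (i, a) * uvec s u)" unfolding \<kappa>_def by (rule S(2))
      also have "\<dots> = 0" using that by (intro sum.neutral) (auto simp: uvec_def)
      finally show ?thesis .
    qed
    have \<kappa>B: "\<kappa> s \<in> B" for s unfolding \<kappa>_def by (rule row_op_entry[OF row])
    have \<kappa>: "\<kappa> (j, b) = (if (j, b) = (i, a) then 1 else 0)" for j b
    proof -
      \<comment> \<open>The part of row \<open>(i, a)\<close> that belongs to the index
        \<open>j\<close>, read as a polynomial in the position; the plane wave in direction
        \<open>j\<close> evaluates it at \<open>t\<close>.\<close>
      define p where "p = (\<Sum>s\<in>{s\<in>S. fst s = j}. monom (\<kappa> s) (snd s))"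
      have "poly p t = (\<Sum>s\<in>{s\<in>S. fst s = j}. \<kappa> s * t ^ snd s)" by (simp add: p_def poly_sum poly_monom)
      also have "\<dots> = (\<Sum>s\<in>S. \<kappa> s * (uvec j (fst s) * t ^ snd s))"
        using S(1) by (intro sum.mono_neutral_cong_left) (auto simp: uvec_def)
      also have "\<dots> = G (\<lambda>(k, b). uvec j k * t ^ b) (i, a)"
        unfolding \<kappa>_def by (subst S(2)) (simp add: case_prod_unfold)
      also have "\<dots> = uvec j i * t ^ a" using r that by simp
      finally have "poly p t = poly (monom (uvec j i) a) t" by (simp add: poly_monom)
      moreover have "pol B p" unfolding p_def using \<kappa>B B by (intro pol_sum pol_monom)
      moreover have "pol B (monom (uvec j i) a)"
        using B by (intro pol_monom) (auto simp: uvec_def subring_0 subring_1)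
      ultimately have "p = monom (uvec j i) a" using transc_eq[OF B] by blast
      then have "coeff p b = (if (j, b) = (i, a) then 1 else 0)" by (auto simp: uvec_def)
      moreover have "coeff p b = (\<Sum>s\<in>{s\<in>S. fst s = j}. if s = (j, b) then \<kappa> s else 0)"
        unfolding p_def coeff_sum by (intro sum.cong) auto
      then have "coeff p b = \<kappa> (j, b)" using S(1) \<kappa>S[of "(j, b)"] by auto
      ultimately show ?thesis by simp
    qed
    have "(i, a) \<in> S" using \<kappa>[of i a] \<kappa>S[of "(i, a)"] by auto
    have "G f (i, a) = (\<Sum>s\<in>S. \<kappa> s * f s)" unfolding \<kappa>_def by (rule S(2))
    also have "\<dots> = (\<Sum>s\<in>S. if s = (i, a) then f s else 0)" using \<kappa> by (intro sum.cong) (auto split: if_splits)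
    also have "\<dots> = f (i, a)" using S(1) \<open>(i, a) \<in> S\<close> by simp
    finally show ?thesis .
  qed
  then show ?thesis by blast
qed

lemma linear_matop:
  assumes "linear_op Z"
  shows "linear_op (matop Z N P)"
proof -
  note L = linear_opD[OF linear_papp[OF assms]]
  show ?thesis unfolding linear_op_def
    by (auto simp: matop_def fun_eq_iff L sum.distrib sum_distrib_left)
qed

lemma papp_cong:
  assumes "\<And>d. d \<le> degree p \<Longrightarrow> (Z ^^ d) h a = (Z ^^ d) h' a"
  shows "papp Z p h a = papp Z p h' a"
  unfolding papp_def using assms by (intro sum.cong) auto

lemma row_op_matop:
  assumes B: "is_subring B" and P: "\<And>i j. pol B (P i j)" and Z: "Z = Ysh \<or> Z = Xsh"
  shows "row_op B (matop Z N P)"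
  unfolding row_op_def
proof (intro conjI allI)
  show "linear_op (matop Z N P)" using Z linear_Ysh linear_Xsh by (auto intro: linear_matop)
  have ZB: "(Z ^^ d) h a \<in> B" if "\<And>b. h b \<in> B" for d h a
    using Z that B by (auto simp: Ysh_pow Xsh_pow subring_0)
  have uB: "uvec s k \<in> B" for s k :: "nat \<times> nat" using B by (auto simp: uvec_def subring_0 subring_1)
  fix s k :: "nat \<times> nat"
  obtain i a where k: "k = (i, a)" by fastforce
  have "papp Z (P i j) (\<lambda>b. uvec s (j, b)) a \<in> B" for j
    unfolding papp_def using P B by (intro subring_sum subring_mult ZB uB) (auto simp: pol_def)
  then show "matop Z N P (uvec s) k \<in> B" using uB B by (auto simp: k matop_def intro!: subring_sum)
next
  fix k :: "nat \<times> nat"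
  obtain i a where k: "k = (i, a)" by fastforce
  define S where "S = insert (i, a) (SIGMA j:{..<N}. {..a + degree (P i j)})"
  show "\<exists>S. finite S \<and> (\<forall>f g. (\<forall>s\<in>S. f s = g s) \<longrightarrow> matop Z N P f k = matop Z N P g k)"
  proof (intro exI[of _ S] conjI allI impI)
    show "finite S" by (auto simp: S_def)
    fix f g :: "nat \<times> nat \<Rightarrow> 'a" assume fg: "\<forall>s\<in>S. f s = g s"
    have "papp Z (P i j) (\<lambda>b. f (j, b)) a = papp Z (P i j) (\<lambda>b. g (j, b)) a" if "j < N" for j
      by (rule papp_cong) (use Z fg that in \<open>auto simp: Ysh_pow Xsh_pow S_def\<close>)
    then show "matop Z N P f k = matop Z N P g k" using fg by (auto simp: k matop_def S_def)
  qed
qed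

lemma asy_matop_Ysh:
  assumes B: "is_subring B" and P: "\<And>i j. pol B (P i j)"
  shows "asy B t (matop Ysh N P) (pblk N P t)"
proof (rule asyI[where N = N and r = 0])
  show "row_op B (matop Ysh N P)" using row_op_matop[of B P Ysh] B P by blast
  show "matop Ysh N P f (i, a) = f (i, a)" if "N \<le> i" for f i a using that by (simp add: matop_def)
  show "matop Ysh N P f (i, a) = matop Ysh N P g (i, a)"
    if "\<And>j b. a \<le> b + 0 \<Longrightarrow> f (j, b) = g (j, b)" for f g i a
    using that by (simp add: matop_def papp_Ysh)
  show "matop Ysh N P (\<lambda>(j, b). \<phi> j * t ^ b) (i, a) = pblk N P t \<phi> i * t ^ a" for \<phi> i a
  proof -
    have "papp Ysh (P i j) (\<lambda>b. \<phi> j * t ^ b) a = poly (P i j) t * \<phi> j * t ^ a" for j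
      unfolding papp_Ysh poly_altdef sum_distrib_right by (intro sum.cong) (auto simp: power_add)
    then show ?thesis by (simp add: matop_def pblk_def sum_distrib_right)
  qed
qed

lemma degree_bound:
  fixes P :: "nat \<Rightarrow> nat \<Rightarrow> 'a::field poly"
  assumes "i < N" "j < N"
  shows "degree (P i j) \<le> (\<Sum>i<N. \<Sum>j<N. degree (P i j))"
proof -
  have "degree (P i j) \<le> (\<Sum>j<N. degree (P i j))" using assms by (intro member_le_sum) auto
  also have "\<dots> \<le> (\<Sum>i<N. \<Sum>j<N. degree (P i j))"
    using assms by (intro member_le_sum[where f = "\<lambda>i. \<Sum>j<N. degree (P i j)"]) auto
  finally show ?thesis .
qed

lemma asy_matop_Xsh:
  assumes B: "is_subring B" and P: "\<And>i j. pol B (P i j)" and t: "t \<noteq> 0"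
  shows "asy B t (matop Xsh N P) (pblk N P (1 / t))" "fin_op B (matop Xsh N P)"
proof -
  \<comment> \<open>A bound for the degrees of all entries. In rows at positions below
    \<open>r\<close>, a power of \<open>Xsh\<close> may reach past position 0, where it puts 0
    instead of the wave.\<close>
  define r where "r = (\<Sum>i<N. \<Sum>j<N. degree (P i j))"
  have r: "degree (P i j) \<le> r" if "i < N" "j < N" for i j
    using degree_bound[of i N j P] that by (simp add: r_def)
  have row: "row_op B (matop Xsh N P)" using row_op_matop[of B P Xsh] B P by blast
  show "asy B t (matop Xsh N P) (pblk N P (1 / t))"
  proof (rule asyI[where N = N and r = r, OF row])
    show "matop Xsh N P f (i, a) = f (i, a)" if "N \<le> i" for f i a using that by (simp add: matop_def)
    show "matop Xsh N P f (i, a) = matop Xsh N P g (i, a)"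
      if fg: "\<And>j b. a \<le> b + r \<Longrightarrow> f (j, b) = g (j, b)" for f g i a
    proof (cases "i < N")
      case True
      have "papp Xsh (P i j) (\<lambda>b. f (j, b)) a = papp Xsh (P i j) (\<lambda>b. g (j, b)) a" if "j < N" for j
        by (rule papp_cong) (use fg r[OF True that] in \<open>auto simp: Xsh_pow\<close>)
      then show ?thesis using True by (simp add: matop_def)
    qed (use fg in \<open>simp add: matop_def\<close>)
    show "matop Xsh N P (\<lambda>(j, b). \<phi> j * t ^ b) (i, a) = pblk N P (1 / t) \<phi> i * t ^ a" if "r \<le> a" for \<phi> i a
    proof (cases "i < N")
      case True
      have "papp Xsh (P i j) (\<lambda>b. \<phi> j * t ^ b) a = poly (P i j) (1 / t) * \<phi> j * t ^ a" if "j < N" for j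
      proof -
        have "papp Xsh (P i j) (\<lambda>b. \<phi> j * t ^ b) a = (\<Sum>d\<le>degree (P i j). coeff (P i j) d * (1 / t) ^ d * (\<phi> j * t ^ a))"
          unfolding papp_Xsh
        proof (intro sum.cong refl)
          fix d assume "d \<in> {..degree (P i j)}"
          then have "d \<le> a" using r[OF True that] \<open>r \<le> a\<close> by simp
          then show "coeff (P i j) d * (if d \<le> a then \<phi> j * t ^ (a - d) else 0)
              = coeff (P i j) d * (1 / t) ^ d * (\<phi> j * t ^ a)"
            using t by (simp add: power_diff power_one_over field_simps)
        qed
        then show ?thesis by (simp add: poly_altdef sum_distrib_right mult.assoc)
      qed
      then show ?thesis using True by (simp add: matop_def pblk_def sum_distrib_right)
    qed (simp add: matop_def pblk_def)
  qed
  show "fin_op B (matop Xsh N P)" unfolding fin_op_def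
  proof (intro conjI allI row)
    fix s :: "nat \<times> nat"
    obtain k b where s: "s = (k, b)" by fastforce
    have "{k. matop Xsh N P (uvec s) k \<noteq> 0} \<subseteq> insert s ({..<N} \<times> {..b + r})"
    proof
      fix u assume u: "u \<in> {k. matop Xsh N P (uvec s) k \<noteq> 0}"
      obtain i a where ia: "u = (i, a)" by fastforce
      show "u \<in> insert s ({..<N} \<times> {..b + r})"
      proof (rule ccontr)
        assume n: "\<not> ?thesis"
        have "matop Xsh N P (uvec s) u = 0"
        proof (cases "i < N")
          case True
          then have "b + r < a" using n ia by auto
          have "papp Xsh (P i j) (\<lambda>c. uvec s (j, c)) a = 0" if "j < N" for j
            unfolding papp_Xsh using r[OF True that] \<open>b + r < a\<close>
            by (intro sum.neutral) (auto simp: s uvec_def)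
          then show ?thesis using True by (simp add: ia matop_def)
        next
          case False
          then show ?thesis using n ia by (auto simp: matop_def uvec_def)
        qed
        then show False using u by simp
      qed
    qed
    then show "finite {k. matop Xsh N P (uvec s) k \<noteq> 0}" by (rule finite_subset) simp
  qed
qed

text \<open>The lift of a transvection with monomial entry: \<open>b * t ^ d\<close> for
  \<open>Z = Ysh\<close> and \<open>b / t ^ d\<close> for \<open>Z = Xsh\<close>.\<close>

definition Top :: "((nat \<Rightarrow> 'a::field) \<Rightarrow> nat \<Rightarrow> 'a) \<Rightarrow> nat \<Rightarrow> nat \<Rightarrow> 'a \<Rightarrow> nat \<Rightarrow>
    (nat \<times> nat \<Rightarrow> 'a) \<Rightarrow> nat \<times> nat \<Rightarrow> 'a" where
  "Top Z i j b d f = (\<lambda>(k, a). if k = i then f (i, a) + b * (Z ^^ d) (\<lambda>c. f (j, c)) a else f (k, a))"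

lemma Top_inverse: "i \<noteq> j \<Longrightarrow> Top Z i j b d \<circ> Top Z i j (- b) d = id"
  by (auto simp: Top_def fun_eq_iff)

lemma linear_Top:
  assumes "linear_op Z"
  shows "linear_op (Top Z i j b d)"
  using linear_opD[OF linear_funpow[OF assms]]
  by (auto simp: linear_op_def Top_def fun_eq_iff algebra_simps)

lemma fin_op_Top:
  assumes B: "is_subring B" "b \<in> B" and Z: "Z = Ysh \<or> Z = Xsh"
  shows "fin_op B (Top Z i j b d)"
  unfolding fin_op_def row_op_def
proof (intro conjI allI)
  show "linear_op (Top Z i j b d)" using Z linear_Ysh linear_Xsh by (auto intro: linear_Top)
next
  fix s k :: "nat \<times> nat"
  obtain i' a where k: "k = (i', a)" by fastforce
  show "Top Z i j b d (uvec s) k \<in> B"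
    using Z B by (auto simp: k Top_def Ysh_pow Xsh_pow uvec_def intro!: subring_intros)
next
  fix k :: "nat \<times> nat"
  obtain i' a where k: "k = (i', a)" by fastforce
  show "\<exists>S. finite S \<and> (\<forall>f g. (\<forall>s\<in>S. f s = g s) \<longrightarrow> Top Z i j b d f k = Top Z i j b d g k)"
    using Z by (intro exI[of _ "{(i', a), (j, a + d), (j, a - d)}"])
      (auto simp: k Top_def Ysh_pow Xsh_pow split: if_splits)
next
  fix s :: "nat \<times> nat"
  obtain k c where s: "s = (k, c)" by fastforce
  show "finite {k. Top Z i j b d (uvec s) k \<noteq> 0}"
    by (rule finite_subset[of _ "{s, (i, c + d), (i, c - d)}"])
      (use Z in \<open>auto simp: s Top_def Ysh_pow Xsh_pow uvec_def split: if_splits\<close>)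
qed

lemma asy_Top_Ysh:
  assumes B: "is_subring B" "b \<in> B"
  shows "asy B t (Top Ysh i j b d) (transv i j (b * t ^ d))"
proof (rule asyI[where N = "Suc i" and r = 0])
  show "row_op B (Top Ysh i j b d)" using fin_op_Top[OF B, of Ysh i j d] by (simp add: fin_op_def)
qed (auto simp: Top_def Ysh_pow transv_def power_add algebra_simps)

lemma asy_Top_Xsh:
  assumes B: "is_subring B" "b \<in> B" and t: "t \<noteq> 0"
  shows "asy B t (Top Xsh i j b d) (transv i j (b / t ^ d))"
proof (rule asyI[where N = "Suc i" and r = d])
  show "row_op B (Top Xsh i j b d)" using fin_op_Top[OF B, of Xsh i j d] by (simp add: fin_op_def)
qed (use t in \<open>auto simp: Top_def Xsh_pow transv_def power_diff field_simps\<close>)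

section \<open>Commutators with \<open>1 - t x\<close>\<close>

definition Dop :: "'a::field \<Rightarrow> (nat \<times> nat \<Rightarrow> 'a) \<Rightarrow> nat \<times> nat \<Rightarrow> 'a" where
  "Dop t f = (\<lambda>(i, a). if a = 0 then f (i, a) else f (i, a) - t * f (i, a - 1))"

text \<open>\<open>Dop t\<close> is \<open>1 - t x\<close> on positions, and \<open>Dinv t\<close>
  is its geometric series. The columns of the latter are infinite but its rows are finite, so it
  acts on all functions.\<close>

definition Dinv :: "'a::field \<Rightarrow> (nat \<times> nat \<Rightarrow> 'a) \<Rightarrow> nat \<times> nat \<Rightarrow> 'a" where
  "Dinv t f = (\<lambda>(i, a). \<Sum>b\<le>a. t ^ (a - b) * f (i, b))"

lemma Dinv_0: "Dinv t f (i, 0) = f (i, 0)"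
  by (simp add: Dinv_def)

lemma Dinv_Suc: "Dinv t f (i, Suc a) = f (i, Suc a) + t * Dinv t f (i, a)"
  by (auto simp: Dinv_def sum_distrib_left Suc_diff_le mult.assoc intro!: sum.cong)

lemma Dop_Dinv: "Dop t \<circ> Dinv t = id"
proof (intro ext)
  fix f :: "nat \<times> nat \<Rightarrow> 'a" and s :: "nat \<times> nat"
  obtain i a where s: "s = (i, a)" by fastforce
  show "(Dop t \<circ> Dinv t) f s = id f s"
    by (cases a) (auto simp: s Dop_def Dinv_0 Dinv_Suc)
qed

lemma Dinv_Dop: "Dinv t \<circ> Dop t = id"
proof (intro ext)
  fix f :: "nat \<times> nat \<Rightarrow> 'a" and s :: "nat \<times> nat"
  obtain i a where s: "s = (i, a)" by fastforce
  have "Dinv t (Dop t f) (i, a) = f (i, a)"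
    by (induction a) (auto simp: Dinv_0 Dinv_Suc, auto simp: Dop_def)
  then show "(Dinv t \<circ> Dop t) f s = id f s" by (simp add: s)
qed

lemma Dop_Dinv_apply: "Dop t (Dinv t f) = f" "Dinv t (Dop t f) = f"
  using Dop_Dinv[of t] Dinv_Dop[of t] by (metis comp_apply id_apply)+

text \<open>Both operators are polynomials in the same shift \<open>x\<close>, so they
  commute.\<close>

lemma commutator_Xsh:
  assumes "i \<noteq> j"
  shows "Top Xsh i j b d \<circ> Dop t \<circ> Top Xsh i j (- b) d \<circ> Dinv t = id"
proof -
  have "Dop t \<circ> Top Xsh i j (- b) d = Top Xsh i j (- b) d \<circ> Dop t"
    by (auto simp: Top_def Dop_def Xsh_pow fun_eq_iff algebra_simps)
  then have "Top Xsh i j b d \<circ> Dop t \<circ> Top Xsh i j (- b) d \<circ> Dinv t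
     = (Top Xsh i j b d \<circ> Top Xsh i j (- b) d) \<circ> (Dop t \<circ> Dinv t)" by (simp only: comp_assoc)
  then show ?thesis by (simp only: Top_inverse[OF assms] Dop_Dinv comp_id)
qed

text \<open>\<open>x y^d\<close> and \<open>y^d x\<close> agree except at position 0, because
  \<open>y x = 1\<close> while \<open>x y\<close> loses position 0. So the commutator changes only
  the coordinate \<open>(i, 0)\<close>, by a finite combination of coordinates of line
  \<open>j\<close>.\<close>

lemma commutator_Ysh:
  assumes R: "is_subring R" "t \<in> R" "b \<in> R" and ij: "i \<noteq> j"
  shows "Top Ysh i j b d \<circ> Dop t \<circ> Top Ysh i j (- b) d \<circ> Dinv t \<in> elem_ops R"
proof -
  define S where "S = {j} \<times> {..<d}"
  \<comment> \<open>Row \<open>d - 1\<close> of \<open>Dinv t\<close>, scaled by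
    \<open>- t * b\<close>: the boundary term is \<open>- t * b * h (j, d - 1)\<close> with
    \<open>h = Dinv t f\<close>.\<close>
  define w where "w = (\<lambda>(k :: nat, c). - (t * b) * t ^ (d - 1 - c))"
  have "Top Ysh i j b d \<circ> Dop t \<circ> Top Ysh i j (- b) d \<circ> Dinv t
     = (\<lambda>f. f((i, 0) := f (i, 0) + (\<Sum>s\<in>S. w s * f s)))"
  proof (intro ext)
    fix f and s :: "nat \<times> nat"
    define h where "h = Dinv t f"
    have f: "f = Dop t h" by (simp add: h_def Dop_Dinv_apply)
    have w: "(\<Sum>s\<in>S. w s * f s) = (if d = 0 then 0 else - (t * b) * h (j, d - 1))"
    proof (cases d)
      case (Suc e)
      have "(\<Sum>s\<in>S. w s * f s) = (\<Sum>c\<le>e. - (t * b) * (t ^ (e - c) * f (j, c)))"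
        unfolding S_def w_def by (rule sum.reindex_cong[where l = "\<lambda>c. (j, c)"])
          (auto simp: Suc inj_on_def lessThan_Suc_atMost)
      also have "\<dots> = - (t * b) * Dinv t f (j, e)" by (simp add: Dinv_def sum_distrib_left)
      finally show ?thesis by (simp add: Suc h_def)
    qed (simp add: S_def)
    obtain k a where s: "s = (k, a)" by fastforce
    have "(Top Ysh i j b d \<circ> Dop t \<circ> Top Ysh i j (- b) d \<circ> Dinv t) f s
        = Top Ysh i j b d (Dop t (Top Ysh i j (- b) d h)) s" by (simp add: h_def)
    also have "\<dots> = (f((i, 0) := f (i, 0) + (\<Sum>s\<in>S. w s * f s))) s"
      unfolding w unfolding f s using ij by (auto simp: Top_def Dop_def Ysh_pow algebra_simps)
    finally show "(Top Ysh i j b d \<circ> Dop t \<circ> Top Ysh i j (- b) d \<circ> Dinv t) f s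
        = (f((i, 0) := f (i, 0) + (\<Sum>s\<in>S. w s * f s))) s" .
  qed
  also have "\<dots> \<in> elem_ops R"
    using R ij by (intro elem_row_op) (auto simp: S_def w_def intro!: subring_intros)
  finally show ?thesis .
qed

text \<open>The lifts \<open>E\<close>, \<open>E'\<close> have entries in \<open>B\<close>; powers
  of \<open>t\<close> enter only through \<open>Dop t\<close> and its inverse. So the commutator is
  a matrix over \<open>adj B t\<close> even if \<open>e\<close> involves
  \<open>1 / t\<close>.\<close>

definition lifted :: "'a::field set \<Rightarrow> 'a \<Rightarrow> ((nat \<Rightarrow> 'a) \<Rightarrow> nat \<Rightarrow> 'a) \<Rightarrow> bool" where
  "lifted B t e \<longleftrightarrow> (\<exists>e' E E'. e \<circ> e' = id \<and> e' \<circ> e = id \<and> E \<circ> E' = id \<and> E' \<circ> E = id \<and>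
     asy B t E e \<and> asy B t E' e' \<and> fin_op B E \<and> fin_op B E' \<and>
     E \<circ> Dop t \<circ> E' \<circ> Dinv t \<in> elem_ops (adj B t))"

lemma infinite_nat_prod: "infinite (UNIV :: (nat \<times> nat) set)"
  using finite_prod[where 'a = nat and 'b = nat] by simp

lemma fin_op_subset: "fin_op R M \<Longrightarrow> R \<subseteq> R' \<Longrightarrow> fin_op R' M"
  unfolding fin_op_def row_op_def by blast

lemma asy_id: "is_subring B \<Longrightarrow> asy B t id id"
  by (rule asyI[where N = 0 and r = 0]) (use fin_op_id in \<open>auto simp: fin_op_def\<close>)

text \<open>Commutators satisfy \<open>[T E, D] = (T [E, D] T^-1) [T, D]\<close>. The first factor
  is elementary by \<open>elem_conj\<close>, the second by \<open>commutator_Ysh\<close> or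
  \<open>commutator_Xsh\<close>.\<close>

lemma lifted_step:
  assumes B: "is_subring B" and ij: "i \<noteq> j" and Z: "Z = Ysh \<or> Z = Xsh" and b: "b \<in> B"
    and u: "\<And>b. b \<in> B \<Longrightarrow> asy B t (Top Z i j b d) (transv i j (b * c))" and e: "lifted B t e"
  shows "lifted B t (transv i j (b * c) \<circ> e)"
proof -
  obtain e' E E' where h: "e \<circ> e' = id" "e' \<circ> e = id" "E \<circ> E' = id" "E' \<circ> E = id"
     "asy B t E e" "asy B t E' e'" "fin_op B E" "fin_op B E'"
     "E \<circ> Dop t \<circ> E' \<circ> Dinv t \<in> elem_ops (adj B t)"
    using e unfolding lifted_def by blast
  let ?T = "Top Z i j b d" and ?T' = "Top Z i j (- b) d"
  let ?v = "transv i j (b * c)" and ?v' = "transv i j (- b * c)"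
  have b': "- b \<in> B" using B b by (rule subring_uminus)
  have vv: "?v \<circ> ?v' = id" "?v' \<circ> ?v = id" using ij by (simp_all add: transv_add transv_0)
  have TT: "?T \<circ> ?T' = id" "?T' \<circ> ?T = id" using Top_inverse[OF ij, of Z b d] Top_inverse[OF ij, of Z "- b" d] by simp_all
  note fT = fin_op_Top[OF B b Z, of i j d] fin_op_Top[OF B b' Z, of i j d]
  note A = adj_subring[OF B, of t] and BA = adj_incl[OF B, of t]
  have T_comm: "?T \<circ> Dop t \<circ> ?T' \<circ> Dinv t \<in> elem_ops (adj B t)"
    using Z
  proof
    assume "Z = Ysh"
    then show ?thesis using commutator_Ysh[OF A adj_gen[OF B], of b i j d] b BA ij by auto
  next
    assume "Z = Xsh"
    then show ?thesis using commutator_Xsh[OF ij, of b d t] elem_ops.elem_id[of "adj B t"] by metis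
  qed
  have "(?T \<circ> E) \<circ> Dop t \<circ> (E' \<circ> ?T') \<circ> Dinv t
      = (?T \<circ> (E \<circ> Dop t \<circ> E' \<circ> Dinv t) \<circ> ?T') \<circ> (?T \<circ> Dop t \<circ> ?T' \<circ> Dinv t)"
  proof -
    have "(?T \<circ> (E \<circ> Dop t \<circ> E' \<circ> Dinv t) \<circ> ?T') \<circ> (?T \<circ> Dop t \<circ> ?T' \<circ> Dinv t)
       = ?T \<circ> E \<circ> Dop t \<circ> E' \<circ> Dinv t \<circ> (?T' \<circ> ?T) \<circ> Dop t \<circ> ?T' \<circ> Dinv t" by (simp only: comp_assoc)
    also have "\<dots> = ?T \<circ> E \<circ> Dop t \<circ> E' \<circ> (Dinv t \<circ> Dop t) \<circ> ?T' \<circ> Dinv t"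
      by (simp only: TT comp_id comp_assoc)
    also have "\<dots> = (?T \<circ> E) \<circ> Dop t \<circ> (E' \<circ> ?T') \<circ> Dinv t"
      by (simp only: Dinv_Dop comp_id comp_assoc)
    finally show ?thesis by simp
  qed
  moreover have "?T \<circ> (E \<circ> Dop t \<circ> E' \<circ> Dinv t) \<circ> ?T' \<in> elem_ops (adj B t)"
    by (rule elem_conj[OF infinite_nat_prod A fin_op_subset[OF fT(1) BA] fin_op_subset[OF fT(2) BA] TT h(9)])
  ultimately have 1: "(?T \<circ> E) \<circ> Dop t \<circ> (E' \<circ> ?T') \<circ> Dinv t \<in> elem_ops (adj B t)"
    using elem_comp[OF _ T_comm] by simp
  have 2: "(?v \<circ> e) \<circ> (e' \<circ> ?v') = id" "(e' \<circ> ?v') \<circ> (?v \<circ> e) = id"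
    "(?T \<circ> E) \<circ> (E' \<circ> ?T') = id" "(E' \<circ> ?T') \<circ> (?T \<circ> E) = id"
  proof -
    have "(?v \<circ> e) \<circ> (e' \<circ> ?v') = ?v \<circ> (e \<circ> e') \<circ> ?v'" "(e' \<circ> ?v') \<circ> (?v \<circ> e) = e' \<circ> (?v' \<circ> ?v) \<circ> e"
      "(?T \<circ> E) \<circ> (E' \<circ> ?T') = ?T \<circ> (E \<circ> E') \<circ> ?T'" "(E' \<circ> ?T') \<circ> (?T \<circ> E) = E' \<circ> (?T' \<circ> ?T) \<circ> E"
      by (simp_all only: comp_assoc)
    then show "(?v \<circ> e) \<circ> (e' \<circ> ?v') = id" "(e' \<circ> ?v') \<circ> (?v \<circ> e) = id"
      "(?T \<circ> E) \<circ> (E' \<circ> ?T') = id" "(E' \<circ> ?T') \<circ> (?T \<circ> E) = id"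
      by (simp_all only: h vv TT comp_id)
  qed
  have 3: "asy B t (?T \<circ> E) (?v \<circ> e)" "asy B t (E' \<circ> ?T') (e' \<circ> ?v')"
    by (intro asy_comp[OF B] u b b' h)+
  have 4: "fin_op B (?T \<circ> E)" "fin_op B (E' \<circ> ?T')"
    by (intro fin_op_comp[OF B] fT h)+
  show ?thesis unfolding lifted_def using 1 2 3 4 by blast
qed

text \<open>A coefficient from B[t, 1/t] is a sum of terms \<open>c * t ^ d / t ^ k\<close> with
  \<open>c\<close> in \<open>B\<close>, and a transvection is the product of those of the terms.
  Terms with \<open>k \<le> d\<close> are lifted through \<open>Ysh\<close>, the others through
  \<open>Xsh\<close>. The free \<open>d\<close> in the inner induction absorbs the factor
  \<open>t\<close> that each coefficient gains.\<close>

lemma lifted_elem: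
  assumes B: "is_subring B" and t: "t \<noteq> 0" and e: "e \<in> elem_ops (loc (adj B t) t)"
  shows "lifted B t e"
  using e
proof induction
  case elem_id
  have "id \<circ> Dop t \<circ> id \<circ> Dinv t \<in> elem_ops (adj B t)"
    using elem_ops.elem_id[of "adj B t"] Dop_Dinv[of t] by (metis comp_id id_comp)
  then show ?case unfolding lifted_def using asy_id[OF B] fin_op_id[OF B] by (metis comp_id)
next
  case (elem_step i j a g)
  have poly: "lifted B t (transv i j (t ^ d * poly p t / t ^ k) \<circ> g)" if "pol B p" for p d k
    using that
  proof (induction p arbitrary: d)
    case 0
    then show ?case using elem_step by (simp add: transv_0)
  next
    case (pCons c p)
    have c: "c \<in> B" "pol B p" using pCons(3) by (auto simp: pol_pCons)
    have "t ^ d * poly (pCons c p) t / t ^ k = c * (t ^ d / t ^ k) + t ^ Suc d * poly p t / t ^ k"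
      by (simp add: add_divide_distrib algebra_simps)
    then have eq: "transv i j (t ^ d * poly (pCons c p) t / t ^ k) \<circ> g
        = transv i j (c * (t ^ d / t ^ k)) \<circ> (transv i j (t ^ Suc d * poly p t / t ^ k) \<circ> g)"
      by (simp only: comp_assoc[symmetric] transv_add[OF elem_step(1)])
    have IH: "lifted B t (transv i j (t ^ Suc d * poly p t / t ^ k) \<circ> g)" using pCons(2) c by blast
    show ?case
    proof (cases "k \<le> d")
      case True
      then have "t ^ d / t ^ k = t ^ (d - k)" using t by (simp add: power_diff)
      then show ?thesis unfolding eq
        by (intro lifted_step[OF B elem_step(1) _ c(1) _ IH, of Ysh "d - k"])
          (use asy_Top_Ysh[OF B, of _ t i j "d - k"] in simp_all)
    next
      case False
      then have "t ^ d / t ^ k = 1 / t ^ (k - d)" using t by (simp add: power_diff)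
      then show ?thesis unfolding eq
        by (intro lifted_step[OF B elem_step(1) _ c(1) _ IH, of Xsh "k - d"])
          (use asy_Top_Xsh[OF B _ t, of _ i j "k - d"] in simp_all)
    qed
  qed
  from elem_step obtain r k where "a = r / t ^ k" "r \<in> adj B t" by (auto simp: loc_def)
  then obtain p where "a = t ^ 0 * poly p t / t ^ k" "pol B p" by (auto simp: adj_def)
  then show ?case using poly[of p 0 k] by (simp only:)
qed

definition Tcut :: "'a::field \<Rightarrow> nat \<Rightarrow> nat \<Rightarrow> (nat \<times> nat \<Rightarrow> 'a) \<Rightarrow> nat \<times> nat \<Rightarrow> 'a" where
  "Tcut t N n f = (\<lambda>(i, a). if i < N \<and> a = Suc n then f (i, a) - t * f (i, n) else f (i, a))"

text \<open>The part of \<open>Dop t\<close> inside a finite box. Unlike \<open>Dop t\<close> it is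
  a finite product of transvections, with one layer \<open>Tcut\<close> for each position.\<close>

definition Dcut :: "'a::field \<Rightarrow> nat \<Rightarrow> nat \<Rightarrow> (nat \<times> nat \<Rightarrow> 'a) \<Rightarrow> nat \<times> nat \<Rightarrow> 'a" where
  "Dcut t N n f = (\<lambda>(i, a). if i < N \<and> 0 < a \<and> a \<le> n then f (i, a) - t * f (i, a - 1) else f (i, a))"

lemma elem_Tcut:
  assumes "is_subring R" "t \<in> R"
  shows "Tcut t N n \<in> elem_ops R"
proof (induction N)
  case 0
  have "Tcut t 0 n = id" by (auto simp: Tcut_def fun_eq_iff)
  then show ?case using elem_id[of R] by metis
next
  case (Suc N)
  have "Tcut t (Suc N) n = transv (N, Suc n) (N, n) (- t) \<circ> Tcut t N n"
    by (auto simp: Tcut_def transv_def fun_eq_iff less_Suc_eq)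
  moreover have "\<dots> \<in> elem_ops R" using Suc assms by (intro elem_comp elem_transv subring_uminus) auto
  ultimately show ?case by metis
qed

lemma elem_Dcut:
  assumes "is_subring R" "t \<in> R"
  shows "Dcut t N n \<in> elem_ops R"
proof (induction n)
  case 0
  have "Dcut t N 0 = id" by (auto simp: Dcut_def fun_eq_iff)
  then show ?case using elem_id[of R] by metis
next
  case (Suc n)
  have "Dcut t N (Suc n) = Dcut t N n \<circ> Tcut t N n"
    by (auto simp: Tcut_def Dcut_def fun_eq_iff le_Suc_eq)
  moreover have "\<dots> \<in> elem_ops R" using Suc elem_Tcut[OF assms] by (intro elem_comp) auto
  ultimately show ?case by metis
qed

text \<open>\<open>Dop t\<close> is \<open>Dcut t N n\<close> after a rest \<open>C\<close> which is
  the identity on the box of \<open>G'\<close> and hence commutes with \<open>G'\<close>. So the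
  commutator equals \<open>(G Dcut G') Dcut^-1\<close>, which is elementary by normality.\<close>

lemma commutator_finite:
  assumes B: "is_subring B" and g: "fin_op B G" "fin_op B G'" "G \<circ> G' = id" "G' \<circ> G = id"
    and out: "\<And>f i a. \<not> (i < N \<and> a < n) \<Longrightarrow> G' f (i, a) = f (i, a)"
    and ins: "\<And>f h i a. (\<And>j b. j < N \<Longrightarrow> b < n \<Longrightarrow> f (j, b) = h (j, b)) \<Longrightarrow> i < N \<Longrightarrow> a < n \<Longrightarrow> G' f (i, a) = G' h (i, a)"
  shows "G \<circ> Dop t \<circ> G' \<circ> Dinv t \<in> elem_ops (adj B t)"
proof -
  note A = adj_subring[OF B, of t] and BA = adj_incl[OF B, of t]
  \<comment> \<open>The box of \<open>G'\<close> is \<open>a < n\<close>, but \<open>C\<close> is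
    trivial up to \<open>a = n\<close>: row \<open>n\<close> of \<open>Dop t\<close> still reads
    position \<open>n - 1\<close> inside the box, so this row has to belong to
    \<open>Dcut\<close>.\<close>
  define C :: "(nat \<times> nat \<Rightarrow> 'a) \<Rightarrow> nat \<times> nat \<Rightarrow> 'a"
    where "C = (\<lambda>f (i, a). if i < N \<and> a \<le> n then f (i, a) else Dop t f (i, a))"
  have D: "Dcut t N n \<in> elem_ops (adj B t)" by (rule elem_Dcut[OF A adj_gen[OF B]])
  obtain D' where D': "D' \<in> elem_ops (adj B t)" "Dcut t N n \<circ> D' = id" "D' \<circ> Dcut t N n = id"
    using elem_inverse[OF A D] by blast
  have DC: "Dop t = Dcut t N n \<circ> C" by (auto simp: Dcut_def C_def Dop_def fun_eq_iff)
  have CG: "C \<circ> G' = G' \<circ> C"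
  proof (intro ext)
    fix f and s :: "nat \<times> nat"
    obtain i a where s: "s = (i, a)" by fastforce
    show "(C \<circ> G') f s = (G' \<circ> C) f s"
    proof (cases "i < N \<and> a < n")
      case True
      then have "G' (C f) (i, a) = G' f (i, a)" by (intro ins) (auto simp: C_def)
      then show ?thesis using True by (simp add: s C_def)
    next
      case False
      then have "G' (C f) (i, a) = C f (i, a)" by (rule out)
      moreover have "C (G' f) (i, a) = C f (i, a)"
      proof (cases "i < N \<and> a \<le> n")
        case True
        then show ?thesis using out[OF False, of f] by (simp add: C_def)
      next
        case far: False
        then have "\<not> (i < N \<and> a - 1 < n)" by auto
        then have "Dop t (G' f) (i, a) = Dop t f (i, a)"
          using out[OF False, of f] out[of i "a - 1" f] by (cases "a = 0") (simp_all add: Dop_def)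
        moreover have "C h (i, a) = Dop t h (i, a)" for h using far unfolding C_def by auto
        ultimately show ?thesis by simp
      qed
      ultimately show ?thesis by (simp add: s)
    qed
  qed
  have "C \<circ> Dinv t = (D' \<circ> Dcut t N n) \<circ> (C \<circ> Dinv t)" by (simp only: D' id_comp)
  also have "\<dots> = D' \<circ> ((Dcut t N n \<circ> C) \<circ> Dinv t)" by (simp only: comp_assoc)
  also have "\<dots> = D'" by (simp only: DC[symmetric] Dop_Dinv comp_id)
  finally have CD: "C \<circ> Dinv t = D'" .
  have "G \<circ> Dop t \<circ> G' \<circ> Dinv t = G \<circ> Dcut t N n \<circ> (C \<circ> G') \<circ> Dinv t" by (simp only: DC comp_assoc)
  also have "\<dots> = G \<circ> Dcut t N n \<circ> G' \<circ> (C \<circ> Dinv t)" by (simp only: CG comp_assoc)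
  also have "\<dots> = (G \<circ> Dcut t N n \<circ> G') \<circ> D'" by (simp only: CD)
  finally have eq: "G \<circ> Dop t \<circ> G' \<circ> Dinv t = (G \<circ> Dcut t N n \<circ> G') \<circ> D'" .
  have "G \<circ> Dcut t N n \<circ> G' \<in> elem_ops (adj B t)"
    by (rule elem_conj[OF infinite_nat_prod A fin_op_subset[OF g(1) BA] fin_op_subset[OF g(2) BA] g(3,4) D])
  from elem_comp[OF this D'(1)] show ?thesis by (simp only: eq)
qed

text \<open>Far positions are fixed by \<open>asy_id_far\<close> and large \<open>i\<close> by
  \<open>asy\<close>, so finitely many rows remain. Each reads finitely many coordinates, and the
  box is enlarged until it contains all of them.\<close>

lemma asy_id_box:
  assumes B: "is_subring B" "transc B t" and G: "asy B t G id"
  shows "\<exists>N n. (\<forall>f i a. \<not> (i < N \<and> a < n) \<longrightarrow> G f (i, a) = f (i, a)) \<and>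
    (\<forall>f h i a. (\<forall>j b. j < N \<longrightarrow> b < n \<longrightarrow> f (j, b) = h (j, b)) \<longrightarrow> i < N \<longrightarrow> a < n \<longrightarrow> G f (i, a) = G h (i, a))"
proof -
  obtain r where r: "\<And>f i a. r \<le> a \<Longrightarrow> G f (i, a) = f (i, a)" using asy_id_far[OF B G] by blast
  obtain M where M: "\<And>f i a. M \<le> i \<Longrightarrow> G f (i, a) = f (i, a)" using G by (auto simp: asy_def)
  have "\<forall>k. \<exists>S. finite S \<and> (\<forall>f g. (\<forall>s\<in>S. f s = g s) \<longrightarrow> G f k = G g k)"
    using G unfolding asy_def row_op_def by blast
  then obtain T where T: "\<And>k. finite (T k)" "\<And>k f g. (\<forall>s\<in>T k. f s = g s) \<Longrightarrow> G f k = G g k" by metis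
  define U where "U = (\<Union>k\<in>{..<M} \<times> {..<r}. T k)"
  have "finite U" using T(1) by (simp add: U_def)
  then have fin: "finite (fst ` U)" "finite (snd ` U)" by auto
  define N where "N = Suc (Max (insert M (fst ` U)))"
  define n where "n = Suc (Max (insert r (snd ` U)))"
  have N: "M \<le> N" "\<And>j b. (j, b) \<in> U \<Longrightarrow> j < N"
    using fin by (force simp: N_def less_Suc_eq_le intro!: Max_ge le_SucI)+
  have n: "r \<le> n" "\<And>j b. (j, b) \<in> U \<Longrightarrow> b < n"
    using fin by (force simp: n_def less_Suc_eq_le intro!: Max_ge le_SucI)+
  have 1: "G f (i, a) = f (i, a)" if "\<not> (i < N \<and> a < n)" for f i a
    using that r[of a f i] M[of i f a] N(1) n(1) by linarith
  have 2: "G f (i, a) = G h (i, a)"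
    if *: "\<forall>j b. j < N \<longrightarrow> b < n \<longrightarrow> f (j, b) = h (j, b)" "i < N" "a < n" for f h i a
  proof (cases "i < M \<and> a < r")
    case True
    have "T (i, a) \<subseteq> U" using True by (auto simp: U_def)
    then show ?thesis using * N(2) n(2) by (intro T(2)) (metis prod.collapse subsetD)
  next
    case False
    then have "G f (i, a) = f (i, a)" "G h (i, a) = h (i, a)" using r M by (meson not_le)+
    then show ?thesis using * by simp
  qed
  show ?thesis using 1 2 by (intro exI[of _ N] exI[of _ n] conjI allI impI)
qed

lemma elem_support:
  assumes "g \<in> elem_ops R"
  shows "\<exists>S. finite S \<and> (\<forall>f i. i \<notin> S \<longrightarrow> g f i = f i) \<and>
    (\<forall>f h. (\<forall>s\<in>S. f s = h s) \<longrightarrow> (\<forall>i\<in>S. g f i = g h i))"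
  using assms
proof induction
  case elem_id
  then show ?case by (intro exI[of _ "{}"]) auto
next
  case (elem_step i j a g)
  from elem_step.IH obtain S where S0: "finite S" "\<forall>f i. i \<notin> S \<longrightarrow> g f i = f i"
    "\<forall>f h. (\<forall>s\<in>S. f s = h s) \<longrightarrow> (\<forall>i\<in>S. g f i = g h i)" by (elim exE conjE)
  have S: "finite S" "\<And>f i. i \<notin> S \<Longrightarrow> g f i = f i"
    "\<And>f h i. (\<forall>s\<in>S. f s = h s) \<Longrightarrow> i \<in> S \<Longrightarrow> g f i = g h i"
    by (rule S0(1), rule S0(2)[rule_format], assumption, rule S0(3)[rule_format], blast, assumption)
  show ?case
  proof (intro exI[of _ "S \<union> {i, j}"] conjI allI impI ballI)
    show "finite (S \<union> {i, j})" using S by simp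
    show "(transv i j a \<circ> g) f k = f k" if "k \<notin> S \<union> {i, j}" for f k
      using that S(2)[of k f] by (auto simp: transv_def)
    fix f h :: "'a \<Rightarrow> 'b" and k assume *: "\<forall>s\<in>S \<union> {i, j}. f s = h s" "k \<in> S \<union> {i, j}"
    have "g f l = g h l" if "l \<in> S \<union> {i, j}" for l
      using * that S(3)[of f h l] S(2)[of l f] S(2)[of l h] by (cases "l \<in> S") auto
    then show "(transv i j a \<circ> g) f k = (transv i j a \<circ> g) h k" using * by (auto simp: transv_def)
  qed
qed

lemma elem_block_op:
  assumes "finite P" "finite S" "P \<inter> S = {}" "\<And>k s. k \<in> P \<Longrightarrow> s \<in> S \<Longrightarrow> c k s \<in> R"
  shows "(\<lambda>f k. if k \<in> P then f k + (\<Sum>s\<in>S. c k s * f s) else f k) \<in> elem_ops R"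
  using assms
proof (induction P rule: finite_induct)
  case empty
  then show ?case using elem_id by (simp add: id_def)
next
  case (insert x P)
  have eq: "(\<lambda>f k. if k \<in> insert x P then f k + (\<Sum>s\<in>S. c k s * f s) else f k)
    = (\<lambda>f. f(x := f x + (\<Sum>s\<in>S. c x s * f s))) \<circ> (\<lambda>f k. if k \<in> P then f k + (\<Sum>s\<in>S. c k s * f s) else f k)"
  proof (intro ext)
    fix f k
    have "(\<Sum>s\<in>S. c x s * (if s \<in> P then f s + (\<Sum>u\<in>S. c s u * f u) else f s)) = (\<Sum>s\<in>S. c x s * f s)"
      using insert by (intro sum.cong) auto
    then show "(if k \<in> insert x P then f k + (\<Sum>s\<in>S. c k s * f s) else f k)
      = ((\<lambda>f. f(x := f x + (\<Sum>s\<in>S. c x s * f s))) \<circ> (\<lambda>f k. if k \<in> P then f k + (\<Sum>s\<in>S. c k s * f s) else f k)) f k"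
      using insert(2) by auto
  qed
  have r: "(\<lambda>f. f(x := f x + (\<Sum>s\<in>S. c x s * f s))) \<in> elem_ops R"
    using insert by (intro elem_row_op) auto
  have "(\<lambda>f k. if k \<in> P then f k + (\<Sum>s\<in>S. c k s * f s) else f k) \<in> elem_ops R"
    using insert by auto
  from elem_comp[OF r this] show ?case unfolding eq .
qed

lemma elem_reindex:
  assumes "bij \<tau>" "g \<in> elem_ops R"
  shows "(\<lambda>f k. g (f \<circ> \<tau>) (inv_into UNIV \<tau> k)) \<in> elem_ops R"
  using assms(2)
proof induction
  case elem_id
  have "(\<lambda>f k. id (f \<circ> \<tau>) (inv_into UNIV \<tau> k)) = id"
    using assms(1) by (auto simp: fun_eq_iff bij_is_surj surj_f_inv_f)
  then show ?case using elem_ops.elem_id[of R] by metis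
next
  case (elem_step i j a g)
  have inj: "inj \<tau>" "surj \<tau>" using assms(1) by (auto simp: bij_def)
  have *: "(\<lambda>f k. (transv i j a \<circ> g) (f \<circ> \<tau>) (inv_into UNIV \<tau> k))
      = transv (\<tau> i) (\<tau> j) a \<circ> (\<lambda>f k. g (f \<circ> \<tau>) (inv_into UNIV \<tau> k))"
  proof (intro ext)
    fix f k
    show "(transv i j a \<circ> g) (f \<circ> \<tau>) (inv_into UNIV \<tau> k) = (transv (\<tau> i) (\<tau> j) a \<circ> (\<lambda>f k. g (f \<circ> \<tau>) (inv_into UNIV \<tau> k))) f k"
      using inj by (cases "inv_into UNIV \<tau> k = i") (auto simp: transv_def surj_f_inv_f)
  qed
  have "\<tau> i \<noteq> \<tau> j" using elem_step(1) inj(1) by (simp add: inj_eq)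
  from elem_comp[OF elem_transv[OF this elem_step(2)] elem_step.IH] show ?case by (simp only: *)
qed

text \<open>Carries an operator that lives at position 0 back to one indexed by \<open>nat\<close>,
  in such a way that an \<open>N\<close> block keeps its place.\<close>

lemma bij_extending_column:
  "\<exists>\<tau> :: nat \<times> nat \<Rightarrow> nat. bij \<tau> \<and> (\<forall>i<N. \<tau> (i, 0) = i)"
proof -
  let ?A = "{..<N} \<times> {0::nat}"
  have inf: "infinite (- ?A)" "infinite (- {..<N})"
    using Diff_infinite_finite[OF _ infinite_nat_prod, of ?A] Diff_infinite_finite[OF _ infinite_nat, of "{..<N}"]
    by (simp_all add: Compl_eq_Diff_UNIV)
  have "bij_betw (to_nat_on (- ?A)) (- ?A) UNIV" using inf by (intro to_nat_on_infinite) auto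
  moreover have "bij_betw (from_nat_into (- {..<N})) UNIV (- {..<N})" using inf by (intro bij_betw_from_nat_into) auto
  ultimately have 1: "bij_betw (from_nat_into (- {..<N}) \<circ> to_nat_on (- ?A)) (- ?A) (- {..<N})"
    by (rule bij_betw_trans)
  define h where "h = from_nat_into (- {..<N}) \<circ> to_nat_on (- ?A)"
  define \<tau> where "\<tau> = (\<lambda>s. if s \<in> ?A then fst s else h s)"
  have "bij_betw \<tau> ?A {..<N}" by (auto simp: bij_betw_def inj_on_def \<tau>_def image_iff)
  moreover have "bij_betw \<tau> (- ?A) (- {..<N})" using 1 by (subst bij_betw_cong[of _ _ h]) (auto simp: \<tau>_def h_def)
  ultimately have "bij_betw \<tau> (?A \<union> - ?A) ({..<N} \<union> - {..<N})" by (rule bij_betw_combine) auto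
  then have "bij \<tau>" by (simp only: Compl_partition)
  moreover have "\<forall>i<N. \<tau> (i, 0) = i" by (simp add: \<tau>_def)
  ultimately show ?thesis by blast
qed

text \<open>Injectivity of \<open>K\<^sub>1(B[t]) \<rightarrow> K\<^sub>1(B[t,t\<inverse>])\<close> modulo \<open>K\<^sub>1(B[t\<inverse>])\<close>: the commutator of the
  Toeplitz operator \<open>P(y)\<close> with \<open>1 - t x\<close> is trivial for elementary operators and for operators
  in \<open>x\<close> alone, and equals \<open>P(0) P(t)\<inverse>\<close> up to elementary operators.\<close>
lemma elem_of_patching:
  assumes B: "is_subring B" "transc B t"
    and P: "\<And>i j. pol B (P i j)" "\<And>i j. pol B (P' i j)" and S: "\<And>i j. pol B (S i j)" "\<And>i j. pol B (S' i j)"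
    and PP: "pblk N P t \<circ> pblk N P' t = id" "pblk N P' t \<circ> pblk N P t = id"
    and SS: "pblk N S (1 / t) \<circ> pblk N S' (1 / t) = id" "pblk N S' (1 / t) \<circ> pblk N S (1 / t) = id"
    and e: "e \<in> elem_ops (loc (adj B t) t)" "pblk N P t = e \<circ> pblk N S (1 / t)"
  shows "pblk N P 0 \<circ> pblk N P' t \<in> elem_ops (adj B t)"
proof -
  note A = adj_subring[OF B(1), of t] and BA = adj_incl[OF B(1), of t]
  have t: "t \<noteq> 0" by (rule transc_nz[OF B])
  note Bs = B(1) transc_inverse[OF B]
  let ?a = "matop Ysh N P" and ?a' = "matop Ysh N P'" and ?b = "matop Xsh N S" and ?b' = "matop Xsh N S'"
  have aa: "?a \<circ> ?a' = id" "?a' \<circ> ?a = id"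
    by (intro matop_inverse linear_Ysh pblk_inverse_poly[OF B] P PP; assumption)+
  have bb: "?b \<circ> ?b' = id" "?b' \<circ> ?b = id"
    by (intro matop_inverse linear_Xsh pblk_inverse_poly[OF Bs] S SS; assumption)+
  obtain e' E E' where E: "e \<circ> e' = id" "e' \<circ> e = id" "E \<circ> E' = id" "E' \<circ> E = id"
     "asy B t E e" "asy B t E' e'" "fin_op B E" "fin_op B E'"
     "E \<circ> Dop t \<circ> E' \<circ> Dinv t \<in> elem_ops (adj B t)"
    using lifted_elem[OF B(1) t e(1)] unfolding lifted_def by blast
  \<comment> \<open>\<open>G\<close> compares the Toeplitz lift of \<open>P(t) = e S(1 / t)\<close>
    with the product of the lifts of \<open>e\<close> and \<open>S(1 / t)\<close>. Its symbol is the
    identity, so it lives in a finite box and \<open>commutator_finite\<close> applies.\<close>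
  define G where "G = ?b' \<circ> (E' \<circ> ?a)"
  define G' where "G' = ?a' \<circ> (E \<circ> ?b)"
  have "G \<circ> G' = ?b' \<circ> E' \<circ> (?a \<circ> ?a') \<circ> E \<circ> ?b" by (simp only: G_def G'_def comp_assoc)
  also have "\<dots> = ?b' \<circ> (E' \<circ> E) \<circ> ?b" by (simp only: aa comp_id comp_assoc)
  also have "\<dots> = id" by (simp only: E bb comp_id)
  finally have GG: "G \<circ> G' = id" .
  have "G' \<circ> G = ?a' \<circ> E \<circ> (?b \<circ> ?b') \<circ> E' \<circ> ?a" by (simp only: G_def G'_def comp_assoc)
  also have "\<dots> = ?a' \<circ> (E \<circ> E') \<circ> ?a" by (simp only: bb comp_id comp_assoc)
  also have "\<dots> = id" by (simp only: E aa comp_id)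
  finally have GG': "G' \<circ> G = id" .
  note asya = asy_matop_Ysh[OF B(1), of P t N] asy_matop_Ysh[OF B(1), of P' t N]
  note asyb = asy_matop_Xsh[OF B(1) _ t, of S N] asy_matop_Xsh[OF B(1) _ t, of S' N]
  have "asy B t G (pblk N S' (1 / t) \<circ> (e' \<circ> pblk N P t))"
    unfolding G_def by (intro asy_comp[OF B(1)] asya asyb E P S)
  moreover have "pblk N S' (1 / t) \<circ> (e' \<circ> pblk N P t) = pblk N S' (1 / t) \<circ> (e' \<circ> e) \<circ> pblk N S (1 / t)"
    by (simp only: e(2) comp_assoc)
  ultimately have asyG: "asy B t G id" by (simp only: E comp_id SS)
  have "asy B t G' (pblk N P' t \<circ> (e \<circ> pblk N S (1 / t)))"
    unfolding G'_def by (intro asy_comp[OF B(1)] asya asyb E P S)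
  then have asyG': "asy B t G' id" by (simp only: e(2)[symmetric] PP)
  have finG: "fin_op B H" if H: "asy B t H id" for H
    unfolding fin_op_def
  proof (intro conjI allI)
    show "row_op B H" using H by (simp add: asy_def)
    fix s :: "nat \<times> nat"
    obtain M n where Mn: "\<forall>f i a. \<not> (i < M \<and> a < n) \<longrightarrow> H f (i, a) = f (i, a)"
      using asy_id_box[OF B H] by (elim exE conjE)
    have "{k. H (uvec s) k \<noteq> 0} \<subseteq> insert s ({..<M} \<times> {..<n})"
    proof
      fix k assume k: "k \<in> {k. H (uvec s) k \<noteq> 0}"
      obtain i a where ia: "k = (i, a)" by fastforce
      show "k \<in> insert s ({..<M} \<times> {..<n})"
      proof (rule ccontr)
        assume n: "k \<notin> insert s ({..<M} \<times> {..<n})"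
        then have "\<not> (i < M \<and> a < n)" by (auto simp: ia)
        from Mn[rule_format, OF this, of "uvec s"] have "H (uvec s) k = uvec s k" by (simp only: ia)
        then show False using k n by (auto simp: uvec_def)
      qed
    qed
    then show "finite {k. H (uvec s) k \<noteq> 0}" by (rule finite_subset) simp
  qed
  obtain M n where Mn: "\<forall>f i a. \<not> (i < M \<and> a < n) \<longrightarrow> G' f (i, a) = f (i, a)"
    "\<forall>f h i a. (\<forall>j b. j < M \<longrightarrow> b < n \<longrightarrow> f (j, b) = h (j, b)) \<longrightarrow> i < M \<longrightarrow> a < n \<longrightarrow> G' f (i, a) = G' h (i, a)"
    using asy_id_box[OF B asyG'] by (elim exE conjE)
  have comG: "G \<circ> Dop t \<circ> G' \<circ> Dinv t \<in> elem_ops (adj B t)"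
  proof (rule commutator_finite[OF B(1) finG[OF asyG] finG[OF asyG'] GG GG'])
    show "G' f (i, a) = f (i, a)" if "\<not> (i < M \<and> a < n)" for f i a using Mn(1) that by blast
    show "G' f (i, a) = G' h (i, a)"
      if "\<And>j b. j < M \<Longrightarrow> b < n \<Longrightarrow> f (j, b) = h (j, b)" "i < M" "a < n" for f h i a
      by (rule Mn(2)[rule_format]) (use that in auto)
  qed
  define Q where "Q = ?a \<circ> Dop t \<circ> ?a' \<circ> Dinv t"
  have aE: "?a = E \<circ> ?b \<circ> G" 
  proof -
    have "E \<circ> ?b \<circ> G = E \<circ> (?b \<circ> ?b') \<circ> E' \<circ> ?a" by (simp only: G_def comp_assoc)
    also have "\<dots> = (E \<circ> E') \<circ> ?a" by (simp only: bb comp_id comp_assoc)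
    finally show ?thesis by (simp only: E id_comp)
  qed
  have aE': "?a' = G' \<circ> ?b' \<circ> E'"
  proof -
    have "G' \<circ> ?b' \<circ> E' = ?a' \<circ> E \<circ> (?b \<circ> ?b') \<circ> E'" by (simp only: G'_def comp_assoc)
    also have "\<dots> = ?a' \<circ> (E \<circ> E')" by (simp only: bb comp_id comp_assoc)
    finally show ?thesis by (simp only: E comp_id)
  qed
  \<comment> \<open>An operator in \<open>x\<close> alone commutes with \<open>1 - t x\<close>, so
    \<open>S\<close> contributes no commutator.\<close>
  have bD: "Dop t \<circ> ?b' = ?b' \<circ> Dop t"
  proof (intro ext)
    fix f and s :: "nat \<times> nat"
    obtain i a where s: "s = (i, a)" by fastforce
    have D1: "Dop t f = (\<lambda>(i, a). f (i, a) + (- t) * Xsh (\<lambda>b. f (i, b)) a)" for f :: "nat \<times> nat \<Rightarrow> 'a"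
      by (auto simp: Dop_def Xsh_def fun_eq_iff)
    have L: "papp Xsh p (\<lambda>b. h b + (- t) * Xsh h b) a = papp Xsh p h a + (- t) * Xsh (papp Xsh p h) a" for p h
      by (simp only: linear_opD[OF linear_papp[OF linear_Xsh]] papp_comm[OF linear_Xsh])
    have X: "Xsh (\<lambda>b. \<Sum>j<N. papp Xsh (S' i j) (\<lambda>c. f (j, c)) b) a = (\<Sum>j<N. Xsh (papp Xsh (S' i j) (\<lambda>c. f (j, c))) a)"
      by (simp add: Xsh_def)
    show "(Dop t \<circ> ?b') f s = (?b' \<circ> Dop t) f s"
      unfolding s comp_apply D1
      by (simp add: matop_def L[simplified] X sum_subtractf sum_distrib_left)
  qed
  have QE: "Q = (E \<circ> ?b \<circ> (G \<circ> Dop t \<circ> G' \<circ> Dinv t) \<circ> (?b' \<circ> E')) \<circ> (E \<circ> Dop t \<circ> E' \<circ> Dinv t)"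
  proof -
    have "(E \<circ> ?b \<circ> (G \<circ> Dop t \<circ> G' \<circ> Dinv t) \<circ> (?b' \<circ> E')) \<circ> (E \<circ> Dop t \<circ> E' \<circ> Dinv t)
       = E \<circ> ?b \<circ> G \<circ> Dop t \<circ> G' \<circ> Dinv t \<circ> ?b' \<circ> (E' \<circ> E) \<circ> Dop t \<circ> E' \<circ> Dinv t" by (simp only: comp_assoc)
    also have "\<dots> = E \<circ> ?b \<circ> G \<circ> Dop t \<circ> G' \<circ> Dinv t \<circ> (?b' \<circ> Dop t) \<circ> E' \<circ> Dinv t"
      by (simp only: E comp_id comp_assoc)
    also have "\<dots> = E \<circ> ?b \<circ> G \<circ> Dop t \<circ> G' \<circ> (Dinv t \<circ> Dop t) \<circ> ?b' \<circ> E' \<circ> Dinv t"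
      by (simp only: bD[symmetric] comp_assoc)
    also have "\<dots> = (E \<circ> ?b \<circ> G) \<circ> Dop t \<circ> (G' \<circ> ?b' \<circ> E') \<circ> Dinv t"
      by (simp only: Dinv_Dop comp_id comp_assoc)
    finally show ?thesis by (simp only: Q_def aE[symmetric] aE'[symmetric])
  qed
  have "E \<circ> ?b \<circ> (G \<circ> Dop t \<circ> G' \<circ> Dinv t) \<circ> (?b' \<circ> E') \<in> elem_ops (adj B t)"
  proof (rule elem_conj[OF infinite_nat_prod A _ _ _ _ comG])
    show "fin_op (adj B t) (E \<circ> ?b)" "fin_op (adj B t) (?b' \<circ> E')"
      by (intro fin_op_subset[OF fin_op_comp[OF B(1)] BA] E asyb S)+
    have "E \<circ> ?b \<circ> (?b' \<circ> E') = E \<circ> (?b \<circ> ?b') \<circ> E'" "?b' \<circ> E' \<circ> (E \<circ> ?b) = ?b' \<circ> (E' \<circ> E) \<circ> ?b"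
      by (simp_all only: comp_assoc)
    then show "E \<circ> ?b \<circ> (?b' \<circ> E') = id" "?b' \<circ> E' \<circ> (E \<circ> ?b) = id" by (simp_all only: bb E comp_id)
  qed
  from elem_comp[OF this E(9)] have Q: "Q \<in> elem_ops (adj B t)" by (simp only: QE)
  define \<kappa> where "\<kappa> = pblk N P 0 \<circ> pblk N P' t"
  have linQ: "linear_op Q" using fin_op_elem[OF A Q] by (simp add: fin_op_def row_op_def)
  \<comment> \<open>\<open>P(y)\<close> commutes with \<open>1 - t x\<close> away from position 0,
    so \<open>Q\<close> is trivial there.\<close>
  have Qfar: "Q f (i, Suc a) = f (i, Suc a)" for f i a
  proof -
    define g where "g = ?a' (Dinv t f)"
    have ag: "?a g = Dinv t f" unfolding g_def using aa(1) by (metis comp_apply id_apply)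
    have "?a (Dop t g) (i, Suc a) = Dop t (?a g) (i, Suc a)"
    proof (cases "i < N")
      case True
      have "papp Ysh (P i j) (\<lambda>b. Dop t g (j, b)) (Suc a)
         = papp Ysh (P i j) (\<lambda>b. g (j, b)) (Suc a) - t * papp Ysh (P i j) (\<lambda>b. g (j, b)) a" for j
        by (simp add: papp_Ysh Dop_def sum_subtractf sum_distrib_left algebra_simps)
      then show ?thesis using True by (simp add: matop_def Dop_def sum_subtractf sum_distrib_left)
    qed (simp add: matop_def Dop_def)
    then have "Q f (i, Suc a) = Dop t (Dinv t f) (i, Suc a)" by (simp add: Q_def g_def[symmetric] ag)
    then show ?thesis by (simp add: Dop_Dinv_apply)
  qed
  \<comment> \<open>\<open>Dinv t\<close> spreads a vector at position 0 into a plane wave, on which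
    \<open>P'(y)\<close> acts as \<open>P'(t)\<close>; \<open>Dop t\<close> cuts the new wave back
    to position 0, where \<open>P(y)\<close> acts as \<open>P(0)\<close>.\<close>
  have Q0: "Q (\<lambda>(j, b). if b = 0 then \<phi> j else 0) (i, 0) = \<kappa> \<phi> i" for \<phi> i
  proof -
    have "Dinv t (\<lambda>(j, b). if b = 0 then \<phi> j else 0) (i, a) = \<phi> i * t ^ a" for i a
      by (induction a) (auto simp: Dinv_0 Dinv_Suc)
    then have 1: "Dinv t (\<lambda>(j, b). if b = 0 then \<phi> j else 0) = (\<lambda>(j, b). \<phi> j * t ^ b)" by auto
    have pw: "papp Ysh p (\<lambda>b. c * t ^ b) a = poly p t * c * t ^ a" for p c a
      unfolding papp_Ysh poly_altdef sum_distrib_right by (intro sum.cong) (auto simp: power_add)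
    have 2: "?a' (\<lambda>(j, b). \<phi> j * t ^ b) = (\<lambda>(j, b). pblk N P' t \<phi> j * t ^ b)"
      by (auto simp: fun_eq_iff matop_def pblk_def pw sum_distrib_right)
    have 3: "Dop t (\<lambda>(j, b). \<psi> j * t ^ b) = (\<lambda>(j, b). if b = 0 then \<psi> j else 0)" for \<psi> :: "nat \<Rightarrow> 'a"
      by (auto simp: Dop_def fun_eq_iff gr0_conv_Suc power_eq_if)
    have 4: "papp Ysh p (\<lambda>b. if b = 0 then c else 0) 0 = poly p 0 * c" for p c
    proof -
      have "papp Ysh p (\<lambda>b. if b = 0 then c else 0) 0 = (\<Sum>d\<le>degree p. if d = 0 then coeff p 0 * c else 0)"
        unfolding papp_Ysh by (intro sum.cong) auto
      then show ?thesis by (simp add: poly_0_coeff_0)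
    qed
    have 5: "?a (\<lambda>(j, b). if b = 0 then \<psi> j else 0) (i, 0) = pblk N P 0 \<psi> i" for \<psi>
      by (simp add: matop_def pblk_def 4)
    show ?thesis unfolding Q_def \<kappa>_def comp_apply 1 2 3 5 ..
  qed
  \<comment> \<open>\<open>Q\<close> is block triangular for the splitting into position 0 and the
    rest: \<open>q0\<close> is its diagonal part, and \<open>U\<close> is a finite block of row
    operations into position 0.\<close>
  define q0 where "q0 = (\<lambda>f (i, a). if a = (0 :: nat) then \<kappa> (\<lambda>j. f (j, 0)) i else (f (i, a) :: 'a))"
  define hi where "hi = (\<lambda>f (i :: nat, a). if a = (0 :: nat) then 0 else (f (i, a) :: 'a))"
  define U where "U = (\<lambda>f (i, a). if a = (0 :: nat) then f (i, 0) + Q (hi f) (i, 0) else (f (i, a) :: 'a))"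
  have QU: "Q = U \<circ> q0"
  proof (intro ext)
    fix f and s :: "nat \<times> nat"
    obtain i a where s: "s = (i, a)" by fastforce
    have fsplit: "f = (\<lambda>s. (\<lambda>(j, b). if b = 0 then f (j, 0) else 0) s + hi f s)"
      by (auto simp: hi_def fun_eq_iff)
    have "Q f (i, 0) = \<kappa> (\<lambda>j. f (j, 0)) i + Q (hi f) (i, 0)"
      by (subst fsplit, subst linear_opD(1)[OF linQ]) (simp add: Q0)
    moreover have "hi (q0 f) = hi f" by (auto simp: hi_def q0_def fun_eq_iff)
    ultimately show "Q f s = (U \<circ> q0) f s"
      by (cases a) (auto simp: s U_def q0_def Qfar)
  qed
  have U: "U \<in> elem_ops (adj B t)"
  proof -
    obtain T where T: "finite T" "\<forall>f i. i \<notin> T \<longrightarrow> Q f i = f i"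
      "\<forall>f h. (\<forall>s\<in>T. f s = h s) \<longrightarrow> (\<forall>i\<in>T. Q f i = Q h i)"
      using elem_support[OF Q] by (elim exE conjE)
    define T0 where "T0 = {s\<in>T. snd s = 0}"
    define T1 where "T1 = {s\<in>T. snd s \<noteq> 0}"
    have "U = (\<lambda>f k. if k \<in> T0 then f k + (\<Sum>s\<in>T1. Q (uvec s) k * f s) else f k)"
    proof (intro ext)
      fix f and k :: "nat \<times> nat"
      obtain i a where k: "k = (i, a)" by fastforce
      show "U f k = (if k \<in> T0 then f k + (\<Sum>s\<in>T1. Q (uvec s) k * f s) else f k)"
      proof (cases "a = 0")
        case a0: True
        show ?thesis
        proof (cases "k \<in> T")
          case True
          have "Q (hi f) k = (\<Sum>s\<in>T. Q (uvec s) k * hi f s)"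
            using T True by (intro row_expand[OF linQ]) auto
          also have "\<dots> = (\<Sum>s\<in>T1. Q (uvec s) k * f s)"
            using T by (intro sum.mono_neutral_cong_right) (auto simp: T1_def hi_def split: if_splits)
          finally show ?thesis using True a0 by (simp add: U_def k T0_def)
        next
          case False
          then have "Q (hi f) k = hi f k" using T by blast
          then show ?thesis using False a0 by (simp add: U_def k T0_def hi_def)
        qed
      qed (simp add: U_def k T0_def)
    qed
    also have "\<dots> \<in> elem_ops (adj B t)"
    proof (rule elem_block_op)
      show "finite T0" "finite T1" "T0 \<inter> T1 = {}" using T(1) by (auto simp: T0_def T1_def)
      have "row_op (adj B t) Q" using fin_op_elem[OF A Q] by (simp add: fin_op_def)
      then show "Q (uvec s) k \<in> adj B t" for k s by (rule row_op_entry)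
    qed
    finally show ?thesis .
  qed
  have q0: "q0 \<in> elem_ops (adj B t)" using elem_left_cancel[OF A U] Q by (simp only: QU)
  obtain \<tau> :: "nat \<times> nat \<Rightarrow> nat" where \<tau>: "bij \<tau>" "\<forall>i<N. \<tau> (i, 0) = i" using bij_extending_column by blast
  have inj: "inj \<tau>" "surj \<tau>" using \<tau> by (auto simp: bij_def)
  have eq: "(\<lambda>f k. q0 (f \<circ> \<tau>) (inv_into UNIV \<tau> k)) = \<kappa>"
  proof (intro ext)
    fix f and k :: nat
    obtain i a where ia: "inv_into UNIV \<tau> k = (i, a)" by fastforce
    then have k: "k = \<tau> (i, a)" using inj by (metis surj_f_inv_f)
    have "q0 (f \<circ> \<tau>) (i, a) = \<kappa> f k"
    proof (cases "a = 0 \<and> i < N")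
      case True
      then have "k = i" using k \<tau> by simp
      have "pblk N P' t (\<lambda>j. f (\<tau> (j, 0))) l = pblk N P' t f l" if "l < N" for l
        using that \<tau> by (simp add: pblk_def)
      then show ?thesis using True by (simp add: q0_def \<kappa>_def \<open>k = i\<close> pblk_def[of N P])
    next
      case False
      have "\<not> k < N"
      proof
        assume "k < N"
        then have "\<tau> (k, 0) = \<tau> (i, a)" using \<tau> k by simp
        then show False using False inj(1) \<open>k < N\<close> by (auto simp: inj_eq)
      qed
      then show ?thesis using False by (auto simp: q0_def \<kappa>_def pblk_def k)
    qed
    then show "q0 (f \<circ> \<tau>) (inv_into UNIV \<tau> k) = \<kappa> f k" by (simp only: ia)
  qed
  show ?thesis using elem_reindex[OF \<tau>(1) q0] unfolding eq \<kappa>_def .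
qed

subsection \<open>Invertible matrices over Laurent polynomial rings\<close>

definition ratf :: "'a::field set \<Rightarrow> 'a \<Rightarrow> 'a set" where
  "ratf F t = {poly p t / poly q t | p q. pol F p \<and> pol F q \<and> poly q t \<noteq> 0}"

fun Lau :: "'a::field set \<Rightarrow> 'a list \<Rightarrow> 'a set" where
  "Lau F [] = F"
| "Lau F (t # ts) = loc (adj (Lau F ts) t) t"

text \<open>Shaped for the induction of \<open>K1_Laurent\<close>, which moves the first variable
  into the base field: \<open>t\<close> is transcendental over the Laurent ring of the others, and
  these are independent over \<open>F(t)\<close>.\<close>

fun indep :: "'a::field set \<Rightarrow> 'a list \<Rightarrow> bool" where
  "indep F [] = True"
| "indep F (t # ts) = (transc (Lau F ts) t \<and> indep (ratf F t) ts)"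

fun mons :: "'a::field list \<Rightarrow> 'a set" where
  "mons [] = {1}"
| "mons (t # ts) = {t powi k * m | k m. m \<in> mons ts}"

lemma subfield_subring: "is_subfield F \<Longrightarrow> is_subring F"
  by (simp add: is_subfield_def)

lemma ratfI: "pol F p \<Longrightarrow> pol F q \<Longrightarrow> poly q t \<noteq> 0 \<Longrightarrow> poly p t / poly q t \<in> ratf F t"
  by (auto simp: ratf_def)

lemma ratf_subfield:
  assumes F: "is_subring F"
  shows "is_subfield (ratf F t)"
  unfolding is_subfield_def is_subring_def
proof (intro conjI ballI)
  show "0 \<in> ratf F t" "1 \<in> ratf F t"
    using ratfI[OF pol_0[OF F] pol_1[OF F], of t] ratfI[OF pol_1[OF F] pol_1[OF F], of t] by simp_all
next
  fix a b assume "a \<in> ratf F t" "b \<in> ratf F t"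
  then obtain p q p' q' where h: "a = poly p t / poly q t" "b = poly p' t / poly q' t"
    "pol F p" "pol F q" "pol F p'" "pol F q'" "poly q t \<noteq> 0" "poly q' t \<noteq> 0" unfolding ratf_def by blast
  have "a + b = poly (p * q' + p' * q) t / poly (q * q') t" "a * b = poly (p * p') t / poly (q * q') t"
    unfolding h(1,2) using h(7,8) by (simp_all add: field_simps)
  moreover have "poly (p * q' + p' * q) t / poly (q * q') t \<in> ratf F t" "poly (p * p') t / poly (q * q') t \<in> ratf F t"
    using h F by (auto intro!: ratfI pol_add pol_mult simp del: poly_add poly_mult) auto
  ultimately show "a + b \<in> ratf F t" "a * b \<in> ratf F t" by simp_all
next
  fix a assume "a \<in> ratf F t"
  then obtain p q where h: "a = poly p t / poly q t" "pol F p" "pol F q" "poly q t \<noteq> 0"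
    unfolding ratf_def by blast
  then show "- a \<in> ratf F t" using ratfI[of F "- p" q t] pol_uminus[OF F] by simp
  show "inverse a \<in> ratf F t"
  proof (cases "poly p t = 0")
    case True
    then show ?thesis using ratfI[OF pol_0[OF F] pol_1[OF F], of t] h by simp
  next
    case False
    then show ?thesis using ratfI[of F q p t] h by simp
  qed
qed

lemma ratf_incl: "is_subring F \<Longrightarrow> F \<subseteq> ratf F t"
proof
  fix c assume "is_subring F" "c \<in> F"
  then show "c \<in> ratf F t" using ratfI[of F "[:c:]" 1 t] by (simp add: pol_pCons pol_0 pol_1)
qed

lemma ratf_gen: "is_subring F \<Longrightarrow> t \<in> ratf F t"
  using ratfI[of F "[:0, 1:]" 1 t] by (simp add: pol_pCons pol_0 pol_1 subring_0 subring_1)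

lemma loc_self_inverse: "is_subring R \<Longrightarrow> inverse h \<in> loc R h"
  using locI[of 1 R h 1] subring_1[of R] by (simp add: inverse_eq_divide)

lemma subring_inverse_power: "is_subring R \<Longrightarrow> inverse h \<in> R \<Longrightarrow> a \<in> R \<Longrightarrow> a / h ^ k \<in> R"
  by (simp add: divide_inverse power_inverse[symmetric] subring_mult subring_power del: power_inverse)

lemma loc_least:
  assumes "is_subring R'" "R \<subseteq> R'" "inverse h \<in> R'"
  shows "loc R h \<subseteq> R'"
  unfolding loc_def using subring_inverse_power[OF assms(1,3)] assms(2) by blast

lemma adj_mono: "B \<subseteq> B' \<Longrightarrow> adj B t \<subseteq> adj B' t"
  unfolding adj_def pol_def by blast

lemma loc_mono: "R \<subseteq> R' \<Longrightarrow> loc R h \<subseteq> loc R' h"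
  unfolding loc_def by blast

lemma Lau_mono: "F \<subseteq> F' \<Longrightarrow> Lau F ts \<subseteq> Lau F' ts"
  by (induction ts) (simp_all add: loc_mono adj_mono)

lemma Lau_props:
  assumes "is_subring F" "0 \<notin> set ts"
  shows "is_subring (Lau F ts)" "F \<subseteq> Lau F ts"
    "\<And>u. u \<in> set ts \<Longrightarrow> u \<in> Lau F ts \<and> inverse u \<in> Lau F ts"
proof -
  have "is_subring (Lau F ts) \<and> F \<subseteq> Lau F ts \<and> (\<forall>u\<in>set ts. u \<in> Lau F ts \<and> inverse u \<in> Lau F ts)"
    using assms(2)
  proof (induction ts)
    case (Cons t ts)
    let ?B = "Lau F ts"
    have IH: "is_subring ?B" "F \<subseteq> ?B" "\<forall>u\<in>set ts. u \<in> ?B \<and> inverse u \<in> ?B" using Cons by auto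
    note A = adj_subring[OF IH(1), of t] and BA = adj_incl[OF IH(1), of t]
    have 1: "is_subring (Lau F (t # ts))" using Cons(2) by (simp add: loc_subring[OF A adj_gen[OF IH(1)]])
    have 2: "?B \<subseteq> Lau F (t # ts)" using BA loc_incl[of "adj ?B t" t] by simp
    have 3: "t \<in> Lau F (t # ts)" "inverse t \<in> Lau F (t # ts)"
      using adj_gen[OF IH(1)] loc_incl[of "adj ?B t" t] loc_self_inverse[OF A] by auto
    show ?case using 1 2 3 IH by auto
  qed (simp add: assms)
  then show "is_subring (Lau F ts)" "F \<subseteq> Lau F ts"
    "\<And>u. u \<in> set ts \<Longrightarrow> u \<in> Lau F ts \<and> inverse u \<in> Lau F ts" by blast+
qed

lemma Lau_least:
  assumes "is_subring R" "F \<subseteq> R" "\<And>u. u \<in> set ts \<Longrightarrow> u \<in> R \<and> inverse u \<in> R"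
  shows "Lau F ts \<subseteq> R"
  using assms(3)
proof (induction ts)
  case (Cons t ts)
  then have "Lau F ts \<subseteq> R" by auto
  then have "adj (Lau F ts) t \<subseteq> R" using Cons assms(1) by (intro adj_least) auto
  then show ?case using Cons(2)[of t] loc_least[OF assms(1), of "adj (Lau F ts) t" t] by simp
qed (simp add: assms)

lemma indep_nz: "is_subring F \<Longrightarrow> indep F ts \<Longrightarrow> 0 \<notin> set ts"
proof (induction ts arbitrary: F)
  case (Cons t ts)
  have "0 \<notin> set ts"
    using Cons.IH[OF subfield_subring[OF ratf_subfield[OF Cons(2), of t]]] Cons(3) by simp
  then show ?case using transc_nz[OF Lau_props(1)[OF Cons(2)], of ts t] Cons(3) by auto
qed simp

lemma powi_mem: "is_subring R \<Longrightarrow> u \<in> R \<Longrightarrow> inverse u \<in> R \<Longrightarrow> u powi k \<in> R"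
  by (auto simp: power_int_def intro: subring_power)

lemma mons_props:
  assumes "0 \<notin> set ts" "m \<in> mons ts"
  shows "m \<noteq> 0" "inverse m \<in> mons ts" "is_subring R \<Longrightarrow> (\<And>u. u \<in> set ts \<Longrightarrow> u \<in> R \<and> inverse u \<in> R) \<Longrightarrow> m \<in> R"
proof -
  have "m \<noteq> 0 \<and> inverse m \<in> mons ts \<and>
     (is_subring R \<longrightarrow> (\<forall>u\<in>set ts. u \<in> R \<and> inverse u \<in> R) \<longrightarrow> m \<in> R)" if "0 \<notin> set ts" "m \<in> mons ts" for m
    using that
  proof (induction ts arbitrary: m)
    case (Cons t ts)
    then obtain k m' where m: "m = t powi k * m'" "m' \<in> mons ts" by auto
    with Cons have "m' \<noteq> 0" "inverse m' \<in> mons ts"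
       "is_subring R \<longrightarrow> (\<forall>u\<in>set ts. u \<in> R \<and> inverse u \<in> R) \<longrightarrow> m' \<in> R" by auto
    moreover have "inverse m = t powi (- k) * inverse m'"
      using Cons by (simp add: m power_int_minus)
    ultimately show ?case using Cons m by (auto intro!: subring_mult powi_mem)
  qed (auto simp: subring_1)
  then show "m \<noteq> 0" "inverse m \<in> mons ts" "is_subring R \<Longrightarrow> (\<And>u. u \<in> set ts \<Longrightarrow> u \<in> R \<and> inverse u \<in> R) \<Longrightarrow> m \<in> R"
    using assms by blast+
qed

lemma poly_sum_coeffs_mem:
  assumes "is_subring R" "\<And>i. coeff p i \<in> R" "u \<in> R"
  shows "poly p u \<in> R"
  using assms by (auto simp: poly_altdef intro!: subring_intros)

lemma loc_mult_subset:
  assumes "is_subring R" "g \<in> R" "g \<noteq> 0"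
  shows "loc R f \<subseteq> loc R (f * g)"
proof
  fix a assume "a \<in> loc R f"
  then obtain r k where a: "a = r / f ^ k" "r \<in> R" unfolding loc_def by blast
  have "a = (r * g ^ k) / (f * g) ^ k" using assms by (simp add: a power_mult_distrib)
  moreover have "r * g ^ k \<in> R" using a assms by (intro subring_mult subring_power)
  ultimately show "a \<in> loc R (f * g)" by (simp add: locI)
qed

lemma common_denominator:
  assumes F: "is_subring F" and R: "is_subring R" and FR: "F \<subseteq> R" "t \<in> R" and fin: "finite I"
    and h: "\<And>i. i \<in> I \<Longrightarrow> \<exists>f. pol F f \<and> poly f t \<noteq> 0 \<and> a i \<in> loc R (poly f t)"
  shows "\<exists>f. pol F f \<and> poly f t \<noteq> 0 \<and> (\<forall>i\<in>I. a i \<in> loc R (poly f t))"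
  using fin h
proof (induction I rule: finite_induct)
  case empty
  then show ?case using pol_1[OF F] by (intro exI[of _ 1]) auto
next
  case (insert x I)
  then obtain f where f: "pol F f" "poly f t \<noteq> 0" "\<forall>i\<in>I. a i \<in> loc R (poly f t)" by auto
  obtain g where g: "pol F g" "poly g t \<noteq> 0" "a x \<in> loc R (poly g t)" using insert(4)[of x] by auto
  have fR: "poly f t \<in> R" "poly g t \<in> R"
    using f(1) g(1) FR R by (auto intro!: poly_sum_coeffs_mem simp: pol_def)
  have "\<forall>i\<in>insert x I. a i \<in> loc R (poly (f * g) t)"
    using f(3) g(3) loc_mult_subset[OF R fR(2) g(2), of "poly f t"] loc_mult_subset[OF R fR(1) f(2), of "poly g t"]
    by (auto simp: mult.commute)
  moreover have "pol F (f * g)" "poly (f * g) t \<noteq> 0" using f g F by (auto intro: pol_mult)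
  ultimately show ?case by blast
qed

text \<open>An element involves finitely many coefficients from \<open>F(t)\<close>. Their
  denominators combine into one polynomial \<open>f\<close> over \<open>F\<close>, while the other
  variables are invertible on both sides.\<close>

lemma Lau_denominator:
  assumes F: "is_subring F" and t: "t \<noteq> 0"
  shows "0 \<notin> set ts \<Longrightarrow> a \<in> Lau (ratf F t) ts \<Longrightarrow>
    \<exists>f. pol F f \<and> poly f t \<noteq> 0 \<and> a \<in> loc (adj (Lau F ts) t) (poly f t)"
proof (induction ts arbitrary: a)
  case Nil
  then obtain p q where "a = poly p t / poly q t" "pol F p" "pol F q" "poly q t \<noteq> 0" by (auto simp: ratf_def)
  then show ?case using locI[OF adjI[of F p t], of "poly q t" 1] by (intro exI[of _ q]) simp
next
  case (Cons u us)
  let ?B = "Lau F us" and ?B' = "Lau F (u # us)"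
  have B: "is_subring ?B" "F \<subseteq> ?B" using Lau_props[OF F, of us] Cons(2) by auto
  have B': "is_subring ?B'" "F \<subseteq> ?B'" "u \<in> ?B'" "inverse u \<in> ?B'" using Lau_props[OF F Cons(2)] by auto
  have BB': "?B \<subseteq> ?B'" using adj_incl[OF B(1), of u] loc_incl[of "adj ?B u" u] by simp
  obtain P k where P: "pol (Lau (ratf F t) us) P" "a = poly P u / u ^ k"
    using Cons(3) by (auto simp: loc_def adj_def)
  have "\<exists>f. pol F f \<and> poly f t \<noteq> 0 \<and> (\<forall>i\<in>{..degree P}. coeff P i \<in> loc (adj ?B t) (poly f t))"
    using Cons P(1) B adj_incl[OF B(1), of t] adj_gen[OF B(1), of t]
    by (intro common_denominator[OF F adj_subring[OF B(1)]]) (auto simp: pol_def)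
  then obtain f where f: "pol F f" "poly f t \<noteq> 0" "\<And>i. i \<le> degree P \<Longrightarrow> coeff P i \<in> loc (adj ?B t) (poly f t)"
    by auto
  let ?L = "loc (adj ?B' t) (poly f t)"
  have "poly f t \<in> adj ?B' t" using f(1) B' by (intro adjI) (auto simp: pol_def)
  then have L: "is_subring ?L" using f(2) by (intro loc_subring adj_subring B')
  have sub: "loc (adj ?B t) (poly f t) \<subseteq> ?L" by (intro loc_mono adj_mono BB')
  have uL: "u \<in> ?L" "inverse u \<in> ?L" using B' adj_incl[OF B'(1), of t] loc_incl[of "adj ?B' t" "poly f t"] by auto
  have "coeff P i \<in> ?L" for i
  proof (cases "i \<le> degree P")
    case True
    then show ?thesis using f(3) sub by auto
  next
    case False
    then show ?thesis using subring_0[OF L] by (simp add: coeff_eq_0)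
  qed
  then have "poly P u \<in> ?L" using L uL by (intro poly_sum_coeffs_mem)
  then have "a \<in> ?L" using subring_inverse_power[OF L uL(2)] P(2) by simp
  then show ?case using f by blast
qed

lemma elem_denominator:
  assumes F: "is_subring F" and t: "t \<noteq> 0" and ts: "0 \<notin> set ts" and e: "e \<in> elem_ops (Lau (ratf F t) ts)"
  shows "\<exists>f. pol F f \<and> poly f t \<noteq> 0 \<and> e \<in> elem_ops (loc (adj (Lau F ts) t) (poly f t))"
  using e
proof induction
  case elem_id
  have "poly (1 :: 'a poly) t \<noteq> 0" by simp
  then show ?case using pol_1[OF F] elem_ops.elem_id by blast
next
  case (elem_step i j a g)
  let ?A = "adj (Lau F ts) t"
  have B: "is_subring (Lau F ts)" "F \<subseteq> Lau F ts" using Lau_props[OF F ts] by auto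
  have A: "is_subring ?A" "F \<subseteq> ?A" "t \<in> ?A"
    using adj_subring[OF B(1)] adj_incl[OF B(1), of t] B adj_gen[OF B(1)] by auto
  obtain f where f: "pol F f" "poly f t \<noteq> 0" "g \<in> elem_ops (loc ?A (poly f t))" using elem_step.IH by blast
  obtain h where h: "pol F h" "poly h t \<noteq> 0" "a \<in> loc ?A (poly h t)"
    using Lau_denominator[OF F t ts elem_step(2)] by blast
  have fA: "poly f t \<in> ?A" "poly h t \<in> ?A"
    using f(1) h(1) A by (auto intro!: poly_sum_coeffs_mem simp: pol_def)
  have 1: "loc ?A (poly f t) \<subseteq> loc ?A (poly (f * h) t)" "loc ?A (poly h t) \<subseteq> loc ?A (poly (f * h) t)"
    using loc_mult_subset[OF A(1) fA(2) h(2), of "poly f t"] loc_mult_subset[OF A(1) fA(1) f(2), of "poly h t"]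
    by (auto simp: mult.commute)
  have "transv i j a \<in> elem_ops (loc ?A (poly (f * h) t))"
    using elem_step(1) h(3) 1 by (intro elem_transv) auto
  from elem_comp[OF this elem_mono[OF f(3) 1(1)]]
  have "transv i j a \<circ> g \<in> elem_ops (loc ?A (poly (f * h) t))" .
  moreover have "pol F (f * h)" "poly (f * h) t \<noteq> 0" using f h F by (auto intro: pol_mult)
  ultimately show ?case by blast
qed

section \<open>Laurent units, and patching along a denominator\<close>

lemma monom_factor:
  fixes r r' :: "'a::field poly"
  shows "r * r' = monom 1 m \<Longrightarrow> \<exists>b i. r = monom b i"
proof (induction m arbitrary: r r')
  case 0
  then have "r * r' = 1" by (simp add: monom_eq_1)
  then have "degree r + degree r' = 0" by (metis degree_1 degree_mult_eq mult_eq_0_iff one_neq_zero)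
  then obtain b where "r = [:b:]" using degree_eq_zeroE by auto
  then show ?case by (metis monom_0)
next
  case (Suc m)
  have "coeff (r * r') 0 = 0" using Suc(2) by simp
  then have "coeff r 0 = 0 \<or> coeff r' 0 = 0" by (simp add: coeff_mult_0)
  then show ?case
  proof
    assume 0: "coeff r 0 = 0"
    obtain c r1 where r: "r = pCons c r1" by (cases r)
    then have "pCons 0 (r1 * r') = pCons 0 (monom 1 m)" using 0 Suc(2) by (simp add: monom_Suc)
    then obtain b i where "r1 = monom b i" using Suc.IH[of r1 r'] by auto
    then show ?thesis using r 0 by (metis coeff_pCons_0 monom_Suc)
  next
    assume 0: "coeff r' 0 = 0"
    obtain c r1 where r: "r' = pCons c r1" by (cases r')
    then have "pCons 0 (r * r1) = pCons 0 (monom 1 m)" using 0 Suc(2) by (simp add: monom_Suc)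
    then show ?thesis using Suc.IH[of r r1] by auto
  qed
qed

text \<open>The numerators of \<open>c\<close> and of its inverse multiply to a power of
  \<open>t\<close>, so both are monomials. The coefficient \<open>b\<close> is at first only in
  \<open>B\<close>; writing \<open>c\<close> as a fraction over \<open>F\<close> as well exhibits
  \<open>b\<close> as a quotient of leading coefficients, hence in \<open>F\<close>.\<close>

lemma Laurent_unit:
  assumes B: "is_subring B" and F: "is_subfield F" "F \<subseteq> B" and t: "transc B t"
    and c: "c \<in> ratf F t" "c \<noteq> 0" "c \<in> loc (adj B t) t" "inverse c \<in> loc (adj B t) t"
  shows "\<exists>b\<in>F. \<exists>k. b \<noteq> 0 \<and> c = b * t powi k"
proof -
  have t0: "t \<noteq> 0" by (rule transc_nz[OF B t])
  obtain r k where r: "pol B r" "c = poly r t / t ^ k" using c(3) by (auto simp: loc_def adj_def)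
  obtain r' k' where r': "pol B r'" "inverse c = poly r' t / t ^ k'" using c(4) by (auto simp: loc_def adj_def)
  have "poly r t * poly r' t = t ^ (k + k')"
    using r(2) r'(2) c(2) t0 by (simp add: field_simps power_add)
  then have "poly (r * r') t = poly (monom 1 (k + k')) t" by (simp add: poly_monom)
  then have rr: "r * r' = monom 1 (k + k')"
    using transc_eq[OF B t pol_mult[OF B r(1) r'(1)] pol_monom[OF B subring_1[OF B]]] by blast
  obtain b i where ib: "r = monom b i" using monom_factor[OF rr] by blast
  have "b \<noteq> 0" using ib r c by auto
  have cb: "c = b * t powi (int i - int k)"
    using t0 by (simp add: r(2) ib poly_monom power_int_diff)
  have bB: "b \<in> B" using r(1) ib by (auto simp: pol_def dest: spec[of _ i])
  obtain p q where pq: "c = poly p t / poly q t" "pol F p" "pol F q" "poly q t \<noteq> 0"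
    using c(1) unfolding ratf_def by blast
  have "b * t ^ i * poly q t = poly p t * t ^ k"
    using pq(1,4) r(2) t0 by (simp add: ib poly_monom field_simps)
  then have "poly (monom b i * q) t = poly (p * monom 1 k) t" by (simp add: poly_monom)
  moreover have "pol B p" "pol B q" using pq F by (auto simp: pol_def)
  ultimately have eq: "monom b i * q = p * monom 1 k"
    by (intro transc_eq[OF B t] pol_mult[OF B] pol_monom[OF B] bB subring_1[OF B])
  have "q \<noteq> 0" using pq(4) by auto
  then have "lead_coeff (monom b i * q) = b * lead_coeff q"
    using \<open>b \<noteq> 0\<close> by (simp add: lead_coeff_mult degree_monom_eq)
  moreover have "lead_coeff (p * monom 1 k) = lead_coeff p"
    by (simp add: lead_coeff_mult degree_monom_eq)
  ultimately have "b = lead_coeff p / lead_coeff q" using eq \<open>q \<noteq> 0\<close> by (simp add: field_simps)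
  then have "b \<in> F" using pq(2,3) subfield_divide[OF F(1)] by (auto simp: pol_def)
  then show ?thesis using \<open>b \<noteq> 0\<close> cb by blast
qed

text \<open>As \<open>f(0)\<close> is a unit of \<open>B\<close>, the elements \<open>t\<close> and
  \<open>f(t)\<close> are comaximal in B[t], and the word splits into one with denominators
  \<open>t\<close> and one with denominators \<open>f(t)\<close>. The second factor is also
  invertible over B[t, 1/t], hence over the intersection of both localisations, which is
  B[t].\<close>

lemma patch_split:
  assumes B: "is_subring B" and t: "t \<noteq> 0" and f: "pol B f" "coeff f 0 \<noteq> 0" "inverse (coeff f 0) \<in> B" "poly f t \<noteq> 0"
    and e: "e \<in> GLop (loc (adj B t) t)" "e \<in> elem_ops (loc (adj B t) (t * poly f t))"
  shows "\<exists>e1\<in>elem_ops (loc (adj B t) t). \<exists>a\<in>GLop (adj B t). a \<in> elem_ops (loc (adj B t) (poly f t)) \<and> e = e1 \<circ> a"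
proof -
  let ?A = "adj B t" and ?q = "poly f t"
  note A = adj_subring[OF B, of t] and BA = adj_incl[OF B, of t] and tA = adj_gen[OF B, of t]
  have qA: "?q \<in> ?A" using f(1) by (rule adjI)
  obtain c h where h: "f = pCons c h" by (cases f)
  have c: "c \<noteq> 0" "inverse c \<in> B" "pol B h" using f h by (auto simp: pol_pCons)
  have "- (inverse c * poly h t) * t + inverse c * ?q = 1" using c by (simp add: h algebra_simps)
  moreover have "- (inverse c * poly h t) \<in> ?A" "inverse c \<in> ?A"
    using c BA adjI[OF c(3), of t] A by (auto intro!: subring_uminus subring_mult)
  ultimately have "\<exists>a\<in>?A. \<exists>b\<in>?A. a * t + b * ?q = 1" by blast
  note comax = comaximal_power[OF A tA qA this]
  obtain e1 e2 where e12: "e1 \<in> elem_ops (loc ?A t)" "e2 \<in> elem_ops (loc ?A ?q)" "e = e1 \<circ> e2"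
    using elem_loc_factor[OF infinite_nat A tA qA t f(4) comax e(2)] by blast
  note At = loc_subring[OF A tA t] and Aq = loc_subring[OF A qA f(4)]
  obtain d where d: "d \<in> elem_ops (loc ?A t)" "d \<circ> e1 = id" using elem_inverse[OF At e12(1)] by blast
  have "d \<circ> e = (d \<circ> e1) \<circ> e2" by (simp only: e12 comp_assoc)
  then have "e2 = d \<circ> e" by (simp only: d id_comp)
  then have 1: "e2 \<in> GLop (loc ?A t)" using GLop_comp[OF At GLop_elem[OF At d(1)] e(1)] by (simp only:)
  have 2: "e2 \<in> GLop (loc ?A ?q)" by (rule GLop_elem[OF Aq e12(2)])
  have "loc ?A t \<inter> loc ?A ?q \<subseteq> ?A" using loc_inter[OF A t f(4) comax tA qA] by blast
  then have "e2 \<in> GLop ?A" using GLop_Int[OF At Aq 1 2] GLop_subset by blast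
  then show ?thesis using e12 by blast
qed

text \<open>Specialisation at \<open>t = 0\<close>, possible since \<open>f(0)\<close> is a unit.
  The localised ring is just a set of field elements, so instead of applying an evaluation map the
  proof follows the numerators \<open>p\<close> and exponents \<open>k\<close> of all entries
  through the word.\<close>

lemma elem_eval_0:
  assumes B: "is_subring B" and f: "pol B f" "inverse (poly f 0) \<in> B" "poly f 0 \<noteq> 0" "poly f t \<noteq> 0"
    and e: "e \<in> elem_ops (loc (adj B t) (poly f t))"
  shows "\<exists>e0\<in>elem_ops B. \<forall>i j. \<exists>p k. pol B p \<and> e (uvec j) i = poly p t / poly f t ^ k \<and> e0 (uvec j) i = poly p 0 / poly f 0 ^ k"
  using e
proof induction
  case elem_id
  have "\<exists>p k. pol B p \<and> id (uvec j) i = poly p t / poly f t ^ k \<and> id (uvec j) i = poly p 0 / poly f 0 ^ k" for i j :: 'b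
    using pol_0[OF B] pol_1[OF B] by (intro exI[of _ "if i = j then 1 else 0"] exI[of _ 0]) (simp add: uvec_def)
  then show ?case using elem_ops.elem_id[of B] by blast
next
  case (elem_step i j a g)
  obtain e0 where e0: "e0 \<in> elem_ops B"
    "\<forall>i j. \<exists>p k. pol B p \<and> g (uvec j) i = poly p t / poly f t ^ k \<and> e0 (uvec j) i = poly p 0 / poly f 0 ^ k"
    using elem_step.IH by blast
  obtain r m where r: "pol B r" "a = poly r t / poly f t ^ m"
    using elem_step(2) by (auto simp: loc_def adj_def)
  define a0 where "a0 = poly r 0 / poly f 0 ^ m"
  have "poly r 0 \<in> B" using r(1) by (simp add: poly_0_coeff_0 pol_def)
  then have "a0 \<in> B" unfolding a0_def by (rule subring_inverse_power[OF B f(2)])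
  then have "transv i j a0 \<circ> e0 \<in> elem_ops B" using elem_ops.elem_step[OF elem_step(1) _ e0(1)] by blast
  moreover have "\<exists>p k. pol B p \<and> (transv i j a \<circ> g) (uvec v) u = poly p t / poly f t ^ k
      \<and> (transv i j a0 \<circ> e0) (uvec v) u = poly p 0 / poly f 0 ^ k" for u v
  proof (cases "u = i")
    case False
    then show ?thesis using e0(2) by (simp add: transv_def)
  next
    case True
    obtain p k where p: "pol B p" "g (uvec v) i = poly p t / poly f t ^ k" "e0 (uvec v) i = poly p 0 / poly f 0 ^ k"
      using e0(2) by blast
    obtain q l where q: "pol B q" "g (uvec v) j = poly q t / poly f t ^ l" "e0 (uvec v) j = poly q 0 / poly f 0 ^ l"
      using e0(2) by blast
    define P where "P = p * f ^ (m + l) + r * q * f ^ k"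
    have pw: "pol B (f ^ n)" for n by (induction n) (auto intro: pol_1[OF B] pol_mult[OF B] f)
    have "pol B P" unfolding P_def by (intro pol_add[OF B] pol_mult[OF B] pw p q r)
    moreover have "poly p x / poly f x ^ k + poly r x / poly f x ^ m * (poly q x / poly f x ^ l)
        = poly P x / poly f x ^ (k + m + l)" if "poly f x \<noteq> 0" for x
      using that by (simp add: P_def power_add field_simps)
    ultimately show ?thesis using True p q r f(3,4)
      by (intro exI[of _ P] exI[of _ "k + m + l"]) (simp add: transv_def a0_def)
  qed
  ultimately show ?case by blast
qed

lemma isblk_pblk:
  assumes "isblk N R g" "\<And>i j. i < N \<Longrightarrow> j < N \<Longrightarrow> g (uvec j) i = poly (P i j) t"
  shows "g = pblk N P t"
proof (intro ext)
  fix f i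
  show "g f i = pblk N P t f i"
    using isblk_expand[OF assms(1), of i f] isblk_outside[OF assms(1), of i f] assms(2)
    by (cases "i < N") (simp_all add: pblk_def)
qed

lemma adj_block:
  assumes "is_subring B" "isblk N (adj B t) g"
  shows "\<exists>P. (\<forall>i j. pol B (P i j)) \<and> g = pblk N P t"
proof -
  have "\<forall>i j. \<exists>p. pol B p \<and> g (uvec j) i = poly p t"
    using isblk_entry[OF adj_subring[OF assms(1)] assms(2)] by (auto simp: adj_def)
  then obtain P where P: "\<forall>i j. pol B (P i j) \<and> g (uvec j) i = poly (P i j) t" by metis
  then have "g = pblk N P t" by (intro isblk_pblk[OF assms(2)]) blast
  with P show ?thesis by (intro exI[of _ P]) simp
qed

text \<open>The specialisation \<open>a(0)\<close> is elementary over \<open>B\<close>, and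
  \<open>a(0) a^-1\<close> is elementary by \<open>elem_of_patching\<close>; cancelling leaves
  \<open>a\<close>.\<close>

lemma elem_of_two_sided_patch:
  assumes B: "is_subring B" and t: "transc B t"
    and f: "pol B f" "inverse (poly f 0) \<in> B" "poly f 0 \<noteq> 0" "poly f t \<noteq> 0"
    and a: "a \<in> GLop (adj B t)" "a \<in> elem_ops (loc (adj B t) (poly f t))"
    and b: "b \<in> GLop (adj B (1 / t))" and e: "e \<in> elem_ops (loc (adj B t) t)" "a = e \<circ> b"
  shows "a \<in> elem_ops (adj B t)"
proof -
  note A = adj_subring[OF B, of t] and As = adj_subring[OF B, of "1 / t"]
  obtain N1 a' where a': "isblk N1 (adj B t) a" "isblk N1 (adj B t) a'" "a \<circ> a' = id" "a' \<circ> a = id"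
    using a by (auto simp: GLop_def)
  obtain N2 b' where b': "isblk N2 (adj B (1 / t)) b" "isblk N2 (adj B (1 / t)) b'" "b \<circ> b' = id" "b' \<circ> b = id"
    using b by (auto simp: GLop_def)
  obtain a0 where a0: "a0 \<in> elem_ops B" "\<forall>i j. \<exists>p k. pol B p \<and> a (uvec j) i = poly p t / poly f t ^ k \<and> a0 (uvec j) i = poly p 0 / poly f 0 ^ k"
    using elem_eval_0[OF B f a(2)] by blast
  obtain N3 where N3: "isblk N3 B a0" using isblk_elem[OF B a0(1)] by blast
  define N where "N = max N1 (max N2 N3)"
  have N: "isblk N (adj B t) a" "isblk N (adj B t) a'" "isblk N (adj B (1 / t)) b" "isblk N (adj B (1 / t)) b'" "isblk N B a0"
    using isblk_mono[OF A a'(1), of N] isblk_mono[OF A a'(2), of N] isblk_mono[OF As b'(1), of N]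
      isblk_mono[OF As b'(2), of N] isblk_mono[OF B N3, of N] by (auto simp: N_def)
  obtain P where P: "\<And>i j. pol B (P i j)" "a = pblk N P t" using adj_block[OF B N(1)] by blast
  obtain P' where P': "\<And>i j. pol B (P' i j)" "a' = pblk N P' t" using adj_block[OF B N(2)] by blast
  obtain S where S: "\<And>i j. pol B (S i j)" "b = pblk N S (1 / t)" using adj_block[OF B N(3)] by blast
  obtain S' where S': "\<And>i j. pol B (S' i j)" "b' = pblk N S' (1 / t)" using adj_block[OF B N(4)] by blast
  have main: "pblk N P 0 \<circ> pblk N P' t \<in> elem_ops (adj B t)"
    using elem_of_patching[where P = P and P' = P' and S = S and S' = S' and N = N, OF B t P(1) P'(1) S(1) S'(1)
      a'(3,4)[unfolded P(2) P'(2)] b'(3,4)[unfolded S(2) S'(2)] e(1) e(2)[unfolded P(2) S(2)]] .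
  have "a0 = pblk N P 0"
  proof (rule isblk_pblk[OF N(5)])
    fix i j assume ij: "i < N" "j < N"
    obtain p k where p: "pol B p" "a (uvec j) i = poly p t / poly f t ^ k" "a0 (uvec j) i = poly p 0 / poly f 0 ^ k"
      using a0(2) by blast
    have pw: "pol B (f ^ n)" for n by (induction n) (auto intro: pol_1[OF B] pol_mult[OF B] f)
    have "poly (P i j) t = poly p t / poly f t ^ k" using p(2) pblk_entry[OF ij, of P t] by (simp add: P(2))
    then have "poly (P i j * f ^ k) t = poly p t" using f(4) by simp
    then have "P i j * f ^ k = p" by (rule transc_eq[OF B t pol_mult[OF B P(1) pw] p(1)])
    then show "a0 (uvec j) i = poly (P i j) 0" using p(3) f(3) by auto
  qed
  then have p0: "pblk N P 0 \<in> elem_ops (adj B t)" using elem_mono[OF a0(1) adj_incl[OF B]] by simp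
  have "a' \<in> elem_ops (adj B t)" using elem_left_cancel[OF A p0 main] by (simp only: P'(2))
  moreover have "a' \<circ> a \<in> elem_ops (adj B t)" unfolding a'(4) by (rule elem_id)
  ultimately show ?thesis by (rule elem_left_cancel[OF A])
qed

text \<open>By induction the theorem holds over the field \<open>F(t)\<close>, hence after inverting some \<open>f \<in> F[t]\<close>;
  the denominator is then removed by patching along \<open>t\<close> and along \<open>t\<inverse>\<close>.\<close>
theorem K1_Laurent:
  assumes "is_subfield F" "indep F ts" "g \<in> GLop (Lau F ts)"
  shows "\<exists>e\<in>elem_ops (Lau F ts). \<exists>c\<in>F. \<exists>m\<in>mons ts. c \<noteq> 0 \<and> g = e \<circ> dg (c * m)"
  using assms
proof (induction ts arbitrary: F g)
  case Nil
  then obtain e c where "e \<in> elem_ops F" "c \<in> F" "c \<noteq> 0" "g = e \<circ> dg (c * 1)"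
    using GL_field[of F g] unfolding Lau.simps mult_1_right by blast
  then show ?case unfolding Lau.simps mons.simps by blast
next
  case (Cons t ts)
  have F: "is_subring F" using Cons(2) by (rule subfield_subring)
  have nz: "0 \<notin> set (t # ts)" by (rule indep_nz[OF F Cons(3)])
  then have t0: "t \<noteq> 0" and nz': "0 \<notin> set ts" by auto
  define B where "B = Lau F ts"
  have B: "is_subring B" "F \<subseteq> B" unfolding B_def using Lau_props[OF F nz'] by auto
  have tr: "transc B t" using Cons(3) by (simp add: B_def)
  note A = adj_subring[OF B(1), of t] and BA = adj_incl[OF B(1), of t] and tA = adj_gen[OF B(1), of t]
  let ?A = "adj B t" and ?R = "loc (adj B t) t" and ?F' = "ratf F t"
  have R: "is_subring ?R" by (rule loc_subring[OF A tA t0])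
  have LR: "Lau F (t # ts) = ?R" by (simp add: B_def)
  have F': "is_subfield ?F'" by (rule ratf_subfield[OF F])
  let ?R' = "Lau ?F' ts"
  have R': "is_subring ?R'" "?F' \<subseteq> ?R'" using Lau_props[OF subfield_subring[OF F'] nz'] by auto
  have "B \<subseteq> ?R'" unfolding B_def by (rule Lau_mono[OF ratf_incl[OF F]])
  moreover have "t \<in> ?R'" "inverse t \<in> ?R'" using R' ratf_gen[OF F, of t] F' by (auto simp: is_subfield_def)
  ultimately have RR': "?R \<subseteq> ?R'" using R' by (intro loc_least adj_least)
  have g: "g \<in> GLop ?R" using Cons(4) by (simp add: B_def)
  have ind: "indep ?F' ts" using Cons(3) by simp
  obtain e c m where e: "e \<in> elem_ops ?R'" "c \<in> ?F'" "m \<in> mons ts" "c \<noteq> 0" "g = e \<circ> dg (c * m)"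
    using Cons.IH[OF F' ind GLop_subset[OF g RR']] by blast
  have mB: "m \<noteq> 0" "m \<in> B" "inverse m \<in> B"
  proof -
    show "m \<noteq> 0" using mons_props(1)[OF nz' e(3)] .
    show "m \<in> B" "inverse m \<in> B"
      using mons_props(3)[OF nz' e(3) B(1)] mons_props(3)[OF nz' mons_props(2)[OF nz' e(3)] B(1)]
        Lau_props(3)[OF F nz'] by (auto simp: B_def)
  qed
  have mR: "m \<in> ?R" "inverse m \<in> ?R" using mB BA loc_incl[of ?A t] by auto
  have cm: "c * m \<in> ?R'" "c * m \<noteq> 0" using e mR mB RR' R' by (auto intro!: subring_mult)
  \<comment> \<open>\<open>c * m\<close> is the determinant of \<open>g\<close>, hence a unit of the
    Laurent ring over \<open>F\<close>. With \<open>Laurent_unit\<close> this pins down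
    \<open>c\<close>, which so far is only known to lie in \<open>F(t)\<close>.\<close>
  note u = GL_det_unit[OF R R'(1) RR' g e(5) e(1) cm]
  have "c = c * m * inverse m" "inverse c = inverse (c * m) * m" using mB e(4) by auto
  then have "c \<in> ?R" "inverse c \<in> ?R" using subring_mult[OF R u(1) mR(2)] subring_mult[OF R u(2) mR(1)] by metis+
  then obtain b k where b: "b \<in> F" "b \<noteq> 0" "c = b * t powi k"
    using Laurent_unit[OF B(1) Cons(2) B(2) tr e(2,4)] by blast
  have e_eq: "e = g \<circ> dg (inverse (c * m))"
  proof -
    have "g \<circ> dg (inverse (c * m)) = e \<circ> (dg (c * m) \<circ> dg (inverse (c * m)))" by (simp only: e(5) comp_assoc)
    also have "\<dots> = e" using cm(2) by (simp only: dg_mult right_inverse dg_1 comp_id simp_thms)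
    finally show ?thesis by simp
  qed
  have "dg (inverse (c * m)) \<in> GLop ?R" by (rule GLop_dg[OF R u(2,1) left_inverse[OF cm(2)]])
  then have eGL: "e \<in> GLop ?R" unfolding e_eq by (rule GLop_comp[OF R g])
  obtain f where f: "pol F f" "poly f t \<noteq> 0" "e \<in> elem_ops (loc ?A (poly f t))"
    using elem_denominator[OF F t0 nz' e(1)] unfolding B_def by blast
  \<comment> \<open>Since \<open>t\<close> is invertible anyway, only the factor \<open>f1\<close>
    of \<open>f\<close> prime to \<open>t\<close> is a true denominator; its constant term is
    nonzero, as patching requires.\<close>
  define j where "j = order 0 f"
  have "f \<noteq> 0" using f(2) by auto
  then obtain f1 where f1: "f = [:0, 1:] ^ j * f1" "\<not> [:0, 1:] dvd f1"
    using order_decomp[of f 0] by (auto simp: j_def)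
  have c1: "coeff f1 0 \<noteq> 0" using f1(2) by (simp add: poly_eq_0_iff_dvd[of f1 0, symmetric, simplified] poly_0_coeff_0)
  have ft: "poly f t = t ^ j * poly f1 t" by (simp add: f1(1))
  have f1t: "poly f1 t \<noteq> 0" using f(2) ft by auto
  have "f = monom 1 j * f1" using f1(1) by (simp add: monom_altdef)
  then have "coeff f (i + j) = coeff f1 i" for i by (simp add: coeff_monom_mult)
  then have "coeff f1 i \<in> F" for i using f(1) unfolding pol_def by (metis (no_types))
  then have f1F: "pol F f1" by (simp add: pol_def)
  have f1B: "pol B f1" using f1F B by (auto simp: pol_def)
  have invB: "inverse x \<in> B" if "x \<in> F" for x using Cons(2) B(2) that by (auto simp: is_subfield_def)
  have f1A: "poly f1 t \<in> ?A" by (rule adjI[OF f1B])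
  let ?h = "t * poly f1 t"
  have hA: "?h \<in> ?A" "?h \<noteq> 0" using subring_mult[OF A tA f1A] t0 f1t by auto
  note L = loc_subring[OF A hA]
  have "inverse (poly f t) = (t * poly f1 t ^ j) / ?h ^ (j + 1)"
    using t0 f1t by (simp add: ft power_mult_distrib field_simps)
  moreover have "(t * poly f1 t ^ j) / ?h ^ (j + 1) \<in> loc ?A ?h" using A tA f1A by (intro locI subring_mult subring_power)
  ultimately have "loc ?A (poly f t) \<subseteq> loc ?A ?h" by (intro loc_least[OF L loc_incl]) simp
  then have e2: "e \<in> elem_ops (loc ?A ?h)" by (rule elem_mono[OF f(3)])
  obtain e1 a where a: "e1 \<in> elem_ops ?R" "a \<in> GLop ?A" "a \<in> elem_ops (loc ?A (poly f1 t))" "e = e1 \<circ> a"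
    using patch_split[OF B(1) t0 f1B c1 _ f1t eGL e2] invB f1F by (auto simp: pol_def)
  \<comment> \<open>The same splitting at the other end, with the reversed polynomial as
    denominator, gives \<open>e = e1' b'\<close> with \<open>b'\<close> over B[1/t]. Thus
    \<open>a\<close> and \<open>b'\<close> differ by an elementary matrix over B[t, 1/t], which is
    the situation of \<open>elem_of_two_sided_patch\<close>.\<close>
  define s where "s = 1 / t"
  have s0: "s \<noteq> 0" and ts: "t = 1 / s" using t0 by (auto simp: s_def)
  define f2 where "f2 = reflect_poly f1"
  have "f1 \<noteq> 0" using f1t by auto
  have f2: "pol F f2" "coeff f2 0 \<noteq> 0" using pol_reflect[OF F f1F] \<open>f1 \<noteq> 0\<close> by (auto simp: f2_def)
  then have f2B: "pol B f2" using B by (auto simp: pol_def)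
  have f2s: "poly f2 s = s ^ degree f1 * poly f1 t"
    unfolding f2_def using poly_reflect_poly_nz[OF s0, of f1] by (simp add: ts inverse_eq_divide)
  have f2s0: "poly f2 s \<noteq> 0" using f2s s0 f1t by simp
  let ?As = "adj B s"
  note As = adj_subring[OF B(1), of s] and sAs = adj_gen[OF B(1), of s] and BAs = adj_incl[OF B(1), of s]
  note Rs = loc_subring[OF As sAs s0]
  have inv_s: "inverse s = t" "inverse t = s" using t0 by (auto simp: s_def field_simps)
  have R1: "?R \<subseteq> loc ?As s"
    using BAs loc_incl[of ?As s] sAs loc_self_inverse[OF As, of s]
    by (intro loc_least[OF Rs] adj_least[OF Rs]) (auto simp: inv_s)
  have R2: "loc ?As s \<subseteq> ?R"
    using BA loc_incl[of ?A t] tA loc_self_inverse[OF A, of t]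
    by (intro loc_least[OF R] adj_least[OF R]) (auto simp: inv_s)
  let ?hs = "s * poly f2 s"
  have f2A: "poly f2 s \<in> ?As" by (rule adjI[OF f2B])
  have hsA: "?hs \<in> ?As" "?hs \<noteq> 0" using subring_mult[OF As sAs f2A] s0 f2s0 by auto
  note Ls = loc_subring[OF As hsA]
  have AsL: "?As \<subseteq> loc ?As ?hs" by (rule loc_incl)
  have tL: "t \<in> loc ?As ?hs"
  proof -
    have "t = poly f2 s / ?hs ^ 1" using s0 f2s0 by (simp add: ts)
    moreover have "poly f2 s / ?hs ^ 1 \<in> loc ?As ?hs" by (rule locI[OF f2A])
    ultimately show ?thesis by (simp only:)
  qed
  have "inverse ?h \<in> loc ?As ?hs"
  proof -
    have "inverse ?h = (s ^ (degree f1 + 2)) / ?hs ^ 1"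
      using s0 f1t t0 by (simp add: f2s ts field_simps)
    moreover have "(s ^ (degree f1 + 2)) / ?hs ^ 1 \<in> loc ?As ?hs" by (intro locI subring_power[OF As sAs])
    ultimately show ?thesis by (simp only:)
  qed
  then have "loc ?A ?h \<subseteq> loc ?As ?hs"
    using BAs AsL tL by (intro loc_least[OF Ls] adj_least[OF Ls]) auto
  then have e3: "e \<in> elem_ops (loc ?As ?hs)" by (rule elem_mono[OF e2])
  obtain e1' b' where b': "e1' \<in> elem_ops (loc ?As s)" "b' \<in> GLop ?As" "e = e1' \<circ> b'"
    using patch_split[OF B(1) s0 f2B f2(2) _ f2s0 GLop_subset[OF eGL R1] e3] invB f2 by (auto simp: pol_def)
  obtain d where d: "d \<in> elem_ops ?R" "d \<circ> e1 = id" using elem_inverse[OF R a(1)] by blast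
  have "a = (d \<circ> e1) \<circ> a" by (simp only: d id_comp)
  also have "\<dots> = d \<circ> (e1' \<circ> b')" by (simp only: a(4)[symmetric] b'(3)[symmetric] comp_assoc)
  finally have ab: "a = (d \<circ> e1') \<circ> b'" by (simp only: comp_assoc)
  have de: "d \<circ> e1' \<in> elem_ops ?R" by (rule elem_comp[OF d(1) elem_mono[OF b'(1) R2]])
  have "coeff f1 0 \<in> F" using f1F by (simp add: pol_def)
  then have "a \<in> elem_ops ?A"
    using elem_of_two_sided_patch[OF B(1) tr f1B _ _ f1t a(2,3) _ de ab] invB c1 b'(2)
    by (simp add: poly_0_coeff_0 s_def)
  then have "e \<in> elem_ops ?R" unfolding a(4) by (intro elem_comp[OF a(1)] elem_mono[OF _ loc_incl])
  moreover have "t powi k * m \<in> mons (t # ts)" using e(3) by auto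
  moreover have "g = e \<circ> dg (b * (t powi k * m))" using e(5) by (simp only: b(3) mult.assoc)
  ultimately show ?case using b(1,2) unfolding LR by blast
qed

subsection \<open>Independent variables over the ground field\<close>

type_synonym 'k ratfun = "((nat \<Rightarrow>\<^sub>0 nat) \<Rightarrow>\<^sub>0 'k) fract"

definition emb :: "'k::field \<Rightarrow> 'k ratfun" where
  "emb c = to_fract (Poly_Mapping.single 0 c)"

definition Xv :: "nat \<Rightarrow> 'k::field ratfun" where
  "Xv k = to_fract (Poly_Mapping.single (Poly_Mapping.single k 1) 1)"

lemma single_eq_0: "Poly_Mapping.single e c = 0 \<longleftrightarrow> c = 0"
  by (metis lookup_single_eq lookup_zero single_zero)

lemma emb_mult: "emb (a * b) = emb a * emb b"
  by (simp add: emb_def mult_single flip: to_fract_mult)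

lemma emb_0: "emb 0 = 0" and emb_1: "emb 1 = 1" and emb_add: "emb (a + b) = emb a + emb b"
  and emb_uminus: "emb (- a) = - emb a"
  and emb_eq_0: "emb a = 0 \<longleftrightarrow> a = 0"
  by (simp_all add: emb_def single_add single_uminus single_eq_0)

lemma emb_inverse: "emb (inverse a) = inverse (emb a)"
proof (cases "a = 0")
  case False
  then have "emb a * emb (inverse a) = 1" by (simp add: emb_1 flip: emb_mult)
  then show ?thesis by (metis inverse_unique)
qed (simp add: emb_0)

lemma emb_subfield: "is_subfield (range emb)"
  unfolding is_subfield_def is_subring_def
  using emb_0 emb_1 by (auto simp flip: emb_add emb_mult emb_uminus emb_inverse intro: rev_image_eqI)

lemma Xv_power: "Xv k ^ i = to_fract (Poly_Mapping.single (Poly_Mapping.single k i) 1)"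
  by (induction i) (simp_all add: Xv_def mult_single single_add[symmetric] flip: to_fract_mult)

lemma Xv_nz: "Xv k \<noteq> (0 :: 'k::field ratfun)"
  by (simp add: Xv_def single_eq_0)

lemma sum_monomials:
  fixes p :: "'a \<Rightarrow>\<^sub>0 'b::comm_monoid_add"
  shows "p = (\<Sum>e\<in>Poly_Mapping.keys p. Poly_Mapping.single e (Poly_Mapping.lookup p e))"
proof (rule poly_mapping_eqI)
  fix k
  have "(\<Sum>e\<in>Poly_Mapping.keys p. Poly_Mapping.lookup p e when e = k) = Poly_Mapping.lookup p k"
    by (simp add: when_def in_keys_iff)
  then show "Poly_Mapping.lookup p k
     = Poly_Mapping.lookup (\<Sum>e\<in>Poly_Mapping.keys p. Poly_Mapping.single e (Poly_Mapping.lookup p e)) k"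
    by (simp add: lookup_sum lookup_single)
qed

definition free_of :: "nat \<Rightarrow> ((nat \<Rightarrow>\<^sub>0 nat) \<Rightarrow>\<^sub>0 'k::field) \<Rightarrow> bool" where
  "free_of k p \<longleftrightarrow> (\<forall>e\<in>Poly_Mapping.keys p. Poly_Mapping.lookup e k = 0)"

lemma free_of_add: "free_of k p \<Longrightarrow> free_of k q \<Longrightarrow> free_of k (p + q)"
  unfolding free_of_def using keys_add[of p q] by blast

lemma free_of_mult: "free_of k p \<Longrightarrow> free_of k q \<Longrightarrow> free_of k (p * q)"
  unfolding free_of_def using keys_mult[of p q] by (fastforce simp: lookup_add)

lemma free_of_uminus: "free_of k p \<Longrightarrow> free_of k (- p)"
  by (simp add: free_of_def)

lemma free_of_single: "Poly_Mapping.lookup e k = 0 \<Longrightarrow> free_of k (Poly_Mapping.single e c)"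
  by (simp add: free_of_def)

lemma free_of_prod: "(\<And>i. i \<in> A \<Longrightarrow> free_of k (f i)) \<Longrightarrow> free_of k (prod f A)"
  by (induction A rule: infinite_finite_induct)
    (auto intro: free_of_mult simp flip: single_one intro!: free_of_single)

lemma free_of_sum_zero:
  fixes p :: "nat \<Rightarrow> ((nat \<Rightarrow>\<^sub>0 nat) \<Rightarrow>\<^sub>0 'k::field)"
  assumes p: "\<And>i. i \<le> n \<Longrightarrow> free_of k (p i)"
    and z: "(\<Sum>i\<le>n. p i * Poly_Mapping.single (Poly_Mapping.single k i) 1) = 0" and i: "i0 \<le> n"
  shows "p i0 = 0"
proof (rule poly_mapping_eqI)
  fix e0
  show "Poly_Mapping.lookup (p i0) e0 = Poly_Mapping.lookup 0 e0"
  proof (cases "e0 \<in> Poly_Mapping.keys (p i0)")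
    case True
    have pe: "p i * Poly_Mapping.single (Poly_Mapping.single k i) 1
       = (\<Sum>e\<in>Poly_Mapping.keys (p i). Poly_Mapping.single (e + Poly_Mapping.single k i) (Poly_Mapping.lookup (p i) e))" for i
      by (subst (1) sum_monomials[of "p i"]) (simp add: sum_distrib_right mult_single)
    have key: "e + Poly_Mapping.single k i = e0 + Poly_Mapping.single k i0 \<longleftrightarrow> e = e0 \<and> i = i0"
      if "i \<le> n" "e \<in> Poly_Mapping.keys (p i)" for i e
    proof
      assume eq: "e + Poly_Mapping.single k i = e0 + Poly_Mapping.single k i0"
      have "Poly_Mapping.lookup e k + i = Poly_Mapping.lookup e0 k + i0"
        using arg_cong[OF eq, of "\<lambda>m. Poly_Mapping.lookup m k"] by (simp add: lookup_add)
      then have "i = i0" using p[OF that(1)] p[OF i] that(2) True by (simp add: free_of_def)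
      then show "e = e0 \<and> i = i0" using eq by simp
    qed simp
    have "0 = (\<Sum>i\<le>n. \<Sum>e\<in>Poly_Mapping.keys (p i).
        Poly_Mapping.lookup (p i) e when e + Poly_Mapping.single k i = e0 + Poly_Mapping.single k i0)"
      using arg_cong[OF z, of "\<lambda>m. Poly_Mapping.lookup m (e0 + Poly_Mapping.single k i0)"]
      by (simp add: pe lookup_sum lookup_single)
    also have "\<dots> = (\<Sum>i\<le>n. \<Sum>e\<in>Poly_Mapping.keys (p i). if i = i0 then (if e = e0 then Poly_Mapping.lookup (p i) e else 0) else 0)"
      using key by (intro sum.cong) (auto simp: when_def)
    also have "\<dots> = (\<Sum>i\<le>n. if i = i0 then Poly_Mapping.lookup (p i0) e0 else 0)"
      using True by (intro sum.cong) auto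
    also have "\<dots> = Poly_Mapping.lookup (p i0) e0" using i by simp
    finally show ?thesis by simp
  qed (simp add: in_keys_iff)
qed

text \<open>A subfield that contains the Laurent ring in all variables but \<open>k\<close>. Proving
  \<open>Xv k\<close> transcendental over it settles every instance of \<open>indep\<close> at
  once.\<close>

definition Kwo :: "nat \<Rightarrow> 'k::field ratfun set" where
  "Kwo k = {to_fract p / to_fract q | p q. free_of k p \<and> free_of k q \<and> q \<noteq> 0}"

lemma KwoI: "free_of k p \<Longrightarrow> free_of k q \<Longrightarrow> q \<noteq> 0 \<Longrightarrow> to_fract p / to_fract q \<in> Kwo k"
  by (auto simp: Kwo_def)

lemma free_of_1: "free_of k 1" and free_of_0: "free_of k 0"
  by (simp_all add: free_of_def)

lemma Kwo_subfield: "is_subfield (Kwo k :: 'k::field ratfun set)"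
  unfolding is_subfield_def is_subring_def
proof (intro conjI ballI)
  show "(0 :: 'k ratfun) \<in> Kwo k" "(1 :: 'k ratfun) \<in> Kwo k"
    using KwoI[OF free_of_0 free_of_1, of k] KwoI[OF free_of_1 free_of_1, of k] by simp_all
next
  fix a b :: "'k ratfun" assume "a \<in> Kwo k" "b \<in> Kwo k"
  then obtain p q p' q' where h: "a = to_fract p / to_fract q" "b = to_fract p' / to_fract q'"
    "free_of k p" "free_of k q" "free_of k p'" "free_of k q'" "q \<noteq> 0" "q' \<noteq> 0" unfolding Kwo_def by blast
  have "a + b = to_fract (p * q' + p' * q) / to_fract (q * q')" "a * b = to_fract (p * p') / to_fract (q * q')"
    unfolding h(1,2) using h(7,8) by (simp_all add: field_simps)
  moreover have "to_fract (p * q' + p' * q) / to_fract (q * q') \<in> Kwo k" "to_fract (p * p') / to_fract (q * q') \<in> Kwo k"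
    using h(7,8) by (intro KwoI free_of_add free_of_mult h(3-6); simp)+
  ultimately show "a + b \<in> Kwo k" "a * b \<in> Kwo k" by (simp_all only:)
next
  fix a :: "'k ratfun" assume "a \<in> Kwo k"
  then obtain p q where h: "a = to_fract p / to_fract q" "free_of k p" "free_of k q" "q \<noteq> 0"
    unfolding Kwo_def by blast
  then show "- a \<in> Kwo k" using KwoI[OF free_of_uminus[OF h(2)] h(3,4)] by simp
  show "inverse a \<in> Kwo k"
  proof (cases "p = 0")
    case True
    then show ?thesis using KwoI[OF free_of_0 free_of_1, of k] h by simp
  next
    case False
    then show ?thesis using KwoI[of k q p] h by simp
  qed
qed

lemma emb_Kwo: "range emb \<subseteq> Kwo k"
proof
  fix a assume "a \<in> range emb"
  then obtain c where "a = emb c" by blast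
  then show "a \<in> Kwo k" using KwoI[OF free_of_single[of 0 k c] free_of_1] by (simp add: emb_def)
qed

lemma Xv_Kwo: "j \<noteq> k \<Longrightarrow> Xv j \<in> Kwo k"
  using KwoI[OF free_of_single[of "Poly_Mapping.single j 1" k 1] free_of_1]
  by (simp add: Xv_def lookup_single when_def)

text \<open>After clearing denominators the coefficients are polynomials free of \<open>k\<close>,
  and the exponent of \<open>k\<close> then separates the summands
  (\<open>free_of_sum_zero\<close>).\<close>

lemma transc_Xv: "transc (Kwo k :: 'k::field ratfun set) (Xv k)"
  unfolding transc_def
proof (intro allI impI)
  fix P :: "'k ratfun poly" assume P: "pol (Kwo k) P" "poly P (Xv k) = 0"
  have "\<forall>i. \<exists>p q. coeff P i = to_fract p / to_fract q \<and> free_of k p \<and> free_of k q \<and> q \<noteq> 0"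
    using P(1) unfolding pol_def Kwo_def by blast
  then obtain p q where pq: "\<And>i. coeff P i = to_fract (p i) / to_fract (q i)" "\<And>i. free_of k (p i)"
    "\<And>i. free_of k (q i)" "\<And>i. q i \<noteq> 0" by metis
  let ?n = "degree P"
  define r where "r = (\<lambda>i. p i * (\<Prod>j\<in>{..?n} - {i}. q j))"
  have fr: "free_of k (r i)" for i unfolding r_def by (intro free_of_mult free_of_prod pq)
  have to_fract_prod: "to_fract (prod f A) = (\<Prod>x\<in>A. to_fract (f x))"
    for f :: "nat \<Rightarrow> ((nat \<Rightarrow>\<^sub>0 nat) \<Rightarrow>\<^sub>0 'k)" and A
    by (induction A rule: infinite_finite_induct) simp_all
  have "to_fract (r i * Poly_Mapping.single (Poly_Mapping.single k i) 1)
      = (\<Prod>j\<le>?n. to_fract (q j)) * (coeff P i * Xv k ^ i)" if "i \<le> ?n" for i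
  proof -
    have "(\<Prod>j\<le>?n. to_fract (q j)) = to_fract (q i) * (\<Prod>j\<in>{..?n} - {i}. to_fract (q j))"
      using that by (intro prod.remove) auto
    then show ?thesis using pq(4)[of i] by (simp add: r_def to_fract_prod pq(1) Xv_power)
  qed
  then have "to_fract (\<Sum>i\<le>?n. r i * Poly_Mapping.single (Poly_Mapping.single k i) 1)
      = (\<Sum>i\<le>?n. (\<Prod>j\<le>?n. to_fract (q j)) * (coeff P i * Xv k ^ i))"
    unfolding to_fract_sum by (intro sum.cong) auto
  also have "\<dots> = (\<Prod>j\<le>?n. to_fract (q j)) * poly P (Xv k)"
    by (simp add: poly_altdef sum_distrib_left)
  also have "\<dots> = 0" using P(2) by simp
  finally have "(\<Sum>i\<le>?n. r i * Poly_Mapping.single (Poly_Mapping.single k i) 1) = 0" by (simp only: to_fract_eq_0_iff)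
  from free_of_sum_zero[OF fr this, of ?n] have "r ?n = 0" by simp
  then have "p ?n = 0" using pq(4) by (simp add: r_def)
  then have "coeff P ?n = 0" by (simp add: pq(1))
  then show "P = 0" by simp
qed

lemma transc_mono: "transc B' t \<Longrightarrow> B \<subseteq> B' \<Longrightarrow> transc B t"
  unfolding transc_def pol_def by blast

lemma ratf_least:
  assumes "is_subfield L" "F \<subseteq> L" "t \<in> L"
  shows "ratf F t \<subseteq> L"
proof
  fix a assume "a \<in> ratf F t"
  then obtain p q where a: "a = poly p t / poly q t" "pol F p" "pol F q" unfolding ratf_def by blast
  have "poly p t \<in> L" "poly q t \<in> L"
    using a(2,3) assms by (auto simp: pol_def intro!: poly_sum_coeffs_mem[OF subfield_subring])
  then show "a \<in> L" unfolding a(1) by (rule subfield_divide[OF assms(1)])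
qed

text \<open>The base field grows in the induction, so it is only assumed to avoid the variables that
  are still to come.\<close>

lemma indep_Xv:
  "is_subring F \<Longrightarrow> distinct ks \<Longrightarrow> (\<And>k. k \<in> set ks \<Longrightarrow> F \<subseteq> Kwo k) \<Longrightarrow> indep F (map Xv ks)"
proof (induction ks arbitrary: F)
  case (Cons k ks)
  have "Lau F (map Xv ks) \<subseteq> Kwo k"
  proof (rule Lau_least)
    show "is_subring (Kwo k)" using Kwo_subfield by (rule subfield_subring)
    show "F \<subseteq> Kwo k" using Cons(4) by simp
    fix u :: "'a ratfun" assume "u \<in> set (map Xv ks)"
    then obtain j where "u = Xv j" "j \<noteq> k" using Cons(3) by auto
    then have "u \<in> Kwo k" by (simp add: Xv_Kwo)
    then show "u \<in> Kwo k \<and> inverse u \<in> Kwo k" using Kwo_subfield[of k] unfolding is_subfield_def by blast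
  qed
  then have 1: "transc (Lau F (map Xv ks)) (Xv k)" by (rule transc_mono[OF transc_Xv])
  have 2: "indep (ratf F (Xv k)) (map Xv ks)"
  proof (rule Cons.IH)
    show "is_subring (ratf F (Xv k))" by (rule subfield_subring[OF ratf_subfield[OF Cons(2)]])
    show "distinct ks" using Cons(3) by simp
    show "ratf F (Xv k) \<subseteq> Kwo j" if "j \<in> set ks" for j
      using Cons(3,4) that by (intro ratf_least Kwo_subfield Xv_Kwo) auto
  qed
  show ?case using 1 2 by simp
qed simp

lemma Xv_monomials_indep:
  fixes c :: "(nat \<Rightarrow> nat) \<Rightarrow> 'k::field"
  assumes T: "finite T" and E: "finite E" "\<And>e k. e \<in> E \<Longrightarrow> k \<notin> T \<Longrightarrow> e k = 0"
    and z: "(\<Sum>e\<in>E. emb (c e) * (\<Prod>k\<in>T. Xv k ^ e k)) = 0" and e: "e0 \<in> E"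
  shows "c e0 = 0"
proof -
  define m where "m = (\<lambda>e :: nat \<Rightarrow> nat. \<Sum>k\<in>T. Poly_Mapping.single k (e k))"
  have lm: "Poly_Mapping.lookup (m e) k = (if k \<in> T then e k else 0)" for e k
    using T by (simp add: m_def lookup_sum lookup_single when_def)
  have inj: "m e = m e' \<longleftrightarrow> e = e'" if "e \<in> E" "e' \<in> E" for e e'
  proof
    assume "m e = m e'"
    then have "e k = e' k" for k using lm[of e k] lm[of e' k] E(2)[OF that(1), of k] E(2)[OF that(2), of k]
      by (cases "k \<in> T") auto
    then show "e = e'" by auto
  qed simp
  have pr: "(\<Prod>k\<in>S. to_fract (Poly_Mapping.single (Poly_Mapping.single k (e k)) (1 :: 'k)))
     = to_fract (Poly_Mapping.single (\<Sum>k\<in>S. Poly_Mapping.single k (e k)) 1)" if "finite S" for e :: "nat \<Rightarrow> nat" and S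
    using that by (induction S rule: finite_induct) (simp_all add: mult_single flip: to_fract_mult)
  have "to_fract (\<Sum>e\<in>E. Poly_Mapping.single (m e) (c e)) = (\<Sum>e\<in>E. emb (c e) * (\<Prod>k\<in>T. Xv k ^ e k))"
    unfolding to_fract_sum Xv_power pr[OF T] emb_def m_def
    by (simp add: mult_single flip: to_fract_mult)
  then have "(\<Sum>e\<in>E. Poly_Mapping.single (m e) (c e)) = 0" using z by (simp only: to_fract_eq_0_iff)
  then have "Poly_Mapping.lookup (\<Sum>e\<in>E. Poly_Mapping.single (m e) (c e)) (m e0) = 0" by simp
  then have "(\<Sum>e\<in>E. c e when m e = m e0) = 0" unfolding lookup_sum lookup_single .
  moreover have "(\<Sum>e\<in>E. c e when m e = m e0) = (\<Sum>e\<in>E. if e = e0 then c e else 0)"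
    using inj e by (intro sum.cong) (auto simp: when_def)
  ultimately show ?thesis using E(1) e by simp
qed

subsection \<open>A spanning set of the Jacobson algebra and its ideals\<close>

text \<open>\<open>Gop I p q\<close> is the element \<open>x\<^sup>p e\<^sub>I y\<^sup>q\<close> of the algebra.\<close>
definition Gop :: "nat set \<Rightarrow> (nat \<Rightarrow> nat) \<Rightarrow> (nat \<Rightarrow> nat) \<Rightarrow> 'k::field kop" where
  "Gop I p q f a = (if (\<forall>i\<in>I. a i = p i) \<and> (\<forall>k. p k \<le> a k) then f (\<lambda>k. a k - p k + q k) else 0)"

lemma linear_Gop: "linear_op (Gop I p q)"
  by (auto simp: linear_op_def Gop_def fun_eq_iff)

text \<open>Because of \<open>y x = 1\<close> the middle part \<open>y^q x^p'\<close> cancels to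
  \<open>x^(p' - q) y^(q - p')\<close> with truncated differences. An \<open>e_i\<close> kills a
  surviving \<open>x_i\<close> to its right and a surviving \<open>y_i\<close> to its left, which
  gives the conditions on \<open>I\<close> and on \<open>I'\<close>.\<close>

lemma Gop_comp:
  "Gop I p q \<circ> Gop I' p' q' =
    (if (\<forall>i\<in>I. p' i \<le> q i) \<and> (\<forall>i\<in>I'. q i \<le> p' i)
     then Gop (I \<union> I') (\<lambda>k. p k + (p' k - q k)) (\<lambda>k. q' k + (q k - p' k)) else opzero)"
proof (intro ext)
  fix f :: "(nat \<Rightarrow> nat) \<Rightarrow> 'a" and a :: "nat \<Rightarrow> nat"
  let ?b = "\<lambda>k. a k - p k + q k"
  let ?c1 = "(\<forall>i\<in>I. a i = p i) \<and> (\<forall>k. p k \<le> a k)"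
  let ?c2 = "(\<forall>i\<in>I'. ?b i = p' i) \<and> (\<forall>k. p' k \<le> ?b k)"
  let ?d = "(\<forall>i\<in>I. p' i \<le> q i) \<and> (\<forall>i\<in>I'. q i \<le> p' i)"
  let ?e = "(\<forall>i\<in>I \<union> I'. a i = p i + (p' i - q i)) \<and> (\<forall>k. p k + (p' k - q k) \<le> a k)"
  have iff: "?c1 \<and> ?c2 \<longleftrightarrow> ?d \<and> ?e"
  proof
    assume h: "?c1 \<and> ?c2"
    have "p' i \<le> q i" if "i \<in> I" for i using h that by (metis diff_self_eq_0 add_0)
    moreover have "q i \<le> p' i" if "i \<in> I'" for i using h that by (metis le_add2)
    moreover have "a i = p i + (p' i - q i)" if "i \<in> I \<union> I'" for i
    proof (cases "i \<in> I")
      case True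
      then show ?thesis using h \<open>\<And>i. i \<in> I \<Longrightarrow> p' i \<le> q i\<close>[OF True] by simp
    next
      case False
      then have "a i - p i + q i = p' i" "p i \<le> a i" using h that by auto
      then show ?thesis by linarith
    qed
    moreover have "p k + (p' k - q k) \<le> a k" for k
    proof -
      have "p k \<le> a k" "p' k \<le> a k - p k + q k" using h by auto
      then show ?thesis by linarith
    qed
    ultimately show "?d \<and> ?e" by blast
  next
    assume h: "?d \<and> ?e"
    have 1: "p k \<le> a k" "p' k \<le> a k - p k + q k" for k
    proof -
      have "p k + (p' k - q k) \<le> a k" using h by blast
      then show "p k \<le> a k" "p' k \<le> a k - p k + q k" by linarith+
    qed
    moreover have "a i = p i" if "i \<in> I" for i using h that by auto
    moreover have "?b i = p' i" if "i \<in> I'" for i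
    proof -
      have "a i = p i + (p' i - q i)" "q i \<le> p' i" using h that by auto
      then show ?thesis by linarith
    qed
    ultimately show "?c1 \<and> ?c2" by blast
  qed
  have val: "(\<lambda>k. ?b k - p' k + q' k) = (\<lambda>k. a k - (p k + (p' k - q k)) + (q' k + (q k - p' k)))" if "?c1 \<and> ?c2"
  proof
    fix k
    have "p k \<le> a k" "p' k \<le> a k - p k + q k" using that by auto
    then show "?b k - p' k + q' k = a k - (p k + (p' k - q k)) + (q' k + (q k - p' k))" by linarith
  qed
  have "(Gop I p q \<circ> Gop I' p' q') f a = (if ?c1 \<and> ?c2 then f (\<lambda>k. ?b k - p' k + q' k) else 0)"
    unfolding comp_apply Gop_def by (simp only: if_if_eq_conj[symmetric] split: if_split)
  also have "\<dots> = (if ?d \<and> ?e then f (\<lambda>k. a k - (p k + (p' k - q k)) + (q' k + (q k - p' k))) else 0)"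
    using iff val by (auto simp del: Un_iff)
  finally have eq: "(Gop I p q \<circ> Gop I' p' q') f a = (if ?d \<and> ?e then f (\<lambda>k. a k - (p k + (p' k - q k)) + (q' k + (q k - p' k))) else 0)" .
  show "(Gop I p q \<circ> Gop I' p' q') f a = (if ?d
     then Gop (I \<union> I') (\<lambda>k. p k + (p' k - q k)) (\<lambda>k. q' k + (q k - p' k)) else opzero) f a"
  proof (cases ?d)
    case True
    show ?thesis unfolding eq if_P[OF True] Gop_def
      by (rule if_cong) (use True in blast, rule refl, rule refl)
  next
    case False
    then have "\<not> (?d \<and> ?e)" by blast
    then show ?thesis unfolding eq if_not_P[OF False] opzero_def by (rule if_not_P)
  qed
qed

section \<open>Linear spans of the elements \<open>x^p e_I y^q\<close>\<close>

inductive_set sp :: "'k::field kop set \<Rightarrow> 'k kop set" for \<Gamma> where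
  sp_zero: "opzero \<in> sp \<Gamma>"
| sp_add: "g \<in> \<Gamma> \<Longrightarrow> A \<in> sp \<Gamma> \<Longrightarrow> opadd (opsmul c g) A \<in> sp \<Gamma>"

lemma op_simps:
  "opadd opzero A = A" "opadd A opzero = A" "opsmul 1 A = A" "opsmul c opzero = opzero" "opsmul 0 A = opzero"
  "opadd (opadd A B) C = opadd A (opadd B C)" "opsmul c (opadd A B) = opadd (opsmul c A) (opsmul c B)"
  "opsmul c (opsmul d A) = opsmul (c * d) A" "opsub A B = opadd A (opsmul (- 1) B)"
  by (auto simp: opadd_def opzero_def opsmul_def opsub_def fun_eq_iff algebra_simps)

lemma op_comp_left:
  "opadd A B \<circ> C = opadd (A \<circ> C) (B \<circ> C)" "opsmul c A \<circ> C = opsmul c (A \<circ> C)" "opzero \<circ> C = opzero"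
  "opsub A B \<circ> C = opsub (A \<circ> C) (B \<circ> C)"
  by (auto simp: opadd_def opzero_def opsmul_def opsub_def fun_eq_iff)

lemma op_comp_right:
  assumes "linear_op C"
  shows "C \<circ> opadd A B = opadd (C \<circ> A) (C \<circ> B)" "C \<circ> opsmul c A = opsmul c (C \<circ> A)" "C \<circ> opzero = opzero"
  using linear_opD[OF assms] linear_op_0[OF assms]
  by (auto simp: opadd_def opzero_def opsmul_def fun_eq_iff)

lemma op_comp_right_sub:
  assumes "linear_op C"
  shows "C \<circ> opsub A B = opsub (C \<circ> A) (C \<circ> B)"
  by (simp only: op_simps(9) op_comp_right[OF assms])

lemma sp_base: "g \<in> \<Gamma> \<Longrightarrow> g \<in> sp \<Gamma>"
  using sp_add[OF _ sp_zero, of g \<Gamma> 1] by (simp add: op_simps)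

lemma sp_opadd: "A \<in> sp \<Gamma> \<Longrightarrow> B \<in> sp \<Gamma> \<Longrightarrow> opadd A B \<in> sp \<Gamma>"
  by (induction A rule: sp.induct) (simp_all add: op_simps(1,6) sp.sp_add)

lemma sp_opsmul: "A \<in> sp \<Gamma> \<Longrightarrow> opsmul c A \<in> sp \<Gamma>"
  by (induction A rule: sp.induct) (simp_all add: op_simps(4,7,8) sp.intros)

lemma sp_opsub: "A \<in> sp \<Gamma> \<Longrightarrow> B \<in> sp \<Gamma> \<Longrightarrow> opsub A B \<in> sp \<Gamma>"
  unfolding op_simps(9) by (intro sp_opadd sp_opsmul)

lemma sp_least:
  assumes "\<Gamma> \<subseteq> S" "opzero \<in> S" "\<And>A B. A \<in> S \<Longrightarrow> B \<in> S \<Longrightarrow> opadd A B \<in> S" "\<And>c A. A \<in> S \<Longrightarrow> opsmul c A \<in> S"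
  shows "sp \<Gamma> \<subseteq> S"
proof
  fix A assume "A \<in> sp \<Gamma>"
  then show "A \<in> S" by induction (use assms in auto)
qed

lemma sp_mono: "\<Gamma> \<subseteq> sp \<Delta> \<Longrightarrow> sp \<Gamma> \<subseteq> sp \<Delta>"
  by (intro sp_least sp_opadd sp_opsmul sp.sp_zero)

lemma linear_opadd: "linear_op A \<Longrightarrow> linear_op B \<Longrightarrow> linear_op (opadd A B)"
  and linear_opsmul: "linear_op A \<Longrightarrow> linear_op (opsmul c A)"
  and linear_opzero: "linear_op opzero"
  by (auto simp: linear_op_def opadd_def opsmul_def opzero_def fun_eq_iff algebra_simps)

lemma sp_comp:
  assumes lin: "\<And>g. g \<in> \<Gamma> \<Longrightarrow> linear_op g" and prod: "\<And>g h. g \<in> \<Gamma> \<Longrightarrow> h \<in> \<Delta> \<Longrightarrow> g \<circ> h \<in> sp \<Theta>"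
    and A: "A \<in> sp \<Gamma>" and B: "B \<in> sp \<Delta>"
  shows "A \<circ> B \<in> sp \<Theta>"
  using A
proof induction
  case sp_zero
  then show ?case by (simp only: op_comp_left sp.sp_zero)
next
  case (sp_add g A c)
  have "g \<circ> B \<in> sp \<Theta>"
    using B
  proof induction
    case sp_zero
    then show ?case by (simp only: op_comp_right[OF lin[OF sp_add(1)]] sp.sp_zero)
  next
    case (sp_add h B c)
    then show ?case using prod[OF \<open>g \<in> \<Gamma>\<close> sp_add(1)]
      by (simp only: op_comp_right[OF lin[OF \<open>g \<in> \<Gamma>\<close>]] sp_opadd sp_opsmul)
  qed
  then show ?case using sp_add by (simp only: op_comp_left sp_opadd sp_opsmul)
qed

definition supp_in :: "nat set \<Rightarrow> (nat \<Rightarrow> nat) \<Rightarrow> bool" where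
  "supp_in T p \<longleftrightarrow> (\<forall>k. k \<notin> T \<longrightarrow> p k = 0)"

text \<open>The family \<open>U\<close> encodes an ideal by the index sets allowed in its spanning
  elements: \<open>{I. i \<in> I}\<close> for \<open>p_i\<close>,
  \<open>{I'. I \<subseteq> I'}\<close> for \<open>p_I\<close>, \<open>{I. s \<le> card I}\<close>
  for \<open>a_s\<close>. The family \<open>{{}}\<close> spans the whole algebra.\<close>

definition Gens :: "nat set \<Rightarrow> nat set set \<Rightarrow> 'k::field kop set" where
  "Gens T U = {Gop I p q | I p q. I \<in> U \<and> I \<subseteq> T \<and> supp_in T p \<and> supp_in T q}"

lemma GensI: "I \<in> U \<Longrightarrow> I \<subseteq> T \<Longrightarrow> supp_in T p \<Longrightarrow> supp_in T q \<Longrightarrow> Gop I p q \<in> Gens T U"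
  by (auto simp: Gens_def)

lemma linear_Gens: "g \<in> Gens T U \<Longrightarrow> linear_op g"
  by (auto simp: Gens_def linear_Gop)

lemma linear_sp_Gens: "A \<in> sp (Gens T U) \<Longrightarrow> linear_op A"
  by (induction rule: sp.induct) (auto intro: linear_opzero linear_opadd linear_opsmul linear_Gens)

lemma Gens_comp:
  assumes "A \<in> sp (Gens T U)" "B \<in> sp (Gens T V)" "\<And>I J. I \<in> U \<Longrightarrow> J \<in> V \<Longrightarrow> I \<subseteq> T \<Longrightarrow> J \<subseteq> T \<Longrightarrow> I \<union> J \<in> W"
  shows "A \<circ> B \<in> sp (Gens T W)"
proof (rule sp_comp[OF linear_Gens _ assms(1,2)])
  fix g h :: "'a kop" assume "g \<in> Gens T U" "h \<in> Gens T V"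
  then obtain I p q J p' q' where gh: "g = Gop I p q" "h = Gop J p' q'" "I \<in> U" "I \<subseteq> T" "J \<in> V" "J \<subseteq> T"
    "supp_in T p" "supp_in T q" "supp_in T p'" "supp_in T q'" unfolding Gens_def by blast
  have "Gop (I \<union> J) (\<lambda>k. p k + (p' k - q k)) (\<lambda>k. q' k + (q k - p' k)) \<in> Gens T W"
    using gh assms(3) by (intro GensI) (auto simp: supp_in_def)
  then show "g \<circ> h \<in> sp (Gens T W)" unfolding gh(1,2) Gop_comp using sp_base sp.sp_zero by (auto split: if_split)
qed

lemma Gop_id: "Gop {} (\<lambda>_. 0) (\<lambda>_. 0) = id"
  by (auto simp: Gop_def fun_eq_iff)

lemma Gop_Xop: "Gop {} ((\<lambda>_. 0)(k := 1)) (\<lambda>_. 0) = Xop k"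
proof (intro ext)
  fix f :: "(nat \<Rightarrow> nat) \<Rightarrow> 'a" and a :: "nat \<Rightarrow> nat"
  have "(\<lambda>l. a l - ((\<lambda>_. 0)(k := 1)) l + 0) = a(k := a k - 1)" by (auto simp: fun_eq_iff)
  moreover have "(\<forall>l. ((\<lambda>_. 0)(k := 1)) l \<le> a l) \<longleftrightarrow> 0 < a k" by (auto simp: Suc_le_eq)
  ultimately show "Gop {} ((\<lambda>_. 0)(k := 1)) (\<lambda>_. 0) f a = Xop k f a"
    unfolding Gop_def Xop_def by (simp only: ball_simps simp_thms)
qed

lemma Gop_Yop: "Gop {} (\<lambda>_. 0) ((\<lambda>_. 0)(k := 1)) = Yop k"
proof (intro ext)
  fix f :: "(nat \<Rightarrow> nat) \<Rightarrow> 'a" and a :: "nat \<Rightarrow> nat"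
  have "(\<lambda>l. a l - 0 + ((\<lambda>_. 0)(k := 1)) l) = a(k := Suc (a k))" by (auto simp: fun_eq_iff)
  then show "Gop {} (\<lambda>_. 0) ((\<lambda>_. 0)(k := 1)) f a = Yop k f a"
    unfolding Gop_def Yop_def by (simp only: ball_simps simp_thms le0 if_True)
qed

lemma Salg_sp: "A \<in> Salg T \<Longrightarrow> A \<in> sp (Gens T {{}})"
proof (induction rule: Salg.induct)
  case (scal c)
  have "id \<in> Gens T {{}}" using GensI[of "{}" "{{}}" T "\<lambda>_. 0" "\<lambda>_. 0"] unfolding Gop_id by (simp add: supp_in_def)
  then show ?case by (intro sp_opsmul sp_base)
next
  case (genX k)
  have "Gop {} ((\<lambda>_. 0)(k := 1)) (\<lambda>_. 0) \<in> Gens T {{}}" using genX by (intro GensI) (auto simp: supp_in_def)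
  then show ?case unfolding Gop_Xop by (rule sp_base)
next
  case (genY k)
  have "Gop {} (\<lambda>_. 0) ((\<lambda>_. 0)(k := 1)) \<in> Gens T {{}}" using genY by (intro GensI) (auto simp: supp_in_def)
  then show ?case unfolding Gop_Yop by (rule sp_base)
next
  case (add A B)
  then show ?case by (intro sp_opadd)
next
  case (mult A B)
  then show ?case by (elim Gens_comp) auto
qed

lemma linear_Salg: "A \<in> Salg T \<Longrightarrow> linear_op A"
  by (rule linear_sp_Gens[OF Salg_sp])

lemma Salg_id: "id \<in> Salg T"
  using Salg.scal[of 1 T] by (simp add: op_simps)

lemma Salg_opsmul: "A \<in> Salg T \<Longrightarrow> opsmul c A \<in> Salg T"
  using Salg.mult[OF Salg.scal[of c T], of A] by (simp add: op_comp_left)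

lemma Salg_opsub: "A \<in> Salg T \<Longrightarrow> B \<in> Salg T \<Longrightarrow> opsub A B \<in> Salg T"
  unfolding op_simps(9) by (intro Salg.add Salg_opsmul)

lemma Salg_opzero: "opzero \<in> Salg T"
  using Salg.scal[of 0 T] by (simp add: op_simps)

lemma Salg_mono: "A \<in> Salg T \<Longrightarrow> T \<subseteq> T' \<Longrightarrow> A \<in> Salg T'"
  by (induction rule: Salg.induct) (auto intro: Salg.intros)

lemma Gop_empty_Salg:
  assumes T: "finite T"
  shows "supp_in T p \<Longrightarrow> supp_in T q \<Longrightarrow> (Gop {} p q :: 'k::field kop) \<in> Salg T"
proof (induction "\<Sum>k\<in>T. p k + q k" arbitrary: p q rule: less_induct)
  case less
  show ?case
  proof (cases "\<exists>k\<in>T. 0 < p k \<or> 0 < q k")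
    case False
    then have "p = (\<lambda>_. 0)" "q = (\<lambda>_. 0)" using less(2,3) by (auto simp: supp_in_def fun_eq_iff)
    then show ?thesis using Gop_id Salg_id by metis
  next
    case True
    then obtain k where k: "k \<in> T" "0 < p k \<or> 0 < q k" by blast
    show ?thesis
    proof (cases "0 < p k")
      case True
      let ?p = "p(k := p k - 1)"
      have "(\<Sum>k\<in>T. ?p k + q k) < (\<Sum>k\<in>T. p k + q k)"
        using T k True by (intro sum_strict_mono_ex1) auto
      moreover have "supp_in T ?p" using less(2) by (auto simp: supp_in_def)
      ultimately have "(Gop {} ?p q :: 'k kop) \<in> Salg T" using less(1)[of ?p q] less(3) by blast
      moreover have "(Gop {} p q :: 'k kop) = Xop k \<circ> Gop {} ?p q"
      proof -
        have "(\<lambda>l. ((\<lambda>_. 0)(k := 1)) l + (?p l - 0)) = p" "(\<lambda>l. q l + (0 - ?p l)) = q" using True by (auto simp: fun_eq_iff)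
        then show ?thesis unfolding Gop_Xop[symmetric] Gop_comp by simp
      qed
      ultimately show ?thesis using Salg.mult[OF Salg.genX[OF k(1)]] by metis
    next
      case False
      then have qk: "0 < q k" using k by auto
      let ?q = "q(k := q k - 1)"
      have "(\<Sum>k\<in>T. p k + ?q k) < (\<Sum>k\<in>T. p k + q k)"
        using T k qk by (intro sum_strict_mono_ex1) auto
      moreover have "supp_in T ?q" using less(3) by (auto simp: supp_in_def)
      ultimately have "(Gop {} p ?q :: 'k kop) \<in> Salg T" using less(1)[of p ?q] less(2) by blast
      moreover have "(Gop {} p q :: 'k kop) = Gop {} p ?q \<circ> Yop k"
      proof -
        have "(\<lambda>l. p l + (0 - ?q l)) = p" "(\<lambda>l. ((\<lambda>_. 0)(k := 1)) l + (?q l - 0)) = q" using qk by (auto simp: fun_eq_iff)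
        then show ?thesis unfolding Gop_Yop[symmetric] Gop_comp by simp
      qed
      ultimately show ?thesis using Salg.mult[OF _ Salg.genY[OF k(1)]] by metis
    qed
  qed
qed

text \<open>This is \<open>e_i = 1 - x_i y_i\<close> placed between \<open>x^p\<close> and
  \<open>y^q\<close>.\<close>

lemma Gop_insert:
  assumes "i \<notin> I"
  shows "Gop (insert i I) p q = opsub (Gop I p q) (Gop I (p(i := Suc (p i))) (q(i := Suc (q i))))"
proof (intro ext)
  fix f :: "(nat \<Rightarrow> nat) \<Rightarrow> 'a" and a :: "nat \<Rightarrow> nat"
  let ?p = "p(i := Suc (p i))" and ?q = "q(i := Suc (q i))"
  have I: "(\<forall>j\<in>I. a j = ?p j) \<longleftrightarrow> (\<forall>j\<in>I. a j = p j)" using assms by auto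
  have le: "(\<forall>k. ?p k \<le> a k) \<longleftrightarrow> (\<forall>k. p k \<le> a k) \<and> a i \<noteq> p i"
  proof
    assume h: "\<forall>k. ?p k \<le> a k"
    have "p k \<le> a k" for k using h[rule_format, of k] by (cases "k = i") auto
    moreover have "a i \<noteq> p i" using h[rule_format, of i] by auto
    ultimately show "(\<forall>k. p k \<le> a k) \<and> a i \<noteq> p i" by blast
  next
    assume h: "(\<forall>k. p k \<le> a k) \<and> a i \<noteq> p i"
    then have "p i < a i" by (metis le_neq_implies_less)
    then show "\<forall>k. ?p k \<le> a k" using h by auto
  qed
  have val: "(\<lambda>k. a k - ?p k + ?q k) = (\<lambda>k. a k - p k + q k)" if "\<forall>k. ?p k \<le> a k"
  proof
    fix k show "a k - ?p k + ?q k = a k - p k + q k" using that[rule_format, of k] by (cases "k = i") auto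
  qed
  show "Gop (insert i I) p q f a = opsub (Gop I p q) (Gop I ?p ?q) f a"
    unfolding Gop_def opsub_def I using le val by auto
qed

lemma Gop_Salg:
  assumes T: "finite T" and I: "I \<subseteq> T"
  shows "supp_in T p \<Longrightarrow> supp_in T q \<Longrightarrow> Gop I p q \<in> Salg T"
  using finite_subset[OF I T] I
proof (induction I arbitrary: p q rule: finite_induct)
  case empty
  then show ?case using Gop_empty_Salg[OF T] by simp
next
  case (insert i I)
  then show ?case unfolding Gop_insert[OF insert(2)]
    by (intro Salg_opsub insert(3)) (auto simp: supp_in_def)
qed

lemma sp_Gens_Salg: "finite T \<Longrightarrow> sp (Gens T U) \<subseteq> Salg T"
  by (intro sp_least Salg_opzero Salg.add Salg_opsmul) (auto simp: Gens_def intro: Gop_Salg)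

definition res :: "nat set \<Rightarrow> (nat \<Rightarrow> nat) \<Rightarrow> nat \<Rightarrow> nat" where
  "res I p = (\<lambda>k. if k \<in> I then p k else 0)"

lemma Gop_comp_disjoint:
  assumes "\<And>k. q k = 0 \<or> p' k = 0" "\<And>i. i \<in> I \<Longrightarrow> p' i = 0" "\<And>i. i \<in> I' \<Longrightarrow> q i = 0"
  shows "Gop I p q \<circ> Gop I' p' q' = Gop (I \<union> I') (\<lambda>k. p k + p' k) (\<lambda>k. q k + q' k)"
proof -
  have "(\<lambda>k. p k + (p' k - q k)) = (\<lambda>k. p k + p' k)" "(\<lambda>k. q' k + (q k - p' k)) = (\<lambda>k. q k + q' k)"
  proof -
    have "p k + (p' k - q k) = p k + p' k" "q' k + (q k - p' k) = q k + q' k" for k using assms(1)[of k] by auto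
    then show "(\<lambda>k. p k + (p' k - q k)) = (\<lambda>k. p k + p' k)" "(\<lambda>k. q' k + (q k - p' k)) = (\<lambda>k. q k + q' k)"
      by (simp_all only:)
  qed
  moreover have c: "(\<forall>i\<in>I. p' i \<le> q i) \<and> (\<forall>i\<in>I'. q i \<le> p' i)" using assms by simp
  ultimately show ?thesis unfolding Gop_comp if_P[OF c] by (simp only:)
qed

lemma Xop_pow: "(Xop i :: 'k::field kop) ^^ s = Gop {} (res {i} (\<lambda>_. s)) (\<lambda>_. 0)"
proof (induction s)
  case 0
  have "res {i} (\<lambda>_. 0) = (\<lambda>_. 0)" by (simp add: res_def)
  then show ?case by (simp only: funpow.simps Gop_id)
next
  case (Suc s)
  have "(Xop i :: 'k kop) ^^ Suc s = Xop i \<circ> (Xop i ^^ s)" by simp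
  also have "\<dots> = Gop ({} \<union> {}) (\<lambda>k. ((\<lambda>_. 0)(i := 1)) k + res {i} (\<lambda>_. s) k) (\<lambda>k. 0 + 0)"
    unfolding Suc unfolding Gop_Xop[symmetric] by (intro Gop_comp_disjoint) auto
  also have "(\<lambda>k. ((\<lambda>_. 0)(i := 1)) k + res {i} (\<lambda>_. s) k) = res {i} (\<lambda>_. Suc s)"
    by (auto simp: res_def fun_eq_iff)
  finally show ?case by (simp only: Un_empty_left add_0)
qed

lemma Yop_pow: "(Yop i :: 'k::field kop) ^^ s = Gop {} (\<lambda>_. 0) (res {i} (\<lambda>_. s))"
proof (induction s)
  case 0
  have "res {i} (\<lambda>_. 0) = (\<lambda>_. 0)" by (simp add: res_def)
  then show ?case by (simp only: funpow.simps Gop_id)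
next
  case (Suc s)
  have "(Yop i :: 'k kop) ^^ Suc s = Yop i \<circ> (Yop i ^^ s)" by simp
  also have "\<dots> = Gop ({} \<union> {}) (\<lambda>k. 0 + 0) (\<lambda>k. ((\<lambda>_. 0)(i := 1)) k + res {i} (\<lambda>_. s) k)"
    unfolding Suc unfolding Gop_Yop[symmetric] by (intro Gop_comp_disjoint) auto
  also have "(\<lambda>k. ((\<lambda>_. 0)(i := 1)) k + res {i} (\<lambda>_. s) k) = res {i} (\<lambda>_. Suc s)"
    by (auto simp: res_def fun_eq_iff)
  finally show ?case by (simp only: Un_empty_left add_0)
qed

lemma XY_pow: "(Xop i ^^ s) \<circ> (Yop i ^^ t) = Gop {} (res {i} (\<lambda>_. s)) (res {i} (\<lambda>_. t))"
proof -
  have "(Xop i ^^ s) \<circ> (Yop i ^^ t) = Gop ({} \<union> {}) (\<lambda>k. res {i} (\<lambda>_. s) k + 0) (\<lambda>k. 0 + res {i} (\<lambda>_. t) k)"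
    unfolding Xop_pow Yop_pow by (intro Gop_comp_disjoint) auto
  then show ?thesis by (simp only: Un_empty_left add_0 add_0_right)
qed

lemma Est_Gop: "Est i s t = Gop {i} (res {i} (\<lambda>_. s)) (res {i} (\<lambda>_. t))"
proof -
  have "res {i} (\<lambda>_. Suc s) = (res {i} (\<lambda>_. s))(i := Suc (res {i} (\<lambda>_. s) i))" for s
    by (auto simp: res_def fun_eq_iff)
  moreover have "i \<notin> {}" by simp
  ultimately show ?thesis unfolding Est_def XY_pow by (simp only: Gop_insert[of i "{}"] not_False_eq_True)
qed

lemma ee_Gop: "ee i = Gop {i} (\<lambda>_. 0) (\<lambda>_. 0)"
  unfolding ee_def Est_Gop by (simp add: res_def)

lemma listprod_simps: "listprod [] = id" "listprod (A # As) = A \<circ> listprod As"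
  by (simp_all add: listprod_def)

lemma listprod_Est:
  "distinct xs \<Longrightarrow> (listprod (map (\<lambda>i. Est i (al i) (be i)) xs) :: 'k::field kop) = Gop (set xs) (res (set xs) al) (res (set xs) be)"
proof (induction xs)
  case Nil
  have "res {} al = (\<lambda>_. 0)" "res {} be = (\<lambda>_. 0)" by (simp_all add: res_def)
  then show ?case by (simp only: list.map listprod_simps Gop_id list.set)
next
  case (Cons x xs)
  have "(listprod (map (\<lambda>i. Est i (al i) (be i)) (x # xs)) :: 'k kop) = Est x (al x) (be x) \<circ> Gop (set xs) (res (set xs) al) (res (set xs) be)"
    using Cons by (simp add: listprod_simps)
  also have "\<dots> = Gop ({x} \<union> set xs) (\<lambda>k. res {x} (\<lambda>_. al x) k + res (set xs) al k) (\<lambda>k. res {x} (\<lambda>_. be x) k + res (set xs) be k)"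
    unfolding Est_Gop using Cons(2) by (intro Gop_comp_disjoint) (auto simp: res_def)
  also have "(\<lambda>k. res {x} (\<lambda>_. al x) k + res (set xs) al k) = res (set (x # xs)) al"
    using Cons(2) by (auto simp: res_def fun_eq_iff)
  also have "(\<lambda>k. res {x} (\<lambda>_. be x) k + res (set xs) be k) = res (set (x # xs)) be"
    using Cons(2) by (auto simp: res_def fun_eq_iff)
  finally show ?case by (simp only: list.set insert_is_Un[symmetric])
qed

lemma EI_Gop: "finite I \<Longrightarrow> EI al be I = Gop I (res I al) (res I be)"
  unfolding EI_def using listprod_Est[of "sorted_list_of_set I" al be] by simp

lemma eI_Gop: "finite I \<Longrightarrow> eI I = (Gop I (\<lambda>_. 0) (\<lambda>_. 0) :: 'k::field kop)"
proof -
  assume I: "finite I"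
  have E: "ee = (\<lambda>i. Est i 0 0 :: 'k kop)" by (simp add: ee_def fun_eq_iff)
  have "eI I = (Gop I (res I (\<lambda>_. 0)) (res I (\<lambda>_. 0)) :: 'k kop)"
    unfolding eI_def E by (simp only: listprod_Est distinct_sorted_list_of_set set_sorted_list_of_set[OF I])
  then show ?thesis by (simp add: res_def)
qed

lemma supp_in_0: "supp_in T (\<lambda>_. 0)"
  by (simp add: supp_in_def)

section \<open>The ideals \<open>p_I\<close> and \<open>a_s\<close> as spans\<close>

lemma ideal_gen_opsmul: "A \<in> ideal_gen n G \<Longrightarrow> opsmul c A \<in> ideal_gen n G"
proof (induction rule: ideal_gen.induct)
  case zero
  then show ?case by (simp add: op_simps ideal_gen.zero)
next
  case (gen a g b)
  have "opsmul c (a \<circ> g \<circ> b) = opsmul c a \<circ> g \<circ> b" by (simp only: op_comp_left)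
  then show ?case using ideal_gen.gen[OF Salg_opsmul[OF gen(1)] gen(2,3)] by metis
next
  case (add a b)
  then show ?case by (simp add: op_simps(7) ideal_gen.add)
qed

lemma pp_eq:
  assumes i: "i \<in> {1..n}"
  shows "pp n i = (sp (Gens {1..n} {I. i \<in> I}) :: 'k::field kop set)"
proof
  show "pp n i \<subseteq> (sp (Gens {1..n} {I. i \<in> I}) :: 'k kop set)"
  proof
    fix A :: "'k kop" assume "A \<in> pp n i"
    then show "A \<in> sp (Gens {1..n} {I. i \<in> I})" unfolding pp_def
    proof (induction rule: ideal_gen.induct)
      case (gen a g b)
      have g: "g \<in> sp (Gens {1..n} {I. i \<in> I})"
        using gen(2) i by (auto simp: ee_Gop supp_in_0 intro!: sp_base GensI)
      have "a \<circ> g \<in> sp (Gens {1..n} {I. i \<in> I})" by (rule Gens_comp[OF Salg_sp[OF gen(1)] g]) auto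
      then show ?case by (rule Gens_comp[OF _ Salg_sp[OF gen(3)]]) auto
    qed (auto intro: sp.sp_zero sp_opadd)
  qed
  show "sp (Gens {1..n} {I. i \<in> I}) \<subseteq> (pp n i :: 'k kop set)"
    unfolding pp_def
  proof (rule sp_least)
    show "Gens {1..n} {I. i \<in> I} \<subseteq> (ideal_gen n {ee i} :: 'k kop set)"
    proof
      fix g :: "'k kop" assume "g \<in> Gens {1..n} {I. i \<in> I}"
      then obtain I p q where g: "g = Gop I p q" "i \<in> I" "I \<subseteq> {1..n}" "supp_in {1..n} p" "supp_in {1..n} q"
        unfolding Gens_def by blast
      have "Gop I p (\<lambda>_. 0) \<circ> ee i = (Gop (I \<union> {i}) (\<lambda>k. p k + 0) (\<lambda>k. 0 + 0) :: 'k kop)"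
        unfolding ee_Gop by (rule Gop_comp_disjoint) auto
      also have "\<dots> = Gop I p (\<lambda>_. 0)" using g(2) by (simp add: insert_absorb)
      finally have 1: "Gop I p (\<lambda>_. 0) \<circ> ee i = (Gop I p (\<lambda>_. 0) :: 'k kop)" .
      have "Gop I p (\<lambda>_. 0) \<circ> Gop {} (\<lambda>_. 0) q = (Gop (I \<union> {}) (\<lambda>k. p k + 0) (\<lambda>k. 0 + q k) :: 'k kop)"
        by (rule Gop_comp_disjoint) auto
      then have "g = Gop I p (\<lambda>_. 0) \<circ> ee i \<circ> Gop {} (\<lambda>_. 0) q" unfolding 1 g(1) by simp
      moreover have "(Gop I p (\<lambda>_. 0) :: 'k kop) \<in> Sn n" "(Gop {} (\<lambda>_. 0) q :: 'k kop) \<in> Sn n"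
        using g by (auto intro!: Gop_Salg simp: supp_in_0)
      ultimately show "g \<in> ideal_gen n {ee i}" using ideal_gen.gen[of "Gop I p (\<lambda>_. 0)" n "ee i" "{ee i}"] by simp
    qed
  qed (auto intro: ideal_gen.zero ideal_gen.add ideal_gen_opsmul)
qed

lemma idprod_opsmul:
  assumes "\<And>c A. A \<in> P \<Longrightarrow> opsmul c A \<in> P"
  shows "A \<in> idprod P Q \<Longrightarrow> opsmul c A \<in> idprod P Q"
proof (induction rule: idprod.induct)
  case zero
  then show ?case by (simp add: op_simps idprod.zero)
next
  case (prod a b)
  have "opsmul c (a \<circ> b) = opsmul c a \<circ> b" by (simp only: op_comp_left)
  then show ?case using idprod.prod[OF assms[OF prod(1)] prod(2)] by metis
next
  case (add a b)
  then show ?case by (simp add: op_simps(7) idprod.add)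
qed

lemma pI_list_eq:
  "set xs \<subseteq> {1..n} \<Longrightarrow> foldr idprod (map (pp n) xs) (Sn n) = (sp (Gens {1..n} {I. set xs \<subseteq> I}) :: 'k::field kop set)"
proof (induction xs)
  case Nil
  have "sp (Gens {1..n} {I. set [] \<subseteq> I}) \<subseteq> (Sn n :: 'k kop set)" by (rule sp_Gens_Salg) simp
  moreover have "Gens {1..n} {{}} \<subseteq> (Gens {1..n} {I. set [] \<subseteq> I} :: 'k kop set)" by (auto simp: Gens_def)
  then have "(Sn n :: 'k kop set) \<subseteq> sp (Gens {1..n} {I. set [] \<subseteq> I})"
    using Salg_sp[of _ "{1..n}"] sp_mono[of "Gens {1..n} {{}} :: 'k kop set" "Gens {1..n} {I. set [] \<subseteq> I}"]
    by (blast intro: sp_base)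
  ultimately show ?case by (simp only: list.map foldr.simps id_apply)
next
  case (Cons x xs)
  let ?W = "{I. set (x # xs) \<subseteq> I}"
  have x: "x \<in> {1..n}" and xs: "set xs \<subseteq> {1..n}" using Cons(2) by auto
  have eq: "foldr idprod (map (pp n) (x # xs)) (Sn n)
     = idprod (sp (Gens {1..n} {I. x \<in> I})) (sp (Gens {1..n} {I. set xs \<subseteq> I}) :: 'k kop set)"
    by (simp only: list.map foldr.simps comp_apply Cons.IH[OF xs] pp_eq[OF x])
  have "idprod (sp (Gens {1..n} {I. x \<in> I})) (sp (Gens {1..n} {I. set xs \<subseteq> I})) \<subseteq> (sp (Gens {1..n} ?W) :: 'k kop set)"
  proof
    fix A :: "'k kop" assume "A \<in> idprod (sp (Gens {1..n} {I. x \<in> I})) (sp (Gens {1..n} {I. set xs \<subseteq> I}))"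
    then show "A \<in> sp (Gens {1..n} ?W)"
    proof induction
      case (prod a b)
      then show ?case by (rule Gens_comp) auto
    qed (auto intro: sp.sp_zero sp_opadd)
  qed
  moreover have "sp (Gens {1..n} ?W) \<subseteq> (idprod (sp (Gens {1..n} {I. x \<in> I})) (sp (Gens {1..n} {I. set xs \<subseteq> I})) :: 'k kop set)"
  proof (rule sp_least)
    show "Gens {1..n} ?W \<subseteq> (idprod (sp (Gens {1..n} {I. x \<in> I})) (sp (Gens {1..n} {I. set xs \<subseteq> I})) :: 'k kop set)"
    proof
      fix g :: "'k kop" assume "g \<in> Gens {1..n} ?W"
      then obtain I p q where g: "g = Gop I p q" "x \<in> I" "set xs \<subseteq> I" "I \<subseteq> {1..n}" "supp_in {1..n} p" "supp_in {1..n} q"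
        unfolding Gens_def by auto
      \<comment> \<open>\<open>Gop {x} p p\<close> lies in the ideal of \<open>x\<close> and is a
        left identity for the generator, which therefore lies in the product of the two
        ideals.\<close>
      have "Gop {x} p p \<circ> Gop I p q = (Gop I p q :: 'k kop)"
        unfolding Gop_comp using g(2) by (simp add: insert_absorb)
      moreover have "Gop {x} p p \<in> (sp (Gens {1..n} {I. x \<in> I}) :: 'k kop set)" "Gop I p q \<in> (sp (Gens {1..n} {I. set xs \<subseteq> I}) :: 'k kop set)"
        using g x by (auto intro!: sp_base GensI)
      ultimately show "g \<in> idprod (sp (Gens {1..n} {I. x \<in> I})) (sp (Gens {1..n} {I. set xs \<subseteq> I}))"
        using idprod.prod g(1) by metis
    qed
  qed (auto intro: idprod.zero idprod.add idprod_opsmul sp_opsmul)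
  ultimately show ?case unfolding eq by (rule equalityI)
qed

lemma pI_eq: "I \<subseteq> {1..n} \<Longrightarrow> pI n I = sp (Gens {1..n} {I'. I \<subseteq> I'})"
  unfolding pI_def using pI_list_eq[of "sorted_list_of_set I" n] finite_subset[of I "{1..n}"] by simp

lemma addclo_opsmul:
  assumes "\<And>c A. A \<in> S \<Longrightarrow> opsmul c A \<in> S"
  shows "A \<in> addclo S \<Longrightarrow> opsmul c A \<in> addclo S"
  by (induction rule: addclo.induct) (auto simp: op_simps intro: addclo.intros assms)

lemma aa_eq: "aa n s = (sp (Gens {1..n} {I. s \<le> card I}) :: 'k::field kop set)"
proof
  let ?S = "\<Union>{pI n I | I. I \<subseteq> {1..n} \<and> card I = s} :: 'k kop set"
  show "aa n s \<subseteq> (sp (Gens {1..n} {I. s \<le> card I}) :: 'k kop set)"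
  proof
    fix A :: "'k kop" assume "A \<in> aa n s"
    then show "A \<in> sp (Gens {1..n} {I. s \<le> card I})" unfolding aa_def
    proof induction
      case (base a)
      then obtain I where I: "I \<subseteq> {1..n}" "card I = s" "a \<in> sp (Gens {1..n} {I'. I \<subseteq> I'})" using pI_eq by blast
      have "Gens {1..n} {I'. I \<subseteq> I'} \<subseteq> (Gens {1..n} {I. s \<le> card I} :: 'k kop set)"
      proof
        fix g :: "'k kop" assume "g \<in> Gens {1..n} {I'. I \<subseteq> I'}"
        then obtain J p q where g: "g = Gop J p q" "I \<subseteq> J" "J \<subseteq> {1..n}" "supp_in {1..n} p" "supp_in {1..n} q"
          unfolding Gens_def by blast
        have "card I \<le> card J" using g(2,3) finite_subset[of J "{1..n}"] by (intro card_mono) auto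
        then show "g \<in> Gens {1..n} {I. s \<le> card I}" using g I(2) by (auto intro!: GensI)
      qed
      then show ?case using I(3) sp_mono sp_base by (meson subset_iff)
    qed (auto intro: sp.sp_zero sp_opadd)
  qed
  show "sp (Gens {1..n} {I. s \<le> card I}) \<subseteq> (aa n s :: 'k kop set)"
    unfolding aa_def
  proof (rule sp_least)
    show "Gens {1..n} {I. s \<le> card I} \<subseteq> addclo ?S"
    proof
      fix g :: "'k kop" assume "g \<in> Gens {1..n} {I. s \<le> card I}"
      then obtain I p q where g: "g = Gop I p q" "s \<le> card I" "I \<subseteq> {1..n}" "supp_in {1..n} p" "supp_in {1..n} q"
        unfolding Gens_def by auto
      obtain J where J: "J \<subseteq> I" "card J = s" using obtain_subset_with_card_n[OF g(2)] by blast
      have "g \<in> sp (Gens {1..n} {I'. J \<subseteq> I'})" using g J by (auto intro!: sp_base GensI)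
      then have "g \<in> pI n J" using pI_eq[of J n] J g by auto
      then show "g \<in> addclo ?S" using J g(3) by (intro addclo.base) blast
    qed
    have "opsmul c A \<in> ?S" if A: "A \<in> ?S" for c A
    proof -
      obtain I where I: "I \<subseteq> {1..n}" "card I = s" "A \<in> pI n I" using A by blast
      then have "opsmul c A \<in> pI n I" unfolding pI_eq[OF I(1)] by (intro sp_opsmul)
      then show ?thesis using I(1,2) by blast
    qed
    then show "\<And>c A. A \<in> addclo ?S \<Longrightarrow> opsmul c A \<in> addclo ?S" by (rule addclo_opsmul)
  qed (auto intro: addclo.zero addclo.add)
qed

section \<open>Replacing \<open>x_k\<close>, \<open>y_k\<close> by \<open>X_k\<close> and its
  inverse for \<open>k\<close> outside \<open>I\<close>\<close>

definition Xm :: "nat \<Rightarrow> nat set \<Rightarrow> (nat \<Rightarrow> nat) \<Rightarrow> (nat \<Rightarrow> nat) \<Rightarrow> 'k::field ratfun" where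
  "Xm n I p q = (\<Prod>k\<in>{1..n} - I. Xv k ^ p k / Xv k ^ q k)"

lemma Xm_mult: "Xm n I p q * Xm n I p' q' = Xm n I (\<lambda>k. p k + (p' k - q k)) (\<lambda>k. q' k + (q k - p' k))"
proof -
  have "Xv k ^ a / Xv k ^ b * (Xv k ^ a' / Xv k ^ b') = (Xv k ^ (a + (a' - b)) / Xv k ^ (b' + (b - a')) :: 'a ratfun)"
    for k a b a' b'
  proof (cases "b \<le> a'")
    case True
    then have "Xv k ^ a' = (Xv k ^ b * Xv k ^ (a' - b) :: 'a ratfun)" by (simp flip: power_add)
    moreover have "b' + (b - a') = b'" using True by simp
    ultimately show ?thesis unfolding power_add[of _ a] by (simp add: Xv_nz)
  next
    case False
    then have "Xv k ^ b = (Xv k ^ a' * Xv k ^ (b - a') :: 'a ratfun)" by (simp flip: power_add)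
    moreover have "a + (a' - b) = a" using False by simp
    ultimately show ?thesis unfolding power_add[of _ b'] by (simp add: Xv_nz)
  qed
  then show ?thesis unfolding Xm_def prod.distrib[symmetric] by simp
qed

definition Hop :: "nat \<Rightarrow> nat set \<Rightarrow> nat set \<Rightarrow> (nat \<Rightarrow> nat) \<Rightarrow> (nat \<Rightarrow> nat) \<Rightarrow> 'k::field ratfun kop" where
  "Hop n I I' p q = opsmul (Xm n I p q) (Gop I' (res I p) (res I q))"

lemma Hop_comp: "Hop n I {} p q \<circ> Hop n I {} p' q' = Hop n I {} (\<lambda>k. p k + (p' k - q k)) (\<lambda>k. q' k + (q k - p' k))"
proof -
  have r: "(\<lambda>k. res I p k + (res I p' k - res I q k)) = res I (\<lambda>k. p k + (p' k - q k))"
    "(\<lambda>k. res I q' k + (res I q k - res I p' k)) = res I (\<lambda>k. q' k + (q k - p' k))"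
    by (auto simp: res_def fun_eq_iff)
  show ?thesis
    unfolding Hop_def op_comp_left op_comp_right[OF linear_Gop] Gop_comp op_simps(8) Xm_mult r
    by (simp only: ball_simps simp_thms if_True Un_empty_left)
qed

text \<open>A relation at first, because one operator has many expressions by the
  \<open>x^p y^q\<close>. Their linear independence makes the image unique
  (\<open>rep_unique\<close>), and \<open>rho\<close> is the resulting homomorphism.\<close>

inductive rep :: "nat \<Rightarrow> nat set \<Rightarrow> 'k::field kop \<Rightarrow> 'k ratfun kop \<Rightarrow> bool" for n I where
  rep_zero: "rep n I opzero opzero"
| rep_add: "supp_in {1..n} p \<Longrightarrow> supp_in {1..n} q \<Longrightarrow> rep n I A B \<Longrightarrow>
    rep n I (opadd (opsmul c (Gop {} p q)) A) (opadd (opsmul (emb c) (Hop n I {} p q)) B)"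

lemma rep_opadd: "rep n I A B \<Longrightarrow> rep n I A' B' \<Longrightarrow> rep n I (opadd A A') (opadd B B')"
  by (induction rule: rep.induct) (simp_all add: op_simps(1,6) rep.rep_add)

lemma rep_opsmul: "rep n I A B \<Longrightarrow> rep n I (opsmul c A) (opsmul (emb c) B)"
proof (induction rule: rep.induct)
  case rep_zero
  then show ?case by (simp add: op_simps rep.rep_zero)
next
  case (rep_add p q A B d)
  have "rep n I (opadd (opsmul (c * d) (Gop {} p q)) (opsmul c A)) (opadd (opsmul (emb (c * d)) (Hop n I {} p q)) (opsmul (emb c) B))"
    using rep_add by (intro rep.rep_add)
  then show ?case by (simp only: op_simps(7,8) emb_mult)
qed

lemma rep_Gop: "supp_in {1..n} p \<Longrightarrow> supp_in {1..n} q \<Longrightarrow> rep n I (Gop {} p q) (Hop n I {} p q)"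
  using rep.rep_add[OF _ _ rep.rep_zero, of n p q I 1] unfolding op_simps(2,3) emb_1 .

lemma rep_total: "A \<in> Sn n \<Longrightarrow> \<exists>B. rep n I A B"
proof -
  assume "A \<in> Sn n"
  then have "A \<in> sp (Gens {1..n} {{}})" by (rule Salg_sp)
  then show ?thesis
  proof induction
    case sp_zero
    then show ?case using rep.rep_zero by blast
  next
    case (sp_add g A c)
    then obtain p q B where "g = Gop {} p q" "supp_in {1..n} p" "supp_in {1..n} q" "rep n I A B"
      unfolding Gens_def by blast
    then show ?case using rep.rep_add[of n p q I A B c] by (intro exI) simp
  qed
qed

lemma rep_Salg: "rep n I A B \<Longrightarrow> A \<in> Sn n"
  by (induction rule: rep.induct) (auto intro!: Salg_opzero Salg.add Salg_opsmul Gop_Salg)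

lemma linear_Hop: "linear_op (Hop n I I' p q)"
  unfolding Hop_def by (intro linear_opsmul linear_Gop)

lemma linear_rep: "rep n I A B \<Longrightarrow> linear_op B"
  by (induction rule: rep.induct) (auto intro: linear_opzero linear_opadd linear_opsmul linear_Hop)

text \<open>Merges repeated exponent pairs, with the same coefficients on both sides, so that
  independence of the \<open>x^p y^q\<close> can be applied.\<close>

lemma rep_family:
  "rep n I A B \<Longrightarrow> \<exists>P C. finite P \<and> (\<forall>f a. A f a = (\<Sum>r\<in>P. C r * Gop {} (fst r) (snd r) f a)) \<and>
     (\<forall>f a. B f a = (\<Sum>r\<in>P. emb (C r) * Hop n I {} (fst r) (snd r) f a))"
proof (induction rule: rep.induct)
  case rep_zero
  then show ?case by (intro exI[of _ "{}"] exI[of _ "\<lambda>_. 0"]) (simp add: opzero_def)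
next
  case (rep_add p q A B c)
  then obtain P C where PC: "finite P" "\<And>f a. A f a = (\<Sum>r\<in>P. C r * Gop {} (fst r) (snd r) f a)"
    "\<And>f a. B f a = (\<Sum>r\<in>P. emb (C r) * Hop n I {} (fst r) (snd r) f a)" by auto
  define D where "D = (\<lambda>r. if r \<in> P then C r else 0)"
  define E where "E = D((p, q) := D (p, q) + c)"
  have 1: "(\<Sum>r\<in>P. C r * G r) = (\<Sum>r\<in>insert (p, q) P. D r * G r)" for G :: "_ \<Rightarrow> 'a"
    using PC(1) by (intro sum.mono_neutral_cong_left) (auto simp: D_def)
  have 2: "(\<Sum>r\<in>P. emb (C r) * G r) = (\<Sum>r\<in>insert (p, q) P. emb (D r) * G r)" for G :: "_ \<Rightarrow> 'a ratfun"
    using PC(1) by (intro sum.mono_neutral_cong_left) (auto simp: D_def emb_0)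
  have 3: "(\<Sum>r\<in>insert (p, q) P. E r * G r) = c * G (p, q) + (\<Sum>r\<in>insert (p, q) P. D r * G r)" for G :: "_ \<Rightarrow> 'a"
    using PC(1) by (simp add: sum.insert_remove E_def algebra_simps)
  have 4: "(\<Sum>r\<in>insert (p, q) P. emb (E r) * G r) = emb c * G (p, q) + (\<Sum>r\<in>insert (p, q) P. emb (D r) * G r)" for G :: "_ \<Rightarrow> 'a ratfun"
    using PC(1) by (simp add: sum.insert_remove E_def emb_add algebra_simps)
  show ?case
    using PC(1) by (intro exI[of _ "insert (p, q) P"] exI[of _ E] conjI allI)
      (simp_all only: opadd_def opsmul_def PC(2,3) 1 2 3 4 fst_conv snd_conv finite_insert)
qed

text \<open>The operators \<open>x\<^sup>p y\<^sup>q\<close> are linearly independent: evaluate at a minimal \<open>p\<close>.\<close>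
lemma Gop_indep:
  fixes C :: "(nat \<Rightarrow> nat) \<times> (nat \<Rightarrow> nat) \<Rightarrow> 'k::field"
  assumes P: "finite P" and z: "\<And>f a. (\<Sum>r\<in>P. C r * Gop {} (fst r) (snd r) f a) = 0" and r: "r \<in> P"
  shows "C r = 0"
proof (rule ccontr)
  assume "C r \<noteq> 0"
  let ?Q = "{r \<in> P. C r \<noteq> 0}"
  have "r \<in> ?Q" "finite ?Q" using r \<open>C r \<noteq> 0\<close> P by auto
  then have "fst ` ?Q \<noteq> {}" "finite (fst ` ?Q)" by (blast, blast)
  then obtain m where m: "m \<in> fst ` ?Q" "\<And>b. b \<in> fst ` ?Q \<Longrightarrow> b \<le> m \<Longrightarrow> m = b"
    using finite_has_minimal[of "fst ` ?Q"] by blast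
  then obtain q where q: "(m, q) \<in> ?Q" by auto
  have "C r * Gop {} (fst r) (snd r) (uvec q) m = (if r = (m, q) then C r else 0)" if "r \<in> P" for r
  proof (cases "C r = 0")
    case False
    have le: "(\<forall>k. fst r k \<le> m k) \<longleftrightarrow> fst r = m"
      using m(2)[of "fst r"] that False by (auto simp: le_fun_def)
    show ?thesis
    proof (cases "fst r = m")
      case True
      have "(\<lambda>k. m k - m k + snd r k) = snd r" by simp
      then show ?thesis using True le by (auto simp: Gop_def uvec_def prod_eq_iff)
    next
      case False
      then show ?thesis using le by (auto simp: Gop_def)
    qed
  qed auto
  then have "(\<Sum>r\<in>P. C r * Gop {} (fst r) (snd r) (uvec q) m) = (\<Sum>r\<in>P. if r = (m, q) then C r else 0)"
    by (intro sum.cong) auto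
  also have "\<dots> = C (m, q)" using P q by auto
  finally show False using z q by auto
qed

lemma rep_unique:
  assumes "rep n I A B" "rep n I A B'"
  shows "B = B'"
proof -
  have r: "rep n I (opadd A (opsmul (- 1) A)) (opadd B (opsmul (emb (- 1)) B'))"
    by (intro rep_opadd rep_opsmul assms)
  obtain P C where PC: "finite P" "\<forall>f a. opadd A (opsmul (- 1) A) f a = (\<Sum>r\<in>P. C r * Gop {} (fst r) (snd r) f a)"
     "\<forall>f a. opadd B (opsmul (emb (- 1)) B') f a = (\<Sum>r\<in>P. emb (C r) * Hop n I {} (fst r) (snd r) f a)"
    using rep_family[OF r] by (elim exE conjE)
  have "C r = 0" if "r \<in> P" for r
    by (rule Gop_indep[OF PC(1) _ that]) (use PC(2) in \<open>simp add: opadd_def opsmul_def\<close>)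
  then have "opadd B (opsmul (emb (- 1)) B') f a = 0" for f a using PC(3) by (simp add: emb_0)
  then show ?thesis by (simp add: fun_eq_iff opadd_def opsmul_def emb_uminus emb_1)
qed

lemma rep_comp:
  assumes "rep n I A B" "rep n I A' B'"
  shows "rep n I (A \<circ> A') (B \<circ> B')"
  using assms(1)
proof induction
  case rep_zero
  then show ?case by (simp only: op_comp_left rep.rep_zero)
next
  case (rep_add p q A B c)
  have "rep n I (Gop {} p q \<circ> A') (Hop n I {} p q \<circ> B')"
    using assms(2)
  proof induction
    case rep_zero
    then show ?case by (simp only: op_comp_right[OF linear_Gop] op_comp_right[OF linear_Hop] rep.rep_zero)
  next
    case (rep_add p' q' A' B' c)
    have "Gop {} p q \<circ> Gop {} p' q' = (Gop {} (\<lambda>k. p k + (p' k - q k)) (\<lambda>k. q' k + (q k - p' k)) :: 'a kop)"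
      unfolding Gop_comp by simp
    moreover have "rep n I (Gop {} (\<lambda>k. p k + (p' k - q k)) (\<lambda>k. q' k + (q k - p' k)) :: 'a kop)
        (Hop n I {} (\<lambda>k. p k + (p' k - q k)) (\<lambda>k. q' k + (q k - p' k)))"
      using rep_add(1,2) \<open>supp_in {1..n} p\<close> \<open>supp_in {1..n} q\<close> by (intro rep_Gop) (auto simp: supp_in_def)
    ultimately have "rep n I (Gop {} p q \<circ> Gop {} p' q' :: 'a kop) (Hop n I {} p q \<circ> Hop n I {} p' q')"
      by (simp only: Hop_comp)
    then show ?case using rep_add.IH
      by (simp only: op_comp_right[OF linear_Gop] op_comp_right[OF linear_Hop] rep_opadd rep_opsmul)
  qed
  then show ?case using rep_add.IH by (simp only: op_comp_left rep_opadd rep_opsmul)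
qed

definition rho :: "nat \<Rightarrow> nat set \<Rightarrow> 'k::field kop \<Rightarrow> 'k ratfun kop" where
  "rho n I A = (THE B. rep n I A B)"

lemma rho_rep: "A \<in> Sn n \<Longrightarrow> rep n I A (rho n I A)"
proof -
  assume "A \<in> Sn n"
  from rep_total[OF this, of I] obtain B where B: "rep n I A B" by (elim exE)
  show ?thesis unfolding rho_def by (rule theI[where P = "rep n I A", OF B]) (rule rep_unique[OF _ B])
qed

lemma rho_eqI: "rep n I A B \<Longrightarrow> rho n I A = B"
  by (rule rep_unique[OF rho_rep[OF rep_Salg]])

lemma linear_rho: "A \<in> Sn n \<Longrightarrow> linear_op (rho n I A)"
  by (rule linear_rep[OF rho_rep])

lemma rho_opadd: "A \<in> Sn n \<Longrightarrow> B \<in> Sn n \<Longrightarrow> rho n I (opadd A B) = opadd (rho n I A) (rho n I B)"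
  by (intro rho_eqI rep_opadd rho_rep)

lemma rho_opsmul: "A \<in> Sn n \<Longrightarrow> rho n I (opsmul c A) = opsmul (emb c) (rho n I A)"
  by (intro rho_eqI rep_opsmul rho_rep)

lemma rho_opsub: "A \<in> Sn n \<Longrightarrow> B \<in> Sn n \<Longrightarrow> rho n I (opsub A B) = opsub (rho n I A) (rho n I B)"
  by (simp add: op_simps(9) rho_opadd rho_opsmul Salg_opsmul emb_uminus emb_1)

lemma rho_comp: "A \<in> Sn n \<Longrightarrow> B \<in> Sn n \<Longrightarrow> rho n I (A \<circ> B) = rho n I A \<circ> rho n I B"
  by (intro rho_eqI rep_comp rho_rep)

lemma rho_opzero: "rho n I opzero = opzero"
  by (intro rho_eqI rep.rep_zero)

lemma rho_id: "rho n I (id :: 'a::field kop) = id"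
proof -
  have "Hop n I {} (\<lambda>_. 0) (\<lambda>_. 0) = (id :: 'a ratfun kop)"
    by (simp add: Hop_def Xm_def res_def Gop_id op_simps)
  then show ?thesis using rho_eqI[OF rep_Gop[OF supp_in_0 supp_in_0, of n I, where 'a = 'a]] unfolding Gop_id by (rule trans[rotated])
qed

text \<open>For \<open>i\<close> outside \<open>I\<close> the idempotent
  \<open>e_i = 1 - x_i y_i\<close> goes to \<open>1 - X_i X_i^-1 = 0\<close>; for \<open>i\<close>
  in \<open>I\<close> it is kept.\<close>

lemma rho_Gop:
  assumes "I' \<subseteq> {1..n}"
  shows "supp_in {1..n} p \<Longrightarrow> supp_in {1..n} q \<Longrightarrow>
    rho n I (Gop I' p q :: 'k::field kop) = (if I' \<subseteq> I then Hop n I I' p q else opzero)"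
  using finite_subset[OF assms finite_atLeastAtMost] assms
proof (induction I' arbitrary: p q rule: finite_induct)
  case empty
  then show ?case using rho_eqI[OF rep_Gop] by simp
next
  case (insert i I')
  let ?p = "p(i := Suc (p i))" and ?q = "q(i := Suc (q i))"
  have i: "i \<in> {1..n}" "I' \<subseteq> {1..n}" using insert by auto
  have s: "supp_in {1..n} ?p" "supp_in {1..n} ?q" using insert(4,5) i by (auto simp: supp_in_def)
  have "rho n I (Gop (insert i I') p q :: 'k kop) = opsub (rho n I (Gop I' p q)) (rho n I (Gop I' ?p ?q))"
    unfolding Gop_insert[OF insert(2)] by (intro rho_opsub Gop_Salg insert s i) auto
  also have "\<dots> = opsub (if I' \<subseteq> I then Hop n I I' p q else opzero) (if I' \<subseteq> I then Hop n I I' ?p ?q else opzero)"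
    by (simp only: insert.IH[OF insert(4,5) i(2)] insert.IH[OF s i(2)])
  also have "\<dots> = (if insert i I' \<subseteq> I then Hop n I (insert i I') p q else opzero)"
  proof (cases "I' \<subseteq> I")
    case False
    then show ?thesis by (auto simp: opsub_def opzero_def)
  next
    case I': True
    have X: "Xm n I ?p ?q = (Xm n I p q :: 'k ratfun)"
      unfolding Xm_def by (intro prod.cong) (auto simp: Xv_nz)
    show ?thesis
    proof (cases "i \<in> I")
      case True
      have r: "res I ?p = (res I p)(i := Suc (res I p i))" "res I ?q = (res I q)(i := Suc (res I q i))"
        using True by (auto simp: res_def fun_eq_iff)
      have "opsub (Hop n I I' p q) (Hop n I I' ?p ?q) = (Hop n I (insert i I') p q :: 'k ratfun kop)"
        unfolding Hop_def X Gop_insert[OF insert(2)] r by (simp add: opsub_def opsmul_def algebra_simps)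
      then show ?thesis using I' True by simp
    next
      case False
      then have "res I ?p = res I p" "res I ?q = res I q" by (auto simp: res_def fun_eq_iff)
      then have "opsub (Hop n I I' p q) (Hop n I I' ?p ?q) = (opzero :: 'k ratfun kop)"
        unfolding Hop_def X by (simp add: opsub_def opzero_def)
      then show ?thesis using I' False by simp
    qed
  qed
  finally show ?case .
qed

subsection \<open>Symbols\<close>

definition Zs :: "nat set \<Rightarrow> (nat \<Rightarrow> nat) set" where
  "Zs I = {a. supp_in I a}"

lemma enum_exists:
  assumes "finite I" "I \<noteq> {}"
  shows "\<exists>b. bij_betw b (UNIV :: nat set) (Zs I) \<and> b 0 = (\<lambda>_. 0)"
proof -
  have "inj_on (\<lambda>a. map a (sorted_list_of_set I)) (Zs I)"
  proof (rule inj_onI)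
    fix a b assume ab: "a \<in> Zs I" "b \<in> Zs I" "map a (sorted_list_of_set I) = map b (sorted_list_of_set I)"
    have "a k = b k" for k using ab assms(1) by (cases "k \<in> I") (auto simp: Zs_def supp_in_def)
    then show "a = b" by auto
  qed
  moreover have "countable ((\<lambda>a. map a (sorted_list_of_set I)) ` Zs I)" by (rule countableI_type)
  ultimately have c: "countable (Zs I)" by (rule countable_image_inj_on[rotated])
  obtain i where i: "i \<in> I" using assms(2) by blast
  have "inj (\<lambda>m. res {i} (\<lambda>_. m))" by (auto simp: inj_def res_def fun_eq_iff)
  then have "infinite (range (\<lambda>m :: nat. res {i} (\<lambda>_. m)))" by (simp add: finite_image_iff)
  moreover have "range (\<lambda>m :: nat. res {i} (\<lambda>_. m)) \<subseteq> Zs I" using i by (auto simp: Zs_def supp_in_def res_def)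
  ultimately have inf: "infinite (Zs I)" using infinite_super by blast
  define h where "h = from_nat_into (Zs I)"
  have h: "bij_betw h UNIV (Zs I)" unfolding h_def using c inf by (rule bij_betw_from_nat_into)
  have "(\<lambda>_. 0) \<in> Zs I" by (simp add: Zs_def supp_in_0)
  then have "(\<lambda>_. 0) \<in> range h" using h by (simp only: bij_betw_def)
  then obtain j where j: "h j = (\<lambda>_. 0)" by (rule rangeE) (rule that[OF sym])
  have "bij_betw (Transposition.transpose 0 j) (UNIV :: nat set) UNIV" by simp
  then have "bij_betw (h \<circ> Transposition.transpose 0 j) UNIV (Zs I)" using h by (rule bij_betw_trans)
  moreover have "(h \<circ> Transposition.transpose 0 j) 0 = (\<lambda>_. 0)" using j by simp
  ultimately show ?thesis by blast
qed

text \<open>The origin gets number 0 because \<open>e_I\<close> projects to the origin while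
  \<open>dg\<close> scales coordinate 0: \<open>mu\<close> and the factors of \<open>theta\<close>
  then have symbols of the form \<open>dg\<close>.\<close>

definition enumZ :: "nat set \<Rightarrow> nat \<Rightarrow> nat \<Rightarrow> nat" where
  "enumZ I = (SOME b. bij_betw b (UNIV :: nat set) (Zs I) \<and> b 0 = (\<lambda>_. 0))"

definition idx :: "nat set \<Rightarrow> (nat \<Rightarrow> nat) \<Rightarrow> nat" where
  "idx I = inv_into UNIV (enumZ I)"

lemma enumZ:
  assumes "finite I" "I \<noteq> {}"
  shows "enumZ I k \<in> Zs I" "idx I (enumZ I k) = k" "a \<in> Zs I \<Longrightarrow> enumZ I (idx I a) = a"
    "idx I (\<lambda>_. 0) = 0" "enumZ I 0 = (\<lambda>_. 0)"
proof -
  have b: "bij_betw (enumZ I) UNIV (Zs I)" "enumZ I 0 = (\<lambda>_. 0)"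
    unfolding enumZ_def using someI_ex[OF enum_exists[OF assms]] by auto
  show "enumZ I k \<in> Zs I" using b(1) by (auto simp: bij_betw_def)
  show 1: "idx I (enumZ I k) = k" for k unfolding idx_def using b(1) by (auto simp: bij_betw_def)
  show "enumZ I (idx I a) = a" if "a \<in> Zs I" unfolding idx_def using b(1) that by (auto simp: bij_betw_def f_inv_into_f)
  show "enumZ I 0 = (\<lambda>_. 0)" by (rule b(2))
  show "idx I (\<lambda>_. 0) = 0" using 1[of 0] b(2) by simp
qed

definition extZ :: "nat set \<Rightarrow> (nat \<Rightarrow> 'a::field) \<Rightarrow> (nat \<Rightarrow> nat) \<Rightarrow> 'a" where
  "extZ I f = (\<lambda>a. if a \<in> Zs I then f (idx I a) else 0)"

text \<open>The symbol at \<open>I\<close>: \<open>rho n I\<close> sends \<open>x\<^sub>k, y\<^sub>k\<close> with \<open>k \<notin> I\<close> to \<open>X\<^sub>k\<close> and its inverse; here it is restricted to the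
  functions on \<open>\<nat>\<^sup>I\<close>, whose points are enumerated so that the origin has index \<open>0\<close>.\<close>
definition RI :: "nat \<Rightarrow> nat set \<Rightarrow> 'k::field kop \<Rightarrow> (nat \<Rightarrow> 'k ratfun) \<Rightarrow> nat \<Rightarrow> 'k ratfun" where
  "RI n I A f k = rho n I A (extZ I f) (enumZ I k)"

text \<open>The image moves points only along coordinates in \<open>I\<close>, so values on
  \<open>Zs I\<close> depend on values on \<open>Zs I\<close> alone. This makes the restriction in
  \<open>RI\<close> multiplicative.\<close>

lemma rep_local:
  assumes "rep n I A B" "\<And>a. a \<in> Zs I \<Longrightarrow> g a = g' a"
  shows "a \<in> Zs I \<Longrightarrow> B g a = B g' a"
  using assms(1)
proof (induction arbitrary: a)
  case (rep_add p q A B c)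
  have "(\<lambda>k. a k - res I p k + res I q k) \<in> Zs I"
    using rep_add(5) by (auto simp: Zs_def supp_in_def res_def)
  then have "g (\<lambda>k. a k - res I p k + res I q k) = g' (\<lambda>k. a k - res I p k + res I q k)" by (rule assms(2))
  then have "Gop {} (res I p) (res I q) g a = Gop {} (res I p) (res I q) g' a" by (simp only: Gop_def)
  then show ?case using rep_add by (simp add: opadd_def opsmul_def Hop_def)
qed (simp add: opzero_def)

lemma rep_outside:
  assumes "rep n I A B" "\<And>a. a \<notin> Zs I \<Longrightarrow> g a = 0"
  shows "a \<notin> Zs I \<Longrightarrow> B g a = 0"
  using assms(1)
proof (induction arbitrary: a)
  case (rep_add p q A B c)
  have "(\<lambda>k. a k - res I p k + res I q k) \<notin> Zs I"
    using rep_add(5) by (auto simp: Zs_def supp_in_def res_def)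
  then have "g (\<lambda>k. a k - res I p k + res I q k) = 0" by (rule assms(2))
  then have "Gop {} (res I p) (res I q) g a = 0" by (simp only: Gop_def if_cancel)
  then show ?case using rep_add by (simp add: opadd_def opsmul_def Hop_def)
qed (simp add: opzero_def)

lemma RI_comp:
  assumes I: "finite I" "I \<noteq> {}" and A: "A \<in> Sn n" "B \<in> Sn n"
  shows "RI n I (A \<circ> B) = RI n I A \<circ> RI n I B"
proof (intro ext)
  fix f k
  have "rho n I A (extZ I (RI n I B f)) (enumZ I k) = rho n I A (rho n I B (extZ I f)) (enumZ I k)"
    by (rule rep_local[OF rho_rep[OF A(1)] _ enumZ(1)[OF I]]) (simp add: extZ_def[of I "RI n I B f"] RI_def enumZ[OF I])
  then show "RI n I (A \<circ> B) f k = (RI n I A \<circ> RI n I B) f k"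
    by (simp add: RI_def rho_comp[OF A])
qed

lemma RI_id: "finite I \<Longrightarrow> I \<noteq> {} \<Longrightarrow> RI n I id = id"
  by (simp add: RI_def rho_id extZ_def enumZ fun_eq_iff)

lemma RI_opadd: "A \<in> Sn n \<Longrightarrow> B \<in> Sn n \<Longrightarrow> RI n I (opadd A B) f k = RI n I A f k + RI n I B f k"
  by (simp add: RI_def rho_opadd) (simp add: opadd_def)

lemma RI_opsub: "A \<in> Sn n \<Longrightarrow> B \<in> Sn n \<Longrightarrow> RI n I (opsub A B) f k = RI n I A f k - RI n I B f k"
  by (simp add: RI_def rho_opsub) (simp add: opsub_def)

lemma RI_opsmul: "A \<in> Sn n \<Longrightarrow> RI n I (opsmul c A) f k = emb c * RI n I A f k"
  by (simp add: RI_def rho_opsmul) (simp add: opsmul_def)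

lemma RI_opzero: "RI n I opzero f k = 0"
  by (simp add: RI_def rho_opzero) (simp add: opzero_def)

lemma res_Zs: "res I p \<in> Zs I"
  by (simp add: Zs_def supp_in_def res_def)

text \<open>For \<open>I' = I\<close> the idempotent leaves a single point of N^I, so the symbol is
  a matrix unit times a Laurent monomial.\<close>

lemma RI_Gop:
  assumes I: "finite I" "I \<noteq> {}" and I': "I' \<subseteq> {1..n}" "supp_in {1..n} p" "supp_in {1..n} q"
  shows "\<not> I' \<subseteq> I \<Longrightarrow> RI n I (Gop I' p q) f k = 0"
    "I' = I \<Longrightarrow> RI n I (Gop I' p q) f k = (if k = idx I (res I p) then Xm n I p q * f (idx I (res I q)) else 0)"
proof -
  show "RI n I (Gop I' p q) f k = 0" if "\<not> I' \<subseteq> I"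
    using that by (simp add: RI_def rho_Gop[OF I'] opzero_def)
  assume eq: "I' = I"
  define a where "a = enumZ I k"
  have a: "a \<in> Zs I" "k = idx I a" unfolding a_def using enumZ[OF I] by auto
  have "Gop I (res I p) (res I q) g a = (if a = res I p then g (res I q) else 0)" for g :: "(nat \<Rightarrow> nat) \<Rightarrow> 'a ratfun"
  proof (cases "a = res I p")
    case True
    have "(\<lambda>k. a k - res I p k + res I q k) = res I q" using True by simp
    then show ?thesis using True by (simp add: Gop_def)
  next
    case False
    then obtain l where l: "a l \<noteq> res I p l" by (auto simp: fun_eq_iff)
    then have "l \<in> I" using a(1) by (cases "l \<in> I") (auto simp: Zs_def supp_in_def res_def)
    then have "\<not> ((\<forall>i\<in>I. a i = res I p i) \<and> (\<forall>k. res I p k \<le> a k))" using l by blast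
    then show ?thesis unfolding Gop_def by (simp only: if_not_P False if_False)
  qed
  moreover have "a = res I p \<longleftrightarrow> k = idx I (res I p)"
  proof
    assume "k = idx I (res I p)"
    then show "a = res I p" unfolding a_def by (simp only: enumZ(3)[OF I res_Zs])
  qed (simp only: a(2))
  moreover have "extZ I f (res I q) = f (idx I (res I q))" by (simp add: extZ_def res_Zs)
  moreover have "RI n I (Gop I' p q) f k = Xm n I p q * Gop I (res I p) (res I q) (extZ I f) a"
    unfolding RI_def rho_Gop[OF I'] unfolding eq by (simp add: Hop_def opsmul_def a_def)
  ultimately show "RI n I (Gop I' p q) f k = (if k = idx I (res I p) then Xm n I p q * f (idx I (res I q)) else 0)"
    by simp
qed

section \<open>Reduced forms and the kernel of the symbols\<close>

lemma RI_sum: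
  assumes "finite P" "\<And>r. r \<in> P \<Longrightarrow> G r \<in> Sn n"
  shows "(\<lambda>f a. \<Sum>r\<in>P. C r * G r f a) \<in> Sn n \<and>
    (\<forall>f k. RI n I (\<lambda>f a. \<Sum>r\<in>P. C r * G r f a) f k = (\<Sum>r\<in>P. emb (C r) * RI n I (G r) f k))"
  using assms
proof (induction P rule: finite_induct)
  case empty
  have "(\<lambda>f a. \<Sum>r\<in>{}. C r * G r f a) = opzero" by (simp add: opzero_def)
  then show ?case by (simp only: Salg_opzero RI_opzero sum.empty) simp
next
  case (insert x P)
  let ?S = "\<lambda>f a. \<Sum>r\<in>P. C r * G r f a"
  have eq: "(\<lambda>f a. \<Sum>r\<in>insert x P. C r * G r f a) = opadd (opsmul (C x) (G x)) ?S"
    using insert by (simp add: opadd_def opsmul_def)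
  have S: "?S \<in> Sn n" "\<And>f k. RI n I ?S f k = (\<Sum>r\<in>P. emb (C r) * RI n I (G r) f k)" using insert by auto
  have x: "G x \<in> Sn n" using insert by simp
  show ?case unfolding eq using S x insert
    by (simp add: Salg.add Salg_opsmul RI_opadd RI_opsmul)
qed

text \<open>Modulo larger index sets \<open>x_k y_k = 1\<close> for \<open>k\<close> outside
  \<open>I\<close>: removing such a common factor changes the element by one with index set
  \<open>insert k I\<close>, as \<open>Gop_insert\<close> shows.\<close>

lemma Gop_reduce:
  assumes I: "I \<subseteq> {1..n}"
  shows "supp_in {1..n} p \<Longrightarrow> supp_in {1..n} q \<Longrightarrow> \<exists>p' q'. supp_in {1..n} p' \<and> supp_in {1..n} q' \<and>
    (\<forall>k. k \<notin> I \<longrightarrow> p' k = 0 \<or> q' k = 0) \<and>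
    opsub (Gop I p q) (Gop I p' q') \<in> (sp (Gens {1..n} {J. card I < card J}) :: 'k::field kop set)"
proof (induction "\<Sum>k\<in>{1..n}. p k" arbitrary: p q rule: less_induct)
  case less
  show ?case
  proof (cases "\<exists>k. k \<notin> I \<and> p k \<noteq> 0 \<and> q k \<noteq> 0")
    case False
    have "opsub (Gop I p q) (Gop I p q) = (opzero :: 'k kop)" by (simp add: opsub_def opzero_def)
    then show ?thesis using less(2,3) False sp.sp_zero by (intro exI[of _ p] exI[of _ q]) auto
  next
    case True
    then obtain k where k: "k \<notin> I" "p k \<noteq> 0" "q k \<noteq> 0" by blast
    have kn: "k \<in> {1..n}" using k(2) less(2) by (auto simp: supp_in_def)
    let ?p = "p(k := p k - 1)" and ?q = "q(k := q k - 1)"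
    have s: "supp_in {1..n} ?p" "supp_in {1..n} ?q" using less(2,3) by (auto simp: supp_in_def)
    have "(\<Sum>l\<in>{1..n}. ?p l) < (\<Sum>l\<in>{1..n}. p l)" using kn k(2) by (intro sum_strict_mono_ex1) auto
    from less(1)[OF this s] obtain p' q' where pq: "supp_in {1..n} p'" "supp_in {1..n} q'"
      "\<forall>k. k \<notin> I \<longrightarrow> p' k = 0 \<or> q' k = 0"
      "opsub (Gop I ?p ?q) (Gop I p' q') \<in> (sp (Gens {1..n} {J. card I < card J}) :: 'k kop set)" by blast
    have pp: "?p(k := Suc (?p k)) = p" "?q(k := Suc (?q k)) = q" using k by auto
    have "Gop (insert k I) ?p ?q = (opsub (Gop I ?p ?q) (Gop I p q) :: 'k kop)"
      using Gop_insert[OF k(1), of ?p ?q] unfolding pp .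
    then have "opsub (Gop I p q) (Gop I p' q') = (opsub (opsub (Gop I ?p ?q) (Gop I p' q')) (Gop (insert k I) ?p ?q) :: 'k kop)"
      by (simp add: opsub_def)
    moreover have "Gop (insert k I) ?p ?q \<in> (sp (Gens {1..n} {J. card I < card J}) :: 'k kop set)"
      using k I kn s finite_subset[OF I] by (intro sp_base GensI) auto
    ultimately have "opsub (Gop I p q) (Gop I p' q') \<in> (sp (Gens {1..n} {J. card I < card J}) :: 'k kop set)"
      using pq(4) by (simp only: sp_opsub)
    then show ?thesis using pq by blast
  qed
qed

definition reduced :: "nat \<Rightarrow> nat \<Rightarrow> nat set \<times> (nat \<Rightarrow> nat) \<times> (nat \<Rightarrow> nat) \<Rightarrow> bool" where
  "reduced n s r = (case r of (I, p, q) \<Rightarrow> I \<subseteq> {1..n} \<and> card I = s \<and> supp_in {1..n} p \<and> supp_in {1..n} q \<and>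
     (\<forall>k. k \<notin> I \<longrightarrow> p k = 0 \<or> q k = 0))"

definition Gr :: "nat set \<times> (nat \<Rightarrow> nat) \<times> (nat \<Rightarrow> nat) \<Rightarrow> 'k::field kop" where
  "Gr r = Gop (fst r) (fst (snd r)) (snd (snd r))"

lemma reduced_form:
  fixes A :: "'k::field kop"
  assumes "A \<in> sp (Gens {1..n} {I. s \<le> card I})"
  shows "\<exists>P C A'. finite P \<and> (\<forall>r\<in>P. reduced n s r) \<and> A' \<in> sp (Gens {1..n} {I. s < card I}) \<and>
    A = opadd (\<lambda>f a. \<Sum>r\<in>P. C r * Gr r f a) A'"
  using assms
proof induction
  case sp_zero
  have "opzero = opadd (\<lambda>f a. \<Sum>r\<in>{}. (0 :: 'k) * Gr r f a) opzero" by (simp add: opadd_def opzero_def)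
  then show ?case using sp.sp_zero by (intro exI[of _ "{}"] exI[of _ "\<lambda>_. 0"] exI[of _ opzero]) auto
next
  case (sp_add g A c)
  obtain P C A' where h: "finite P" "\<forall>r\<in>P. reduced n s r" "A' \<in> sp (Gens {1..n} {I. s < card I})"
    "A = opadd (\<lambda>f a. \<Sum>r\<in>P. C r * Gr r f a) A'" using sp_add.IH by (elim exE conjE)
  obtain I p q where g: "g = Gop I p q" "s \<le> card I" "I \<subseteq> {1..n}" "supp_in {1..n} p" "supp_in {1..n} q"
    using sp_add(1) unfolding Gens_def by blast
  show ?case
  proof (cases "s < card I")
    case True
    have "g \<in> sp (Gens {1..n} {I. s < card I})" using g True by (auto intro!: sp_base GensI)
    then have A'': "opadd (opsmul c g) A' \<in> sp (Gens {1..n} {I. s < card I})" using h(3) by (intro sp_opadd sp_opsmul)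
    have "opadd (opsmul c g) A = opadd (\<lambda>f a. \<Sum>r\<in>P. C r * Gr r f a) (opadd (opsmul c g) A')"
      unfolding h(4) by (simp add: opadd_def algebra_simps)
    then show ?thesis using h(1,2) A'' by blast
  next
    case False
    then have s: "card I = s" using g(2) by simp
    obtain p' q' where pq: "supp_in {1..n} p'" "supp_in {1..n} q'" "\<forall>k. k \<notin> I \<longrightarrow> p' k = 0 \<or> q' k = 0"
      "opsub g (Gop I p' q') \<in> (sp (Gens {1..n} {J. s < card J}))"
      using Gop_reduce[OF g(3-5)] unfolding g(1) s by blast
    define r where "r = (I, p', q')"
    have Gr: "Gr r = (Gop I p' q' :: 'k kop)" by (simp add: Gr_def r_def)
    have red: "reduced n s r" using pq g s by (simp add: reduced_def r_def)
    define D where "D = (\<lambda>u. if u \<in> P then C u else 0)"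
    define E where "E = D(r := D r + c)"
    have 1: "(\<Sum>u\<in>P. C u * G u) = (\<Sum>u\<in>insert r P. D u * G u)" for G :: "_ \<Rightarrow> 'k"
      using h(1) by (intro sum.mono_neutral_cong_left) (auto simp: D_def)
    have 2: "(\<Sum>u\<in>insert r P. E u * G u) = c * G r + (\<Sum>u\<in>insert r P. D u * G u)" for G :: "_ \<Rightarrow> 'k"
      using h(1) by (simp add: sum.insert_remove E_def algebra_simps)
    have "opadd (opsmul c g) A = opadd (\<lambda>f a. \<Sum>r\<in>insert r P. E r * Gr r f a) (opadd (opsmul c (opsub g (Gop I p' q'))) A')"
      unfolding h(4) 2 Gr by (simp add: opadd_def opsmul_def opsub_def 1 algebra_simps)
    moreover have "opadd (opsmul c (opsub g (Gop I p' q'))) A' \<in> sp (Gens {1..n} {I. s < card I})"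
      using pq(4) h(3) by (intro sp_opadd sp_opsmul)
    moreover have "finite (insert r P)" "\<forall>r\<in>insert r P. reduced n s r" using h red by auto
    ultimately show ?thesis by blast
  qed
qed

lemma Gr_Sn: "reduced n s r \<Longrightarrow> Gr r \<in> Sn n"
  by (auto simp: reduced_def Gr_def split: prod.splits intro!: Gop_Salg)

lemma RI_high:
  assumes I: "finite I" "I \<noteq> {}" and A: "A \<in> sp (Gens {1..n} U)" and U: "\<And>J. J \<in> U \<Longrightarrow> \<not> J \<subseteq> I"
  shows "RI n I A f k = 0"
  using A
proof induction
  case (sp_add g A c)
  then obtain J p q where g: "g = Gop J p q" "J \<in> U" "J \<subseteq> {1..n}" "supp_in {1..n} p" "supp_in {1..n} q"
    unfolding Gens_def by blast
  have "g \<in> Sn n" "A \<in> Sn n" using g sp_add(2) sp_Gens_Salg[of "{1..n}" U] by (auto intro: Gop_Salg)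
  then show ?case using sp_add.IH RI_Gop(1)[OF I g(3-5) U[OF g(2)], of f k]
    by (simp add: RI_opadd RI_opsmul Salg_opsmul g(1))
qed (simp add: RI_opzero)

text \<open>One matrix entry of the symbol collects the terms that agree with \<open>r0\<close> on
  \<open>I\<close>. Outside \<open>I\<close> these are separated by their Laurent monomials, since a
  reduced pair \<open>(p, q)\<close> is determined by the difference \<open>p - q\<close>.\<close>

lemma reduced_coeff_zero:
  fixes C :: "_ \<Rightarrow> 'k::field"
  assumes P: "finite P" "\<forall>r\<in>P. reduced n s r" and s: "0 < s" and r0: "r0 \<in> P" "fst r0 = I"
    and z: "\<And>f k. (\<Sum>r\<in>P. emb (C r) * RI n I (Gr r) f k) = 0"
  shows "C r0 = 0"
proof -
  obtain p0 q0 where r0': "r0 = (I, p0, q0)" using r0(2) by (cases r0) auto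
  have I: "I \<subseteq> {1..n}" "card I = s" using P(2) r0 by (auto simp: r0' reduced_def)
  have fI: "finite I" "I \<noteq> {}" using I s finite_subset[OF I(1)] by auto
  define T where "T = {1..n} - I"
  define Q where "Q = {r \<in> P. fst r = I \<and> res I (fst (snd r)) = res I p0 \<and> res I (snd (snd r)) = res I q0}"
  have Q: "finite Q" "r0 \<in> Q" using P r0 by (auto simp: Q_def r0')
  have idx_eq: "idx I (res I p) = idx I (res I p') \<longleftrightarrow> res I p = res I p'" for p p'
    using enumZ(3)[OF fI res_Zs] by metis
  have "emb (C r) * RI n I (Gr r) (uvec (idx I (res I q0))) (idx I (res I p0))
     = (if r \<in> Q then emb (C r) * Xm n I (fst (snd r)) (snd (snd r)) else 0)" if r: "r \<in> P" for r
  proof -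
    obtain J p q where rJ: "r = (J, p, q)" by (cases r)
    have J: "J \<subseteq> {1..n}" "card J = s" "supp_in {1..n} p" "supp_in {1..n} q" using P(2) r by (auto simp: rJ reduced_def)
    show ?thesis
    proof (cases "J = I")
      case True
      have "RI n I (Gr r) (uvec (idx I (res I q0))) (idx I (res I p0))
          = (if res I p0 = res I p then Xm n I p q * (if res I q = res I q0 then 1 else 0) else (0 :: 'k ratfun))"
        using RI_Gop(2)[OF fI J(1,3,4) True, of "uvec (idx I (res I q0))" "idx I (res I p0)"]
        unfolding uvec_def idx_eq by (simp add: rJ Gr_def)
      then show ?thesis using r True by (auto simp: rJ Q_def)
    next
      case False
      have "\<not> J \<subseteq> I"
      proof
        assume "J \<subseteq> I"
        from card_subset_eq[OF fI(1) this] False show False by (simp add: J(2) I(2))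
      qed
      then show ?thesis using False by (simp add: rJ Gr_def Q_def RI_Gop(1)[OF fI J(1,3,4)])
    qed
  qed
  then have "0 = (\<Sum>r\<in>P. if r \<in> Q then emb (C r) * Xm n I (fst (snd r)) (snd (snd r)) else 0)"
    using z[of "uvec (idx I (res I q0))" "idx I (res I p0)"] by simp
  also have "\<dots> = (\<Sum>r\<in>Q. emb (C r) * Xm n I (fst (snd r)) (snd (snd r)))"
    using P(1) by (intro sum.mono_neutral_cong_right) (auto simp: Q_def)
  finally have sum0: "(\<Sum>r\<in>Q. emb (C r) * Xm n I (fst (snd r)) (snd (snd r))) = 0" by simp
  \<comment> \<open>Multiplication by the \<open>M\<close>-th power of all variables makes the
    Laurent monomials ordinary ones, for which \<open>Xv_monomials_indep\<close> applies;
    \<open>M\<close> bounds every \<open>q\<close> that occurs.\<close>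
  define M where "M = (\<Sum>r\<in>Q. \<Sum>k\<in>T. snd (snd r) k)"
  have M: "snd (snd r) k \<le> M" if "r \<in> Q" "k \<in> T" for r k
  proof -
    have "snd (snd r) k \<le> (\<Sum>k\<in>T. snd (snd r) k)" using that by (intro member_le_sum) (auto simp: T_def)
    also have "\<dots> \<le> M" unfolding M_def using that Q
      by (intro member_le_sum[where f = "\<lambda>r. \<Sum>k\<in>T. snd (snd r) k"]) auto
    finally show ?thesis .
  qed
  define e where "e = (\<lambda>r :: nat set \<times> (nat \<Rightarrow> nat) \<times> (nat \<Rightarrow> nat). res T (\<lambda>k. fst (snd r) k + M - snd (snd r) k))"
  have inj: "inj_on e Q"
  proof (rule inj_onI)
    fix r r' assume rr: "r \<in> Q" "r' \<in> Q" "e r = e r'"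
    obtain p q where r: "r = (I, p, q)" using rr(1) by (cases r) (auto simp: Q_def)
    obtain p' q' where r': "r' = (I, p', q')" using rr(2) by (cases r') (auto simp: Q_def)
    have R: "reduced n s r" "reduced n s r'" using rr P by (auto simp: Q_def)
    have "p k = p' k \<and> q k = q' k" for k
    proof -
      consider "k \<in> I" | "k \<in> T" | "k \<notin> {1..n}" by (auto simp: T_def)
      then show ?thesis
      proof cases
        case 1
        have "res I p = res I p'" "res I q = res I q'" using rr by (auto simp: Q_def r r')
        then have "res I p k = res I p' k" "res I q k = res I q' k" by simp_all
        then show ?thesis using 1 by (simp add: res_def)
      next
        case 2
        have "p k + M - q k = p' k + M - q' k" using fun_cong[OF rr(3), of k] 2 by (simp add: e_def r r' res_def)
        moreover have "p k = 0 \<or> q k = 0" "p' k = 0 \<or> q' k = 0" using R 2 by (auto simp: reduced_def r r' T_def)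
        moreover have "q k \<le> M" "q' k \<le> M" using M[OF rr(1) 2] M[OF rr(2) 2] by (auto simp: r r')
        ultimately show ?thesis by linarith
      next
        case 3
        then show ?thesis using R by (auto simp: reduced_def r r' supp_in_def)
      qed
    qed
    then show "r = r'" by (auto simp: r r' fun_eq_iff)
  qed
  have X: "Xm n I (fst (snd r)) (snd (snd r)) * (\<Prod>k\<in>T. Xv k ^ M) = (\<Prod>k\<in>T. Xv k ^ e r k :: 'k ratfun)" if "r \<in> Q" for r
    unfolding Xm_def T_def[symmetric] prod.distrib[symmetric]
  proof (intro prod.cong refl)
    fix k assume k: "k \<in> T"
    have "e r k + snd (snd r) k = fst (snd r) k + M" using M[OF that k] k by (simp add: e_def res_def)
    then have "Xv k ^ e r k * Xv k ^ snd (snd r) k = (Xv k ^ fst (snd r) k * Xv k ^ M :: 'k ratfun)"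
      by (simp only: flip: power_add)
    then show "Xv k ^ fst (snd r) k / Xv k ^ snd (snd r) k * Xv k ^ M = (Xv k ^ e r k :: 'k ratfun)"
      by (simp add: field_simps Xv_nz)
  qed
  have "(\<Sum>d\<in>e ` Q. emb (C (the_inv_into Q e d)) * (\<Prod>k\<in>T. Xv k ^ d k))
      = (\<Sum>r\<in>Q. emb (C r) * (\<Prod>k\<in>T. Xv k ^ e r k))"
    by (subst sum.reindex[OF inj]) (auto simp: the_inv_into_f_f[OF inj])
  also have "\<dots> = (\<Sum>r\<in>Q. emb (C r) * Xm n I (fst (snd r)) (snd (snd r)) * (\<Prod>k\<in>T. Xv k ^ M))"
    by (intro sum.cong refl) (simp only: X[symmetric] mult.assoc)
  also have "\<dots> = 0" by (simp add: sum0 flip: sum_distrib_right)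
  finally have z: "(\<Sum>d\<in>e ` Q. emb (C (the_inv_into Q e d)) * (\<Prod>k\<in>T. Xv k ^ d k)) = 0" .
  define D where "D = (\<lambda>d. C (the_inv_into Q e d))"
  have "D (e r0) = 0"
  proof (rule Xv_monomials_indep[of T "e ` Q" D "e r0"])
    show "(\<Sum>d\<in>e ` Q. emb (D d) * (\<Prod>k\<in>T. Xv k ^ d k)) = 0" unfolding D_def by (rule z)
  qed (use Q in \<open>auto simp: T_def e_def res_def\<close>)
  then have "C (the_inv_into Q e (e r0)) = 0" unfolding D_def .
  then show ?thesis using the_inv_into_f_f[OF inj Q(2)] by simp
qed

text \<open>At a set \<open>I\<close> of size \<open>s\<close> the symbol sees only the reduced
  terms with index set \<open>I\<close>; those of other index sets of size at least \<open>s\<close>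
  vanish. The choice \<open>J = UNIV\<close> gives the descent to the next ideal, and the subsets of
  one set are the choice for the index relation.\<close>

lemma RI_kernel:
  fixes A :: "'k::field kop"
  assumes A: "A \<in> sp (Gens {1..n} {I. s \<le> card I})" and s: "0 < s"
    and z: "\<And>I f k. I \<in> J \<Longrightarrow> I \<subseteq> {1..n} \<Longrightarrow> card I = s \<Longrightarrow> RI n I A f k = 0"
  shows "A \<in> sp (Gens {1..n} {I. s < card I \<or> card I = s \<and> I \<notin> J})"
proof -
  let ?U = "{I. s < card I \<or> card I = s \<and> I \<notin> J}"
  obtain P C A' where h: "finite P" "\<forall>r\<in>P. reduced n s r" "A' \<in> sp (Gens {1..n} {I. s < card I})"
    "A = opadd (\<lambda>f a. \<Sum>r\<in>P. C r * Gr r f a) A'" using reduced_form[OF A] by (elim exE conjE)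
  have GS: "Gr r \<in> Sn n" if "r \<in> P" for r using h(2) that Gr_Sn by blast
  have A'S: "A' \<in> Sn n" using h(3) sp_Gens_Salg[of "{1..n}"] by blast
  have C0: "C r = 0" if r: "r \<in> P" "fst r \<in> J" for r
  proof (rule reduced_coeff_zero[OF h(1,2) s r(1) refl])
    fix f k
    have "reduced n s r" using h(2) r by blast
    then have I: "fst r \<subseteq> {1..n}" "card (fst r) = s" by (cases r; simp add: reduced_def)+
    then have fI: "finite (fst r)" "fst r \<noteq> {}" using s finite_subset[OF I(1)] by auto
    have "RI n (fst r) A' f k = 0"
    proof (rule RI_high[OF fI h(3)])
      fix J :: "nat set" assume "J \<in> {I. s < card I}"
      then show "\<not> J \<subseteq> fst r" using card_mono[OF fI(1), of J] I(2) by auto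
    qed
    moreover have "RI n (fst r) A f k = 0" using z r I by blast
    ultimately show "(\<Sum>u\<in>P. emb (C u) * RI n (fst r) (Gr u) f k) = 0"
      using RI_sum[where I = "fst r" and C = C and G = Gr, OF h(1) GS] A'S by (simp add: h(4) RI_opadd)
  qed
  then have eq: "(\<lambda>f a. \<Sum>r\<in>P. C r * Gr r f a) = (\<lambda>f a. \<Sum>r\<in>{r\<in>P. fst r \<notin> J}. C r * (Gr r :: 'k kop) f a)"
    using h(1) by (intro ext sum.mono_neutral_right) (auto simp: C0)
  have "(\<lambda>f a. \<Sum>r\<in>P'. C r * Gr r f a) \<in> sp (Gens {1..n} ?U)" if "finite P'" "P' \<subseteq> {r\<in>P. fst r \<notin> J}" for P'
    using that
  proof (induction P' rule: finite_induct)
    case empty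
    have "(\<lambda>f a. \<Sum>r\<in>{}. C r * Gr r f a) = (opzero :: 'k kop)" by (simp add: opzero_def)
    then show ?case by (simp only: sp.sp_zero)
  next
    case (insert x P')
    have eq: "(\<lambda>f a. \<Sum>r\<in>insert x P'. C r * Gr r f a) = (opadd (opsmul (C x) (Gr x)) (\<lambda>f a. \<Sum>r\<in>P'. C r * Gr r f a) :: 'k kop)"
      using insert by (simp add: opadd_def opsmul_def)
    have "reduced n s x" "fst x \<notin> J" using insert h(2) by auto
    then have "(Gr x :: 'k kop) \<in> Gens {1..n} ?U"
      by (auto simp: Gr_def reduced_def split: prod.splits intro!: GensI)
    then show ?case unfolding eq using insert by (intro sp.sp_add) auto
  qed
  then have 1: "(\<lambda>f a. \<Sum>r\<in>P. C r * Gr r f a) \<in> sp (Gens {1..n} ?U)" unfolding eq using h(1) by simp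
  have "Gens {1..n} {I. s < card I} \<subseteq> (Gens {1..n} ?U :: 'k kop set)" by (auto simp: Gens_def)
  then have "sp (Gens {1..n} {I. s < card I}) \<subseteq> (sp (Gens {1..n} ?U) :: 'k kop set)" by (intro sp_mono) (auto intro: sp_base)
  then have 2: "A' \<in> sp (Gens {1..n} ?U)" using h(3) by (rule subsetD)
  show ?thesis unfolding h(4) by (rule sp_opadd[OF 1 2])
qed

subsection \<open>The filtration of the unit group\<close>

text \<open>Index sets are united under multiplication, so this closure makes the span of
  \<open>Gens {1..n} U\<close> an ideal.\<close>

definition upc :: "nat \<Rightarrow> nat set set \<Rightarrow> bool" where
  "upc n U \<longleftrightarrow> (\<forall>I J. I \<in> U \<longrightarrow> I \<subseteq> {1..n} \<longrightarrow> J \<subseteq> {1..n} \<longrightarrow> I \<union> J \<in> U)"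

lemma upc_card: "upc n {I. s \<le> card I}"
  unfolding upc_def
proof (intro allI impI)
  fix I J :: "nat set" assume h: "I \<in> {I. s \<le> card I}" "I \<subseteq> {1..n}" "J \<subseteq> {1..n}"
  have "card I \<le> card (I \<union> J)" using h finite_subset[of _ "{1..n}"] by (intro card_mono) auto
  then show "I \<union> J \<in> {I. s \<le> card I}" using h by auto
qed

lemma upc_mem: "upc n {I. k \<in> I}" and upc_super: "upc n {I. I0 \<subseteq> I}"
  by (auto simp: upc_def)

lemma ideal_left: "upc n U \<Longrightarrow> A \<in> Sn n \<Longrightarrow> B \<in> sp (Gens {1..n} U) \<Longrightarrow> A \<circ> B \<in> sp (Gens {1..n} U)"
  by (rule Gens_comp[OF Salg_sp]) (auto simp: upc_def)

lemma sp_Sn: "A \<in> sp (Gens {1..n} U) \<Longrightarrow> A \<in> Sn n"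
  using sp_Gens_Salg[of "{1..n}" U] by (auto simp del: One_nat_def)

lemma inv_unit:
  assumes "u \<circ> v = id" "v \<circ> u = id"
  shows "inv_into UNIV u = v"
  by (rule inv_unique_comp[OF assms])

lemma units_in_id: "(id :: 'k::field kop) \<in> units_in n (sp (Gens {1..n} U))"
proof -
  have "opsub id id = (opzero :: 'k kop)" by (simp add: opsub_def opzero_def)
  then show ?thesis unfolding units_in_def by (auto simp: Salg_id sp.sp_zero)
qed

lemma units_in_comp:
  fixes u v :: "'k::field kop"
  assumes U: "upc n U" and u: "u \<in> units_in n (sp (Gens {1..n} U))" "v \<in> units_in n (sp (Gens {1..n} U))"
  shows "u \<circ> v \<in> units_in n (sp (Gens {1..n} U))"
proof -
  obtain u' where u': "u \<in> Sn n" "opsub u id \<in> sp (Gens {1..n} U)" "u' \<in> Sn n" "u \<circ> u' = id" "u' \<circ> u = id"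
    using u(1) unfolding units_in_def by blast
  obtain v' where v': "v \<in> Sn n" "opsub v id \<in> sp (Gens {1..n} U)" "v' \<in> Sn n" "v \<circ> v' = id" "v' \<circ> v = id"
    using u(2) unfolding units_in_def by blast
  have "opsub (u \<circ> v) id = opadd (u \<circ> opsub v id) (opsub u id)"
    unfolding op_comp_right_sub[OF linear_Salg[OF u'(1)]] by (simp add: opsub_def opadd_def fun_eq_iff)
  then have 1: "opsub (u \<circ> v) id \<in> sp (Gens {1..n} U)"
    using ideal_left[OF U u'(1) v'(2)] u'(2) by (simp only: sp_opadd)
  have 2: "(u \<circ> v) \<circ> (v' \<circ> u') = u \<circ> (v \<circ> v') \<circ> u'" "(v' \<circ> u') \<circ> (u \<circ> v) = v' \<circ> (u' \<circ> u) \<circ> v"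
    by (simp_all only: o_assoc)
  have "(u \<circ> v) \<circ> (v' \<circ> u') = id" "(v' \<circ> u') \<circ> (u \<circ> v) = id"
    unfolding 2 by (simp_all only: v' u' comp_id)
  then show ?thesis using 1 Salg.mult[OF u'(1) v'(1)] Salg.mult[OF v'(3) u'(3)] unfolding units_in_def by blast
qed

lemma units_in_inverse:
  fixes u :: "'k::field kop"
  assumes U: "upc n U" and u: "u \<in> units_in n (sp (Gens {1..n} U))"
  shows "inv_into UNIV u \<in> units_in n (sp (Gens {1..n} U))" "u \<circ> inv_into UNIV u = id" "inv_into UNIV u \<circ> u = id"
proof -
  obtain v where v: "u \<in> Sn n" "opsub u id \<in> sp (Gens {1..n} U)" "v \<in> Sn n" "u \<circ> v = id" "v \<circ> u = id"
    using u unfolding units_in_def by blast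
  have i: "inv_into UNIV u = v" by (rule inv_unit[OF v(4,5)])
  have "opsub v id = opsmul (- 1) (v \<circ> opsub u id)"
    unfolding op_comp_right_sub[OF linear_Salg[OF v(3)]] v(5) by (simp add: opsub_def opsmul_def fun_eq_iff)
  then have "opsub v id \<in> sp (Gens {1..n} U)" using ideal_left[OF U v(3,2)] by (simp only: sp_opsmul)
  then show "inv_into UNIV u \<in> units_in n (sp (Gens {1..n} U))" unfolding i units_in_def using v by blast
  show "u \<circ> inv_into UNIV u = id" "inv_into UNIV u \<circ> u = id" unfolding i by (rule v(4), rule v(5))
qed

lemma units_in_Sn: "u \<in> units_in n b \<Longrightarrow> u \<in> Sn n"
  by (simp add: units_in_def)

lemma sp_Gens_mono:
  assumes "\<And>I. I \<in> U \<Longrightarrow> I \<subseteq> {1..n} \<Longrightarrow> I \<in> V"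
  shows "sp (Gens {1..n} U) \<subseteq> (sp (Gens {1..n} V) :: 'k::field kop set)"
proof (rule sp_mono)
  show "Gens {1..n} U \<subseteq> (sp (Gens {1..n} V) :: 'k kop set)"
  proof
    fix g :: "'k kop" assume "g \<in> Gens {1..n} U"
    then obtain I p q where "g = Gop I p q" "I \<in> U" "I \<subseteq> {1..n}" "supp_in {1..n} p" "supp_in {1..n} q"
      unfolding Gens_def by blast
    then show "g \<in> sp (Gens {1..n} V)" using assms by (auto intro!: sp_base GensI simp del: One_nat_def)
  qed
qed

lemma units_in_mono: "b \<subseteq> b' \<Longrightarrow> units_in n b \<subseteq> units_in n b'"
  by (auto simp: units_in_def)

text \<open>The group \<open>(1 + p\<^sub>n)\<^sup>*\<^sub>s\<close>, with both ideals given by their spanning sets.\<close>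
definition Gs :: "nat \<Rightarrow> nat \<Rightarrow> 'k::field kop set" where
  "Gs n s = units_in n (sp (Gens {1..n} {I. n \<in> I})) \<inter> units_in n (sp (Gens {1..n} {I. s \<le> card I}))"

lemma units_pn_s_Gs: "0 < n \<Longrightarrow> units_pn_s n s = Gs n s"
  unfolding units_pn_s_def Gs_def by (simp add: aa_eq pp_eq)

lemma Gs_id: "id \<in> Gs n s"
  by (simp add: Gs_def units_in_id del: One_nat_def)

lemma Gs_comp: "u \<in> Gs n s \<Longrightarrow> v \<in> Gs n s \<Longrightarrow> u \<circ> v \<in> Gs n s"
  unfolding Gs_def by (intro IntI units_in_comp upc_card upc_mem) auto

lemma Gs_inverse:
  assumes "u \<in> Gs n s"
  shows "inv_into UNIV u \<in> Gs n s" "u \<circ> inv_into UNIV u = id" "inv_into UNIV u \<circ> u = id"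
  using assms units_in_inverse[OF upc_card] units_in_inverse[OF upc_mem] unfolding Gs_def by blast+

lemma Gs_mono: "s \<le> t \<Longrightarrow> Gs n t \<subseteq> Gs n s"
  unfolding Gs_def by (intro Int_mono order_refl units_in_mono sp_Gens_mono) auto

lemma Gs_Sn: "u \<in> Gs n s \<Longrightarrow> u \<in> Sn n"
  by (simp add: Gs_def units_in_def)

lemma GsI:
  assumes "u \<in> Sn n" "v \<in> Sn n" "u \<circ> v = id" "v \<circ> u = id" "opsub u id \<in> sp (Gens {1..n} {I. n \<in> I \<and> s \<le> card I})"
  shows "u \<in> Gs n s"
proof -
  have "opsub u id \<in> sp (Gens {1..n} {I. n \<in> I})" "opsub u id \<in> sp (Gens {1..n} {I. s \<le> card I})"
    using assms(5) sp_Gens_mono[of "{I. n \<in> I \<and> s \<le> card I}" n "{I. n \<in> I}"]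
      sp_Gens_mono[of "{I. n \<in> I \<and> s \<le> card I}" n "{I. s \<le> card I}"] by (auto simp del: One_nat_def)
  then show ?thesis using assms(1-4) unfolding Gs_def units_in_def by blast
qed

lemma subset_card_eq: "I \<subseteq> {1..n} \<Longrightarrow> card J = card I \<Longrightarrow> J \<subseteq> I \<Longrightarrow> J = (I :: nat set)"
  using card_subset_eq[OF finite_subset[OF _ finite_atLeastAtMost]] by blast

text \<open>Every spanning element of \<open>p_n\<close> contains \<open>e_n\<close>, which a symbol
  at a set without \<open>n\<close> sends to 0.\<close>

lemma RI_Gs_id:
  assumes u: "u \<in> Gs n s" and I: "finite I" "I \<noteq> {}" "n \<notin> I"
  shows "RI n I u = id"
proof (intro ext)
  fix f k
  have z: "RI n I (opsub u id) f k = 0"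
    using u unfolding Gs_def units_in_def by (intro RI_high[OF I(1,2), of _ n "{I. n \<in> I}"]) (use I(3) in auto)
  then show "RI n I u f k = id f k"
    using RI_opsub[OF Gs_Sn[OF u] Salg_id, of I f k] by (simp add: RI_id[OF I(1,2)])
qed

section \<open>Symbols of units are invertible Laurent matrices\<close>

definition Lr :: "nat \<Rightarrow> nat set \<Rightarrow> 'k::field ratfun set" where
  "Lr n I = Lau (range emb) (map Xv (sorted_list_of_set ({1..n} - I)))"

lemma indep_Lr: "indep (range emb) (map Xv (sorted_list_of_set ({1..n} - I)) :: 'k::field ratfun list)"
  using emb_Kwo by (intro indep_Xv[OF subfield_subring[OF emb_subfield]]) auto

lemma Lr_props:
  fixes c :: "'a::field"
  shows "is_subring (Lr n I :: 'a ratfun set)" "emb c \<in> Lr n I"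
    "k \<in> {1..n} - I \<Longrightarrow> Xv k \<in> (Lr n I :: 'a ratfun set)"
    "k \<in> {1..n} - I \<Longrightarrow> inverse (Xv k) \<in> (Lr n I :: 'a ratfun set)"
proof -
  have nz: "(0 :: 'a ratfun) \<notin> set (map Xv (sorted_list_of_set ({1..n} - I)))" by (auto simp: Xv_nz)
  note P = Lau_props[OF subfield_subring[OF emb_subfield] nz]
  show "is_subring (Lr n I :: 'a ratfun set)" unfolding Lr_def by (rule P(1))
  show "emb c \<in> Lr n I" unfolding Lr_def by (rule subsetD[OF P(2) rangeI])
  assume "k \<in> {1..n} - I"
  then have "Xv k \<in> set (map Xv (sorted_list_of_set ({1..n} - I)) :: 'a ratfun list)" by simp
  from P(3)[OF this] show "Xv k \<in> (Lr n I :: 'a ratfun set)" "inverse (Xv k) \<in> (Lr n I :: 'a ratfun set)"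
    unfolding Lr_def by (rule conjunct1, rule conjunct2)
qed

lemma Xm_Lr: "Xm n I p q \<in> Lr n I"
  unfolding Xm_def divide_inverse power_inverse[symmetric]
  by (intro subring_prod subring_mult subring_power Lr_props)

lemma isblk_add_unit:
  assumes R: "is_subring R" and g: "isblk N R g" and ij: "i < N" "j < N" and x: "x \<in> R"
  shows "isblk N R (\<lambda>f k. g f k + (if k = i then x * f j else 0))"
  unfolding isblk_def
proof (intro conjI allI impI)
  have "linear_op g" using g by (rule isblk_linear)
  then show "linear_op (\<lambda>f k. g f k + (if k = i then x * f j else 0))"
    unfolding linear_op_def by (auto simp: fun_eq_iff algebra_simps)
  show "g f k + (if k = i then x * f j else 0) = f k" if "N \<le> k" for f k
    using isblk_outside[OF g that] that ij by simp
  show "g f k + (if k = i then x * f j else 0) = g h k + (if k = i then x * h j else 0)"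
    if "\<forall>j<N. f j = h j" "k < N" for f h k
    using isblk_local[OF g, of f h k] that ij by simp
  show "g (uvec l) k + (if k = i then x * uvec l j else 0) \<in> R" for k l
    using isblk_entry[OF R g] x R by (auto simp: uvec_def intro: subring_add subring_0)
qed

lemma RI_isblk:
  fixes A :: "'k::field kop"
  assumes I: "finite I" "I \<noteq> {}" "I \<subseteq> {1..n}" and A: "A \<in> sp (Gens {1..n} {J. card I \<le> card J})"
  shows "\<exists>N. isblk N (Lr n I) (\<lambda>f k. f k + RI n I A f k)"
  using A
proof induction
  case sp_zero
  have "(\<lambda>f k. f k + RI n I (opzero :: 'k kop) f k) = id" by (simp add: RI_opzero fun_eq_iff)
  then show ?case by (intro exI[of _ 0]) (simp only: isblk_id[OF Lr_props(1)])
next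
  case (sp_add g A c)
  obtain N where N: "isblk N (Lr n I) (\<lambda>f k. f k + RI n I A f k)" using sp_add.IH by blast
  obtain J p q where g: "g = Gop J p q" "card I \<le> card J" "J \<subseteq> {1..n}" "supp_in {1..n} p" "supp_in {1..n} q"
    using sp_add(1) unfolding Gens_def by blast
  have S: "g \<in> Sn n" "A \<in> Sn n" using g sp_Sn[OF sp_add(2)] by (auto intro: Gop_Salg)
  have eq: "(\<lambda>f k. f k + RI n I (opadd (opsmul c g) A) f k) = (\<lambda>f k. (f k + RI n I A f k) + emb c * RI n I g f k)"
    by (simp only: RI_opadd[OF Salg_opsmul[OF S(1)] S(2)] RI_opsmul[OF S(1)] ac_simps)
  show ?case
  proof (cases "J = I")
    case False
    have nJ: "\<not> J \<subseteq> I"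
    proof
      assume J: "J \<subseteq> I"
      then have "card J = card I" using card_mono[OF I(1) J] g(2) by simp
      then show False using subset_card_eq[OF I(3) _ J] False by simp
    qed
    show ?thesis unfolding eq unfolding g(1) RI_Gop(1)[OF I(1,2) g(3-5) nJ] using N by auto
  next
    case True
    let ?i = "idx I (res I p)" and ?j = "idx I (res I q)"
    define N' where "N' = max N (max (Suc ?i) (Suc ?j))"
    have "isblk N' (Lr n I) (\<lambda>f k. f k + RI n I A f k)"
      by (rule isblk_mono[OF Lr_props(1) N]) (simp add: N'_def)
    then have B: "isblk N' (Lr n I) (\<lambda>f k. f k + RI n I A f k + (if k = ?i then (emb c * Xm n I p q) * f ?j else 0))"
      by (rule isblk_add_unit[OF Lr_props(1)]) (auto simp: N'_def intro: subring_mult Lr_props Xm_Lr)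
    have "(\<lambda>f k. f k + RI n I A f k + emb c * RI n I g f k)
      = (\<lambda>f k. f k + RI n I A f k + (if k = ?i then (emb c * Xm n I p q) * f ?j else 0))"
      unfolding g(1) RI_Gop(2)[OF I(1,2) g(3-5) True] by (auto simp: fun_eq_iff)
    then show ?thesis unfolding eq using B by (intro exI[of _ N']) (simp only:)
  qed
qed

text \<open>The inverse unit lies in the same group, so its symbol is a block as well;
  \<open>isblk_inverse\<close> makes the two sizes equal.\<close>

lemma RI_GLop:
  fixes u :: "'k::field kop"
  assumes I: "I \<noteq> {}" "I \<subseteq> {1..n}" and u: "u \<in> Gs n (card I)"
  shows "RI n I u \<in> GLop (Lr n I)"
proof -
  have fI: "finite I" using finite_subset[OF I(2)] by simp
  have blk: "\<exists>N. isblk N (Lr n I) (RI n I w)" if w: "w \<in> Gs n (card I)" for w :: "'k kop"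
  proof -
    have "opsub w id \<in> sp (Gens {1..n} {J. card I \<le> card J})" using w unfolding Gs_def units_in_def by blast
    from RI_isblk[OF fI I this] obtain N where N: "isblk N (Lr n I) (\<lambda>f k. f k + RI n I (opsub w id) f k)" by blast
    have "(\<lambda>f k. f k + RI n I (opsub w id) f k) = RI n I w"
      by (simp add: RI_opsub[OF Gs_Sn[OF w] Salg_id] RI_id[OF fI I(1)] fun_eq_iff)
    then show ?thesis using N by (intro exI[of _ N]) (simp only:)
  qed
  obtain N where N: "isblk N (Lr n I) (RI n I u)" using blk[OF u] by blast
  obtain M where M: "isblk M (Lr n I) (RI n I (inv_into UNIV u))" using blk[OF Gs_inverse(1)[OF u]] by blast
  have S: "u \<in> Sn n" "inv_into UNIV u \<in> Sn n" using Gs_Sn Gs_inverse(1)[OF u] u by blast+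
  have "RI n I u \<circ> RI n I (inv_into UNIV u) = id" "RI n I (inv_into UNIV u) \<circ> RI n I u = id"
    unfolding RI_comp[OF fI I(1) S, symmetric] RI_comp[OF fI I(1) S(2,1), symmetric]
    by (simp_all only: Gs_inverse(2,3)[OF u] RI_id[OF fI I(1)])
  then show ?thesis using N isblk_inverse[OF Lr_props(1) N M] unfolding GLop_def by blast
qed

text \<open>Together with the trivial symbols at sets without \<open>n\<close>, all symbols at level
  \<open>s\<close> are trivial, and \<open>RI_kernel\<close> removes the terms of size
  \<open>s\<close>.\<close>

lemma Gs_step:
  fixes u :: "'k::field kop"
  assumes u: "u \<in> Gs n s" and s: "0 < s"
    and z: "\<And>I. I \<subseteq> {1..n} \<Longrightarrow> card I = s \<Longrightarrow> n \<in> I \<Longrightarrow> RI n I u = id"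
  shows "u \<in> Gs n (Suc s)"
proof -
  have A: "opsub u id \<in> sp (Gens {1..n} {I. s \<le> card I})" using u unfolding Gs_def units_in_def by blast
  have "RI n I (opsub u id) f k = 0" if I: "I \<subseteq> {1..n}" "card I = s" for I f k
  proof -
    have fI: "finite I" "I \<noteq> {}" using I s finite_subset[OF I(1)] by auto
    have "RI n I u = id" using z[OF I] RI_Gs_id[OF u fI] by blast
    then show ?thesis by (simp add: RI_opsub[OF Gs_Sn[OF u] Salg_id] RI_id[OF fI])
  qed
  then have "opsub u id \<in> sp (Gens {1..n} {I. s < card I \<or> card I = s \<and> I \<notin> UNIV})"
    by (intro RI_kernel[OF A s]) auto
  then have "opsub u id \<in> sp (Gens {1..n} {I. Suc s \<le> card I})" by (simp add: Suc_le_eq)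
  then show ?thesis using u unfolding Gs_def units_in_def by blast
qed

lemma Gs_top: "s > n \<Longrightarrow> Gs n s = {id :: 'k::field kop}"
proof -
  assume s: "s > n"
  have c: "card I \<le> n" if "I \<subseteq> {1..n}" for I :: "nat set" using card_mono[OF _ that] by simp
  have G: "Gens {1..n} {I. s \<le> card I} = ({} :: 'k kop set)"
    using s by (auto simp: Gens_def simp del: One_nat_def dest!: c)
  have z: "A = opzero" if "A \<in> sp {}" for A :: "'k kop" using that by induction auto
  have "u = id" if u: "u \<in> Gs n s" for u :: "'k kop"
  proof (intro ext)
    fix f a
    have "opsub u id \<in> sp {}" using u unfolding Gs_def units_in_def G by blast
    then have "opsub u id = opzero" by (rule z)
    then have "opsub u id f a = opzero f a" by (simp only:)
    then show "u f a = id f a" by (simp add: opsub_def opzero_def)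
  qed
  then show ?thesis using Gs_id[of n s] by blast
qed

section \<open>Lifting elementary matrices and constants\<close>

lemma RI_scalar_Gop:
  fixes f :: "nat \<Rightarrow> 'k::field ratfun"
  assumes I: "finite I" "I \<noteq> {}" and p: "supp_in ({1..n} - I) p" "supp_in ({1..n} - I) q"
  shows "RI n I (Gop {} p q) f k = Xm n I p q * f k"
proof -
  have s: "supp_in {1..n} p" "supp_in {1..n} q" using p by (auto simp: supp_in_def)
  have r: "res I p = (\<lambda>_. 0)" "res I q = (\<lambda>_. 0)" using p by (auto simp: supp_in_def res_def fun_eq_iff)
  have "rho n I (Gop {} p q) = opsmul (Xm n I p q) (id :: 'k ratfun kop)"
    unfolding rho_Gop[OF empty_subsetI s] Hop_def r Gop_id by simp
  then show ?thesis by (simp add: RI_def opsmul_def extZ_def enumZ[OF I])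
qed

lemma Xm_X: "k \<in> {1..n} - I \<Longrightarrow> Xm n I ((\<lambda>_. 0)(k := 1)) (\<lambda>_. 0) = Xv k"
  and Xm_Y: "k \<in> {1..n} - I \<Longrightarrow> Xm n I (\<lambda>_. 0) ((\<lambda>_. 0)(k := 1)) = inverse (Xv k)"
proof -
  assume k: "k \<in> {1..n} - I"
  have "(\<Prod>l\<in>{1..n} - I. Xv l ^ ((\<lambda>_. 0)(k := 1)) l / Xv l ^ 0) = (\<Prod>l\<in>{1..n} - I. if l = k then Xv k else 1 :: 'a ratfun)"
    by (intro prod.cong) auto
  then show "Xm n I ((\<lambda>_. 0)(k := 1)) (\<lambda>_. 0) = (Xv k :: 'a ratfun)" unfolding Xm_def using k by simp
next
  assume k: "k \<in> {1..n} - I"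
  have "(\<Prod>l\<in>{1..n} - I. Xv l ^ 0 / Xv l ^ ((\<lambda>_. 0)(k := 1)) l) = (\<Prod>l\<in>{1..n} - I. if l = k then inverse (Xv k) else 1 :: 'b ratfun)"
    by (intro prod.cong) (auto simp: inverse_eq_divide)
  then show "Xm n I (\<lambda>_. 0) ((\<lambda>_. 0)(k := 1)) = (inverse (Xv k) :: 'b ratfun)" unfolding Xm_def using k by simp
qed

text \<open>The scalars that lift form a subring. It contains the constants, and \<open>x_l\<close>,
  \<open>y_l\<close> lift each variable and its inverse; so it contains the Laurent ring.\<close>

lemma Lr_lift:
  fixes x :: "'k::field ratfun"
  assumes I: "finite I" "I \<noteq> {}" and x: "x \<in> Lr n I"
  shows "\<exists>a\<in>Salg ({1..n} - I). \<forall>f k. RI n I (a :: 'k kop) f k = x * f k"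
proof -
  define R where "R = {x. \<exists>a\<in>Salg ({1..n} - I). \<forall>f k. RI n I (a :: 'k kop) f k = x * f k}"
  have S: "a \<in> Sn n" if "a \<in> Salg ({1..n} - I)" for a :: "'k kop" using Salg_mono[OF that] by blast
  have RI: "x \<in> R" if "a \<in> Salg ({1..n} - I)" "\<And>f k. RI n I (a :: 'k kop) f k = x * f k" for x a
    using that unfolding R_def by blast
  have c: "emb c \<in> R" for c
    by (rule RI[OF Salg.scal[of c]]) (simp add: RI_opsmul[OF Salg_id] RI_id[OF I])
  have "is_subring R"
    unfolding is_subring_def
  proof (intro conjI ballI)
    show "0 \<in> R" "1 \<in> R" using c[of 0] c[of 1] by (simp_all add: emb_0 emb_1)
    fix x y assume xy: "x \<in> R" "y \<in> R"
    obtain a where a: "a \<in> Salg ({1..n} - I)" "\<And>f k. RI n I (a :: 'k kop) f k = x * f k" using xy(1) unfolding R_def by blast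
    obtain b where b: "b \<in> Salg ({1..n} - I)" "\<And>f k. RI n I (b :: 'k kop) f k = y * f k" using xy(2) unfolding R_def by blast
    show "x + y \<in> R"
      by (rule RI[OF Salg.add[OF a(1) b(1)]]) (simp add: RI_opadd[OF S[OF a(1)] S[OF b(1)]] a(2) b(2) algebra_simps)
    show "x * y \<in> R"
      by (rule RI[OF Salg.mult[OF a(1) b(1)]]) (simp add: RI_comp[OF I S[OF a(1)] S[OF b(1)]] a(2) b(2))
  next
    fix x assume x: "x \<in> R"
    obtain a where a: "a \<in> Salg ({1..n} - I)" "\<And>f k. RI n I (a :: 'k kop) f k = x * f k" using x unfolding R_def by blast
    show "- x \<in> R"
      by (rule RI[OF Salg_opsmul[OF a(1), of "- 1"]]) (simp add: RI_opsmul[OF S[OF a(1)]] a(2) emb_uminus emb_1)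
  qed
  moreover have "Xv l \<in> R \<and> inverse (Xv l) \<in> R" if l: "l \<in> {1..n} - I" for l
  proof
    have s: "supp_in ({1..n} - I) ((\<lambda>_. 0)(l := 1))" using l by (auto simp: supp_in_def)
    show "Xv l \<in> R"
      using RI[OF Salg.genX[OF l]] RI_scalar_Gop[OF I s supp_in_0] unfolding Gop_Xop Xm_X[OF l] by blast
    show "inverse (Xv l) \<in> R"
      using RI[OF Salg.genY[OF l]] RI_scalar_Gop[OF I supp_in_0 s] unfolding Gop_Yop Xm_Y[OF l] by blast
  qed
  ultimately have "Lr n I \<subseteq> R" unfolding Lr_def using c by (intro Lau_least) auto
  then show ?thesis using x unfolding R_def by blast
qed

lemma Gop_Salg_commute:
  assumes a: "a \<in> Salg ({1..n} - I)" and al: "supp_in I al" "supp_in I be"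
  shows "Gop I al be \<circ> a = a \<circ> (Gop I al be :: 'k::field kop)"
  using Salg_sp[OF a]
proof induction
  case sp_zero
  then show ?case by (simp only: op_comp_left op_comp_right[OF linear_Gop])
next
  case (sp_add g A c)
  obtain p q where g: "g = Gop {} p q" "supp_in ({1..n} - I) p" "supp_in ({1..n} - I) q"
    using sp_add(1) unfolding Gens_def by blast
  have z: "be k = 0 \<or> p k = 0" "q k = 0 \<or> al k = 0" for k
    using al g(2,3) by (cases "k \<in> I"; simp add: supp_in_def)+
  have zI: "p i = 0" "q i = 0" if "i \<in> I" for i using g(2,3) that by (simp_all add: supp_in_def)
  have "Gop I al be \<circ> (Gop {} p q :: 'k kop) = Gop (I \<union> {}) (\<lambda>k. al k + p k) (\<lambda>k. be k + q k)"
    by (intro Gop_comp_disjoint z zI) auto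
  moreover have "Gop {} p q \<circ> (Gop I al be :: 'k kop) = Gop ({} \<union> I) (\<lambda>k. p k + al k) (\<lambda>k. q k + be k)"
    by (intro Gop_comp_disjoint z zI) auto
  ultimately have "Gop I al be \<circ> g = g \<circ> (Gop I al be :: 'k kop)" unfolding g(1) by (simp add: add.commute)
  then show ?case by (simp only: op_comp_left op_comp_right[OF linear_Gop] sp_add.IH)
qed

text \<open>The units in \<open>1 + p_I\<close>. Their symbols are trivial at every set not
  containing \<open>I\<close> (\<open>RI_Vn\<close>), so factors for different sets of one size do
  not interfere.\<close>

definition Vn :: "nat \<Rightarrow> nat set \<Rightarrow> 'k::field kop set" where
  "Vn n I = units_in n (sp (Gens {1..n} {J. I \<subseteq> J}))"

lemma Vn_comp: "u \<in> Vn n I \<Longrightarrow> v \<in> Vn n I \<Longrightarrow> u \<circ> v \<in> Vn n I"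
  unfolding Vn_def by (rule units_in_comp[OF upc_super])

lemma Vn_Gs:
  assumes I: "I \<subseteq> {1..n}" "n \<in> I" "s \<le> card I"
  shows "Vn n I \<subseteq> Gs n s"
proof -
  have "s \<le> card J" if "I \<subseteq> J" "J \<subseteq> {1..n}" for J
    using card_mono[OF finite_subset[OF that(2)] that(1)] I(3) by simp
  then show ?thesis unfolding Vn_def Gs_def using I
    by (intro Int_greatest units_in_mono sp_Gens_mono) (auto simp del: One_nat_def)
qed

lemma RI_Vn:
  assumes u: "u \<in> Vn n I" and I: "finite I'" "I' \<noteq> {}" "\<not> I \<subseteq> I'"
  shows "RI n I' u = id"
proof (intro ext)
  fix f k
  have "opsub u id \<in> sp (Gens {1..n} {J. I \<subseteq> J})" using u unfolding Vn_def units_in_def by blast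
  from RI_high[OF I(1,2) this] have z: "RI n I' (opsub u id) f k = 0" using I(3) by blast
  have "u \<in> Sn n" using u unfolding Vn_def by (rule units_in_Sn)
  from RI_opsub[OF this Salg_id, of I' f k] show "RI n I' u f k = id f k" using z by (simp add: RI_id[OF I(1,2)])
qed

definition Egen :: "nat set \<Rightarrow> 'k::field kop \<Rightarrow> (nat \<Rightarrow> nat) \<Rightarrow> (nat \<Rightarrow> nat) \<Rightarrow> 'k kop" where
  "Egen I a al be = opadd id (a \<circ> Gop I (res I al) (res I be))"

lemma supp_res: "supp_in I (res I p)"
  by (simp add: supp_in_def res_def)

text \<open>The matrix unit squares to 0, as its two indices differ on \<open>I\<close>, and it
  commutes with \<open>a\<close>, which involves other variables. So \<open>a E\<close> squares to 0
  and \<open>1 - a E\<close> is the inverse.\<close>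

lemma Egen_Vn:
  fixes a :: "'k::field kop"
  assumes I: "I \<subseteq> {1..n}" and a: "a \<in> Salg ({1..n} - I)" and i: "i \<in> I" "al i \<noteq> be i"
  shows "Egen I a al be \<in> Vn n I"
proof -
  let ?E = "Gop I (res I al) (res I be) :: 'k kop"
  have E0: "?E \<circ> ?E = opzero"
  proof -
    have "\<not> ((\<forall>i\<in>I. res I al i \<le> res I be i) \<and> (\<forall>i\<in>I. res I be i \<le> res I al i))"
    proof
      assume "(\<forall>i\<in>I. res I al i \<le> res I be i) \<and> (\<forall>i\<in>I. res I be i \<le> res I al i)"
      then have "res I al i \<le> res I be i" "res I be i \<le> res I al i" using i(1) by blast+
      then show False using i by (simp add: res_def)
    qed
    then show ?thesis unfolding Gop_comp by (rule if_not_P)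
  qed
  have aS: "a \<in> Sn n" using Salg_mono[OF a] by blast
  have s: "supp_in {1..n} (res I al)" "supp_in {1..n} (res I be)" using I by (auto simp: supp_in_def res_def)
  have ES: "?E \<in> sp (Gens {1..n} {J. I \<subseteq> J})" using I s by (intro sp_base GensI) auto
  let ?A = "a \<circ> ?E"
  have A: "?A \<in> sp (Gens {1..n} {J. I \<subseteq> J})" by (rule ideal_left[OF upc_super aS ES])
  have AS: "?A \<in> Sn n" by (rule sp_Sn[OF A])
  have "?A \<circ> ?A = a \<circ> (?E \<circ> a) \<circ> ?E" by (simp only: o_assoc)
  also have "\<dots> = a \<circ> a \<circ> (?E \<circ> ?E)" unfolding Gop_Salg_commute[OF a supp_res supp_res] by (simp only: o_assoc)
  also have "\<dots> = opzero" unfolding E0 by (rule op_comp_right[OF linear_op_comp[OF linear_Salg[OF a] linear_Salg[OF a]]])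
  finally have A0: "?A \<circ> ?A = opzero" .
  have "opadd id ?A \<circ> opsub id ?A = opsub (opadd id ?A) (opadd ?A (?A \<circ> ?A))"
    unfolding op_comp_left op_comp_right_sub[OF linear_Salg[OF AS]] by (simp add: opadd_def opsub_def fun_eq_iff)
  also have "\<dots> = id" unfolding A0 by (simp add: opadd_def opsub_def opzero_def fun_eq_iff)
  finally have 1: "opadd id ?A \<circ> opsub id ?A = id" .
  have "opsub id ?A \<circ> opadd id ?A = opsub (opadd id ?A) (opadd ?A (?A \<circ> ?A))"
    unfolding op_comp_left op_comp_right[OF linear_Salg[OF AS]] by (simp add: opadd_def opsub_def fun_eq_iff)
  also have "\<dots> = id" unfolding A0 by (simp add: opadd_def opsub_def opzero_def fun_eq_iff)
  finally have 2: "opsub id ?A \<circ> opadd id ?A = id" .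
  have "opsub (opadd id ?A) id = ?A" by (simp add: opadd_def opsub_def fun_eq_iff)
  then show ?thesis unfolding Vn_def units_in_def Egen_def
    by (intro CollectI conjI bexI[of _ "opsub id ?A"] 1 2 Salg.add[OF Salg_id AS] Salg_opsub[OF Salg_id AS]) (simp only: A)
qed

lemma RI_Egen:
  fixes a :: "'k::field kop"
  assumes I: "I \<subseteq> {1..n}" "I \<noteq> {}" and a: "a \<in> Salg ({1..n} - I)" "\<And>f k. RI n I a f k = x * f k"
  shows "RI n I (Egen I a al be) = transv (idx I (res I al)) (idx I (res I be)) x"
proof (intro ext)
  fix f k
  have fI: "finite I" using finite_subset[OF I(1)] by simp
  have aS: "a \<in> Sn n" using Salg_mono[OF a(1)] by blast
  have s: "supp_in {1..n} (res I al)" "supp_in {1..n} (res I be)" using I by (auto simp: supp_in_def res_def)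
  let ?E = "Gop I (res I al) (res I be) :: 'k kop"
  have ES: "?E \<in> Sn n" using I s by (intro Gop_Salg) auto
  have X: "Xm n I (res I al) (res I be) = (1 :: 'k ratfun)" unfolding Xm_def by (intro prod.neutral) (auto simp: res_def)
  have rr: "res I (res I p) = res I p" for p by (auto simp: res_def)
  have "RI n I (Egen I a al be) f k = f k + x * RI n I ?E f k"
    unfolding Egen_def RI_opadd[OF Salg_id Salg.mult[OF aS ES]] RI_comp[OF fI I(2) aS ES] by (simp add: a(2) RI_id[OF fI I(2)])
  then show "RI n I (Egen I a al be) f k = transv (idx I (res I al)) (idx I (res I be)) x f k"
    unfolding RI_Gop(2)[OF fI I(2,1) s refl] X rr by (simp add: transv_def)
qed

lemma grp_gen_subset:
  assumes "\<And>g. g \<in> G \<Longrightarrow> g \<in> H" "\<And>g. g \<in> G \<Longrightarrow> inv_into UNIV g \<in> H" "id \<in> H" "\<And>g h. g \<in> H \<Longrightarrow> h \<in> H \<Longrightarrow> g \<circ> h \<in> H"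
  shows "grp_gen G \<subseteq> H"
proof
  fix g assume "g \<in> grp_gen G"
  then show "g \<in> H"
  proof induction
    case one
    show ?case by (rule assms(3))
  next
    case (mul g h)
    show ?case by (rule assms(4)[OF assms(1)[OF mul(1)] mul(3)])
  next
    case (mulinv g h)
    show ?case by (rule assms(4)[OF assms(2)[OF mulinv(1)] mulinv(3)])
  qed
qed

lemma grp_gen_comp: "g \<in> grp_gen G \<Longrightarrow> h \<in> grp_gen G \<Longrightarrow> g \<circ> h \<in> grp_gen G"
proof (induction rule: grp_gen.induct)
  case (mul a b)
  then show ?case unfolding comp_assoc by (intro grp_gen.mul[OF mul(1)])
next
  case (mulinv a b)
  then show ?case unfolding comp_assoc by (intro grp_gen.mulinv[OF mulinv(1)])
qed (simp only: id_comp)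

lemma grp_gen_base: "g \<in> G \<Longrightarrow> g \<in> grp_gen G"
  using grp_gen.mul[OF _ grp_gen.one, of g G] by (simp only: comp_id)

lemma Einf_eq:
  assumes "finite I"
  shows "Einf n I = grp_gen {Egen I a al be | a al be. a \<in> Salg ({1..n} - I) \<and> (\<exists>i\<in>I. al i \<noteq> be i)}"
  unfolding Einf_def Egen_def EI_Gop[OF assms] ..

lemma Einf_comp: "g \<in> Einf n I \<Longrightarrow> h \<in> Einf n I \<Longrightarrow> g \<circ> h \<in> Einf n I"
  unfolding Einf_def by (rule grp_gen_comp)

lemma Einf_id: "id \<in> Einf n I"
  unfolding Einf_def by (rule grp_gen.one)

lemma Egen_Einf: "finite I \<Longrightarrow> a \<in> Salg ({1..n} - I) \<Longrightarrow> i \<in> I \<Longrightarrow> al i \<noteq> be i \<Longrightarrow> Egen I a al be \<in> Einf n I"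
  unfolding Einf_eq by (intro grp_gen_base) blast

lemma Einf_Vn:
  assumes I: "I \<subseteq> {1..n}"
  shows "(Einf n I :: 'k::field kop set) \<subseteq> Vn n I"
  unfolding Einf_eq[OF finite_subset[OF I finite_atLeastAtMost]]
proof (rule grp_gen_subset)
  show 1: "g \<in> Vn n I" if "g \<in> {Egen I a al be | a al be. a \<in> Salg ({1..n} - I) \<and> (\<exists>i\<in>I. al i \<noteq> be i)}" for g :: "'k kop"
    using that Egen_Vn[OF I] by (elim CollectE exE conjE bexE) (simp only:)
  show "inv_into UNIV g \<in> Vn n I" if "g \<in> {Egen I a al be | a al be. a \<in> Salg ({1..n} - I) \<and> (\<exists>i\<in>I. al i \<noteq> be i)}" for g :: "'k kop"
    using 1[OF that] unfolding Vn_def by (rule units_in_inverse[OF upc_super])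
  show "(id :: 'k kop) \<in> Vn n I" unfolding Vn_def by (rule units_in_id)
qed (rule Vn_comp)

lemma elem_lift:
  fixes e :: "(nat \<Rightarrow> 'k::field ratfun) \<Rightarrow> nat \<Rightarrow> 'k ratfun"
  assumes I: "I \<subseteq> {1..n}" "I \<noteq> {}" and e: "e \<in> elem_ops (Lr n I)"
  shows "\<exists>g\<in>Einf n I. RI n I (g :: 'k kop) = e"
  using e
proof induction
  case elem_id
  have fI: "finite I" using finite_subset[OF I(1)] by simp
  show ?case by (rule bexI[where P = "\<lambda>g. RI n I g = id" and x = "id :: 'k kop", OF RI_id[OF fI I(2)] Einf_id])
next
  case (elem_step i j x e)
  have fI: "finite I" using finite_subset[OF I(1)] by simp
  obtain g where g: "g \<in> Einf n I" "RI n I (g :: 'k kop) = e" using elem_step.IH by blast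
  obtain a where a: "a \<in> Salg ({1..n} - I)" "\<And>f k. RI n I (a :: 'k kop) f k = x * f k"
    using Lr_lift[OF fI I(2) elem_step(2)] by blast
  let ?al = "enumZ I i" and ?be = "enumZ I j"
  have Z: "?al \<in> Zs I" "?be \<in> Zs I" by (rule enumZ[OF fI I(2)])+
  have "?al \<noteq> ?be"
  proof
    assume "?al = ?be"
    then have "idx I ?al = idx I ?be" by simp
    then show False using elem_step(1) by (simp only: enumZ(2)[OF fI I(2)])
  qed
  then obtain l where l: "?al l \<noteq> ?be l" by (auto simp: fun_eq_iff)
  then have lI: "l \<in> I" using Z by (cases "l \<in> I") (auto simp: Zs_def supp_in_def)
  have r: "res I ?al = ?al" "res I ?be = ?be" using Z by (auto simp: Zs_def supp_in_def res_def fun_eq_iff)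
  have E: "Egen I a ?al ?be \<in> Einf n I" by (rule Egen_Einf[where i = l, OF fI a(1) lI]) (rule l)
  have RE: "RI n I (Egen I a ?al ?be) = transv i j x" unfolding RI_Egen[OF I a] r enumZ(2)[OF fI I(2)] ..
  have S: "Egen I a ?al ?be \<in> Sn n" "g \<in> Sn n"
    using subsetD[OF Einf_Vn[OF I(1)] E] subsetD[OF Einf_Vn[OF I(1)] g(1)] unfolding Vn_def by (simp_all only: units_in_Sn)
  have "RI n I (Egen I a ?al ?be \<circ> g) = transv i j x \<circ> e" unfolding RI_comp[OF fI I(2) S] RE g(2) ..
  then show ?case by (rule bexI[OF _ Einf_comp[OF E g(1)]])
qed

lemma Gop_00: "Gop I (\<lambda>_. 0) (\<lambda>_. 0) f a = (if \<forall>i\<in>I. a i = 0 then f a else 0)"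
  by (simp add: Gop_def)

lemma mu_apply: "finite I \<Longrightarrow> mu I c f a = (if \<forall>i\<in>I. a i = 0 then c * f a else f a)"
  by (simp add: mu_def eI_Gop opadd_def opsmul_def opsub_def Gop_00)

lemma mu_comp: "finite I \<Longrightarrow> mu I c \<circ> mu I d = mu I (c * d)"
  by (auto simp: fun_eq_iff mu_apply)

lemma mu_1: "finite I \<Longrightarrow> mu I 1 = id"
  by (auto simp: fun_eq_iff mu_apply)

lemma mu_Vn:
  assumes I: "I \<subseteq> {1..n}" and c: "c \<noteq> (0 :: 'k::field)"
  shows "mu I c \<in> Vn n I"
proof -
  have fI: "finite I" using finite_subset[OF I] by simp
  have G: "Gop I (\<lambda>_. 0) (\<lambda>_. 0) \<in> (sp (Gens {1..n} {J. I \<subseteq> J}) :: 'k kop set)"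
    using I by (intro sp_base GensI supp_in_0) auto
  have "opsub (mu I d) id = opsmul (d - 1) (Gop I (\<lambda>_. 0) (\<lambda>_. 0))" for d :: 'k
    by (simp add: fun_eq_iff opsub_def opsmul_def mu_apply[OF fI] Gop_00 algebra_simps)
  then have 1: "opsub (mu I d) id \<in> sp (Gens {1..n} {J. I \<subseteq> J})" for d :: 'k using sp_opsmul[OF G] by metis
  have "mu I d = opadd (opsub (mu I d) id) id" for d :: 'k by (simp add: opsub_def opadd_def fun_eq_iff)
  then have 2: "mu I d \<in> Sn n" for d :: 'k using Salg.add[OF sp_Sn[OF 1] Salg_id] by metis
  have "mu I c \<circ> mu I (inverse c) = id" "mu I (inverse c) \<circ> mu I c = id"
    using c by (simp_all add: mu_comp[OF fI] mu_1[OF fI])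
  then show ?thesis unfolding Vn_def units_in_def using 1 2 by blast
qed

lemma RI_mu:
  assumes I: "I \<subseteq> {1..n}" "I \<noteq> {}"
  shows "RI n I (mu I c) = dg (emb (c :: 'k::field))"
proof (intro ext)
  fix f k
  have fI: "finite I" using finite_subset[OF I(1)] by simp
  let ?E = "Gop I (\<lambda>_. 0) (\<lambda>_. 0) :: 'k kop"
  have E: "?E \<in> Sn n" using I by (intro Gop_Salg supp_in_0) auto
  have X: "Xm n I (\<lambda>_. 0) (\<lambda>_. 0) = (1 :: 'k ratfun)" by (simp add: Xm_def)
  have r: "res I (\<lambda>_. 0) = (\<lambda>_. 0)" by (simp add: res_def)
  have "RI n I (mu I c) f k = emb c * RI n I ?E f k + (f k - RI n I ?E f k)"
    unfolding mu_def eI_Gop[OF fI] RI_opadd[OF Salg_opsmul[OF E] Salg_opsub[OF Salg_id E]] RI_opsmul[OF E] RI_opsub[OF Salg_id E]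
    by (simp add: RI_id[OF fI I(2)])
  then show "RI n I (mu I c) f k = dg (emb c) f k"
    unfolding RI_Gop(2)[OF fI I(2,1) supp_in_0 supp_in_0 refl] X r enumZ(4)[OF fI I(2)] by (simp add: dg_def)
qed

lemma UE_Vn: "I \<subseteq> {1..n} \<Longrightarrow> (UE n I :: 'k::field kop set) \<subseteq> Vn n I"
proof
  fix w :: "'k kop" assume I: "I \<subseteq> {1..n}" and w: "w \<in> UE n I"
  obtain c g where "w = mu I c \<circ> g" "c \<noteq> 0" "g \<in> Einf n I" using w unfolding UE_def UI_def by blast
  then show "w \<in> Vn n I" using Vn_comp[OF mu_Vn[OF I] subsetD[OF Einf_Vn[OF I]]] by simp
qed

lemma UE_lift:
  fixes e :: "(nat \<Rightarrow> 'k::field ratfun) \<Rightarrow> nat \<Rightarrow> 'k ratfun"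
  assumes I: "I \<subseteq> {1..n}" "I \<noteq> {}" and e: "e \<in> elem_ops (Lr n I)" and c: "c \<noteq> 0"
  shows "\<exists>w\<in>UE n I. RI n I (w :: 'k kop) = dg (emb c) \<circ> e"
proof -
  have fI: "finite I" using finite_subset[OF I(1)] by simp
  obtain g where g: "g \<in> Einf n I" "RI n I (g :: 'k kop) = e" using elem_lift[OF I e] by blast
  have S: "mu I c \<in> Sn n" "g \<in> Sn n"
    using subsetD[OF Einf_Vn[OF I(1)] g(1)] mu_Vn[OF I(1) c] unfolding Vn_def by (simp_all only: units_in_Sn)
  have "RI n I (mu I c \<circ> g) = dg (emb c) \<circ> e" unfolding RI_comp[OF fI I(2) S] g(2) RI_mu[OF I] ..
  moreover have "mu I c \<circ> g \<in> UE n I" using c g(1) unfolding UE_def UI_def by blast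
  ultimately show ?thesis by blast
qed

subsection \<open>The elements theta\<close>

text \<open>For \<open>p\<close> and \<open>q\<close> supported off \<open>I\<close> this is
  \<open>1 + (x^p y^q - 1) e_I\<close>, with diagonal symbol \<open>X^(p - q)\<close>. Both factors
  of \<open>theta\<close> have this form, and so do the axis shifts in
  \<open>index_nonneg\<close>.\<close>

definition Tm :: "nat set \<Rightarrow> (nat \<Rightarrow> nat) \<Rightarrow> (nat \<Rightarrow> nat) \<Rightarrow> 'k::field kop" where
  "Tm I p q = opadd id (opsub (Gop I p q) (Gop I (\<lambda>_. 0) (\<lambda>_. 0)))"

lemma Tm_props:
  assumes I: "I \<subseteq> {1..n}" and p: "supp_in {1..n} p" "supp_in {1..n} q"
  shows "opsub (Tm I p q) id \<in> (sp (Gens {1..n} {J. I \<subseteq> J}) :: 'k::field kop set)" "(Tm I p q :: 'k kop) \<in> Sn n"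
proof -
  have eq: "opsub (Tm I p q) id = (opsub (Gop I p q) (Gop I (\<lambda>_. 0) (\<lambda>_. 0)) :: 'k kop)"
    by (simp add: Tm_def opadd_def opsub_def fun_eq_iff)
  show 1: "opsub (Tm I p q) id \<in> (sp (Gens {1..n} {J. I \<subseteq> J}) :: 'k kop set)"
    unfolding eq using I p by (intro sp_opsub sp_base GensI supp_in_0) auto
  show "(Tm I p q :: 'k kop) \<in> Sn n"
    unfolding Tm_def using sp_Sn[OF 1] unfolding eq by (intro Salg.add Salg_id)
qed

lemma RI_Tm:
  assumes I: "I \<subseteq> {1..n}" "I \<noteq> {}" and p: "supp_in ({1..n} - I) p" "supp_in ({1..n} - I) q"
  shows "RI n I (Tm I p q) = dg (Xm n I p q :: 'k::field ratfun)"
proof (intro ext)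
  fix f k
  have fI: "finite I" using finite_subset[OF I(1)] by simp
  have p': "supp_in {1..n} p" "supp_in {1..n} q" using p by (auto simp: supp_in_def)
  let ?E = "Gop I (\<lambda>_. 0) (\<lambda>_. 0) :: 'k kop" and ?F = "Gop I p q :: 'k kop"
  have E: "?E \<in> Sn n" using I by (intro Gop_Salg supp_in_0) auto
  have F: "?F \<in> Sn n" using I p' by (intro Gop_Salg) auto
  have X: "Xm n I (\<lambda>_. 0) (\<lambda>_. 0) = (1 :: 'k ratfun)" by (simp add: Xm_def)
  have r: "res I (\<lambda>_. 0) = (\<lambda>_. 0)" by (simp add: res_def)
  have r': "res I p = (\<lambda>_. 0)" "res I q = (\<lambda>_. 0)" using p by (auto simp: supp_in_def res_def fun_eq_iff)
  have "RI n I (Tm I p q) f k = f k + (RI n I ?F f k - RI n I ?E f k)"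
    unfolding Tm_def RI_opadd[OF Salg_id Salg_opsub[OF F E]] RI_opsub[OF F E] by (simp add: RI_id[OF fI I(2)])
  then show "RI n I (Tm I p q) f k = dg (Xm n I p q) f k"
    unfolding RI_Gop(2)[OF fI I(2,1) supp_in_0 supp_in_0 refl] RI_Gop(2)[OF fI I(2,1) p' refl] X r r' enumZ(4)[OF fI I(2)]
    by (simp add: dg_def)
qed

lemma RI_Tm_id:
  assumes I: "I \<subseteq> {1..n}" and p: "supp_in {1..n} p" "supp_in {1..n} q" and I': "finite I'" "I' \<noteq> {}" "\<not> I \<subseteq> I'"
  shows "RI n I' (Tm I p q :: 'k::field kop) = id"
proof (intro ext)
  fix f k
  have z: "RI n I' (opsub (Tm I p q :: 'k kop) id) f k = 0"
    by (rule RI_high[OF I'(1,2) Tm_props(1)[OF I p]]) (use I'(3) in blast)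
  then show "RI n I' (Tm I p q :: 'k kop) f k = id f k"
    using RI_opsub[OF Tm_props(2)[OF I p] Salg_id, of I' f k] by (simp add: RI_id[OF I'(1,2)])
qed

definition on_axis :: "nat set \<Rightarrow> (nat \<Rightarrow> nat) \<Rightarrow> bool" where
  "on_axis K a \<longleftrightarrow> (\<forall>l\<in>K. a l = 0)"

lemma eI_apply: "finite K \<Longrightarrow> eI K f a = (if on_axis K a then f a else 0)"
  by (simp add: eI_Gop Gop_00 on_axis_def)

lemma on_axis_upd: "i \<notin> K \<Longrightarrow> on_axis K (a(i := v)) = on_axis K a"
  by (auto simp: on_axis_def)

definition thY :: "nat \<Rightarrow> nat set \<Rightarrow> 'k::field kop" where
  "thY i J = opadd id (opsub (Yop i) id \<circ> eI (J - {i}))"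

definition thX :: "nat \<Rightarrow> nat set \<Rightarrow> 'k::field kop" where
  "thX j J = opadd id (opsub (Xop j) id \<circ> eI (J - {j}))"

lemma theta_eq: "theta i j J = thY i J \<circ> thX j J"
  by (simp only: theta_def thY_def thX_def)

lemma thY_apply: "finite J \<Longrightarrow> thY i J f a = (if on_axis (J - {i}) a then f (a(i := Suc (a i))) else f a)"
  by (simp add: thY_def opadd_def opsub_def Yop_def eI_apply on_axis_upd)

lemma thX_apply: "finite J \<Longrightarrow> thX j J f a =
    (if on_axis (J - {j}) a then if 0 < a j then f (a(j := a j - 1)) else 0 else f a)"
  by (simp add: thX_def opadd_def opsub_def Xop_def eI_apply on_axis_upd)

lemma thY_thX: "finite J \<Longrightarrow> thY i J \<circ> thX i J = id"
  by (auto simp: fun_eq_iff thY_apply thX_apply on_axis_upd)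

lemma thX_thY:
  assumes "finite J" "j \<in> J"
  shows "thX j J (thY j J f) a = (if on_axis J a then 0 else f a)"
proof -
  have "on_axis J a \<longleftrightarrow> on_axis (J - {j}) a \<and> a j = 0" using assms(2) by (auto simp: on_axis_def)
  moreover have "a(j := Suc (a j - Suc 0)) = a" if "0 < a j" using that by auto
  ultimately show ?thesis using assms(1) by (simp add: thY_apply thX_apply on_axis_upd)
qed

text \<open>The defect of each factor from being invertible is the projection onto the corner of the axes
  in \<open>J\<close>, and the other factor never looks at that corner.\<close>
lemma theta_inverse:
  assumes J: "finite J" "i \<in> J" "j \<in> J" "i \<noteq> j"
  shows "theta i j J \<circ> theta j i J = (id :: 'k::field kop)"
proof (intro ext)
  fix f :: "(nat \<Rightarrow> nat) \<Rightarrow> 'k" and a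
  have "theta i j J (theta j i J f) a = thY i J (thX j J (thY j J (thX i J f))) a" by (simp add: theta_eq)
  also have "\<dots> = thY i J (thX i J f) a"
  proof (cases "on_axis (J - {i}) a")
    case True
    have "\<not> on_axis J (a(i := Suc (a i)))" using J(2) by (auto simp: on_axis_def)
    then show ?thesis using True by (simp add: thY_apply[OF J(1), of i] thX_thY[OF J(1,3)])
  next
    case False
    then have "\<not> on_axis J a" by (auto simp: on_axis_def)
    then show ?thesis using False by (simp add: thY_apply[OF J(1), of i] thX_thY[OF J(1,3)])
  qed
  also have "\<dots> = f a" using fun_cong[OF thY_thX[OF J(1), of i], of f] by simp
  finally show "(theta i j J \<circ> theta j i J) f a = id f a" by simp
qed

lemma thY_Tm:
  assumes "finite J"
  shows "thY i J = (Tm (J - {i}) (\<lambda>_. 0) ((\<lambda>_. 0)(i := 1)) :: 'k::field kop)"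
proof -
  have "Gop {} (\<lambda>_. 0) ((\<lambda>_. 0)(i := 1)) \<circ> Gop (J - {i}) (\<lambda>_. 0) (\<lambda>_. 0)
    = (Gop ({} \<union> (J - {i})) (\<lambda>k. 0 + 0) (\<lambda>k. ((\<lambda>_. 0)(i := 1)) k + 0) :: 'k kop)"
    by (rule Gop_comp_disjoint) auto
  then have "Yop i \<circ> Gop (J - {i}) (\<lambda>_. 0) (\<lambda>_. 0) = (Gop (J - {i}) (\<lambda>_. 0) ((\<lambda>_. 0)(i := 1)) :: 'k kop)"
    unfolding Gop_Yop by (simp only: Un_empty_left add_0_right)
  then show ?thesis unfolding thY_def Tm_def eI_Gop[OF finite_Diff[OF assms]] op_comp_left by (simp only: id_comp)
qed

lemma thX_Tm:
  assumes "finite J"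
  shows "thX i J = (Tm (J - {i}) ((\<lambda>_. 0)(i := 1)) (\<lambda>_. 0) :: 'k::field kop)"
proof -
  have "Gop {} ((\<lambda>_. 0)(i := 1)) (\<lambda>_. 0) \<circ> Gop (J - {i}) (\<lambda>_. 0) (\<lambda>_. 0)
    = (Gop ({} \<union> (J - {i})) (\<lambda>k. ((\<lambda>_. 0)(i := 1)) k + 0) (\<lambda>k. 0 + 0) :: 'k kop)"
    by (rule Gop_comp_disjoint) auto
  then have "Xop i \<circ> Gop (J - {i}) (\<lambda>_. 0) (\<lambda>_. 0) = (Gop (J - {i}) ((\<lambda>_. 0)(i := 1)) (\<lambda>_. 0) :: 'k kop)"
    unfolding Gop_Xop by (simp only: Un_empty_left add_0_right)
  then show ?thesis unfolding thX_def Tm_def eI_Gop[OF finite_Diff[OF assms]] op_comp_left by (simp only: id_comp)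
qed

text \<open>The factors of \<open>theta\<close> live on \<open>J - {i}\<close> and
  \<open>J - {j}\<close>, which have size \<open>s\<close> and contain \<open>n\<close> because
  \<open>i\<close> and \<open>j\<close> differ from \<open>n\<close>.\<close>

lemma theta_Gs:
  assumes J: "J \<subseteq> {1..n}" "n \<in> J" "i \<in> J" "j \<in> J" "i \<noteq> j" "i \<noteq> n" "j \<noteq> n" and s: "card J = Suc s"
  shows "theta i j J \<in> (Gs n s :: 'k::field kop set)"
proof -
  have fJ: "finite J" using finite_subset[OF J(1)] by simp
  let ?U = "{I. n \<in> I \<and> s \<le> card I}"
  have U: "upc n ?U" using upc_card[of n s] by (auto simp: upc_def)
  have sub: "sp (Gens {1..n} {K. J - {l} \<subseteq> K}) \<subseteq> (sp (Gens {1..n} ?U) :: 'k kop set)" if l: "l \<in> J" "l \<noteq> n" for l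
  proof (rule sp_Gens_mono)
    fix K assume K: "K \<in> {K. J - {l} \<subseteq> K}" "K \<subseteq> {1..n}"
    have "card (J - {l}) \<le> card K" using K finite_subset[OF K(2)] by (intro card_mono) auto
    then show "K \<in> ?U" using K l J(2) s fJ by auto
  qed
  have si: "supp_in {1..n} ((\<lambda>_. 0)(l := 1))" if "l \<in> J" for l using that J(1) by (auto simp: supp_in_def)
  have Jl: "J - {l} \<subseteq> {1..n}" for l using J(1) by blast
  have Y: "thY l J \<in> (Sn n :: 'k kop set)" "l \<noteq> n \<Longrightarrow> opsub (thY l J) id \<in> (sp (Gens {1..n} ?U) :: 'k kop set)" if l: "l \<in> J" for l
    unfolding thY_Tm[OF fJ] using Tm_props[OF Jl supp_in_0 si[OF l], of l, where 'k = 'k] sub[OF l] by (blast, blast)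
  have X: "thX l J \<in> (Sn n :: 'k kop set)" "l \<noteq> n \<Longrightarrow> opsub (thX l J) id \<in> (sp (Gens {1..n} ?U) :: 'k kop set)" if l: "l \<in> J" for l
    unfolding thX_Tm[OF fJ] using Tm_props[OF Jl si[OF l] supp_in_0, of l, where 'k = 'k] sub[OF l] by (blast, blast)
  have S: "theta l m J \<in> (Sn n :: 'k kop set)" if "l \<in> J" "m \<in> J" for l m
    unfolding theta_eq using Y(1) X(1) that by (intro Salg.mult)
  have "opsub (thY i J \<circ> thX j J) id = (opadd (thY i J \<circ> opsub (thX j J) id) (opsub (thY i J) id) :: 'k kop)"
    unfolding op_comp_right_sub[OF linear_Salg[OF Y(1)[OF J(3)]]] by (simp add: opsub_def opadd_def fun_eq_iff)
  then have "opsub (theta i j J) id \<in> (sp (Gens {1..n} ?U) :: 'k kop set)"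
    unfolding theta_eq using ideal_left[OF U Y(1)[OF J(3)] X(2)[OF J(4,7)]] Y(2)[OF J(3,6)] by (simp only: sp_opadd)
  then show ?thesis
    by (rule GsI[OF S[OF J(3,4)] S[OF J(4,3)] theta_inverse[OF fJ J(3,4,5)] theta_inverse[OF fJ J(4,3) J(5)[symmetric]]])
qed

text \<open>A set of size \<open>s\<close> contains \<open>J - {l}\<close> only if it equals it, so
  each factor is visible in a single symbol.\<close>

lemma RI_theta:
  assumes J: "J \<subseteq> {1..n}" "i \<in> J" "j \<in> J" and s: "card J = Suc s" and I: "I \<subseteq> {1..n}" "card I = s" "I \<noteq> {}"
  shows "RI n I (theta i j J) =
    dg ((if I = J - {i} then inverse (Xv i) else 1) * (if I = J - {j} then Xv j else 1 :: 'k::field ratfun))"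
proof -
  have fJ: "finite J" using finite_subset[OF J(1)] by simp
  have fI: "finite I" using finite_subset[OF I(1)] by simp
  have si: "supp_in {1..n} ((\<lambda>_. 0)(l := 1))" if "l \<in> J" for l using that J(1) by (auto simp: supp_in_def)
  have Jl: "J - {l} \<subseteq> {1..n}" for l using J(1) by blast
  have nsub: "\<not> J - {l} \<subseteq> I" if "l \<in> J" "I \<noteq> J - {l}" for l
    using subset_card_eq[OF I(1), of "J - {l}"] that s I(2) fJ by auto
  have Y: "thY i J \<in> (Sn n :: 'k kop set)" unfolding thY_Tm[OF fJ] by (rule Tm_props(2)[OF Jl supp_in_0 si[OF J(2)]])
  have X: "thX j J \<in> (Sn n :: 'k kop set)" unfolding thX_Tm[OF fJ] by (rule Tm_props(2)[OF Jl si[OF J(3)] supp_in_0])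
  have RY: "RI n I (thY i J) = dg (if I = J - {i} then inverse (Xv i) else 1 :: 'k ratfun)"
  proof (cases "I = J - {i}")
    case True
    have i: "i \<in> {1..n} - I" using True J by auto
    then have si: "supp_in ({1..n} - I) ((\<lambda>_. 0)(i := 1))" by (auto simp: supp_in_def)
    show ?thesis unfolding thY_Tm[OF fJ] True[symmetric] RI_Tm[OF I(1,3) supp_in_0 si] Xm_Y[OF i] by simp
  next
    case False
    then show ?thesis
      unfolding thY_Tm[OF fJ] RI_Tm_id[OF Jl supp_in_0 si[OF J(2)] fI I(3) nsub[OF J(2) False]] by (simp add: dg_1)
  qed
  have RX: "RI n I (thX j J) = dg (if I = J - {j} then Xv j else 1 :: 'k ratfun)"
  proof (cases "I = J - {j}")
    case True
    have i: "j \<in> {1..n} - I" using True J by auto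
    then have si: "supp_in ({1..n} - I) ((\<lambda>_. 0)(j := 1))" by (auto simp: supp_in_def)
    show ?thesis unfolding thX_Tm[OF fJ] True[symmetric] RI_Tm[OF I(1,3) si supp_in_0] Xm_X[OF i] by simp
  next
    case False
    then show ?thesis
      unfolding thX_Tm[OF fJ] RI_Tm_id[OF Jl si[OF J(3)] supp_in_0 fI I(3) nsub[OF J(3) False]] by (simp add: dg_1)
  qed
  show ?thesis unfolding theta_eq RI_comp[OF fI I(3) Y X] RY RX dg_mult ..
qed

section \<open>Symbols of inverses, powers and ordered products\<close>

lemma RI_inverse:
  assumes I: "finite I" "I \<noteq> {}" and u: "u \<in> Gs n s" and x: "RI n I u \<circ> y = id" "y \<circ> RI n I u = id"
  shows "RI n I (inv_into UNIV u) = y"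
proof -
  have S: "u \<in> Sn n" "inv_into UNIV u \<in> Sn n" using Gs_Sn[OF u] Gs_Sn[OF Gs_inverse(1)[OF u]] by simp_all
  have "RI n I (inv_into UNIV u) \<circ> RI n I u = id"
    unfolding RI_comp[OF I S(2,1), symmetric] Gs_inverse(3)[OF u] by (rule RI_id[OF I])
  then have "RI n I (inv_into UNIV u) \<circ> RI n I u \<circ> y = y" by (simp only: id_comp)
  then show ?thesis unfolding comp_assoc x(1) comp_id .
qed

lemma dg_inverse: "x \<noteq> 0 \<Longrightarrow> dg x \<circ> dg (inverse x) = id" "x \<noteq> 0 \<Longrightarrow> dg (inverse x) \<circ> dg x = id"
  by (simp_all add: dg_mult dg_1)

lemma Gs_funpow:
  assumes I: "finite I" "I \<noteq> {}" and u: "u \<in> Gs n s" "RI n I u = dg x"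
  shows "u ^^ m \<in> Gs n s" "RI n I (u ^^ m) = dg (x ^ m)"
proof -
  have "u ^^ m \<in> Gs n s \<and> RI n I (u ^^ m) = dg (x ^ m)"
  proof (induction m)
    case 0
    have "u ^^ 0 = id" by simp
    then show ?case by (simp only: Gs_id RI_id[OF I] power_0 dg_1)
  next
    case (Suc m)
    then have h: "u ^^ m \<in> Gs n s" "RI n I (u ^^ m) = dg (x ^ m)" by blast+
    have eq: "u ^^ Suc m = u \<circ> (u ^^ m)" by simp
    show ?case unfolding eq RI_comp[OF I Gs_Sn[OF u(1)] Gs_Sn[OF h(1)]] u(2) h(2) dg_mult
      by (simp only: Gs_comp[OF u(1) h(1)] power_Suc)
  qed
  then show "u ^^ m \<in> Gs n s" "RI n I (u ^^ m) = dg (x ^ m)" by blast+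
qed

lemma Gs_zpow:
  assumes I: "finite I" "I \<noteq> {}" and u: "u \<in> Gs n s" "RI n I u = dg x" "x \<noteq> 0"
  shows "zpow u k \<in> Gs n s" "RI n I (zpow u k) = dg (x powi k)"
proof -
  have i: "RI n I (inv_into UNIV u) = dg (inverse x)"
    by (rule RI_inverse[OF I u(1)]) (simp_all add: u(2) dg_inverse[OF u(3)])
  show "zpow u k \<in> Gs n s"
    unfolding zpow_def using Gs_funpow(1)[OF I u(1,2)] Gs_funpow(1)[OF I Gs_inverse(1)[OF u(1)] i] by simp
  show "RI n I (zpow u k) = dg (x powi k)"
    unfolding zpow_def using Gs_funpow(2)[OF I u(1,2)] Gs_funpow(2)[OF I Gs_inverse(1)[OF u(1)] i]
    by (simp add: power_int_def)
qed

lemma listprod_mem: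
  assumes "id \<in> H" "\<And>g h. g \<in> H \<Longrightarrow> h \<in> H \<Longrightarrow> g \<circ> h \<in> H" "\<And>x. x \<in> set xs \<Longrightarrow> F x \<in> H"
  shows "listprod (map F xs) \<in> H"
  using assms(3)
proof (induction xs)
  case Nil
  show ?case by (simp only: list.map listprod_simps assms(1))
next
  case (Cons x xs)
  then show ?case by (simp only: list.map listprod_simps) (intro assms(2), auto)
qed

lemma set_prods_listprod: "(\<And>x. x \<in> set xs \<Longrightarrow> F x \<in> A x) \<Longrightarrow> listprod (map F xs) \<in> set_prods (map A xs)"
proof (induction xs)
  case Nil
  show ?case by (simp only: list.map listprod_simps set_prods.simps singleton_iff)
next
  case (Cons x xs)
  have "F x \<in> A x" "listprod (map F xs) \<in> set_prods (map A xs)" using Cons by auto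
  then show ?case unfolding list.map listprod_simps set_prods.simps by blast
qed

lemma set_prods_subset:
  assumes "id \<in> H" "\<And>g h. g \<in> H \<Longrightarrow> h \<in> H \<Longrightarrow> g \<circ> h \<in> H"
  shows "(\<And>A. A \<in> set As \<Longrightarrow> A \<subseteq> H) \<Longrightarrow> set_prods As \<subseteq> H"
proof (induction As)
  case Nil
  show ?case using assms(1) by simp
next
  case (Cons A As)
  have "A \<subseteq> H" "set_prods As \<subseteq> H" using Cons by auto
  then show ?case unfolding set_prods.simps using assms(2) by blast
qed

lemma RI_listprod_dg:
  assumes I: "finite I" "I \<noteq> {}" and "\<And>x. x \<in> set xs \<Longrightarrow> F x \<in> Sn n" "\<And>x. x \<in> set xs \<Longrightarrow> RI n I (F x) = dg (y x)"
  shows "RI n I (listprod (map F xs)) = dg (prod_list (map y xs))"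
  using assms(3,4)
proof (induction xs)
  case Nil
  show ?case by (simp only: list.map listprod_simps RI_id[OF I] prod_list.Nil dg_1)
next
  case (Cons x xs)
  have S: "F x \<in> Sn n" "listprod (map F xs) \<in> Sn n"
    using Cons(2) by (auto intro: listprod_mem Salg_id Salg.mult)
  have "RI n I (listprod (map F xs)) = dg (prod_list (map y xs))" "RI n I (F x) = dg (y x)" using Cons by auto
  then show ?case unfolding list.map listprod_simps RI_comp[OF I S] prod_list.Cons by (simp only: dg_mult)
qed

lemma RI_listprod_single:
  assumes I: "finite I" "I \<noteq> {}" and S: "\<And>x. x \<in> set xs \<Longrightarrow> F x \<in> Sn n"
    and id: "\<And>x. x \<in> set xs \<Longrightarrow> x \<noteq> x0 \<Longrightarrow> RI n I (F x) = id" and d: "distinct xs"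
  shows "RI n I (listprod (map F xs)) = (if x0 \<in> set xs then RI n I (F x0) else id)"
  using S id d
proof (induction xs)
  case Nil
  show ?case by (simp only: list.map listprod_simps RI_id[OF I] list.set empty_iff if_False)
next
  case (Cons x xs)
  have S: "F x \<in> Sn n" "listprod (map F xs) \<in> Sn n"
    using Cons(2) by (auto intro: listprod_mem Salg_id Salg.mult)
  have IH: "RI n I (listprod (map F xs)) = (if x0 \<in> set xs then RI n I (F x0) else id)"
    using Cons by auto
  show ?case
  proof (cases "x = x0")
    case True
    then have "x0 \<notin> set xs" using Cons(4) by auto
    then show ?thesis unfolding list.map listprod_simps RI_comp[OF I S] IH using True by (simp only: if_False comp_id list.set insertI1 if_True)
  next
    case False
    have "RI n I (F x) = id" using Cons(3) False by auto
    moreover have "x0 \<in> set (x # xs) \<longleftrightarrow> x0 \<in> set xs" using False by auto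
    ultimately show ?thesis unfolding list.map listprod_simps RI_comp[OF I S] IH by (simp only: id_comp)
  qed
qed

subsection \<open>The index relation\<close>

text \<open>If \<open>Q\<close> were smaller, padding with zeros to square matrices of size
  \<open>card P\<close> would give the left factor a zero column, although the product is the
  identity.\<close>

lemma card_le_of_left_inverse:
  fixes A B :: "'i \<Rightarrow> 'i \<Rightarrow> 'a::field"
  assumes P: "finite P" "finite Q"
    and BA: "\<And>a b. a \<in> P \<Longrightarrow> b \<in> P \<Longrightarrow> (\<Sum>c\<in>Q. B a c * A c b) = (if a = b then 1 else 0)"
  shows "card P \<le> card Q"
proof (rule ccontr)
  assume less: "\<not> card P \<le> card Q"
  define N where "N = card P"
  define m where "m = card Q"
  have mN: "m < N" using less by (simp add: N_def m_def)
  obtain h where h: "bij_betw h {0..<N} P" unfolding N_def using ex_bij_betw_nat_finite[OF P(1)] by blast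
  obtain g where g: "bij_betw g {0..<m} Q" unfolding m_def using ex_bij_betw_nat_finite[OF P(2)] by blast
  define MB where "MB = mat N N (\<lambda>(i, c). if c < m then B (h i) (g c) else 0)"
  define MA where "MA = mat N N (\<lambda>(c, j). if c < m then A (g c) (h j) else 0)"
  have car: "MB \<in> carrier_mat N N" "MA \<in> carrier_mat N N" by (auto simp: MA_def MB_def)
  have "MB * MA = 1\<^sub>m N"
  proof (rule eq_matI)
    fix i j assume "i < dim_row (1\<^sub>m N)" "j < dim_col (1\<^sub>m N)"
    then have ij: "i < N" "j < N" by auto
    have hP: "h i \<in> P" "h j \<in> P" using h ij by (auto simp: bij_betw_def)
    have "(MB * MA) $$ (i, j) = (\<Sum>c = 0..<N. (if c < m then B (h i) (g c) else 0) * (if c < m then A (g c) (h j) else 0))"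
      using ij by (simp add: MA_def MB_def scalar_prod_def)
    also have "\<dots> = (\<Sum>c = 0..<m. B (h i) (g c) * A (g c) (h j))"
      using mN by (intro sum.mono_neutral_cong_right) auto
    also have "\<dots> = (\<Sum>c\<in>Q. B (h i) c * A c (h j))" using sum.reindex_bij_betw[OF g, of "\<lambda>c. B (h i) c * A c (h j)"] .
    also have "\<dots> = (if i = j then 1 else 0)"
      using BA[OF hP] h ij by (auto simp: bij_betw_def inj_on_def)
    finally show "(MB * MA) $$ (i, j) = 1\<^sub>m N $$ (i, j)" using ij by simp
  qed (auto simp: MA_def MB_def)
  then have "det MB * det MA = 1" using det_mult[OF car] by simp
  moreover have "det MB = (\<Sum>i<N. MB $$ (i, m) * cofactor MB i m)" using laplace_expansion_column[OF car(1) mN] .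
  then have "det MB = 0" using mN by (simp add: MB_def)
  ultimately show False by simp
qed

definition mon :: "nat \<Rightarrow> nat set \<Rightarrow> (nat \<Rightarrow> int) \<Rightarrow> 'k::field ratfun" where
  "mon n I e = (\<Prod>l\<in>{1..n} - I. Xv l powi e l)"

lemma mon_nz: "mon n I e \<noteq> 0"
  by (simp add: mon_def Xv_nz)

lemma mon_uminus: "mon n I (\<lambda>l. - e l) = inverse (mon n I e)"
  by (simp add: mon_def power_int_minus prod_inversef comp_def flip: prod_inversef)

lemma Xm_mon: "Xm n I (res ({1..n} - I) (\<lambda>l. nat (e l))) (res ({1..n} - I) (\<lambda>l. nat (- e l))) = (mon n I e :: 'k::field ratfun)"
  unfolding Xm_def mon_def
  by (intro prod.cong refl) (auto simp: res_def power_int_def inverse_eq_divide power_one_over)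

lemma rho_sum:
  assumes "finite P" "\<And>r. r \<in> P \<Longrightarrow> G r \<in> (sp (Gens {1..n} U) :: 'k::field kop set)"
  shows "(\<lambda>f a. \<Sum>r\<in>P. G r f a) \<in> sp (Gens {1..n} U) \<and>
    (\<forall>I f a. rho n I (\<lambda>f a. \<Sum>r\<in>P. G r f a) f a = (\<Sum>r\<in>P. rho n I (G r) f a))"
  using assms
proof (induction P rule: finite_induct)
  case empty
  have "(\<lambda>f a. \<Sum>r\<in>{}. G r f a) = (opzero :: 'k kop)" by (simp add: opzero_def)
  then show ?case by (simp only: sp.sp_zero rho_opzero sum.empty) (simp add: opzero_def)
next
  case (insert x P)
  let ?S = "\<lambda>f a. \<Sum>r\<in>P. G r f a"
  have eq: "(\<lambda>f a. \<Sum>r\<in>insert x P. G r f a) = opadd (G x) ?S"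
    using insert by (simp add: opadd_def)
  have S: "?S \<in> sp (Gens {1..n} U)" "\<And>I f a. rho n I ?S f a = (\<Sum>r\<in>P. rho n I (G r) f a)" using insert by auto
  have x: "G x \<in> sp (Gens {1..n} U)" using insert by simp
  have "rho n I (opadd (G x) ?S) f a = (\<Sum>r\<in>insert x P. rho n I (G r) f a)" for I f a
    unfolding rho_opadd[OF sp_Sn[OF x] sp_Sn[OF S(1)]] using S(2) insert by (simp add: opadd_def)
  then show ?case unfolding eq using sp_opadd[OF x S(1)] by blast
qed

text \<open>At \<open>J\<close> only terms with index set inside \<open>J\<close> survive. By the
  hypothesis this leaves the index set \<open>J\<close> itself, and such a term has values only over
  one point of N^J.\<close>

lemma rho_bounded_rows:
  fixes D :: "'k::field kop"
  assumes J: "J \<subseteq> {1..n}" "card J = Suc s" and D: "D \<in> sp (Gens {1..n} {I. s < card I \<or> card I = s \<and> \<not> I \<subseteq> J})"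
  shows "\<exists>M. \<forall>g a. rho n J D g a \<noteq> 0 \<longrightarrow> (\<forall>l\<in>J. a l \<le> M)"
  using D
proof induction
  case sp_zero
  show ?case by (simp add: rho_opzero) (simp add: opzero_def)
next
  case (sp_add g A c)
  have fJ: "finite J" using finite_subset[OF J(1)] by simp
  obtain M where M: "\<And>g a. rho n J A g a \<noteq> 0 \<Longrightarrow> \<forall>l\<in>J. a l \<le> M" using sp_add.IH by blast
  obtain I p q where g: "g = Gop I p q" "s < card I \<or> card I = s \<and> \<not> I \<subseteq> J" "I \<subseteq> {1..n}" "supp_in {1..n} p" "supp_in {1..n} q"
    using sp_add(1) unfolding Gens_def by blast
  have S: "g \<in> Sn n" "A \<in> Sn n" using g sp_Sn[OF sp_add(2)] by (auto intro: Gop_Salg)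
  have ng: "\<forall>l\<in>J. a l \<le> sum p J" if nz: "rho n J g h a \<noteq> 0" for h a
  proof -
    have IJ: "I \<subseteq> J" using nz unfolding g(1) rho_Gop[OF g(3-5)] by (auto simp: opzero_def split: if_splits)
    then have "card I = card J" using g(2) J(2) card_mono[OF fJ IJ] by auto
    then have "I = J" by (rule subset_card_eq[OF J(1) _ IJ])
    then have "Hop n J J p q h a \<noteq> 0" using nz unfolding g(1) rho_Gop[OF g(3-5)] by simp
    then have "Gop J (res J p) (res J q) h a \<noteq> 0" by (auto simp: Hop_def opsmul_def)
    then have a: "\<forall>i\<in>J. a i = res J p i" unfolding Gop_def by (rule contrapos_np) (simp only: simp_thms if_False)
    show ?thesis
    proof
      fix l assume l: "l \<in> J"
      then have "a l = p l" using a by (simp add: res_def)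
      also have "\<dots> \<le> sum p J" using l fJ by (intro member_le_sum) auto
      finally show "a l \<le> sum p J" .
    qed
  qed
  have "\<forall>l\<in>J. a l \<le> max M (sum p J)" if "rho n J (opadd (opsmul c g) A) h a \<noteq> 0" for h a
  proof -
    have "rho n J g h a \<noteq> 0 \<or> rho n J A h a \<noteq> 0"
      using that unfolding rho_opadd[OF Salg_opsmul[OF S(1)] S(2)] rho_opsmul[OF S(1)] by (auto simp: opadd_def opsmul_def)
    then show ?thesis using ng[of h a] M[of h a] by (auto simp: le_max_iff_disj)
  qed
  then show ?case by blast
qed

text \<open>The origin is left out, so different axes stay disjoint and the cardinality is the sum
  of the heights.\<close>

definition axpts :: "nat set \<Rightarrow> (nat \<Rightarrow> nat) \<Rightarrow> (nat \<Rightarrow> nat) set" where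
  "axpts K h = (\<lambda>(k, j). res {k} (\<lambda>_. j)) ` (SIGMA k:K. {1..h k})"

lemma axpts_card: "finite K \<Longrightarrow> finite (axpts K h) \<and> card (axpts K h) = (\<Sum>k\<in>K. h k)"
proof -
  assume K: "finite K"
  have inj: "inj_on (\<lambda>(k, j). res {k} (\<lambda>_. j)) (SIGMA k:K. {1..h k})"
  proof (rule inj_onI, clarify)
    fix k j k' j' assume h: "j \<in> {1..h k}" "j' \<in> {1..h k'}" "res {k} (\<lambda>_. j) = res {k'} (\<lambda>_. j')"
    have a: "j = (if k = k' then j' else 0)" using fun_cong[OF h(3), of k] by (simp add: res_def)
    then have "k = k'" using h(1) by (auto split: if_splits)
    then show "k = k' \<and> j = j'" using a by simp
  qed
  have "card (SIGMA k:K. {1..h k}) = (\<Sum>k\<in>K. h k)" using K by simp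
  then show ?thesis unfolding axpts_def using card_image[OF inj] K by simp
qed

lemma axptsE: "a \<in> axpts K h \<Longrightarrow> \<exists>k j. k \<in> K \<and> 1 \<le> j \<and> j \<le> h k \<and> a = res {k} (\<lambda>_. j)"
  unfolding axpts_def by (elim imageE SigmaE) auto

lemma axpts_mem:
  assumes k: "k \<in> K" "k \<in> J" and a: "a \<in> Zs J" "on_axis (J - {k}) a" "0 < a k" "a k \<le> h k"
  shows "a \<in> axpts K h"
proof -
  have "a = res {k} (\<lambda>_. a k)"
  proof
    fix l show "a l = res {k} (\<lambda>_. a k) l" using a(1,2) by (cases "l \<in> J") (auto simp: Zs_def supp_in_def on_axis_def res_def)
  qed
  then have "a = (\<lambda>(k, j). res {k} (\<lambda>_. j)) (k, a k)" by simp
  moreover have "(k, a k) \<in> (SIGMA k:K. {1..h k})" using k a by auto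
  ultimately show ?thesis unfolding axpts_def by (rule image_eqI)
qed

lemma box_finite:
  assumes "finite J"
  shows "finite {a \<in> Zs J. \<forall>l\<in>J. a l \<le> M}"
proof (rule finite_subset)
  show "{a \<in> Zs J. \<forall>l\<in>J. a l \<le> M} \<subseteq> (\<lambda>f. res J f) ` (PiE J (\<lambda>_. {..M}))"
  proof
    fix a assume a: "a \<in> {a \<in> Zs J. \<forall>l\<in>J. a l \<le> M}"
    then have "a = res J (restrict a J)" by (auto simp: Zs_def supp_in_def res_def fun_eq_iff)
    moreover have "restrict a J \<in> PiE J (\<lambda>_. {..M})" using a by auto
    ultimately show "a \<in> (\<lambda>f. res J f) ` (PiE J (\<lambda>_. {..M}))" by (rule image_eqI)
  qed
  show "finite ((\<lambda>f. res J f) ` (PiE J (\<lambda>_. {..M})))" using assms by (intro finite_imageI finite_PiE) auto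
qed

text \<open>On functions on N^J, \<open>v\<close> shifts the far part of axis \<open>k\<close> by
  \<open>d k k\<close>, up to scalars, and fixes the other far points; it is arbitrary only in a
  bounded region. So functions on a large box go to functions on the box with its axes lengthened
  (or shortened) by the \<open>d k k\<close>. As \<open>v\<close> is injective, the new set is not
  smaller.\<close>

lemma index_nonneg:
  fixes v :: "'k::field kop"
  assumes v: "v \<in> Gs n s" and s: "0 < s" and J: "J \<subseteq> {1..n}" "card J = Suc s" "n \<in> J"
    and d: "\<And>k. k \<in> J - {n} \<Longrightarrow> RI n (J - {k}) v = dg (mon n (J - {k}) (d k))"
  shows "0 \<le> (\<Sum>k\<in>J - {n}. d k k)"
proof -
  have fJ: "finite J" using finite_subset[OF J(1)] by simp
  let ?K = "J - {n}"
  define p where "p = (\<lambda>k. res ({1..n} - (J - {k})) (\<lambda>l. nat (d k l)))"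
  define q where "q = (\<lambda>k. res ({1..n} - (J - {k})) (\<lambda>l. nat (- d k l)))"
  \<comment> \<open>The deviation from the identity of a model operator with the symbol of
    \<open>v\<close> at \<open>J - {k}\<close>. Subtracting all models from \<open>v - 1\<close>
    leaves \<open>D\<close>, whose symbols at the subsets of \<open>J\<close> of size
    \<open>s\<close> vanish, so its rows are bounded.\<close>
  define T :: "nat \<Rightarrow> 'k kop" where "T = (\<lambda>k. opsub (Gop (J - {k}) (p k) (q k)) (Gop (J - {k}) (\<lambda>_. 0) (\<lambda>_. 0)))"
  have Jk: "J - {k} \<subseteq> {1..n}" for k using J(1) by blast
  have pC: "supp_in ({1..n} - (J - {k})) (p k)" "supp_in ({1..n} - (J - {k})) (q k)" for k
    unfolding p_def q_def by (rule supp_res)+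
  have pn: "supp_in {1..n} (p k)" "supp_in {1..n} (q k)" for k using pC[of k] by (auto simp: supp_in_def)
  have cJ: "card (J - {k}) = s" if "k \<in> J" for k using that J(2) fJ by simp
  have T: "T k \<in> sp (Gens {1..n} {I. s \<le> card I})" if k: "k \<in> J" for k
    unfolding T_def using Jk cJ[OF k] pn[of k] by (intro sp_opsub sp_base GensI supp_in_0) auto
  have TK: "T k \<in> sp (Gens {1..n} {I. s \<le> card I})" if k: "k \<in> ?K" for k using T that by blast
  let ?W = "\<lambda>f a. \<Sum>k\<in>?K. T k f a"
  have W: "?W \<in> sp (Gens {1..n} {I. s \<le> card I})" "\<And>I f a. rho n I ?W f a = (\<Sum>k\<in>?K. rho n I (T k) f a)"
    using rho_sum[of ?K T, OF _ TK] fJ by auto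
  define D where "D = opsub (opsub v id) ?W"
  have v1: "opsub v id \<in> sp (Gens {1..n} {I. s \<le> card I})" using v unfolding Gs_def units_in_def by blast
  have D: "D \<in> sp (Gens {1..n} {I. s \<le> card I})" unfolding D_def by (rule sp_opsub[OF v1 W(1)])
  have vS: "v \<in> Sn n" by (rule Gs_Sn[OF v])
  have Dz: "RI n I D f m = 0" if I: "I \<in> {I. I \<subseteq> J}" "I \<subseteq> {1..n}" "card I = s" for I f m
  proof -
    have fI: "finite I" "I \<noteq> {}" using I s finite_subset[OF I(2)] by auto
    have "card (J - I) = 1" using I J(2) card_Diff_subset[OF fI(1), of J] by simp
    then obtain k0 where "J - I = {k0}" by (auto simp: card_1_singleton_iff)
    then have k0: "k0 \<in> J" "I = J - {k0}" using I(1) by auto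
    have RT: "RI n I (T k) f m = RI n I (Tm (J - {k}) (p k) (q k)) f m - f m" if "k \<in> J" for k
      unfolding Tm_def T_def[symmetric] using RI_opadd[OF Salg_id sp_Sn[OF T[OF that]], of I f m]
      by (simp add: T_def RI_id[OF fI])
    have Tk: "RI n I (T k) f m = (if k = k0 then dg (mon n I (d k0)) f m - f m else 0)" if k: "k \<in> ?K" for k
    proof (cases "k = k0")
      case True
      have "RI n I (Tm (J - {k}) (p k) (q k)) = dg (Xm n I (p k) (q k) :: 'k ratfun)"
        unfolding k0(2) True[symmetric] by (rule RI_Tm[OF Jk _ pC]) (use fI k0 True in blast)
      also have "Xm n I (p k) (q k) = (mon n I (d k0) :: 'k ratfun)" unfolding p_def q_def k0(2) True by (rule Xm_mon)
      finally show ?thesis using RT[of k] k True by simp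
    next
      case False
      have "\<not> J - {k} \<subseteq> I" using k0 False by blast
      from RI_Tm_id[OF Jk pn fI this, where 'k = 'k] have "RI n I (Tm (J - {k}) (p k) (q k) :: 'k kop) = id" .
      then show ?thesis using RT[of k] k False by simp
    qed
    have "RI n I ?W f m = (\<Sum>k\<in>?K. RI n I (T k) f m)" unfolding RI_def W(2) ..
    also have "\<dots> = (\<Sum>k\<in>?K. if k = k0 then dg (mon n I (d k0)) f m - f m else 0)" using Tk by (intro sum.cong) auto
    also have "\<dots> = RI n I v f m - f m"
    proof (cases "k0 = n")
      case True
      have "RI n I v = id" by (rule RI_Gs_id[OF v fI]) (use k0 True in blast)
      then show ?thesis using True fJ by simp
    next
      case False
      have "RI n I v = dg (mon n I (d k0))" unfolding k0(2) using d k0 False by blast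
      then show ?thesis using False k0 fJ by simp
    qed
    finally show ?thesis
      unfolding D_def RI_opsub[OF sp_Sn[OF v1] sp_Sn[OF W(1)]] RI_opsub[OF vS Salg_id] by (simp add: RI_id[OF fI])
  qed
  have "D \<in> sp (Gens {1..n} {I. s < card I \<or> card I = s \<and> I \<notin> {I. I \<subseteq> J}})"
    by (rule RI_kernel[OF D s]) (rule Dz)
  then have "D \<in> sp (Gens {1..n} {I. s < card I \<or> card I = s \<and> \<not> I \<subseteq> J})" by (simp only: mem_Collect_eq)
  from rho_bounded_rows[OF J(1,2) this] obtain M0 where M0: "\<And>g a. rho n J D g a \<noteq> 0 \<Longrightarrow> \<forall>l\<in>J. a l \<le> M0" by blast
  \<comment> \<open>Large enough that every new height \<open>M + d k k\<close> is still at least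
    the bound \<open>M0\<close> for the rows of \<open>D\<close>.\<close>
  define M where "M = M0 + (\<Sum>k\<in>?K. nat \<bar>d k k\<bar>)"
  have Md: "int M0 \<le> int M + d k k" "int M0 \<le> int M" if "k \<in> ?K" for k
  proof -
    have "nat \<bar>d k k\<bar> \<le> (\<Sum>k\<in>?K. nat \<bar>d k k\<bar>)" using that fJ by (intro member_le_sum) auto
    then show "int M0 \<le> int M + d k k" "int M0 \<le> int M" unfolding M_def by linarith+
  qed
  define h where "h = (\<lambda>k. nat (int M + d k k))"
  define Box where "Box = {a \<in> Zs J. \<forall>l\<in>J. a l \<le> M}"
  define Q where "Q = (Box - axpts ?K (\<lambda>_. M)) \<union> axpts ?K h"
  have fin: "finite Box" "finite Q" unfolding Q_def Box_def using box_finite[OF fJ] axpts_card[of ?K] fJ by auto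
  define V where "V = rho n J v"
  define V' where "V' = rho n J (inv_into UNIV v)"
  have v'S: "inv_into UNIV v \<in> Sn n" by (rule Gs_Sn[OF Gs_inverse(1)[OF v]])
  have VV: "V' \<circ> V = id" unfolding V_def V'_def rho_comp[OF v'S vS, symmetric] Gs_inverse(3)[OF v] by (rule rho_id)
  have rT: "rho n J (T k) (uvec b) a =
      (if on_axis (J - {k}) a \<and> nat (d k k) \<le> a k then Xm n J (p k) (q k) * uvec b (a(k := a k - nat (d k k) + nat (- d k k))) else 0)
      - (if on_axis (J - {k}) a then uvec b a else 0)" if k: "k \<in> ?K" for a b k
  proof -
    have G: "Gop I (p k) (q k) \<in> (Sn n :: 'k kop set)" "Gop I (\<lambda>_. 0) (\<lambda>_. 0) \<in> (Sn n :: 'k kop set)" if "I \<subseteq> {1..n}" for I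
      using pn[of k] that by (auto intro!: Gop_Salg supp_in_0)
    have kn: "k \<in> {1..n}" using k J(1) by blast
    have r: "res J (p k) = (\<lambda>_. 0)(k := nat (d k k))" "res J (q k) = (\<lambda>_. 0)(k := nat (- d k k))"
      using k kn by (auto simp: p_def q_def res_def fun_eq_iff)
    have r0: "res J (\<lambda>_. 0) = (\<lambda>_. 0)" by (simp add: res_def)
    have upd: "(\<lambda>l. a l - ((\<lambda>_. 0)(k := nat (d k k))) l + ((\<lambda>_. 0)(k := nat (- d k k))) l) = a(k := a k - nat (d k k) + nat (- d k k))"
      by (auto simp: fun_eq_iff)
    have c: "(\<forall>i\<in>J - {k}. a i = ((\<lambda>_. 0)(k := nat (d k k))) i) \<and> (\<forall>l. ((\<lambda>_. 0)(k := nat (d k k))) l \<le> a l)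
       \<longleftrightarrow> on_axis (J - {k}) a \<and> nat (d k k) \<le> a k" by (auto simp: on_axis_def)
    have "rho n J (T k) (uvec b) a = Hop n J (J - {k}) (p k) (q k) (uvec b) a - Hop n J (J - {k}) (\<lambda>_. 0) (\<lambda>_. 0) (uvec b) a"
      unfolding T_def rho_opsub[OF G[OF Jk]] rho_Gop[OF Jk pn] rho_Gop[OF Jk supp_in_0 supp_in_0]
      by (simp add: opsub_def)
    also have "Hop n J (J - {k}) (\<lambda>_. 0) (\<lambda>_. 0) (uvec b) a = (if on_axis (J - {k}) a then uvec b a else (0 :: 'k ratfun))"
      unfolding Hop_def r0 opsmul_def Gop_00 by (simp add: Xm_def on_axis_def)
    also have "Hop n J (J - {k}) (p k) (q k) (uvec b) a =
      (if on_axis (J - {k}) a \<and> nat (d k k) \<le> a k then Xm n J (p k) (q k) * uvec b (a(k := a k - nat (d k k) + nat (- d k k))) else (0 :: 'k ratfun))"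
      unfolding Hop_def opsmul_def Gop_def r upd c by simp
    finally show ?thesis .
  qed
  have Vsum: "V g a = g a + (\<Sum>k\<in>?K. rho n J (T k) g a) + rho n J D g a" for g a
  proof -
    have "rho n J D g a = V g a - g a - (\<Sum>k\<in>?K. rho n J (T k) g a)"
      unfolding D_def rho_opsub[OF sp_Sn[OF v1] sp_Sn[OF W(1)]] rho_opsub[OF vS Salg_id] rho_id V_def by (simp only: opsub_def W(2) id_apply)
    then show ?thesis by simp
  qed
  have supp: "a \<in> Q" if b: "b \<in> Box" and a: "a \<in> Zs J" "V (uvec b) a \<noteq> 0" for a b
  proof (cases "\<forall>l\<in>J. a l \<le> M0")
    case True
    have aB: "a \<in> Box" using True a(1) by (auto simp: Box_def M_def intro: trans_le_add1)
    show ?thesis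
    proof (cases "a \<in> axpts ?K (\<lambda>_. M)")
      case True
      then obtain k j where k: "k \<in> ?K" "1 \<le> j" "a = res {k} (\<lambda>_. j)" using axptsE by blast
      have "a k \<le> M0" using \<open>\<forall>l\<in>J. a l \<le> M0\<close> k(1) by blast
      then have "a k \<le> h k" using Md(1)[OF k(1)] unfolding h_def by linarith
      moreover have "on_axis (J - {k}) a" "0 < a k" using k by (auto simp: on_axis_def res_def)
      ultimately have "a \<in> axpts ?K h" using axpts_mem[OF k(1) _ a(1)] k(1) by blast
      then show ?thesis unfolding Q_def by blast
    qed (use aB in \<open>auto simp: Q_def\<close>)
  next
    case False
    then have D0: "rho n J D (uvec b) a = 0" using M0 by blast
    show ?thesis
    proof (cases "\<exists>k\<in>?K. on_axis (J - {k}) a")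
      case True
      then obtain k where k: "k \<in> ?K" "on_axis (J - {k}) a" by blast
      have ak: "0 < a k"
      proof (rule ccontr)
        assume "\<not> 0 < a k"
        then have "a l = 0" if "l \<in> J" for l using k(2) that by (cases "l = k") (auto simp: on_axis_def)
        then show False using False by auto
      qed
      have "rho n J (T l) (uvec b) a = 0" if l: "l \<in> ?K" "l \<noteq> k" for l
      proof -
        have "\<not> on_axis (J - {l}) a" using ak k(1) l by (auto simp: on_axis_def)
        then show ?thesis unfolding rT[OF l(1)] by simp
      qed
      then have "(\<Sum>l\<in>?K. rho n J (T l) (uvec b) a) = rho n J (T k) (uvec b) a"
        using fJ k(1) by (subst sum.remove[OF _ k(1)]) auto
      then have "V (uvec b) a = (if nat (d k k) \<le> a k then Xm n J (p k) (q k) * uvec b (a(k := a k - nat (d k k) + nat (- d k k))) else 0)"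
        unfolding Vsum D0 rT[OF k(1)] using k(2) by simp
      then have 1: "nat (d k k) \<le> a k" "uvec b (a(k := a k - nat (d k k) + nat (- d k k))) \<noteq> (0 :: 'k ratfun)"
        using a(2) by (auto split: if_splits)
      then have "b = a(k := a k - nat (d k k) + nat (- d k k))" by (auto simp: uvec_def split: if_splits)
      then have "b k = a k - nat (d k k) + nat (- d k k)" by simp
      moreover have "b k \<le> M" using b k(1) by (auto simp: Box_def)
      ultimately have "a k \<le> h k" using 1(1) unfolding h_def by linarith
      then have "a \<in> axpts ?K h" using axpts_mem[OF k(1) _ a(1) k(2) ak] k(1) by blast
      then show ?thesis unfolding Q_def by blast
    next
      case noax: False
      then have "rho n J (T l) (uvec b) a = 0" if l: "l \<in> ?K" for l unfolding rT[OF l] using l by auto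
      then have "V (uvec b) a = uvec b a" unfolding Vsum D0 by simp
      then have "a = b" using a(2) by (auto simp: uvec_def split: if_splits)
      moreover have "a \<notin> axpts ?K (\<lambda>_. M)"
      proof
        assume "a \<in> axpts ?K (\<lambda>_. M)"
        then obtain k j where k: "k \<in> ?K" "a = res {k} (\<lambda>_. j)" using axptsE by blast
        then have "on_axis (J - {k}) a" by (simp add: on_axis_def res_def)
        then show False using noax k(1) by blast
      qed
      ultimately show ?thesis unfolding Q_def using b by blast
    qed
  qed
  have "card Box \<le> card Q"
  proof (rule card_le_of_left_inverse[OF fin])
    fix a b assume ab: "a \<in> Box" "b \<in> Box"
    have "V (uvec b) x = (\<Sum>c\<in>Q. V (uvec b) c * uvec c x)" for x
    proof (cases "x \<in> Q")
      case True
      then show ?thesis using fin by (simp add: uvec_def if_distrib[of "\<lambda>t. _ * t"] cong: if_cong)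
    next
      case False
      have "V (uvec b) x = 0"
      proof (cases "x \<in> Zs J")
        case True
        then show ?thesis using supp[OF ab(2) True] False by blast
      next
        case nx: False
        have "uvec b a = (0 :: 'k ratfun)" if "a \<notin> Zs J" for a using that ab(2) by (auto simp: uvec_def Box_def)
        then show ?thesis unfolding V_def by (rule rep_outside[OF rho_rep[OF vS] _ nx])
      qed
      moreover have "(\<Sum>c\<in>Q. V (uvec b) c * uvec c x) = 0" using False by (intro sum.neutral) (auto simp: uvec_def)
      ultimately show ?thesis by simp
    qed
    then have "V (uvec b) = (\<lambda>x. \<Sum>c\<in>Q. V (uvec b) c * uvec c x)" by (rule ext)
    then have "V' (V (uvec b)) a = V' (\<lambda>x. \<Sum>c\<in>Q. V (uvec b) c * uvec c x) a" by (rule arg_cong)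
    also have "\<dots> = (\<Sum>c\<in>Q. V (uvec b) c * V' (uvec c) a)"
      unfolding V'_def by (rule linear_op_sum[OF linear_rho[OF v'S]])
    finally have "(\<Sum>c\<in>Q. V (uvec b) c * V' (uvec c) a) = (V' \<circ> V) (uvec b) a" by simp
    then show "(\<Sum>c\<in>Q. V' (uvec c) a * V (uvec b) c) = (if a = b then 1 else 0)"
      unfolding VV by (simp add: uvec_def mult.commute)
  qed
  moreover have "axpts ?K (\<lambda>_. M) \<subseteq> Box"
  proof
    fix a assume "a \<in> axpts ?K (\<lambda>_. M)"
    then obtain k j where "k \<in> ?K" "j \<le> M" "a = res {k} (\<lambda>_. j)" using axptsE by blast
    then show "a \<in> Box" by (auto simp: Box_def Zs_def supp_in_def res_def)
  qed
  then have "card (Box - axpts ?K (\<lambda>_. M)) + (\<Sum>k\<in>?K. M) = card Box"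
    using axpts_card[of ?K "\<lambda>_. M"] fJ fin(1) card_mono[of Box "axpts ?K (\<lambda>_. M)"] by (simp add: card_Diff_subset)
  moreover have "card Q \<le> card (Box - axpts ?K (\<lambda>_. M)) + (\<Sum>k\<in>?K. h k)"
    unfolding Q_def using card_Un_le[of "Box - axpts ?K (\<lambda>_. M)" "axpts ?K h"] axpts_card[of ?K h] fJ by simp
  ultimately have "(\<Sum>k\<in>?K. M) \<le> (\<Sum>k\<in>?K. h k)" by linarith
  then have "int (\<Sum>k\<in>?K. M) \<le> int (\<Sum>k\<in>?K. h k)" by (simp only: of_nat_le_iff)
  also have "int (\<Sum>k\<in>?K. h k) = (\<Sum>k\<in>?K. int M + d k k)"
    unfolding of_nat_sum h_def using Md(1) by (intro sum.cong refl) force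
  finally show ?thesis by (simp add: sum.distrib)
qed

text \<open>The inverse unit has the opposite exponents, so the inequality holds in both
  directions.\<close>

lemma index_zero:
  fixes v :: "'k::field kop"
  assumes v: "v \<in> Gs n s" and s: "0 < s" and J: "J \<subseteq> {1..n}" "card J = Suc s" "n \<in> J"
    and d: "\<And>k. k \<in> J - {n} \<Longrightarrow> RI n (J - {k}) v = dg (mon n (J - {k}) (d k))"
  shows "(\<Sum>k\<in>J - {n}. d k k) = 0"
proof -
  have "RI n (J - {k}) (inv_into UNIV v) = dg (mon n (J - {k}) (\<lambda>l. - d k l))" if k: "k \<in> J - {n}" for k
  proof -
    have fJk: "finite (J - {k})" "J - {k} \<noteq> {}" using finite_subset[OF J(1)] k J(3) by auto
    show ?thesis unfolding mon_uminus
    proof (rule RI_inverse[OF fJk v])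
      show "RI n (J - {k}) v \<circ> dg (inverse (mon n (J - {k}) (d k))) = id"
        "dg (inverse (mon n (J - {k}) (d k))) \<circ> RI n (J - {k}) v = id"
        by (simp_all only: d[OF k] dg_inverse[OF mon_nz])
    qed
  qed
  then have "0 \<le> (\<Sum>k\<in>J - {n}. - d k k)"
    by (intro index_nonneg[OF Gs_inverse(1)[OF v] s J, where d = "\<lambda>k l. - d k l"])
  moreover have "0 \<le> (\<Sum>k\<in>J - {n}. d k k)" by (rule index_nonneg[OF v s J d])
  ultimately show ?thesis by (simp add: sum_negf)
qed

subsection \<open>The factorization\<close>

lemma mons_exponents:
  "distinct ks \<Longrightarrow> m \<in> mons (map Xv ks) \<Longrightarrow> \<exists>e. m = (\<Prod>k\<in>set ks. Xv k powi e k :: 'k::field ratfun)"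
proof (induction ks arbitrary: m)
  case Nil
  then show ?case by simp
next
  case (Cons k ks)
  obtain a m' where m: "m = Xv k powi a * m'" "m' \<in> mons (map Xv ks)" using Cons(3) by auto
  obtain e where e: "m' = (\<Prod>k\<in>set ks. Xv k powi e k)" using Cons.IH[OF _ m(2)] Cons(2) by auto
  have "m' = (\<Prod>l\<in>set ks. Xv l powi (e(k := a)) l)" unfolding e using Cons(2) by (intro prod.cong) auto
  then have "m = (\<Prod>l\<in>set (k # ks). Xv l powi (e(k := a)) l)" unfolding m(1) using Cons(2) by simp
  then show ?case by (intro exI[of _ "e(k := a)"])
qed

text \<open>\<open>K1_Laurent\<close> leaves the diagonal unit on the right; conjugating the
  elementary part moves it to the left. There \<open>mon\<close> is to be matched by the
  \<open>theta\<close> and \<open>dg (emb c)\<close> by \<open>UI\<close>.\<close>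

lemma RI_decompose:
  fixes u :: "'k::field kop"
  assumes I: "I \<noteq> {}" "I \<subseteq> {1..n}" and u: "u \<in> Gs n (card I)"
  shows "\<exists>d c e. c \<noteq> 0 \<and> e \<in> elem_ops (Lr n I) \<and> RI n I u = dg (mon n I d) \<circ> (dg (emb c) \<circ> e)"
proof -
  let ?ks = "sorted_list_of_set ({1..n} - I)"
  have "RI n I u \<in> GLop (Lau (range emb) (map Xv ?ks))" using RI_GLop[OF I u] unfolding Lr_def .
  from K1_Laurent[OF emb_subfield indep_Lr this] obtain e c m where
    e: "e \<in> elem_ops (Lr n I)" "c \<in> range emb" "m \<in> mons (map Xv ?ks)" "c \<noteq> 0" "RI n I u = e \<circ> dg (c * m)"
    unfolding Lr_def by blast
  obtain c' where c': "c = emb c'" using e(2) by blast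
  obtain d where d: "m = mon n I d" using mons_exponents[OF _ e(3)] by (auto simp: mon_def)
  have nz: "c * m \<noteq> 0" using e(4) mon_nz by (simp add: d)
  have c0: "c' \<noteq> 0" using e(4) by (auto simp: c' emb_0)
  have mL: "mon n I f \<in> Lr n I" for f :: "nat \<Rightarrow> int"
    unfolding mon_def by (intro subring_prod Lr_props(1) powi_mem) (auto intro: Lr_props simp del: One_nat_def)
  have L1: "c * m \<in> Lr n I" unfolding c' d by (intro subring_mult Lr_props mL)
  have "inverse (c * m) = emb (inverse c') * mon n I (\<lambda>l. - d l)"
    unfolding c' d by (simp add: mon_uminus emb_inverse)
  then have L2: "inverse (c * m) \<in> Lr n I" by (simp only:) (intro subring_mult Lr_props mL)
  have G: "dg (c * m) \<in> GLop (Lr n I)" "dg (inverse (c * m)) \<in> GLop (Lr n I)"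
    using GLop_dg[OF Lr_props(1) L1 L2 right_inverse[OF nz]] GLop_dg[OF Lr_props(1) L2 L1 left_inverse[OF nz]] .
  let ?e = "dg (inverse (c * m)) \<circ> e \<circ> dg (c * m)"
  have e': "?e \<in> elem_ops (Lr n I)" by (rule GLop_conj[OF Lr_props(1) G(2,1) dg_inverse(2,1)[OF nz] e(1)])
  have "dg (mon n I d) \<circ> (dg (emb c') \<circ> ?e) = dg (mon n I d) \<circ> dg (emb c') \<circ> dg (inverse (c * m)) \<circ> e \<circ> dg (c * m)"
    by (simp only: o_assoc)
  also have "dg (mon n I d) \<circ> dg (emb c') \<circ> dg (inverse (c * m)) = id"
    unfolding dg_mult c'[symmetric] d[symmetric] mult.commute[of m c] right_inverse[OF nz] by (rule dg_1)
  finally have "RI n I u = dg (mon n I d) \<circ> (dg (emb c') \<circ> ?e)" unfolding e(5) by (simp only: id_comp)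
  then show ?thesis using c0 e' by blast
qed

lemma UE_Gs: "I \<subseteq> {1..n} \<Longrightarrow> n \<in> I \<Longrightarrow> s \<le> card I \<Longrightarrow> UE n I \<subseteq> Gs n s"
  using UE_Vn Vn_Gs by blast

lemma prod_list_pairs:
  assumes "distinct Js" "\<And>J. J \<in> set Js \<Longrightarrow> distinct (js J)"
  shows "prod_list (map y (concat (map (\<lambda>J. map (Pair J) (js J)) Js))) = (\<Prod>J\<in>set Js. \<Prod>j\<in>set (js J). y (J, j) :: 'a::comm_monoid_mult)"
  using assms
proof (induction Js)
  case (Cons J Js)
  have "prod_list (map y (map (Pair J) (js J))) = (\<Prod>j\<in>set (js J). y (J, j))"
    using Cons(3)[of J] by (simp add: prod.distinct_set_conv_list comp_def)
  then show ?case using Cons by simp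
qed simp

lemma prod_powi: "x \<noteq> 0 \<Longrightarrow> (\<Prod>j\<in>S. x powi e j) = (x :: 'a::field) powi (\<Sum>j\<in>S. e j)"
  by (induction S rule: infinite_finite_induct) (simp_all add: power_int_add)

text \<open>Let \<open>m\<close> be the maximum of \<open>J - {n}\<close>. The power of
  \<open>theta m j J\<close> gives the desired exponent at \<open>J - {j}\<close> for each
  \<open>j\<close> other than \<open>m\<close>; at \<open>J - {m}\<close> the powers together give
  minus the sum of these exponents, which the index relation identifies as the desired one.\<close>

lemma theta_exponents:
  fixes d :: "nat set \<Rightarrow> nat \<Rightarrow> int"
  assumes J: "J \<subseteq> {1..n}" "n \<in> J" "2 \<le> card (J - {n})" and I: "n \<in> I" and d: "(\<Sum>k\<in>J - {n}. d (J - {k}) k) = 0"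
  shows "k \<notin> I \<Longrightarrow> J = insert k I \<Longrightarrow>
    (\<Prod>j\<in>J - {n, Max (J - {n})}. ((if I = J - {Max (J - {n})} then inverse (Xv (Max (J - {n}))) else 1) *
      (if I = J - {j} then Xv j else 1 :: 'k::field ratfun)) powi d (J - {j}) j) = Xv k powi d I k"
    and "\<not> I \<subseteq> J \<Longrightarrow> (\<Prod>j\<in>J - {n, Max (J - {n})}. ((if I = J - {Max (J - {n})} then inverse (Xv (Max (J - {n}))) else 1) *
      (if I = J - {j} then Xv j else 1 :: 'k::field ratfun)) powi d (J - {j}) j) = 1"
proof -
  have fJ: "finite J" using finite_subset[OF J(1)] by simp
  define m where "m = Max (J - {n})"
  have "J - {n} \<noteq> {}"
  proof
    assume "J - {n} = {}"
    then have "card (J - {n}) = 0" by (simp only: card.empty)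
    then show False using J(3) by linarith
  qed
  then have m: "m \<in> J - {n}" unfolding m_def using fJ by (intro Max_in) auto
  let ?y = "\<lambda>j. ((if I = J - {m} then inverse (Xv m) else 1) * (if I = J - {j} then Xv j else 1 :: 'k ratfun)) powi d (J - {j}) j"
  {
    assume k: "k \<notin> I" "J = insert k I"
    have Ik: "I = J - {k}" using k by auto
    have kJ: "k \<in> J" unfolding k(2) by simp
    have kn: "k \<noteq> n" using k I by auto
    have eqI: "I = J - {j} \<longleftrightarrow> j = k" if "j \<in> J" for j using that k(1) unfolding k(2) by auto
    show "(\<Prod>j\<in>J - {n, Max (J - {n})}. ((if I = J - {Max (J - {n})} then inverse (Xv (Max (J - {n}))) else 1) *
      (if I = J - {j} then Xv j else 1 :: 'k ratfun)) powi d (J - {j}) j) = Xv k powi d I k"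
    proof (cases "k = m")
      case True
      have y: "?y j = inverse (Xv m) powi d (J - {j}) j" if "j \<in> J - {n, m}" for j
        using that True eqI[of j] eqI[of m] m by auto
      have "(\<Prod>j\<in>J - {n, m}. ?y j) = inverse (Xv m) powi (\<Sum>j\<in>J - {n, m}. d (J - {j}) j)"
        using y by (subst prod_powi[symmetric]) (auto simp: Xv_nz intro!: prod.cong)
      also have "(\<Sum>j\<in>J - {n, m}. d (J - {j}) j) = - d (J - {m}) m"
      proof -
        have "J - {n} - {m} = J - {n, m}" by auto
        then show ?thesis using d sum.remove[OF _ m, of "\<lambda>k. d (J - {k}) k"] fJ by simp
      qed
      also have "inverse (Xv m) powi (- d (J - {m}) m) = (Xv m powi d (J - {m}) m :: 'k ratfun)"
        by (simp add: power_int_minus power_int_inverse)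
      finally have fin: "(\<Prod>j\<in>J - {n, m}. ?y j) = Xv m powi d (J - {m}) m" .
      have Im: "J - {m} = I" using Ik True by simp
      show ?thesis unfolding m_def[symmetric] True using fin unfolding Im .
    next
      case False
      have y: "?y j = (if j = k then Xv k powi d I k else 1)" if "j \<in> J - {n, m}" for j
        using that False eqI[of j] eqI[of m] m by (auto simp: Ik[symmetric])
      have "(\<Prod>j\<in>J - {n, m}. ?y j) = (\<Prod>j\<in>J - {n, m}. if j = k then Xv k powi d I k else 1)"
        using y by (intro prod.cong) auto
      also have "\<dots> = Xv k powi d I k" using fJ kJ kn False by simp
      finally show ?thesis unfolding m_def[symmetric] .
    qed
  }
  assume nI: "\<not> I \<subseteq> J"
  have "?y j = 1" for j
  proof -
    have "I \<noteq> J - {m}" "I \<noteq> J - {j}" using nI by auto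
    then show ?thesis by simp
  qed
  then show "(\<Prod>j\<in>J - {n, Max (J - {n})}. ((if I = J - {Max (J - {n})} then inverse (Xv (Max (J - {n}))) else 1) *
      (if I = J - {j} then Xv j else 1 :: 'k ratfun)) powi d (J - {j}) j) = 1"
    unfolding m_def[symmetric] by simp
qed

text \<open>The symbol at \<open>I\<close> is affected only by the sets \<open>insert k I\<close>,
  and the one for \<open>k\<close> supplies the power of \<open>X_k\<close>. All these symbols are
  diagonal, so the prescribed order of the factors does not matter.\<close>

lemma theta_realizes:
  fixes d :: "nat set \<Rightarrow> nat \<Rightarrow> int"
  assumes s: "2 \<le> s"
    and Js: "distinct Js" "set Js = {J. J \<subseteq> {1..n} \<and> card J = s + 1 \<and> n \<in> J}"
    and jord: "\<And>J. J \<in> set Js \<Longrightarrow> distinct (jord J) \<and> set (jord J) = J - {n, Max (J - {n})}"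
    and d: "\<And>J. J \<in> set Js \<Longrightarrow> (\<Sum>k\<in>J - {n}. d (J - {k}) k) = 0"
  shows "\<exists>th\<in>Thtil n Js jord. (th :: 'k::field kop) \<in> Gs n s \<and>
    (\<forall>I. I \<subseteq> {1..n} \<longrightarrow> card I = s \<longrightarrow> n \<in> I \<longrightarrow> RI n I th = dg (mon n I (d I)))"
proof -
  define prs where "prs = concat (map (\<lambda>J. map (Pair J) (jord J)) Js)"
  define F :: "nat set \<times> nat \<Rightarrow> 'k kop" where "F = (\<lambda>(J, j). zpow (theta (Max (J - {n})) j J) (d (J - {j}) j))"
  define A :: "nat set \<times> nat \<Rightarrow> 'k kop set" where "A = (\<lambda>(J, j). {zpow (theta (Max (J - {n})) j J) k | k. True})"
  have "map A prs = concat (map (\<lambda>J. map (\<lambda>j. {zpow (theta (Max (J - {n})) j J) k | k. True}) (jord J)) Js)"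
    unfolding prs_def map_concat by (simp add: A_def comp_def)
  then have Th: "Thtil n Js jord = set_prods (map A prs)" unfolding Thtil_def by (simp only:)
  have mem: "listprod (map F prs) \<in> Thtil n Js jord"
    unfolding Th by (rule set_prods_listprod) (auto simp: F_def A_def)
  have Jp: "J \<subseteq> {1..n}" "n \<in> J" "card J = Suc s" "finite J" "2 \<le> card (J - {n})" "Max (J - {n}) \<in> J - {n}" if J: "J \<in> set Js" for J
  proof -
    show 1: "J \<subseteq> {1..n}" "n \<in> J" "card J = Suc s" using J Js(2) by auto
    show fJ: "finite J" using finite_subset[OF 1(1)] by simp
    show 2: "2 \<le> card (J - {n})" using 1 fJ s by simp
    have "J - {n} \<noteq> {}"
    proof
      assume "J - {n} = {}"
      then have "card (J - {n}) = 0" by (simp only: card.empty)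
      then show False using 2 by linarith
    qed
    then show "Max (J - {n}) \<in> J - {n}" using fJ by (intro Max_in) auto
  qed
  have pr: "x \<in> set prs \<Longrightarrow> \<exists>J j. x = (J, j) \<and> J \<in> set Js \<and> j \<in> J - {n, Max (J - {n})}" for x
    unfolding prs_def using jord by auto
  have thG: "theta (Max (J - {n})) j J \<in> (Gs n s :: 'k kop set)" if "J \<in> set Js" "j \<in> J - {n, Max (J - {n})}" for J j
    using theta_Gs[OF Jp(1,2)[OF that(1)], of "Max (J - {n})" j s] Jp[OF that(1)] that(2) by auto
  define y :: "nat set \<Rightarrow> nat set \<times> nat \<Rightarrow> 'k ratfun" where
    "y = (\<lambda>I (J, j). ((if I = J - {Max (J - {n})} then inverse (Xv (Max (J - {n}))) else 1) * (if I = J - {j} then Xv j else 1)) powi d (J - {j}) j)"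
  have FG: "F x \<in> Gs n s \<and> (\<forall>I. I \<subseteq> {1..n} \<longrightarrow> card I = s \<longrightarrow> n \<in> I \<longrightarrow> RI n I (F x) = dg (y I x))" if x: "x \<in> set prs" for x
  proof -
    obtain J j where J: "x = (J, j)" "J \<in> set Js" "j \<in> J - {n, Max (J - {n})}" using pr[OF x] by blast
    have "RI n I (F x) = dg (y I x) \<and> F x \<in> Gs n s" if I: "I \<subseteq> {1..n}" "card I = s" "n \<in> I" for I
    proof -
      have fI: "finite I" "I \<noteq> {}" using finite_subset[OF I(1)] I by auto
      have mJ: "Max (J - {n}) \<in> J" "j \<in> J" using Jp(6)[OF J(2)] J(3) by auto
      note R = RI_theta[OF Jp(1)[OF J(2)] mJ Jp(3)[OF J(2)] I(1,2) fI(2), where 'k = 'k]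
      show ?thesis unfolding J(1) F_def y_def prod.case
        by (intro conjI Gs_zpow[OF fI thG[OF J(2,3)] R]) (simp_all add: Xv_nz)
    qed
    moreover have "J - {j} \<subseteq> {1..n} \<and> card (J - {j}) = s \<and> n \<in> J - {j}" using Jp(1-4)[OF J(2)] J(3) by auto
    ultimately show ?thesis by blast
  qed
  have G: "listprod (map F prs) \<in> Gs n s" using FG by (intro listprod_mem Gs_id Gs_comp) auto
  have "RI n I (listprod (map F prs)) = dg (mon n I (d I))" if I: "I \<subseteq> {1..n}" "card I = s" "n \<in> I" for I
  proof -
    have fI: "finite I" "I \<noteq> {}" using finite_subset[OF I(1)] I by auto
    have "RI n I (listprod (map F prs)) = dg (prod_list (map (y I) prs))"
      using FG I by (intro RI_listprod_dg[OF fI]) (blast intro: Gs_Sn, blast)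
    also have "prod_list (map (y I) prs) = (\<Prod>J\<in>set Js. \<Prod>j\<in>J - {n, Max (J - {n})}. y I (J, j))"
      unfolding prs_def using jord by (subst prod_list_pairs[OF Js(1)]) auto
    also have "\<dots> = (\<Prod>J\<in>(\<lambda>k. insert k I) ` ({1..n} - I). \<Prod>j\<in>J - {n, Max (J - {n})}. y I (J, j))"
    proof (rule prod.mono_neutral_right)
      show "(\<lambda>k. insert k I) ` ({1..n} - I) \<subseteq> set Js" unfolding Js(2) using I fI by auto
      show "\<forall>J\<in>set Js - (\<lambda>k. insert k I) ` ({1..n} - I). (\<Prod>j\<in>J - {n, Max (J - {n})}. y I (J, j)) = 1"
      proof
        fix J assume J: "J \<in> set Js - (\<lambda>k. insert k I) ` ({1..n} - I)"
        then have J': "J \<in> set Js" by blast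
        have "\<not> I \<subseteq> J"
        proof
          assume IJ: "I \<subseteq> J"
          have "card (J - I) = 1" using card_Diff_subset[OF fI(1) IJ] Jp(3)[OF J'] I(2) by simp
          then obtain k where "J - I = {k}" by (auto simp: card_1_singleton_iff)
          then have "J = insert k I" "k \<in> {1..n} - I" using IJ Jp(1)[OF J'] by auto
          then show False using J by blast
        qed
        then show "(\<Prod>j\<in>J - {n, Max (J - {n})}. y I (J, j)) = 1"
          unfolding y_def prod.case by (rule theta_exponents(2)[where d = d, OF Jp(1,2,5)[OF J'] I(3) d[OF J']])
      qed
    qed simp
    also have "\<dots> = (\<Prod>k\<in>{1..n} - I. \<Prod>j\<in>insert k I - {n, Max (insert k I - {n})}. y I (insert k I, j))"
    proof (subst prod.reindex)
      show "inj_on (\<lambda>k. insert k I) ({1..n} - I)" by (rule inj_onI) blast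
    qed simp
    also have "\<dots> = mon n I (d I)"
      unfolding mon_def
    proof (intro prod.cong refl)
      fix k assume k: "k \<in> {1..n} - I"
      then have J: "insert k I \<in> set Js" unfolding Js(2) using I fI by auto
      show "(\<Prod>j\<in>insert k I - {n, Max (insert k I - {n})}. y I (insert k I, j)) = Xv k powi d I k"
        unfolding y_def prod.case using k by (intro theta_exponents(1)[where d = d, OF Jp(1,2,5)[OF J] I(3) d[OF J]]) auto
    qed
    finally show ?thesis .
  qed
  then show ?thesis using mem G by blast
qed

text \<open>The \<open>w I\<close> match the symbols of \<open>u\<close> up to monomials. Removing
  their product on the right gives a unit \<open>v\<close> with monomial symbols, whose exponents
  obey the index relation, so a product \<open>th\<close> of \<open>theta\<close> powers has the
  same symbols. What then remains of \<open>u\<close> has trivial symbols and descends one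
  level.\<close>

lemma Gs_factor:
  fixes u :: "'k::field kop"
  assumes u: "u \<in> Gs n s" and s: "1 \<le> s"
    and Eo: "distinct Eo" "set Eo = {I. I \<subseteq> {1..n} \<and> card I = s \<and> n \<in> I}"
    and Js: "2 \<le> s \<Longrightarrow> distinct Js \<and> set Js = {J. J \<subseteq> {1..n} \<and> card J = s + 1 \<and> n \<in> J}"
    and jord: "\<And>J. J \<subseteq> {1..n} \<Longrightarrow> n \<in> J \<Longrightarrow> 3 \<le> card J \<Longrightarrow> distinct (jord J) \<and> set (jord J) = J - {n, Max (J - {n})}"
  shows "\<exists>th e g. (2 \<le> s \<longrightarrow> th \<in> Thtil n Js jord) \<and> (s = 1 \<longrightarrow> th = id) \<and> e \<in> Etil n Eo \<and> g \<in> Gs n (Suc s) \<and> u = th \<circ> (e \<circ> g)"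
proof -
  have Ip: "finite I" "I \<noteq> {}" "I \<subseteq> {1..n}" "n \<in> I" "card I = s" if "I \<in> set Eo" for I
    using that Eo(2) finite_subset[of I "{1..n}"] by auto
  have "\<forall>I\<in>set Eo. \<exists>x. snd x \<in> UE n I \<and> RI n I u = dg (mon n I (fst x)) \<circ> RI n I (snd x)"
  proof
    fix I assume I: "I \<in> set Eo"
    have "u \<in> Gs n (card I)" using u Ip(5)[OF I] by simp
    from RI_decompose[OF Ip(2,3)[OF I] this] obtain d c e where
      e: "c \<noteq> 0" "e \<in> elem_ops (Lr n I)" "RI n I u = dg (mon n I d) \<circ> (dg (emb c) \<circ> e)" by blast
    obtain w where w: "w \<in> UE n I" "RI n I (w :: 'k kop) = dg (emb c) \<circ> e" using UE_lift[OF Ip(3,2)[OF I] e(2,1)] by blast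
    have "RI n I u = dg (mon n I d) \<circ> RI n I w" unfolding w(2) by (rule e(3))
    then show "\<exists>x. snd x \<in> UE n I \<and> RI n I u = dg (mon n I (fst x)) \<circ> RI n I (snd x)"
      using w(1) by (intro exI[of _ "(d, w)"]) (simp only: fst_conv snd_conv simp_thms)
  qed
  from bchoice[OF this] obtain X where X: "\<forall>I\<in>set Eo. snd (X I) \<in> UE n I \<and> RI n I u = dg (mon n I (fst (X I))) \<circ> RI n I (snd (X I))"
    by (elim exE)
  define d where "d = (\<lambda>I. fst (X I))"
  define w where "w = (\<lambda>I. snd (X I))"
  have w: "w I \<in> UE n I" "RI n I u = dg (mon n I (d I)) \<circ> RI n I (w I)" if "I \<in> set Eo" for I
    using bspec[OF X that] unfolding d_def w_def by (rule conjunct1, rule conjunct2)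
  define e where "e = listprod (map w Eo)"
  have eE: "e \<in> Etil n Eo" unfolding e_def Etil_def by (rule set_prods_listprod) (rule w(1))
  have wV: "w I \<in> Vn n I" if "I \<in> set Eo" for I using UE_Vn[OF Ip(3)[OF that]] w(1)[OF that] by blast
  have wG: "w I \<in> Gs n s" if "I \<in> set Eo" for I using Vn_Gs[OF Ip(3,4)[OF that]] wV[OF that] Ip(5)[OF that] by blast
  have eG: "e \<in> Gs n s" unfolding e_def using wG by (intro listprod_mem Gs_id Gs_comp)
  have Re: "RI n I e = RI n I (w I)" if I: "I \<in> set Eo" for I
  proof -
    have "RI n I (w I') = id" if I': "I' \<in> set Eo" "I' \<noteq> I" for I'
    proof (rule RI_Vn[OF wV[OF I'(1)] Ip(1,2)[OF I]])
      show "\<not> I' \<subseteq> I" using subset_card_eq[OF Ip(3)[OF I], of I'] Ip(5)[OF I] Ip(5)[OF I'(1)] I'(2) by auto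
    qed
    then show ?thesis unfolding e_def
      using RI_listprod_single[OF Ip(1,2)[OF I], of Eo w n I] Gs_Sn[OF wG] Eo(1) I by simp
  qed
  define v where "v = u \<circ> inv_into UNIV e"
  have vG: "v \<in> Gs n s" unfolding v_def by (intro Gs_comp u Gs_inverse(1) eG)
  have Rv: "RI n I v = dg (mon n I (d I))" if I: "I \<in> set Eo" for I
  proof -
    note S = Gs_Sn[OF u] Gs_Sn[OF eG] Gs_Sn[OF Gs_inverse(1)[OF eG]]
    have "RI n I v = dg (mon n I (d I)) \<circ> (RI n I e \<circ> RI n I (inv_into UNIV e))"
      unfolding v_def RI_comp[OF Ip(1,2)[OF I] S(1,3)] w(2)[OF I] Re[OF I] by (simp only: o_assoc)
    also have "RI n I e \<circ> RI n I (inv_into UNIV e) = id"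
      unfolding RI_comp[OF Ip(1,2)[OF I] S(2,3), symmetric] Gs_inverse(2)[OF eG] by (rule RI_id[OF Ip(1,2)[OF I]])
    finally show ?thesis by (simp only: comp_id)
  qed
  have d0: "(\<Sum>k\<in>J - {n}. d (J - {k}) k) = 0" if J: "J \<subseteq> {1..n}" "card J = Suc s" "n \<in> J" for J
  proof (rule index_zero[OF vG _ J, where d = "\<lambda>k. d (J - {k})"])
    show "0 < s" using s by simp
    fix k assume "k \<in> J - {n}"
    then have "J - {k} \<in> set Eo" unfolding Eo(2) using J finite_subset[OF J(1)] by auto
    then show "RI n (J - {k}) v = dg (mon n (J - {k}) (d (J - {k})))" by (rule Rv)
  qed
  have "\<exists>th. (2 \<le> s \<longrightarrow> th \<in> Thtil n Js jord) \<and> (s = 1 \<longrightarrow> th = id) \<and> (th :: 'k kop) \<in> Gs n s \<and>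
    (\<forall>I\<in>set Eo. RI n I th = dg (mon n I (d I)))"
  proof (cases "2 \<le> s")
    case True
    have "\<exists>th\<in>Thtil n Js jord. (th :: 'k kop) \<in> Gs n s \<and>
      (\<forall>I. I \<subseteq> {1..n} \<longrightarrow> card I = s \<longrightarrow> n \<in> I \<longrightarrow> RI n I th = dg (mon n I (d I)))"
    proof (rule theta_realizes[OF True])
      show "distinct Js" "set Js = {J. J \<subseteq> {1..n} \<and> card J = s + 1 \<and> n \<in> J}" using Js[OF True] by blast+
      fix J assume "J \<in> set Js"
      then have J: "J \<subseteq> {1..n}" "card J = Suc s" "n \<in> J" using Js[OF True] by auto
      show "distinct (jord J) \<and> set (jord J) = J - {n, Max (J - {n})}" using J True by (intro jord) auto
      show "(\<Sum>k\<in>J - {n}. d (J - {k}) k) = 0" by (rule d0[OF J])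
    qed
    then obtain th :: "'k kop" where th: "th \<in> Thtil n Js jord" "th \<in> Gs n s"
      "\<forall>I. I \<subseteq> {1..n} \<longrightarrow> card I = s \<longrightarrow> n \<in> I \<longrightarrow> RI n I th = dg (mon n I (d I))" by (elim bexE conjE)
    have "s \<noteq> 1" using True by simp
    moreover have "RI n I th = dg (mon n I (d I))" if "I \<in> set Eo" for I using th(3) Ip(3-5)[OF that] by blast
    ultimately show ?thesis using th(1,2) by (intro exI[of _ th] conjI impI ballI) simp_all
  next
    case False
    then have s1: "s = 1" using s by simp
    \<comment> \<open>For \<open>s = 1\<close> the relation of \<open>{k, n}\<close> has a single
      term, so every exponent is 0 and \<open>id\<close> serves as \<open>th\<close>.\<close>
    have "mon n I (d I) = (1 :: 'k ratfun)" if I: "I \<in> set Eo" for I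
    proof -
      have In: "I = {n}" using Ip(4,5)[OF I] s1 by (auto simp: card_1_singleton_iff)
      have "d I k = 0" if k: "k \<in> {1..n} - I" for k
      proof -
        have "{k, n} - {n} = {k}" "{k, n} - {k} = {n}" using k In by auto
        moreover have "(\<Sum>l\<in>{k, n} - {n}. d ({k, n} - {l}) l) = 0" using k In s1 Ip(3)[OF I] by (intro d0) auto
        ultimately show ?thesis using In by simp
      qed
      then show ?thesis unfolding mon_def by simp
    qed
    then have R: "RI n I (id :: 'k kop) = dg (mon n I (d I))" if "I \<in> set Eo" for I
      using that by (simp only: dg_1 RI_id[OF Ip(1,2)[OF that]])
    have "\<not> 2 \<le> s" using s1 by simp
    then show ?thesis by (intro exI[of _ id] conjI impI ballI R Gs_id refl) (rule notE)
  qed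
  then obtain th where th: "2 \<le> s \<longrightarrow> th \<in> Thtil n Js jord" "s = 1 \<longrightarrow> th = id" "(th :: 'k kop) \<in> Gs n s"
    "\<And>I. I \<in> set Eo \<Longrightarrow> RI n I th = dg (mon n I (d I))" by blast
  define t where "t = th \<circ> e"
  have tG: "t \<in> Gs n s" unfolding t_def by (rule Gs_comp[OF th(3) eG])
  define g where "g = inv_into UNIV t \<circ> u"
  have gG: "g \<in> Gs n s" unfolding g_def by (intro Gs_comp Gs_inverse(1) tG u)
  have "g \<in> Gs n (Suc s)"
  proof (rule Gs_step[OF gG])
    show "0 < s" using s by simp
    fix I assume "I \<subseteq> {1..n}" "card I = s" "n \<in> I"
    then have I: "I \<in> set Eo" unfolding Eo(2) by blast
    have Rt: "RI n I t = RI n I u"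
      unfolding t_def RI_comp[OF Ip(1,2)[OF I] Gs_Sn[OF th(3)] Gs_Sn[OF eG]] th(4)[OF I] w(2)[OF I] Re[OF I] ..
    note S = Gs_Sn[OF tG] Gs_Sn[OF Gs_inverse(1)[OF tG]]
    have "RI n I g = RI n I (inv_into UNIV t) \<circ> RI n I t"
      unfolding g_def RI_comp[OF Ip(1,2)[OF I] S(2) Gs_Sn[OF u]] Rt ..
    also have "\<dots> = id"
      unfolding RI_comp[OF Ip(1,2)[OF I] S(2,1), symmetric] Gs_inverse(3)[OF tG] by (rule RI_id[OF Ip(1,2)[OF I]])
    finally show "RI n I g = id" .
  qed
  moreover have "u = th \<circ> (e \<circ> g)"
  proof -
    have "th \<circ> (e \<circ> g) = (t \<circ> inv_into UNIV t) \<circ> u" unfolding t_def g_def by (simp only: o_assoc)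
    then show ?thesis unfolding Gs_inverse(2)[OF tG] by (simp only: id_comp)
  qed
  ultimately show ?thesis using th(1,2) eE by blast
qed

section \<open>The units of \<open>1 + F_n\<close> become elementary\<close>

lemma Gs_top_inject:
  assumes u: "u \<in> Gs n n" "h \<in> Gs n n" and n: "0 < n" and eq: "RI n {1..n} u = RI n {1..n} h"
  shows "u = h"
proof -
  have N: "finite {1..n}" "{1..n} \<noteq> {}" using n by auto
  let ?h = "inv_into UNIV h"
  have hG: "?h \<in> Gs n n" by (rule Gs_inverse(1)[OF u(2)])
  have "?h \<circ> u \<in> Gs n (Suc n)"
  proof (rule Gs_step[OF Gs_comp[OF hG u(1)] n])
    fix I assume "I \<subseteq> {1..n}" "card I = n" "n \<in> I"
    then have I: "I = {1..n}" using subset_card_eq[of "{1..n}" n I] by simp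
    have "RI n {1..n} (?h \<circ> u) = RI n {1..n} (?h \<circ> h)"
      unfolding RI_comp[OF N Gs_Sn[OF hG] Gs_Sn[OF u(1)]] RI_comp[OF N Gs_Sn[OF hG] Gs_Sn[OF u(2)]] eq ..
    then show "RI n I (?h \<circ> u) = id" unfolding I Gs_inverse(3)[OF u(2)] RI_id[OF N] .
  qed
  then have 1: "?h \<circ> u = id" using Gs_top[of n "Suc n"] by blast
  have "u = (h \<circ> ?h) \<circ> u" unfolding Gs_inverse(2)[OF u(2)] by (simp only: id_comp)
  also have "\<dots> = h" unfolding comp_assoc 1 by (simp only: comp_id)
  finally show ?thesis .
qed

text \<open>The Whitehead identity: \<open>U L U\<close> exchanges two rows, with coefficients
  \<open>c\<close> and \<open>- inverse c\<close>. The rows are predicates \<open>A\<close>,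
  \<open>B\<close> on points with mutually inverse maps between them, so that \<open>A\<close> may
  also be the part of a row with positive coordinate \<open>k\<close>, as happens when
  \<open>x_k\<close> takes the place of a scalar.\<close>

lemma swap_op:
  fixes c :: "'k::field"
  assumes c: "c \<noteq> 0" and A: "\<And>b. A b \<Longrightarrow> B (\<sigma> b) \<and> \<tau> (\<sigma> b) = b" and B: "\<And>b. B b \<Longrightarrow> A (\<tau> b) \<and> \<sigma> (\<tau> b) = b"
    and AB: "\<And>b. A b \<Longrightarrow> \<not> B b"
    and U: "\<And>f b. U f b = f b + (if A b then c * f (\<sigma> b) else 0)"
    and L: "\<And>f b. L f b = f b + (if B b then - inverse c * f (\<tau> b) else 0)"
  shows "(U \<circ> (L \<circ> U)) f b = (if A b then c * f (\<sigma> b) else if B b then - inverse c * f (\<tau> b) else f b)"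
proof -
  consider "A b" | "B b" "\<not> A b" | "\<not> A b" "\<not> B b" by blast
  then show ?thesis
  proof cases
    case 1
    have "B (\<sigma> b)" "\<tau> (\<sigma> b) = b" "\<not> B b" "\<not> A (\<sigma> b)" using A[OF 1] AB[of "\<sigma> b"] AB[OF 1] by auto
    then show ?thesis using 1 c by (simp add: U L field_simps)
  next
    case 2
    have "A (\<tau> b)" "\<sigma> (\<tau> b) = b" using B[OF 2(1)] by auto
    then show ?thesis using 2 c by (simp add: U L field_simps)
  next
    case 3
    then show ?thesis by (simp add: U L)
  qed
qed

text \<open>A second exchange, with coefficient \<open>-1\<close>, undoes the permutation and leaves
  \<open>diag(c, c^-1)\<close>.\<close>

lemma swap_op_diag:
  fixes c :: "'k::field"
  assumes A: "\<And>b. A b \<Longrightarrow> B (\<sigma> b) \<and> \<tau> (\<sigma> b) = b" and B: "\<And>b. B b \<Longrightarrow> A (\<tau> b) \<and> \<sigma> (\<tau> b) = b"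
    and AB: "\<And>b. A b \<Longrightarrow> \<not> B b"
    and S: "\<And>f b. S f b = (if A b then c * f (\<sigma> b) else if B b then - inverse c * f (\<tau> b) else f b)"
    and T: "\<And>f b. T f b = (if A b then - 1 * f (\<sigma> b) else if B b then - inverse (- 1) * f (\<tau> b) else f b)"
  shows "(S \<circ> T) f b = (if A b then c * f b else if B b then inverse c * f b else f b)"
proof -
  consider "A b" | "B b" "\<not> A b" | "\<not> A b" "\<not> B b" by blast
  then show ?thesis
  proof cases
    case 1
    have "B (\<sigma> b)" "\<tau> (\<sigma> b) = b" "\<not> A (\<sigma> b)" using A[OF 1] AB[of "\<sigma> b"] by auto
    then show ?thesis using 1 by (simp add: S T)
  next
    case 2
    have "A (\<tau> b)" "\<sigma> (\<tau> b) = b" using B[OF 2(1)] by auto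
    then show ?thesis using 2 by (simp add: S T)
  next
    case 3
    then show ?thesis by (simp add: S T)
  qed
qed

text \<open>In the \<open>2 \<times> 2\<close> block of rows \<open>0\<close> and \<open>\<epsilon>\<^sub>n\<close> over \<open>S\<^sub>k\<close>, write \<open>U\<close>, \<open>L\<close> for the upper and lower
  unipotent matrices. As \<open>y x = 1\<close> and \<open>e = 1 - x y\<close>, the products \<open>U(c\<^sup>-\<^sup>1x) L(-cy) U(c\<^sup>-\<^sup>1x)\<close> have rows
  \<open>(e, c\<^sup>-\<^sup>1x)\<close> and \<open>(-cy, 0)\<close>; combined with the scalar Whitehead matrices they give
  \<open>diag(1 + (c - 1)e, 1)\<close>.\<close>
lemma mu_top_Einf:
  fixes c :: "'k::field"
  assumes I: "I = {1..n} - {k}" "k \<in> {1..n}" "k \<noteq> n" and c: "c \<noteq> 0"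
  shows "mu {1..n} c \<in> Einf n I"
proof -
  have nI: "n \<in> I" "k \<notin> I" "finite I" using I by auto
  define ep :: "nat \<Rightarrow> nat" where "ep = (\<lambda>_. 0)(n := 1)"
  define ze :: "nat \<Rightarrow> nat" where "ze = (\<lambda>_. 0)"
  have r: "res I ep = ep" "res I ze = ze" using nI by (auto simp: res_def ep_def ze_def fun_eq_iff)
  have ne: "ze n \<noteq> ep n" "ep n \<noteq> ze n" by (simp_all add: ep_def ze_def)
  have kS: "id \<in> (Salg ({1..n} - I) :: 'k kop set)" "Xop k \<in> (Salg ({1..n} - I) :: 'k kop set)" "Yop k \<in> (Salg ({1..n} - I) :: 'k kop set)"
    using I by (auto intro: Salg_id Salg.genX Salg.genY)
  have mem: "Egen I (opsmul t a) ze ep \<in> Einf n I" "Egen I (opsmul t a) ep ze \<in> Einf n I"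
    if "a \<in> Salg ({1..n} - I)" for a :: "'k kop" and t
    using Egen_Einf[where i = n, OF nI(3) Salg_opsmul[OF that] nI(1)] ne by blast+
  define A where "A = on_axis I"
  define B where "B = (\<lambda>b. \<forall>i\<in>I. b i = ep i)"
  define \<sigma> where "\<sigma> = (\<lambda>b :: nat \<Rightarrow> nat. b(n := Suc (b n)))"
  define \<tau> where "\<tau> = (\<lambda>b :: nat \<Rightarrow> nat. b(n := b n - 1))"
  have G1: "Gop I ze ep f b = (if A b then f (\<sigma> b) else 0)" for f :: "(nat \<Rightarrow> nat) \<Rightarrow> 'k" and b
  proof -
    have "(\<lambda>l. b l - ze l + ep l) = \<sigma> b" by (auto simp: ze_def ep_def \<sigma>_def fun_eq_iff)
    moreover have "(\<forall>i\<in>I. b i = ze i) \<and> (\<forall>l. ze l \<le> b l) \<longleftrightarrow> A b" by (auto simp: ze_def A_def on_axis_def)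
    ultimately show ?thesis unfolding Gop_def by (simp only:)
  qed
  have Bn: "b n = 1" if "B b" for b using that nI(1) by (auto simp: B_def ep_def)
  have G2: "Gop I ep ze f b = (if B b then f (\<tau> b) else 0)" for f :: "(nat \<Rightarrow> nat) \<Rightarrow> 'k" and b
  proof -
    have "(\<lambda>l. b l - ep l + ze l) = \<tau> b" by (auto simp: ze_def ep_def \<tau>_def fun_eq_iff)
    moreover have "(\<forall>i\<in>I. b i = ep i) \<and> (\<forall>l. ep l \<le> b l) \<longleftrightarrow> B b" using Bn[of b] by (auto simp: ep_def B_def)
    ultimately show ?thesis unfolding Gop_def by (simp only:)
  qed
  have AB: "\<not> B b" if "A b" for b using that Bn[of b] nI(1) by (auto simp: A_def on_axis_def)
  have As: "B (\<sigma> b) \<and> \<tau> (\<sigma> b) = b" if "A b" for b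
    using that by (auto simp: A_def B_def on_axis_def \<sigma>_def \<tau>_def ep_def nI(1))
  have Bt: "A (\<tau> b) \<and> \<sigma> (\<tau> b) = b" if "B b" for b
    using that Bn[OF that] by (auto simp: A_def B_def on_axis_def \<sigma>_def \<tau>_def ep_def)
  have kA: "A (b(k := v)) = A b" "B (b(k := v)) = B b" for b v using nI(2) by (auto simp: A_def B_def on_axis_def)
  define A' where "A' = (\<lambda>b. A b \<and> 0 < b k)"
  define \<sigma>' where "\<sigma>' = (\<lambda>b. \<sigma> (b(k := b k - 1)))"
  define \<tau>' where "\<tau>' = (\<lambda>b. \<tau> (b(k := Suc (b k))))"
  have comm: "\<sigma> (b(k := v)) = (\<sigma> b)(k := v)" "\<tau> (b(k := v)) = (\<tau> b)(k := v)" "\<sigma> b k = b k" "\<tau> b k = b k" for b v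
    using I(3) by (auto simp: \<sigma>_def \<tau>_def fun_eq_iff)
  have AB': "\<not> B b" if "A' b" for b using that AB by (simp add: A'_def)
  have As': "B (\<sigma>' b) \<and> \<tau>' (\<sigma>' b) = b" if "A' b" for b
  proof -
    have "A b" "0 < b k" using that by (auto simp: A'_def)
    then show ?thesis using As[of b] by (simp add: \<sigma>'_def \<tau>'_def comm kA)
  qed
  have Bt': "A' (\<tau>' b) \<and> \<sigma>' (\<tau>' b) = b" if "B b" for b
    using Bt[OF that] by (simp add: A'_def \<sigma>'_def \<tau>'_def comm kA)
  define W where "W = (\<lambda>t :: 'k. Egen I (opsmul t id) ze ep \<circ> (Egen I (opsmul (- inverse t) id) ep ze \<circ> Egen I (opsmul t id) ze ep))"
  define Z where "Z = (\<lambda>t :: 'k. Egen I (opsmul t (Xop k)) ze ep \<circ> (Egen I (opsmul (- inverse t) (Yop k)) ep ze \<circ> Egen I (opsmul t (Xop k)) ze ep))"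
  have W: "W t f b = (if A b then t * f (\<sigma> b) else if B b then - inverse t * f (\<tau> b) else f b)" if "t \<noteq> 0" for t f b
    unfolding W_def
  proof (rule swap_op[OF that As Bt AB])
    show "Egen I (opsmul t id) ze ep f b = f b + (if A b then t * f (\<sigma> b) else 0)" for f b
      by (simp add: Egen_def r opadd_def opsmul_def G1)
    show "Egen I (opsmul (- inverse t) id) ep ze f b = f b + (if B b then - inverse t * f (\<tau> b) else 0)" for f b
      by (simp add: Egen_def r opadd_def opsmul_def G2)
  qed
  have Z: "Z t f b = (if A' b then t * f (\<sigma>' b) else if B b then - inverse t * f (\<tau>' b) else f b)" if "t \<noteq> 0" for t f b
    unfolding Z_def
  proof (rule swap_op[OF that As' Bt' AB'])
    show "Egen I (opsmul t (Xop k)) ze ep f b = f b + (if A' b then t * f (\<sigma>' b) else 0)" for f b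
      by (simp add: Egen_def r opadd_def opsmul_def Xop_def G1 kA A'_def \<sigma>'_def)
    show "Egen I (opsmul (- inverse t) (Yop k)) ep ze f b = f b + (if B b then - inverse t * f (\<tau>' b) else 0)" for f b
      by (simp add: Egen_def r opadd_def opsmul_def Yop_def G2 kA \<tau>'_def)
  qed
  have m1: "(- 1 :: 'k) \<noteq> 0" and ci: "inverse c \<noteq> 0" using c by auto
  have WW: "(W c \<circ> W (- 1)) f b = (if A b then c * f b else if B b then inverse c * f b else f b)" for f b
    by (rule swap_op_diag[where A = A and B = B and \<sigma> = \<sigma> and \<tau> = \<tau> and S = "W c" and T = "W (- 1)"])
      (erule As, erule Bt, erule AB, rule W[OF c], rule W[OF m1])
  have ZZ: "(Z (inverse c) \<circ> Z (- 1)) f b = (if A' b then inverse c * f b else if B b then inverse (inverse c) * f b else f b)" for f b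
    by (rule swap_op_diag[where A = A' and B = B and \<sigma> = \<sigma>' and \<tau> = \<tau>' and S = "Z (inverse c)" and T = "Z (- 1)"])
      (erule As', erule Bt', erule AB', rule Z[OF ci], rule Z[OF m1])
  have ax: "(\<forall>i\<in>{1..n}. b i = 0) \<longleftrightarrow> A b \<and> b k = 0" for b unfolding I(1) A_def on_axis_def using I(2) by auto
  \<comment> \<open>The \<open>W\<close> part is \<open>diag(c, c^-1)\<close> on both full rows. The
    \<open>Z\<close> part is \<open>diag(c^-1, c)\<close>, but it does not touch the points of the
    first row with \<open>b k = 0\<close>; only these keep the factor \<open>c\<close>.\<close>
  have "mu {1..n} c = (W c \<circ> W (- 1)) \<circ> (Z (inverse c) \<circ> Z (- 1))"
  proof (intro ext)
    fix f b
    have "((W c \<circ> W (- 1)) \<circ> (Z (inverse c) \<circ> Z (- 1))) f b = (W c \<circ> W (- 1)) ((Z (inverse c) \<circ> Z (- 1)) f) b"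
      by (simp only: comp_apply)
    also have "\<dots> = (if A b \<and> b k = 0 then c * f b else f b)"
      unfolding WW ZZ using AB[of b] c by (auto simp: A'_def)
    finally show "mu {1..n} c f b = ((W c \<circ> W (- 1)) \<circ> (Z (inverse c) \<circ> Z (- 1))) f b"
      unfolding mu_apply[OF finite_atLeastAtMost] ax by (rule sym)
  qed
  moreover have "W t \<in> Einf n I" "Z t \<in> Einf n I" for t
    unfolding W_def Z_def by (intro Einf_comp mem kS)+
  ultimately show ?thesis by (simp only: Einf_comp)
qed

lemma transv_commutator:
  assumes "i \<noteq> l" "l \<noteq> j" "i \<noteq> j"
  shows "transv i j a = transv i l a \<circ> (transv l j 1 \<circ> (transv i l (- a) \<circ> transv l j (- 1)))"
  using assms by (auto simp: transv_def fun_eq_iff algebra_simps)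

text \<open>At level \<open>n\<close> a unit is determined by its symbol, a matrix over
  \<open>K\<close> indexed by N^n. A matrix unit there is one of N^I whose coefficient is a matrix
  unit in the variable \<open>k\<close>. So transvections between indices that differ on
  \<open>I\<close> are generators, the others are commutators of such, and the determinant is
  supplied by \<open>mu_top_Einf\<close>.\<close>

lemma Gs_top_Einf:
  fixes u :: "'k::field kop"
  assumes I: "I = {1..n} - {k}" "k \<in> {1..n}" "k \<noteq> n" and u: "u \<in> Gs n n"
  shows "u \<in> Einf n I"
proof -
  let ?N = "{1..n}"
  have n: "0 < n" "n \<in> ?N" "n \<in> I" "finite I" "k \<notin> I" using I by auto
  have N: "finite ?N" "?N \<noteq> {}" "?N \<subseteq> ?N" using n by auto
  have VG: "(Vn n ?N :: 'k kop set) \<subseteq> Gs n n" using n by (intro Vn_Gs) auto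
  define H where "H = {h. h \<in> Einf n I \<and> h \<in> (Gs n n :: 'k kop set)}"
  have Hc: "g \<circ> h \<in> H" if "g \<in> H" "h \<in> H" for g h using that unfolding H_def by (auto intro: Einf_comp Gs_comp simp del: o_apply)
  have RH: "RI n ?N (g \<circ> h) = RI n ?N g \<circ> RI n ?N h" if "g \<in> H" "h \<in> H" for g h
    using that unfolding H_def by (intro RI_comp[OF N(1,2)] Gs_Sn[of _ n n]) auto
  have Z: "res ?N a = a" if "a \<in> Zs ?N" for a using that by (auto simp: Zs_def supp_in_def res_def fun_eq_iff)
  have base: "\<exists>h\<in>H. RI n ?N h = transv (idx ?N al) (idx ?N be) (emb c)"
    if ab: "al \<in> Zs ?N" "be \<in> Zs ?N" and i: "i \<in> I" "al i \<noteq> be i" for al be i and c :: 'k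
  proof -
    have cS: "opsmul c id \<in> (Salg (?N - ?N) :: 'k kop set)" by (rule Salg.scal)
    have "RI n ?N (opsmul c id :: 'k kop) f m = emb c * f m" for f m
      unfolding RI_opsmul[OF Salg_id] RI_id[OF N(1,2)] by simp
    from RI_Egen[OF N(3,2) cS this, of al be]
    have R: "RI n ?N (Egen ?N (opsmul c id) al be :: 'k kop) = transv (idx ?N al) (idx ?N be) (emb c)"
      unfolding Z[OF ab(1)] Z[OF ab(2)] .
    have "i \<in> ?N" using i(1) I(1) by blast
    then have G: "Egen ?N (opsmul c id) al be \<in> (Gs n n :: 'k kop set)"
      using Egen_Vn[OF N(3) cS, of i al be] i(2) VG by blast
    have "(Gop {k} (res {k} al) (res {k} be) \<circ> Gop I (res I al) (res I be) :: 'k kop)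
      = Gop ({k} \<union> I) (\<lambda>l. res {k} al l + res I al l) (\<lambda>l. res {k} be l + res I be l)"
      using n(5) by (intro Gop_comp_disjoint) (auto simp: res_def)
    also have "{k} \<union> I = ?N" using I by auto
    also have "(\<lambda>l. res {k} al l + res I al l) = res ?N al" using I by (auto simp: res_def fun_eq_iff)
    also have "(\<lambda>l. res {k} be l + res I be l) = res ?N be" using I by (auto simp: res_def fun_eq_iff)
    finally have "Egen ?N (opsmul c id) al be = Egen I (opsmul c (Gop {k} (res {k} al) (res {k} be))) al be"
      unfolding Egen_def op_comp_left by (simp only: id_comp)
    moreover have "Gop {k} (res {k} al) (res {k} be) \<in> (Salg (?N - I) :: 'k kop set)"
      using I by (intro Gop_Salg) (auto simp: supp_in_def res_def)
    then have "Egen I (opsmul c (Gop {k} (res {k} al) (res {k} be))) al be \<in> Einf n I"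
      using Egen_Einf[where i = i, OF n(4) Salg_opsmul i(1)] i(2) by blast
    ultimately have "Egen ?N (opsmul c id) al be \<in> H" using G unfolding H_def by simp
    then show ?thesis unfolding Bex_def using R by (intro exI[of _ "Egen ?N (opsmul c id) al be"] conjI)
  qed
  have tr: "\<exists>h\<in>H. RI n ?N h = transv i j (emb c)" if ij: "i \<noteq> j" for i j and c :: 'k
  proof -
    define al be where "al = enumZ ?N i" and "be = enumZ ?N j"
    have ab: "al \<in> Zs ?N" "be \<in> Zs ?N" "idx ?N al = i" "idx ?N be = j"
      unfolding al_def be_def by (rule enumZ[OF N(1,2)])+
    show ?thesis
    proof (cases "\<exists>l\<in>I. al l \<noteq> be l")
      case True
      then obtain l where l: "l \<in> I" "al l \<noteq> be l" by blast
      show ?thesis using base[OF ab(1,2) l] unfolding ab(3,4) .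
    next
      case False
      \<comment> \<open>Here \<open>al\<close> and \<open>be\<close> differ at \<open>k\<close>
        only; \<open>ga\<close> differs from both at \<open>n\<close>, which lies in
        \<open>I\<close>, and serves as middle index of the commutator.\<close>
      define ga where "ga = al(n := Suc (al n))"
      have ga: "ga \<in> Zs ?N" using ab(1) n(2) by (auto simp: ga_def Zs_def supp_in_def)
      have an: "al n = be n" using False n(3) by blast
      have d: "al n \<noteq> ga n" "ga n \<noteq> be n" unfolding ga_def using an by auto
      define l where "l = idx ?N ga"
      have el: "enumZ ?N l = ga" unfolding l_def by (rule enumZ(3)[OF N(1,2) ga])
      have "i \<noteq> l" "l \<noteq> j" using d el unfolding al_def be_def by auto
      then have eq: "transv i j (emb c) = transv i l (emb c) \<circ> (transv l j (emb 1) \<circ> (transv i l (emb (- c)) \<circ> transv l j (emb (- 1))))"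
        unfolding emb_uminus emb_1 by (rule transv_commutator[OF _ _ ij])
      note b1 = base[OF ab(1) ga n(3), unfolded ab(3) l_def[symmetric], OF d(1)]
      note b2 = base[OF ga ab(2) n(3), unfolded ab(4) l_def[symmetric], OF d(2)]
      obtain h1 where h1: "h1 \<in> H" "RI n ?N h1 = transv i l (emb c)" using b1 by blast
      obtain h2 where h2: "h2 \<in> H" "RI n ?N h2 = transv l j (emb (1 :: 'k))" using b2 by blast
      obtain h3 where h3: "h3 \<in> H" "RI n ?N h3 = transv i l (emb (- c))" using b1 by blast
      obtain h4 where h4: "h4 \<in> H" "RI n ?N h4 = transv l j (emb (- 1 :: 'k))" using b2 by blast
      have "RI n ?N (h1 \<circ> (h2 \<circ> (h3 \<circ> h4))) = transv i j (emb c)"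
        unfolding eq by (simp only: RH Hc h1 h2 h3 h4)
      then show ?thesis unfolding Bex_def by (intro exI[of _ "h1 \<circ> (h2 \<circ> (h3 \<circ> h4))"] conjI Hc h1 h2 h3 h4)
    qed
  qed
  have L: "Lr n ?N = (range emb :: 'k ratfun set)" by (simp add: Lr_def)
  have el: "\<exists>h\<in>H. RI n ?N h = e" if "e \<in> elem_ops (Lr n ?N)" for e
    using that
  proof induction
    case elem_id
    have "id \<in> H" unfolding H_def using Einf_id Gs_id by blast
    then show ?case unfolding Bex_def by (intro exI[of _ id] conjI RI_id[OF N(1,2)])
  next
    case (elem_step i j a e)
    obtain c where c: "a = emb c" using elem_step(2) unfolding L by blast
    obtain h where h: "h \<in> H" "RI n ?N h = e" using elem_step.IH by blast
    obtain t where t: "t \<in> H" "RI n ?N t = transv i j (emb c)" using tr[OF elem_step(1)] by blast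
    have "RI n ?N (t \<circ> h) = transv i j a \<circ> e" unfolding RH[OF t(1) h(1)] t(2) h(2) c ..
    then show ?case unfolding Bex_def by (intro exI[of _ "t \<circ> h"] conjI Hc[OF t(1) h(1)])
  qed
  have "u \<in> Gs n (card ?N)" using u by simp
  from RI_decompose[OF N(2,3) this] obtain d c e where
    e: "c \<noteq> 0" "e \<in> elem_ops (Lr n ?N)" "RI n ?N u = dg (mon n ?N d) \<circ> (dg (emb c) \<circ> e)" by blast
  have "mon n ?N d = (1 :: 'k ratfun)" by (simp add: mon_def)
  then have Ru: "RI n ?N u = dg (emb c) \<circ> e" unfolding e(3) by (simp only: dg_1 id_comp)
  have "mu ?N c \<in> H" unfolding H_def using mu_top_Einf[OF I e(1)] mu_Vn[OF N(3) e(1)] VG by blast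
  moreover obtain h where h: "h \<in> H" "RI n ?N h = e" using el[OF e(2)] by blast
  ultimately have mh: "mu ?N c \<circ> h \<in> H" "RI n ?N (mu ?N c \<circ> h) = RI n ?N u"
    unfolding Ru by (simp_all only: Hc RH RI_mu[OF N(3,2)])
  then have "u = mu ?N c \<circ> h" unfolding H_def by (intro Gs_top_inject[OF u _ n(1)]) auto
  then show ?thesis using mh(1) unfolding H_def by simp
qed

section \<open>Assembling the products\<close>

lemma Gs_funpow_mem: "u \<in> Gs n s \<Longrightarrow> u ^^ m \<in> Gs n s"
proof (induction m)
  case 0
  show ?case unfolding funpow.simps by (rule Gs_id)
next
  case (Suc m)
  then show ?case unfolding funpow.simps by (intro Gs_comp)
qed

lemma Gs_zpow_mem: "u \<in> Gs n s \<Longrightarrow> zpow u k \<in> Gs n s"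
  unfolding zpow_def by (simp add: Gs_funpow_mem Gs_inverse(1))

lemma Etil_Gs:
  assumes "set Eo = {I. I \<subseteq> {1..n} \<and> card I = s \<and> n \<in> I}"
  shows "Etil n Eo \<subseteq> Gs n s"
  unfolding Etil_def
proof (rule set_prods_subset[OF Gs_id Gs_comp])
  fix A :: "'a kop set" assume "A \<in> set (map (UE n) Eo)"
  then obtain I where I: "A = UE n I" "I \<in> set Eo" by auto
  then show "A \<subseteq> Gs n s" unfolding I(1) using assms by (intro UE_Gs) auto
qed

lemma Thtil_Gs:
  assumes s: "2 \<le> s" and Js: "set Js = {J. J \<subseteq> {1..n} \<and> card J = s + 1 \<and> n \<in> J}"
    and jord: "\<And>J. J \<in> set Js \<Longrightarrow> set (jord J) = J - {n, Max (J - {n})}"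
  shows "Thtil n Js jord \<subseteq> Gs n s"
  unfolding Thtil_def
proof (rule set_prods_subset[OF Gs_id Gs_comp])
  fix A :: "'a kop set"
  assume "A \<in> set (concat (map (\<lambda>J. map (\<lambda>j. {zpow (theta (Max (J - {n})) j J) k | k. True}) (jord J)) Js))"
  then obtain J j where A: "A = {zpow (theta (Max (J - {n})) j J) k | k. True}" "J \<in> set Js" "j \<in> set (jord J)" by auto
  have J: "J \<subseteq> {1..n}" "n \<in> J" "card J = Suc s" using A(2) Js by auto
  have fJ: "finite J" using finite_subset[OF J(1)] by simp
  have j: "j \<in> J" "j \<noteq> n" "j \<noteq> Max (J - {n})" using A(3) jord[OF A(2)] by auto
  then have "J - {n} \<noteq> {}" by blast
  then have m: "Max (J - {n}) \<in> J - {n}" using fJ by (intro Max_in) auto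
  have "theta (Max (J - {n})) j J \<in> (Gs n s :: 'a kop set)"
    using m j by (intro theta_Gs[OF J(1,2) _ _ _ _ _ J(3)]) auto
  then show "A \<subseteq> Gs n s" unfolding A(1) using Gs_zpow_mem by blast
qed

lemma set_prods_absorb_last:
  assumes "\<And>b. b \<in> A \<Longrightarrow> b \<circ> g \<in> A"
  shows "e \<in> set_prods (As @ [A]) \<Longrightarrow> e \<circ> g \<in> set_prods (As @ [A])"
proof (induction As arbitrary: e)
  case Nil
  then have "e \<in> A" by simp
  then have "e \<circ> g \<in> A" by (rule assms)
  then have "e \<circ> g \<in> {a \<circ> b | a b. a \<in> A \<and> b \<in> {id}}"
    by (intro CollectI exI[of _ "e \<circ> g"] exI[of _ id]) (simp only: comp_id singleton_iff simp_thms)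
  then show ?case unfolding append_Nil set_prods.simps .
next
  case (Cons B As)
  then obtain b c where e: "e = b \<circ> c" "b \<in> B" "c \<in> set_prods (As @ [A])" by auto
  have "e \<circ> g = b \<circ> (c \<circ> g)" unfolding e(1) by (simp only: o_assoc)
  then show ?case unfolding append_Cons set_prods.simps using e(2) Cons.IH[OF e(3)] by blast
qed

text \<open>Whatever the order, the last set is \<open>{1..n} - {k}\<close> for some
  \<open>k\<close> other than \<open>n\<close>, and its group \<open>Einf n I\<close> already
  contains all of \<open>Gs n n\<close>.\<close>

lemma Etil_absorb:
  fixes g :: "'k::field kop"
  assumes n: "2 \<le> n" and Eo: "set Eo = {I. I \<subseteq> {1..n} \<and> card I = n - 1 \<and> n \<in> I}"
    and e: "e \<in> Etil n Eo" and g: "g \<in> Gs n n"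
  shows "e \<circ> g \<in> Etil n Eo"
proof -
  have "{1..n} - {1} \<in> set Eo" unfolding Eo using n by auto
  then have ne: "Eo \<noteq> []" by auto
  define I where "I = last Eo"
  have EoI: "Eo = butlast Eo @ [I]" using ne by (simp add: I_def)
  have "I \<in> set Eo" using ne by (simp add: I_def)
  then have I: "I \<subseteq> {1..n}" "card I = n - 1" "n \<in> I" unfolding Eo by auto
  have "card ({1..n} - I) = 1" using card_Diff_subset[OF finite_subset[OF I(1)] I(1)] I(2) n by simp
  then obtain k where k: "{1..n} - I = {k}" by (auto simp: card_1_singleton_iff)
  have k': "I = {1..n} - {k}" "k \<in> {1..n}" "k \<noteq> n" using k I(1,3) by auto
  have gE: "g \<in> Einf n I" by (rule Gs_top_Einf[OF k' g])
  have UEg: "b \<circ> g \<in> UE n I" if b: "b \<in> UE n I" for b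
  proof -
    obtain u h where uh: "b = u \<circ> h" "u \<in> UI I" "h \<in> Einf n I" using b unfolding UE_def by blast
    have "b \<circ> g = u \<circ> (h \<circ> g)" unfolding uh(1) by (simp only: o_assoc)
    then show ?thesis unfolding UE_def using uh(2) Einf_comp[OF uh(3) gE] by blast
  qed
  have eq: "Etil n Eo = set_prods (map (UE n) (butlast Eo) @ [UE n I])"
    unfolding Etil_def by (subst EoI) simp
  show ?thesis using set_prods_absorb_last[OF UEg] e unfolding eq by blast
qed

theorem theorem3p3:
  fixes n :: nat and Eord :: "nat \<Rightarrow> nat set list" and Jord :: "nat \<Rightarrow> nat set list"
    and jord :: "nat set \<Rightarrow> nat list"
  assumes "2 \<le> n"
    and "\<forall>s \<in> {1..n-1}. distinct (Eord s) \<and>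
           set (Eord s) = {I. I \<subseteq> {1..n} \<and> card I = s \<and> n \<in> I}"
    and "\<forall>s \<in> {2..n-1}. distinct (Jord s) \<and>
           set (Jord s) = {J. J \<subseteq> {1..n} \<and> card J = s + 1 \<and> n \<in> J}"
    and "\<forall>J. J \<subseteq> {1..n} \<and> n \<in> J \<and> 3 \<le> card J \<longrightarrow>
           distinct (jord J) \<and> set (jord J) = J - {n, Max (J - {n})}"
  shows "((units_in n (pp n n) :: 'k::field kop set) =
           set_prods (Etil n (Eord 1) #
              concat (map (\<lambda>s. [Thtil n (Jord s) jord, Etil n (Eord s)]) [2..<n]))) \<and>
         (\<forall>s \<in> {2..n-1}. (units_pn_s n s :: 'k::field kop set) =
           set_prods (concat (map (\<lambda>t. [Thtil n (Jord t) jord, Etil n (Eord t)]) [s..<n]))) \<and>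
         ((units_pn_s n n :: 'k::field kop set) = units_in n (Fn n))"
proof -
  have n: "0 < n" "n \<in> {1..n}" using assms(1) by auto
  have jord: "distinct (jord J) \<and> set (jord J) = J - {n, Max (J - {n})}"
    if "J \<subseteq> {1..n}" "n \<in> J" "3 \<le> card J" for J using assms(4) that by blast
  have Eo: "distinct (Eord s)" "set (Eord s) = {I. I \<subseteq> {1..n} \<and> card I = s \<and> n \<in> I}" if "1 \<le> s" "s < n" for s
    using bspec[OF assms(2), of s] that by auto
  have Jo: "distinct (Jord s)" "set (Jord s) = {J. J \<subseteq> {1..n} \<and> card J = s + 1 \<and> n \<in> J}" if "2 \<le> s" "s < n" for s
    using bspec[OF assms(3), of s] that by auto
  define fac where "fac = (\<lambda>t. [Thtil n (Jord t) jord, Etil n (Eord t) :: 'k kop set])"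
  define P where "P = (\<lambda>s. set_prods (concat (map fac [s..<n])))"
  have Pn: "P n = {id}" by (simp add: P_def)
  have Prec: "P s = {a \<circ> b | a b. a \<in> Thtil n (Jord s) jord \<and> b \<in> {c \<circ> d | c d. c \<in> Etil n (Eord s) \<and> d \<in> P (Suc s)}}" if "s < n" for s
    unfolding P_def upt_conv_Cons[OF that] by (simp add: fac_def)
  have E: "Etil n (Eord s) \<subseteq> (Gs n s :: 'k kop set)" if "1 \<le> s" "s < n" for s by (rule Etil_Gs[OF Eo(2)[OF that]])
  have Th: "Thtil n (Jord s) jord \<subseteq> (Gs n s :: 'k kop set)" if s: "2 \<le> s" "s < n" for s
  proof (rule Thtil_Gs[OF s(1) Jo(2)[OF s]])
    fix J assume "J \<in> set (Jord s)"
    then show "set (jord J) = J - {n, Max (J - {n})}" using jord[of J] s(1) unfolding Jo(2)[OF s] by auto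
  qed
  have P_sub: "P s \<subseteq> Gs n t" if "2 \<le> s" "t \<le> s" for s t
    unfolding P_def
  proof (rule set_prods_subset[OF Gs_id Gs_comp])
    fix A assume "A \<in> set (concat (map fac [s..<n]))"
    then obtain r where r: "s \<le> r" "r < n" "A = Thtil n (Jord r) jord \<or> A = Etil n (Eord r)" by (auto simp: fac_def)
    then have "A \<subseteq> Gs n r" using E[of r] Th[of r] that(1) by auto
    also have "Gs n r \<subseteq> Gs n t" using r(1) that(2) by (intro Gs_mono) simp
    finally show "A \<subseteq> Gs n t" .
  qed
  define Q where "Q = (\<lambda>s. {c \<circ> d | c d. c \<in> Etil n (Eord s) \<and> d \<in> P (Suc s)})"
  have factor: "\<exists>th e g. (2 \<le> s \<longrightarrow> th \<in> Thtil n (Jord s) jord) \<and> (s = 1 \<longrightarrow> th = id) \<and> e \<in> Etil n (Eord s) \<and>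
      g \<in> Gs n (Suc s) \<and> u = th \<circ> (e \<circ> g)" if u: "u \<in> Gs n s" and s: "1 \<le> s" "s < n" for s and u :: "'k kop"
  proof (rule Gs_factor[OF u s(1) Eo[OF s]])
    show "distinct (Jord s) \<and> set (Jord s) = {J. J \<subseteq> {1..n} \<and> card J = s + 1 \<and> n \<in> J}" if "2 \<le> s"
      using Jo[OF that s(2)] by (rule conjI)
  qed (rule jord)
  \<comment> \<open>Downward induction from \<open>n - 1\<close>, where the rest from
    \<open>Gs n n\<close> is absorbed. Level 1 is included with \<open>id\<close> in place of the
    Theta factor.\<close>
  have step: "1 \<le> s \<longrightarrow> (\<forall>u\<in>Gs n s. \<exists>th q. (2 \<le> s \<longrightarrow> th \<in> Thtil n (Jord s) jord) \<and> (s = 1 \<longrightarrow> th = id) \<and>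
      q \<in> Q s \<and> u = th \<circ> q)" if "s \<le> n - 1" for s
    using that
  proof (induction rule: inc_induct)
    case base
    show ?case
    proof (intro impI ballI)
      fix u :: "'k kop" assume s1: "1 \<le> n - 1" and u: "u \<in> Gs n (n - 1)"
      have s: "n - 1 < n" "Suc (n - 1) = n" using assms(1) by auto
      from factor[OF u s1 s(1)]
      obtain th e g where h: "2 \<le> n - 1 \<longrightarrow> th \<in> Thtil n (Jord (n - 1)) jord" "n - 1 = 1 \<longrightarrow> th = id"
        "e \<in> Etil n (Eord (n - 1))" "g \<in> Gs n (Suc (n - 1))" "u = th \<circ> (e \<circ> g)" by (elim exE conjE)
      have "e \<circ> g \<in> Etil n (Eord (n - 1))"
        by (rule Etil_absorb[OF assms(1) Eo(2)[OF s1 s(1)] h(3) h(4)[unfolded s(2)]])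
      then have "e \<circ> g \<in> Q (n - 1)"
        unfolding Q_def s(2) Pn by (intro CollectI exI[of _ "e \<circ> g"] exI[of _ id]) (simp only: comp_id singleton_iff simp_thms)
      then show "\<exists>th q. (2 \<le> n - 1 \<longrightarrow> th \<in> Thtil n (Jord (n - 1)) jord) \<and> (n - 1 = 1 \<longrightarrow> th = id) \<and>
          q \<in> Q (n - 1) \<and> u = th \<circ> q"
        using h(1,2,5) by (intro exI[of _ th] exI[of _ "e \<circ> g"] conjI)
    qed
  next
    case (step s)
    show ?case
    proof (intro impI ballI)
      fix u :: "'k kop" assume s1: "1 \<le> s" and u: "u \<in> Gs n s"
      have s: "s < n" "2 \<le> Suc s" "Suc s < n" "1 \<le> Suc s" using step.hyps s1 by auto
      from factor[OF u s1 s(1)]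
      obtain th e g where h: "2 \<le> s \<longrightarrow> th \<in> Thtil n (Jord s) jord" "s = 1 \<longrightarrow> th = id"
        "e \<in> Etil n (Eord s)" "g \<in> Gs n (Suc s)" "u = th \<circ> (e \<circ> g)" by (elim exE conjE)
      from bspec[OF mp[OF step.IH s(4)] h(4)] obtain th' q where
        q: "2 \<le> Suc s \<longrightarrow> th' \<in> Thtil n (Jord (Suc s)) jord" "q \<in> Q (Suc s)" "g = th' \<circ> q" by (elim exE conjE)
      have "g \<in> P (Suc s)" unfolding Prec[OF s(3)] q(3) using mp[OF q(1) s(2)] q(2) unfolding Q_def by blast
      then have "e \<circ> g \<in> Q s" unfolding Q_def using h(3) by blast
      then show "\<exists>th q. (2 \<le> s \<longrightarrow> th \<in> Thtil n (Jord s) jord) \<and> (s = 1 \<longrightarrow> th = id) \<and> q \<in> Q s \<and> u = th \<circ> q"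
        using h(1,2,5) by (intro exI[of _ th] exI[of _ "e \<circ> g"] conjI)
    qed
  qed
  have 2: "(Gs n s :: 'k kop set) = P s" if s: "2 \<le> s" "s < n" for s
  proof
    show "P s \<subseteq> Gs n s" by (rule P_sub[OF s(1) order_refl])
    show "(Gs n s :: 'k kop set) \<subseteq> P s"
    proof
      fix u :: "'k kop" assume u: "u \<in> Gs n s"
      have s': "s \<le> n - 1" "1 \<le> s" using s by auto
      from bspec[OF mp[OF step[OF s'(1)] s'(2)] u] obtain th q where
        q: "2 \<le> s \<longrightarrow> th \<in> Thtil n (Jord s) jord" "q \<in> Q s" "u = th \<circ> q" by (elim exE conjE)
      show "u \<in> P s" unfolding Prec[OF s(2)] q(3) using mp[OF q(1) s(1)] q(2) unfolding Q_def by blast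
    qed
  qed
  have S1: "Suc 1 = 2" by simp
  have Q1: "set_prods (Etil n (Eord 1) # concat (map fac [2..<n])) = Q 1"
    unfolding Q_def S1 P_def set_prods.simps ..
  have 1: "(Gs n 1 :: 'k kop set) = Q 1"
  proof
    show "Q 1 \<subseteq> (Gs n 1 :: 'k kop set)"
    proof
      fix u assume "u \<in> Q 1"
      then obtain c d where u: "u = c \<circ> d" "c \<in> Etil n (Eord 1)" "d \<in> P (Suc 1)" unfolding Q_def by blast
      have "c \<in> Gs n 1" using subsetD[OF E[of 1] u(2)] assms(1) by simp
      moreover have "d \<in> Gs n 1" using subsetD[OF P_sub[of "Suc 1" 1] u(3)] by simp
      ultimately show "u \<in> Gs n 1" unfolding u(1) by (rule Gs_comp)
    qed
    show "(Gs n 1 :: 'k kop set) \<subseteq> Q 1"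
    proof
      fix u :: "'k kop" assume u: "u \<in> Gs n 1"
      have s': "1 \<le> n - 1" "1 \<le> (1 :: nat)" using assms(1) by auto
      from bspec[OF mp[OF step[OF s'(1)] s'(2)] u] obtain th q where h: "1 = (1 :: nat) \<longrightarrow> th = id" "q \<in> Q 1" "u = th \<circ> q"
        by (elim exE conjE)
      have "u = q" unfolding h(3) mp[OF h(1) refl] by (rule id_comp)
      then show "u \<in> Q 1" using h(2) by (simp only:)
    qed
  qed
  \<comment> \<open>A set containing \<open>n\<close> is nonempty, so \<open>1 + p_n\<close> lies in
    \<open>1 + a_1\<close> and its whole unit group is \<open>Gs n 1\<close>.\<close>
  have "1 \<le> card I" if "n \<in> I" "I \<subseteq> {1..n}" for I
    using that finite_subset[OF that(2)] by (auto simp: Suc_le_eq card_gt_0_iff)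
  then have "sp (Gens {1..n} {I. n \<in> I}) \<subseteq> (sp (Gens {1..n} {I. 1 \<le> card I}) :: 'k kop set)" by (intro sp_Gens_mono) blast
  then have "units_in n (pp n n) = (Gs n 1 :: 'k kop set)"
    unfolding Gs_def pp_eq[OF n(2)] by (simp only: Int_absorb2[OF units_in_mono])
  then have c1: "(units_in n (pp n n) :: 'k kop set) = set_prods (Etil n (Eord 1) # concat (map fac [2..<n]))"
    unfolding Q1 1 .
  have c2: "\<forall>s\<in>{2..n-1}. (units_pn_s n s :: 'k kop set) = set_prods (concat (map fac [s..<n]))"
  proof
    fix s assume "s \<in> {2..n-1}"
    then have "2 \<le> s" "s < n" using n by auto
    then show "(units_pn_s n s :: 'k kop set) = set_prods (concat (map fac [s..<n]))"
      unfolding units_pn_s_Gs[OF n(1)] using 2 unfolding P_def by blast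
  qed
  \<comment> \<open>The full set is the only subset of \<open>{1..n}\<close> with \<open>n\<close>
    elements, so \<open>a_n\<close> is \<open>F_n\<close>.\<close>
  have top: "n \<le> card I \<longleftrightarrow> {1..n} \<subseteq> I" if I: "I \<subseteq> {1..n}" for I
  proof
    assume "n \<le> card I"
    moreover have "card I \<le> n" using card_mono[OF _ I] by simp
    ultimately have "card I = card {1..n}" by simp
    from subset_card_eq[OF order_refl this I] show "{1..n} \<subseteq> I" by simp
  next
    assume "{1..n} \<subseteq> I"
    then have "I = {1..n}" using I by blast
    then show "n \<le> card I" by simp
  qed
  have "sp (Gens {1..n} {I. n \<le> card I}) \<subseteq> (sp (Gens {1..n} {I. {1..n} \<subseteq> I}) :: 'k kop set)"
    by (rule sp_Gens_mono) (simp only: mem_Collect_eq top)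
  moreover have "sp (Gens {1..n} {I. {1..n} \<subseteq> I}) \<subseteq> (sp (Gens {1..n} {I. n \<le> card I}) :: 'k kop set)"
    by (rule sp_Gens_mono) (simp only: mem_Collect_eq top)
  ultimately have eq: "sp (Gens {1..n} {I. n \<le> card I}) = (Fn n :: 'k kop set)"
    unfolding Fn_def pI_eq[OF order_refl] by (rule equalityI)
  have "(Fn n :: 'k kop set) \<subseteq> sp (Gens {1..n} {I. n \<in> I})"
    unfolding Fn_def pI_eq[OF order_refl] using n(2) by (intro sp_Gens_mono) blast
  then have c3: "(units_pn_s n n :: 'k kop set) = units_in n (Fn n)"
    unfolding units_pn_s_Gs[OF n(1)] Gs_def eq by (simp only: Int_absorb1[OF units_in_mono])
  show ?thesis using c1 c2 c3 unfolding fac_def by (intro conjI)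
qed

end
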